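(* Let $\mathcal G$ be a compact metric graph with edge set $\mathcal E$, $p>2$, $m^*$ a positive integer, $W\in L^\infty(\mathcal G)$, and $\rho\in L^\infty(\mathcal G)$ such that $\inf_{\mathcal G}\rho>0$. Consider the problem $$(E)\quad\begin{cases}-u''+W(x)u+\lambda u=\rho(x)|u|^{p-2}u&\text{on every edge } e\in\mathcal E,\\ u\text{ is continuous on }\mathcal G,\\ \sum_{e\succ v}\frac{du_e}{dx}(v)=0&\text{at every vertex }v,\end{cases}$$ and define $$\Lambda_{m^*}:=\inf\bigl\{\lambda\in\mathbb R\bigm|\exists u\in H^1(\mathcal G)\setminus\{0\},\ (\lambda,u)\text{ solves }(E),\ \mathrm m(u)\le m^*\bigr\},$$ $$q_{m^*}(\lambda):=\sup\bigl\{\|u\|_{L^2(\mathcal G)}\bigm| u\in H^1(\mathcal G)\setminus\{0\},\ (\lambda,u)\text{ solves }(E),\ \mathrm m(u)\le m^*\bigr\},$$ with the convention $q_{m^*}(\lambda)=0$ if no such $u$ exists. Then, for all $\tilde\Lambda>0$, there exists $C=C(\mathcal G,p,m^*,W,\rho,\tilde\Lambda)>0$ such that, for all $\lambda\in\mathbb R$: 1. if $\lambda<\Lambda_{m^*}$, then $q_{m^*}(\lambda)=0$; 2. $q_{m^*}(\Lambda_{m^*})>0$ if and only if the infimum $\Lambda_{m^*}$ is attained; 3. if $\Lambda_{m^*}$ is not attained, then $q_{m^*}(\lambda)\to0$ as $\lambda\to\Lambda_{m^*}$; 4. if $\Lambda_{m^*}\le\lambda\le\tilde\Lambda$, then $q_{m^*}(\lambda)\le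 C$; 5. if $\lambda\ge\tilde\Lambda$, then $q_{m^*}(\lambda)\le C\lambda^{\frac{6-p}{4(p-2)}}$. In particular, if $p\ge6$, then $q_{m^*}$ is bounded on $\mathbb R$. When $p>6$, furthermore $q_{m^*}(\lambda)\to0$ as $\lambda\to+\infty$.
   Context: Metric graphs: $\mathcal G=(\mathcal E,\mathcal V)$ with edges $\mathcal E$ and vertices $\mathcal V$. A compact metric graph is a connected metric graph with finitely many edges, all of finite positive length; each edge $e$ is identified with $[0,\ell_e]$. $u_e$ is the restriction of $u$ to $e$. $H^1(\mathcal G)$ is the space of continuous $u:\mathcal G\to\mathbb R$ with $u_e\in H^1(0,\ell_e)$ for every edge. The notation $e\succ v$ means that $e$ is incident to $v$, and $\frac{du_e}{dx}(v)$ is the derivative along $e$ at $v$ directed away from $v$. Solutions are weak solutions: $\int_{\mathcal G}(u'\varphi'+(W+\lambda)u\varphi)\,dx=\int_{\mathcal G}\rho|u|^{p-2}u\varphi\,dx$ for all $\varphi\in H^1(\mathcal G)$. Infima of functions defined a.e. are essential infima. The Morse index $\mathrm m(u)$ of a solution $(\lambda,u)$ is the maximal dimension (or $+\infty$ if there is no maximal integer) of a subspace $X\subset H^1(\mathcal G)$ such that $\int_{\mathcal G}(|\varphi'|^2+(W+\lambda)\varphi^2-(p-1)\rho|u|^{p-2}\varphi^2)\,dx<0$ for all $\varphi\in X\setminus\{0\}$. *)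

theory Defs
  imports
    "Graph_Theory.Graph_Theory"
    "HOL-Library.Function_Algebras"
    "HOL-Probability.Essential_Supremum"
    "HOL-Analysis.Analysis"
begin

instantiation "fun" :: (type, real_vector) real_vector
begin

definition scaleR_fun :: "real \<Rightarrow> ('a \<Rightarrow> 'b) \<Rightarrow> 'a \<Rightarrow> 'b"
  where "scaleR_fun c f = (\<lambda>x. c *\<^sub>R f x)"

instance
  by standard (auto simp: scaleR_fun_def fun_eq_iff scaleR_add_right scaleR_add_left)

end


section \<open>Compact metric graphs\<close>

text \<open>
  The underlying combinatorial graph is a directed multigraph, loops and multiple edges being
  allowed. The direction of an edge \<open>e\<close> only fixes its identification with \<open>[0, len e]\<close>: the tail
  corresponds to \<open>0\<close> and the head to \<open>len e\<close>. Graph connectedness ignores the directions.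
  A graph without edges (a single point) is not regarded as a metric graph.
\<close>

locale compact_metric_graph = fin_digraph G
  for G :: "('v, 'e) pre_digraph" and len :: "'e \<Rightarrow> real" +
  assumes connected_graph: "Digraph_Component.connected G"
    and arcs_nonempty: "arcs G \<noteq> {}"
    and length_pos: "e \<in> arcs G \<Longrightarrow> 0 < len e"

datatype ('v, 'e) gpoint = Vertex 'v | Inner 'e real

definition gpoints :: "('v, 'e) pre_digraph \<Rightarrow> ('e \<Rightarrow> real) \<Rightarrow> ('v, 'e) gpoint set"
  where "gpoints G len = Vertex ` verts G \<union> {Inner e x | e x. e \<in> arcs G \<and> 0 < x \<and> x < len e}"

text \<open>The point of the graph with coordinate \<open>x \<in> [0, len e]\<close> on the edge \<open>e\<close>.\<close>

definition edge_pt :: "('v, 'e) pre_digraph \<Rightarrow> ('e \<Rightarrow> real) \<Rightarrow> 'e \<Rightarrow> real \<Rightarrow> ('v, 'e) gpoint"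
  where "edge_pt G len e x =
    (if x \<le> 0 then Vertex (tail G e) else if len e \<le> x then Vertex (head G e) else Inner e x)"

definition on_edge ::
  "('v, 'e) pre_digraph \<Rightarrow> ('e \<Rightarrow> real) \<Rightarrow> (('v, 'e) gpoint \<Rightarrow> 'a) \<Rightarrow> 'e \<Rightarrow> real \<Rightarrow> 'a"
  where "on_edge G len u e = (\<lambda>x. u (edge_pt G len e x))"

text \<open>The quotient topology obtained by gluing the intervals \<open>[0, len e]\<close> at the vertices.\<close>

definition graph_topology ::
  "('v, 'e) pre_digraph \<Rightarrow> ('e \<Rightarrow> real) \<Rightarrow> ('v, 'e) gpoint topology"
  where "graph_topology G len = topology (\<lambda>U. U \<subseteq> gpoints G len \<and>
    (\<forall>e\<in>arcs G. openin (top_of_set {0..len e}) {x \<in> {0..len e}. edge_pt G len e x \<in> U}))"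

lemma openin_graph_topology:
  "openin (graph_topology G len) U \<longleftrightarrow> U \<subseteq> gpoints G len \<and>
    (\<forall>e\<in>arcs G. openin (top_of_set {0..len e}) {x \<in> {0..len e}. edge_pt G len e x \<in> U})"
proof -
  let ?P = "\<lambda>U. U \<subseteq> gpoints G len \<and>
    (\<forall>e\<in>arcs G. openin (top_of_set {0..len e}) {x \<in> {0..len e}. edge_pt G len e x \<in> U})"
  have "istopology ?P"
    unfolding istopology_def
  proof (intro conjI allI impI ballI)
    fix S T assume S: "?P S" and T: "?P T"
    show "S \<inter> T \<subseteq> gpoints G len" using S by blast
    fix e assume e: "e \<in> arcs G"
    have "openin (top_of_set {0..len e})
      ({x \<in> {0..len e}. edge_pt G len e x \<in> S} \<inter> {x \<in> {0..len e}. edge_pt G len e x \<in> T})"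
      using S T e by (intro openin_Int) auto
    then show "openin (top_of_set {0..len e}) {x \<in> {0..len e}. edge_pt G len e x \<in> S \<inter> T}"
      by (rule back_subst[where P = "openin _"]) auto
  next
    fix K assume K: "\<forall>S\<in>K. ?P S"
    show "\<Union>K \<subseteq> gpoints G len" using K by blast
    fix e assume e: "e \<in> arcs G"
    have "openin (top_of_set {0..len e}) (\<Union>S\<in>K. {x \<in> {0..len e}. edge_pt G len e x \<in> S})"
      using K e by (intro openin_Union) auto
    then show "openin (top_of_set {0..len e}) {x \<in> {0..len e}. edge_pt G len e x \<in> \<Union>K}"
      by (rule back_subst[where P = "openin _"]) auto
  qed
  then show ?thesis
    by (simp add: graph_topology_def)
qed

lemma (in compact_metric_graph) topspace_graph_topology:
  "topspace (graph_topology G len) = gpoints G len"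
proof -
  have *: "{x \<in> {0..len e}. edge_pt G len e x \<in> gpoints G len} = {0..len e}" if "e \<in> arcs G" for e
    using that by (auto simp: edge_pt_def gpoints_def)
  have "openin (graph_topology G len) (gpoints G len)"
    unfolding openin_graph_topology by (intro conjI ballI) (simp_all only: * openin_subtopology_self subset_refl)
  then show ?thesis
    by (metis openin_graph_topology openin_subset openin_topspace subset_antisym)
qed


section \<open>Integration and function spaces\<close>

definition graph_integral ::
  "('v, 'e) pre_digraph \<Rightarrow> ('e \<Rightarrow> real) \<Rightarrow> (('v, 'e) gpoint \<Rightarrow> real) \<Rightarrow> real"
  where "graph_integral G len f =
    (\<Sum>e\<in>arcs G. integral\<^sup>L (lebesgue_on {0..len e}) (on_edge G len f e))"

definition L2_norm_graph ::
  "('v, 'e) pre_digraph \<Rightarrow> ('e \<Rightarrow> real) \<Rightarrow> (('v, 'e) gpoint \<Rightarrow> real) \<Rightarrow> real"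
  where "L2_norm_graph G len u = sqrt (graph_integral G len (\<lambda>P. (u P)\<^sup>2))"

definition Linf_graph ::
  "('v, 'e) pre_digraph \<Rightarrow> ('e \<Rightarrow> real) \<Rightarrow> (('v, 'e) gpoint \<Rightarrow> real) set"
  where "Linf_graph G len = {f. \<forall>e\<in>arcs G.
    on_edge G len f e \<in> borel_measurable (lebesgue_on {0..len e}) \<and>
    esssup (lebesgue_on {0..len e}) (\<lambda>x. ereal \<bar>on_edge G len f e x\<bar>) < \<infinity>}"

definition essinf_graph ::
  "('v, 'e) pre_digraph \<Rightarrow> ('e \<Rightarrow> real) \<Rightarrow> (('v, 'e) gpoint \<Rightarrow> real) \<Rightarrow> ereal"
  where "essinf_graph G len f =
    (INF e\<in>arcs G. - esssup (lebesgue_on {0..len e}) (\<lambda>x. - ereal (on_edge G len f e x)))"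

definition L2_interval :: "real \<Rightarrow> (real \<Rightarrow> real) set"
  where "L2_interval l = {f. f \<in> borel_measurable (lebesgue_on {0..l}) \<and>
    integrable (lebesgue_on {0..l}) (\<lambda>x. (f x)\<^sup>2)}"

definition test_function :: "real \<Rightarrow> (real \<Rightarrow> real) \<Rightarrow> bool"
  where "test_function l \<eta> \<longleftrightarrow> \<eta> C1_differentiable_on UNIV \<and>
    (\<exists>K. compact K \<and> K \<subseteq> {0<..<l} \<and> (\<forall>x. x \<notin> K \<longrightarrow> \<eta> x = 0))"

definition weak_derivative :: "real \<Rightarrow> (real \<Rightarrow> real) \<Rightarrow> (real \<Rightarrow> real) \<Rightarrow> bool"
  where "weak_derivative l f g \<longleftrightarrow> (\<forall>\<eta>. test_function l \<eta> \<longrightarrow>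
    integral\<^sup>L (lebesgue_on {0..l}) (\<lambda>x. f x * deriv \<eta> x) =
    - integral\<^sup>L (lebesgue_on {0..l}) (\<lambda>x. g x * \<eta> x))"

definition H1_interval :: "real \<Rightarrow> (real \<Rightarrow> real) set"
  where "H1_interval l =
    {f. f \<in> L2_interval l \<and> (\<exists>g. g \<in> L2_interval l \<and> weak_derivative l f g)}"

text \<open>
  Functions on the graph are total functions on the type of points. Requiring the value \<open>0\<close>
  outside the graph makes each function on the graph have exactly one representative, so that
  \<open>0\<close> and linear (in)dependence have their usual meaning.
\<close>

definition H1_graph ::
  "('v, 'e) pre_digraph \<Rightarrow> ('e \<Rightarrow> real) \<Rightarrow> (('v, 'e) gpoint \<Rightarrow> real) set"
  where "H1_graph G len = {u. continuous_map (graph_topology G len) euclideanreal u \<and>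
    (\<forall>P. P \<notin> gpoints G len \<longrightarrow> u P = 0) \<and>
    (\<forall>e\<in>arcs G. on_edge G len u e \<in> H1_interval (len e))}"

text \<open>
  The weak derivative is unique up to null sets, and only enters under integrals. On the graph it
  is taken with respect to the chosen edge directions (reversing an edge changes its sign, which
  does not affect products of two derivatives); its values at the vertices are irrelevant.
\<close>

definition wderiv :: "real \<Rightarrow> (real \<Rightarrow> real) \<Rightarrow> real \<Rightarrow> real"
  where "wderiv l f = (SOME g. g \<in> L2_interval l \<and> weak_derivative l f g)"

definition graph_deriv ::
  "('v, 'e) pre_digraph \<Rightarrow> ('e \<Rightarrow> real) \<Rightarrow> (('v, 'e) gpoint \<Rightarrow> real) \<Rightarrow> ('v, 'e) gpoint \<Rightarrow> real"
  where "graph_deriv G len u P =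
    (case P of Vertex v \<Rightarrow> 0 | Inner e x \<Rightarrow> wderiv (len e) (on_edge G len u e) x)"


section \<open>Solutions and Morse index\<close>

text \<open>
  Weak formulation of \<open>-u'' + W u + \<lambda> u = \<rho> |u|^(p-2) u\<close> on the edges, with continuity and
  the Kirchhoff condition (zero sum of outgoing derivatives) at the vertices.
\<close>

definition solves_E ::
  "('v, 'e) pre_digraph \<Rightarrow> ('e \<Rightarrow> real) \<Rightarrow> (('v, 'e) gpoint \<Rightarrow> real) \<Rightarrow> (('v, 'e) gpoint \<Rightarrow> real)
    \<Rightarrow> real \<Rightarrow> real \<Rightarrow> (('v, 'e) gpoint \<Rightarrow> real) \<Rightarrow> bool"
  where "solves_E G len W \<rho> p lam u \<longleftrightarrow> u \<in> H1_graph G len \<and>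
    (\<forall>\<phi>\<in>H1_graph G len.
      graph_integral G len
        (\<lambda>P. graph_deriv G len u P * graph_deriv G len \<phi> P + (W P + lam) * u P * \<phi> P) =
      graph_integral G len (\<lambda>P. \<rho> P * \<bar>u P\<bar> powr (p - 2) * u P * \<phi> P))"

definition second_variation ::
  "('v, 'e) pre_digraph \<Rightarrow> ('e \<Rightarrow> real) \<Rightarrow> (('v, 'e) gpoint \<Rightarrow> real) \<Rightarrow> (('v, 'e) gpoint \<Rightarrow> real)
    \<Rightarrow> real \<Rightarrow> real \<Rightarrow> (('v, 'e) gpoint \<Rightarrow> real) \<Rightarrow> (('v, 'e) gpoint \<Rightarrow> real) \<Rightarrow> real"
  where "second_variation G len W \<rho> p lam u \<phi> =
    graph_integral G len (\<lambda>P. \<bar>graph_deriv G len \<phi> P\<bar>\<^sup>2 + (W P + lam) * (\<phi> P)\<^sup>2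
      - (p - 1) * \<rho> P * \<bar>u P\<bar> powr (p - 2) * (\<phi> P)\<^sup>2)"

text \<open>
  The supremum runs over the finite-dimensional subspaces, since \<open>dim\<close> is only meaningful for
  these; it is a maximum if it is finite. An infinite-dimensional admissible subspace contains
  admissible subspaces of every finite dimension, and then the supremum is \<open>\<infinity>\<close>.
\<close>

definition morse_index ::
  "('v, 'e) pre_digraph \<Rightarrow> ('e \<Rightarrow> real) \<Rightarrow> (('v, 'e) gpoint \<Rightarrow> real) \<Rightarrow> (('v, 'e) gpoint \<Rightarrow> real)
    \<Rightarrow> real \<Rightarrow> real \<Rightarrow> (('v, 'e) gpoint \<Rightarrow> real) \<Rightarrow> enat"
  where "morse_index G len W \<rho> p lam u =
    Sup {enat (dim X) | X. subspace X \<and> (\<exists>B. finite B \<and> span B = X) \<and> X \<subseteq> H1_graph G len \<and>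
      (\<forall>\<phi>\<in>X - {0}. second_variation G len W \<rho> p lam u \<phi> < 0)}"

definition low_index_solutions ::
  "('v, 'e) pre_digraph \<Rightarrow> ('e \<Rightarrow> real) \<Rightarrow> (('v, 'e) gpoint \<Rightarrow> real) \<Rightarrow> (('v, 'e) gpoint \<Rightarrow> real)
    \<Rightarrow> real \<Rightarrow> nat \<Rightarrow> real \<Rightarrow> (('v, 'e) gpoint \<Rightarrow> real) set"
  where "low_index_solutions G len W \<rho> p m lam =
    {u \<in> H1_graph G len - {0}. solves_E G len W \<rho> p lam u \<and> morse_index G len W \<rho> p lam u \<le> enat m}"

definition low_index_frequencies ::
  "('v, 'e) pre_digraph \<Rightarrow> ('e \<Rightarrow> real) \<Rightarrow> (('v, 'e) gpoint \<Rightarrow> real) \<Rightarrow> (('v, 'e) gpoint \<Rightarrow> real)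
    \<Rightarrow> real \<Rightarrow> nat \<Rightarrow> real set"
  where "low_index_frequencies G len W \<rho> p m = {lam. \<exists>u. u \<in> low_index_solutions G len W \<rho> p m lam}"

definition Lambda_inf ::
  "('v, 'e) pre_digraph \<Rightarrow> ('e \<Rightarrow> real) \<Rightarrow> (('v, 'e) gpoint \<Rightarrow> real) \<Rightarrow> (('v, 'e) gpoint \<Rightarrow> real)
    \<Rightarrow> real \<Rightarrow> nat \<Rightarrow> ereal"
  where "Lambda_inf G len W \<rho> p m = (INF lam\<in>low_index_frequencies G len W \<rho> p m. ereal lam)"

text \<open>In \<^typ>\<open>ennreal\<close> the supremum of the empty set is \<open>0\<close>, which is the convention wanted.\<close>

definition q_sup ::
  "('v, 'e) pre_digraph \<Rightarrow> ('e \<Rightarrow> real) \<Rightarrow> (('v, 'e) gpoint \<Rightarrow> real) \<Rightarrow> (('v, 'e) gpoint \<Rightarrow> real)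
    \<Rightarrow> real \<Rightarrow> nat \<Rightarrow> real \<Rightarrow> ennreal"
  where "q_sup G len W \<rho> p m lam =
    (SUP u\<in>low_index_solutions G len W \<rho> p m lam. ennreal (L2_norm_graph G len u))"

end

theory Submission
  imports Defs "HOL-Complex_Analysis.Great_Picard"
begin

text \<open>
  The upper bounds are one-dimensional: they are obtained on one edge at a time and do not use the
  vertex conditions. If the Morse index is at most \<open>m\<close>, then among \<open>m + 1\<close> functions supported in
  disjoint subintervals of an edge at least one has nonnegative second variation.
  Quadratic bumps give a lower bound for \<open>\<lambda>\<close>. If \<open>sup |u|\<^bsup>p-2\<^esup> / (1 + |\<lambda>|)\<close> were large, the rescaled
  equation would force \<open>m + 2\<close> zeros next to a maximum, and \<open>u\<close> itself, cut off to the \<open>m + 1\<close> nodal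
  intervals, would be negative there; hence \<open>|u|\<^bsup>p-2\<^esup> \<le> C (1 + |\<lambda>|)\<close>. For large \<open>\<lambda>\<close> divide an edge into
  pieces of length about \<open>\<lambda>\<^bsup>-1/2\<^esup>\<close>. Away from at most \<open>3m + 2\<close> of them, stability against \<open>u \<eta>\<close>
  with a cutoff \<open>\<eta>\<close> bounds the integral of \<open>u\<^sup>2\<close> by a small multiple of that over the neighbouring
  pieces, so that \<open>\<integral> u\<^sup>2 \<le> C \<lambda>\<^bsup>-1/2\<^esup> sup u\<^sup>2\<close>, which is the stated power of \<open>\<lambda>\<close>.

  The infimum is taken over a nonempty set because, for one large \<open>\<lambda>\<close>, a maximizer of \<open>\<integral> \<rho> |u|\<^bsup>p\<^esup>\<close> on
  the unit sphere of the quadratic form yields a solution of index at most one. Finally, solutions with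
  \<open>\<lambda>\<^sub>n \<rightarrow> \<Lambda>\<close> and mass bounded below converge in \<open>H\<^sup>1\<close> to a nonzero solution, whose index is at
  most \<open>m\<close> since a finite-dimensional subspace on which the limit form is negative stays negative
  for the approximating forms.
\<close>

section \<open>Primitives of integrable functions on an interval\<close>

text \<open>The coefficients are merely bounded and measurable, so second derivatives exist only
  almost everywhere and a blow-up limit would solve no fixed equation. Everything is therefore
  phrased by increments: \<open>primitive_on\<close> for absolute continuity, and
  \<open>osc_system\<close> for a rescaled solution whose coefficients are known only through their
  bounds. The oscillation argument then becomes quantitative and uniform in these coefficients.
  Strong convergence is not drawn from weak compactness: bounded Dirichlet energy gives uniform
  convergence of a subsequence on the edges, and uniform closeness is fed back into the equation
  (for solutions) or into maximality (for the constrained problem) to obtain a Cauchy sequence. The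
  exponent arises as follows: |u|^(p-2) is of order lam and the mass of order lam^(-1/2) sup u^2, so
  the norm is of order lam^(1/(p-2) - 1/4), and 1/(p-2) - 1/4 = (6-p)/(4(p-2)). Existence is shown
  at lam = \<open>w1 + 1\<close>, where W + lam >= 1 almost everywhere makes the quadratic form
  dominate the H^1 norm.\<close>

abbreviation LI :: "real \<Rightarrow> real \<Rightarrow> (real \<Rightarrow> real) \<Rightarrow> real"
  where "LI a b f \<equiv> integral\<^sup>L (lebesgue_on {a..b}) f"

lemma LI_eq_integral:
  "integrable (lebesgue_on {a..b}) f \<Longrightarrow> LI a b f = integral {a..b} f"
  by (simp add: lebesgue_integral_eq_integral)

lemma LI_refl [simp]: "LI a a f = 0"
proof -
  have "integrable (lebesgue_on {a..a}) (\<lambda>x. 0::real)" by simp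
  have "AE x in lebesgue_on {a..a}. f x = 0"
  proof (rule AE_I)
    show "{a..a} \<in> sets (lebesgue_on {a..a})" by (rule sets_lebesgue_on_refl)
    show "emeasure (lebesgue_on {a..a}) {a..a} = 0"
      by (simp add: emeasure_restrict_space)
  qed auto
  then show ?thesis
    by (rule integral_eq_zero_AE)
qed

lemma LI_singleton [simp]: "integral\<^sup>L (lebesgue_on {a}) f = 0" for a :: real and f :: "real \<Rightarrow> real"
  using LI_refl[of a f] by simp

lemma measure_lebesgue_on_interval [simp]:
  "a \<le> b \<Longrightarrow> measure (lebesgue_on {a..b}) {a..b} = b - (a::real)"
  by (simp add: measure_restrict_space)

lemma LI_combine:
  assumes "integrable (lebesgue_on {a..b}) f" "a \<le> s" "s \<le> t" "t \<le> r" "r \<le> b"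
  shows "LI s r f = LI s t f + LI t r f"
proof -
  have i: "integrable (lebesgue_on {s..r}) f" "integrable (lebesgue_on {s..t}) f" "integrable (lebesgue_on {t..r}) f"
    using assms by (auto intro!: integrable_subinterval[OF assms(1)])
  then show ?thesis
    using Henstock_Kurzweil_Integration.integral_combine[of s t r f] integrable_on_lebesgue_on[OF i(1)] assms
    by (simp add: LI_eq_integral)
qed

lemma LI_le:
  assumes "integrable (lebesgue_on {s..t}) f" "s \<le> t" "\<And>x. x \<in> {s..t} \<Longrightarrow> f x \<le> k"
  shows "LI s t f \<le> k * (t - s)"
proof -
  have "LI s t f \<le> LI s t (\<lambda>x. k)"
    by (rule integral_mono) (use assms in auto)
  also have "\<dots> = k * (t - s)"
    using assms(2) LI_eq_integral[of s t "\<lambda>x. k"] by simp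
  finally show ?thesis .
qed

lemma LI_ge:
  assumes "integrable (lebesgue_on {s..t}) f" "s \<le> t" "\<And>x. x \<in> {s..t} \<Longrightarrow> k \<le> f x"
  shows "k * (t - s) \<le> LI s t f"
proof -
  have "LI s t (\<lambda>x. - f x) \<le> - k * (t - s)"
    by (rule LI_le) (use assms in auto)
  then show ?thesis
    by simp
qed

lemma LI_extend:
  assumes "0 \<le> a" "b \<le> l"
  shows "LI 0 l (\<lambda>x. if x \<in> {a..b} then f x else 0) = LI a b f"
    "integrable (lebesgue_on {0..l}) (\<lambda>x. if x \<in> {a..b} then f x else 0) \<longleftrightarrow> integrable (lebesgue_on {a..b}) f"
proof -
  show "LI 0 l (\<lambda>x. if x \<in> {a..b} then f x else 0) = LI a b f"
    by (rule Lebesgue_Measure.integral_restrict) (use assms in auto)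
  have "(\<lambda>x. if x \<in> {0..l} then if x \<in> {a..b} then f x else 0 else 0) = (\<lambda>x. if x \<in> {a..b} then f x else 0)"
    using assms by auto
  then show "integrable (lebesgue_on {0..l}) (\<lambda>x. if x \<in> {a..b} then f x else 0) \<longleftrightarrow> integrable (lebesgue_on {a..b}) f"
    using Lebesgue_Measure.integrable_restrict_UNIV[of "{0..l}" "\<lambda>x. if x \<in> {a..b} then f x else 0"]
      Lebesgue_Measure.integrable_restrict_UNIV[of "{a..b}" f] by simp
qed

lemma borel_measurable_subinterval:
  assumes "f \<in> borel_measurable (lebesgue_on {a..b})" "{c..d} \<subseteq> {a..b}"
  shows "f \<in> borel_measurable (lebesgue_on {c..d::real})"
  using assms by (rule measurable_restrict_mono)

lemma borel_measurable_continuous_interval: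
  "continuous_on {a..b::real} f \<Longrightarrow> f \<in> borel_measurable (lebesgue_on {a..b})" for f :: "real \<Rightarrow> real"
  by (rule continuous_imp_measurable_on_sets_lebesgue) auto

lemma integrable_bounded_interval:
  assumes "f \<in> borel_measurable (lebesgue_on {a..b::real})" "\<And>x. x \<in> {a..b} \<Longrightarrow> \<bar>f x\<bar> \<le> C"
  shows "integrable (lebesgue_on {a..b}) (f :: real \<Rightarrow> real)"
proof (rule Bochner_Integration.integrable_bound[of _ "\<lambda>x. C"])
  show "AE x in lebesgue_on {a..b}. norm (f x) \<le> norm C"
    using assms(2) by (intro AE_I2) force
qed (use assms in auto)

text \<open>Absolute continuity with density \<open>g\<close>, recorded through increments. In this
  form it restricts to subintervals at once and passes to limits of \<open>f\<close> and
  \<open>g\<close> without differentiating \<open>f\<close>.\<close>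

definition primitive_on :: "real \<Rightarrow> real \<Rightarrow> (real \<Rightarrow> real) \<Rightarrow> (real \<Rightarrow> real) \<Rightarrow> bool"
  where "primitive_on a b f g \<longleftrightarrow> integrable (lebesgue_on {a..b}) g \<and>
    (\<forall>s t. a \<le> s \<longrightarrow> s \<le> t \<longrightarrow> t \<le> b \<longrightarrow> f t - f s = LI s t g)"

lemma primitive_onD:
  assumes "primitive_on a b f g"
  shows "integrable (lebesgue_on {a..b}) g" "a \<le> s \<Longrightarrow> s \<le> t \<Longrightarrow> t \<le> b \<Longrightarrow> f t - f s = LI s t g"
  using assms by (auto simp: primitive_on_def)

lemma primitive_onI:
  assumes "integrable (lebesgue_on {a..b}) g" "\<And>x. x \<in> {a..b} \<Longrightarrow> f x = f a + LI a x g"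
  shows "primitive_on a b f g"
  unfolding primitive_on_def
proof (intro conjI allI impI)
  fix s t assume st: "a \<le> s" "s \<le> t" "t \<le> b"
  then show "f t - f s = LI s t g"
    using LI_combine[OF assms(1), of a s t] assms(2)[of s] assms(2)[of t] by simp
qed fact

lemma primitive_on_subinterval:
  assumes "primitive_on a b f g" "a \<le> c" "d \<le> b"
  shows "primitive_on c d f g"
proof -
  have "integrable (lebesgue_on {c..d}) g"
    by (rule integrable_subinterval[OF primitive_onD(1)[OF assms(1)]]) (use assms(2,3) in auto)
  then show ?thesis
    using assms by (simp add: primitive_on_def)
qed

lemma primitive_on_continuous:
  assumes "primitive_on a b f g"
  shows "continuous_on {a..b} f"
proof -
  have "continuous_on {a..b} (\<lambda>x. f a + LI a x g)"
    by (intro continuous_intros indefinite_integral_continuous_real primitive_onD[OF assms])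
  moreover have "f a + LI a x g = f x" if "x \<in> {a..b}" for x
    using primitive_onD(2)[OF assms, of a x] that by simp
  ultimately show ?thesis
    by (rule continuous_on_eq)
qed

lemma primitive_on_C1:
  assumes "\<And>x. x \<in> {a..b} \<Longrightarrow> (f has_real_derivative g x) (at x within {a..b})" "continuous_on {a..b} g"
  shows "primitive_on a b f g"
proof -
  have i: "integrable (lebesgue_on {a..b}) g"
    by (rule continuous_imp_integrable_real) fact
  show ?thesis
    unfolding primitive_on_def
  proof (intro conjI allI impI i)
    fix s t assume st: "a \<le> s" "s \<le> t" "t \<le> b"
    have "(g has_integral f t - f s) {s..t}"
    proof (rule fundamental_theorem_of_calculus[OF st(2)])
      fix x assume x: "x \<in> {s..t}"
      have "(f has_real_derivative g x) (at x within {s..t})"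
        by (rule DERIV_subset[OF assms(1)]) (use st x in auto)
      then show "(f has_vector_derivative g x) (at x within {s..t})"
        by (simp add: has_real_derivative_iff_has_vector_derivative)
    qed
    then show "f t - f s = LI s t g"
      using LI_eq_integral[of s t g] integrable_subinterval[OF i, of s t] st by (simp add: integral_unique)
  qed
qed

lemma primitive_on_derivative:
  assumes "primitive_on a b f g" "continuous_on {a..b} g" "x \<in> {a..b}"
  shows "(f has_real_derivative g x) (at x within {a..b})"
proof -
  have "((\<lambda>x. f a + integral {a..x} g) has_real_derivative g x) (at x within {a..b})"
    using integral_has_real_derivative[OF assms(2,3)] by (auto intro!: derivative_eq_intros)
  moreover have "f y = f a + integral {a..y} g" if "y \<in> {a..b}" for y
  proof -
    have "LI a y g = integral {a..y} g"
      by (rule LI_eq_integral[OF integrable_subinterval[OF primitive_onD(1)[OF assms(1)]]]) (use that in auto)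
    moreover have "f y - f a = LI a y g"
      by (rule primitive_onD(2)[OF assms(1)]) (use that in auto)
    ultimately show ?thesis by linarith
  qed
  ultimately show ?thesis
    using has_field_derivative_transform_within[OF _ zero_less_one assms(3), of "\<lambda>x. f a + integral {a..x} g"] by metis
qed

lemma primitive_on_add:
  assumes "primitive_on a b f g" "primitive_on a b f' g'"
  shows "primitive_on a b (\<lambda>x. f x + f' x) (\<lambda>x. g x + g' x)"
  unfolding primitive_on_def
proof (intro conjI allI impI)
  show "integrable (lebesgue_on {a..b}) (\<lambda>x. g x + g' x)"
    using primitive_onD(1)[OF assms(1)] primitive_onD(1)[OF assms(2)] by auto
  fix s t assume st: "a \<le> s" "s \<le> t" "t \<le> b"
  have "integrable (lebesgue_on {s..t}) g" "integrable (lebesgue_on {s..t}) g'"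
    using st by (auto intro: integrable_subinterval[OF primitive_onD(1)[OF assms(1)]] integrable_subinterval[OF primitive_onD(1)[OF assms(2)]])
  then show "f t + f' t - (f s + f' s) = LI s t (\<lambda>x. g x + g' x)"
    using primitive_onD(2)[OF assms(1) st] primitive_onD(2)[OF assms(2) st] by simp
qed

lemma primitive_on_cmul:
  assumes "primitive_on a b f g"
  shows "primitive_on a b (\<lambda>x. c * f x) (\<lambda>x. c * g x)"
  using assms unfolding primitive_on_def by (metis integrable_mult_right integral_mult_right_zero right_diff_distrib)

lemma primitive_on_cong_AE:
  assumes "primitive_on a b f g" "AE x in lebesgue_on {a..b}. g x = h x" "h \<in> borel_measurable (lebesgue_on {a..b})"
  shows "primitive_on a b f h"
  unfolding primitive_on_def
proof (intro conjI allI impI)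
  note i = primitive_onD(1)[OF assms(1)]
  show ih: "integrable (lebesgue_on {a..b}) h"
    using i assms by (subst integrable_cong_AE[symmetric]) auto
  fix s t assume st: "a \<le> s" "s \<le> t" "t \<le> b"
  have "AE x in lebesgue_on {s..t}. g x = h x"
    using assms(2) st by (auto simp: AE_restrict_space_iff elim: AE_mp)
  then have "LI s t g = LI s t h"
    using st i ih by (intro integral_cong_AE) (auto dest: integrable_subinterval[of _ _ _ s t])
  then show "f t - f s = LI s t h"
    using primitive_onD(2)[OF assms(1) st] by simp
qed

text \<open>The difference of two densities has integral zero over every subinterval, and Lebesgue
  differentiation makes it vanish off a null set.\<close>

lemma primitive_on_unique:
  assumes "primitive_on a b f g" "primitive_on a b f h"
  shows "AE x in lebesgue_on {a..b}. g x = h x"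
proof -
  define k where "k x = (if x \<in> {a..b} then g x - h x else 0)" for x
  have iK: "integrable (lebesgue_on {a..b}) (\<lambda>x. g x - h x)"
    using primitive_onD(1)[OF assms(1)] primitive_onD(1)[OF assms(2)] by auto
  then have "integrable lebesgue k"
    unfolding k_def by (subst Lebesgue_Measure.integrable_restrict_UNIV) auto
  then have "k integrable_on UNIV" by (rule integrable_on_lebesgue)
  then have int: "k integrable_on cbox s t" for s t
    by (rule integrable_on_subcbox) auto
  obtain N where N: "negligible N" "\<And>x e. \<lbrakk>x \<notin> N; 0 < e\<rbrakk> \<Longrightarrow>
               \<exists>d>0. \<forall>h. 0 < h \<and> h < d \<longrightarrow>
                         norm (integral (cbox x (x + h *\<^sub>R One)) k /\<^sub>R h ^ DIM(real) - k x) < e"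
    using integrable_ccontinuous_explicit[OF int] by metis
  have zero: "integral {s..t} k = 0" if "a \<le> s" "s \<le> t" "t \<le> b" for s t
  proof -
    have i: "integrable (lebesgue_on {s..t}) g" "integrable (lebesgue_on {s..t}) h"
      using that by (auto intro: integrable_subinterval[OF primitive_onD(1)[OF assms(1)]] integrable_subinterval[OF primitive_onD(1)[OF assms(2)]])
    have "integral {s..t} k = integral {s..t} (\<lambda>x. g x - h x)"
      by (rule Henstock_Kurzweil_Integration.integral_cong) (use that in \<open>auto simp: k_def\<close>)
    also have "\<dots> = LI s t (\<lambda>x. g x - h x)"
      using i by (intro LI_eq_integral[symmetric]) auto
    also have "\<dots> = 0"
      using primitive_onD(2)[OF assms(1) that] primitive_onD(2)[OF assms(2) that] i by simp
    finally show ?thesis .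
  qed
  \<comment> \<open>The difference quotients extend to the right of \<open>x\<close>, so the right
    endpoint is excluded here and joined to the null set below.\<close>
  have k0: "k x = 0" if "x \<in> {a..<b}" "x \<notin> N" for x
  proof (rule ccontr)
    assume "k x \<noteq> 0"
    then obtain d where d: "d > 0" "\<And>h. 0 < h \<and> h < d \<Longrightarrow> norm (integral (cbox x (x + h *\<^sub>R One)) k /\<^sub>R h ^ DIM(real) - k x) < \<bar>k x\<bar>"
      using N(2)[OF \<open>x \<notin> N\<close>, of "\<bar>k x\<bar>"] by auto
    define h where "h = min (d/2) (b - x)"
    have "0 < h" "h < d" "x + h \<le> b" using d(1) that by (auto simp: h_def)
    then show False
      using d(2)[of h] zero[of x "x+h"] that by simp
  qed
  have "AE x in lebesgue. x \<notin> insert b N"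
    using N(1) by (intro AE_not_in) (auto simp: negligible_iff_null_sets)
  then have "AE x in lebesgue. x \<in> {a..b} \<longrightarrow> g x = h x"
    by eventually_elim (use k0 in \<open>force simp: k_def\<close>)
  then show ?thesis
    by (simp add: AE_restrict_space_iff)
qed

text \<open>Integration by parts for absolutely continuous functions is Fubini for the product of
  the two densities on the triangle y <= x.\<close>

lemma primitive_on_mult_ends:
  assumes f: "primitive_on a b f f'" and g: "primitive_on a b g g'" and "a \<le> b"
  shows "integrable (lebesgue_on {a..b}) (\<lambda>x. f' x * g x)"
    "f b * g b - f a * g a = LI a b (\<lambda>x. f' x * g x + f x * g' x)"
proof -
  let ?M = "lebesgue_on {a..b}"
  have if': "integrable ?M f'" and ig': "integrable ?M g'"
    using f g by (auto dest: primitive_onD(1))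
  have prod: "integrable ?M (\<lambda>x. p' x * q x)" if "integrable ?M p'" "primitive_on a b q q'" for p' q q'
  proof -
    have c: "continuous_on {a..b} q" by (rule primitive_on_continuous[OF that(2)])
    then obtain C where C: "\<And>x. x \<in> {a..b} \<Longrightarrow> \<bar>q x\<bar> \<le> C"
      using compact_continuous_image[OF c] compact_imp_bounded[of "q ` {a..b}"]
      by (metis bounded_iff compact_Icc image_eqI real_norm_def)
    show ?thesis
    proof (rule Bochner_Integration.integrable_bound[of _ "\<lambda>x. C * p' x"])
      show "(\<lambda>x. p' x * q x) \<in> borel_measurable ?M"
        using that(1) borel_measurable_continuous_interval[OF c] by measurable
      have "\<bar>p' x * q x\<bar> \<le> \<bar>C * p' x\<bar>" if "x \<in> {a..b}" for x
        using mult_left_mono[OF order_trans[OF C[OF that] abs_ge_self[of C]], of "\<bar>p' x\<bar>"] by (simp add: abs_mult mult.commute)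
      then show "AE x in ?M. norm (p' x * q x) \<le> norm (C * p' x)"
        by (intro AE_I2) auto
    qed (use that in auto)
  qed
  show i1: "integrable ?M (\<lambda>x. f' x * g x)" by (rule prod[OF if' g])
  have i2: "integrable ?M (\<lambda>x. g' x * f x)" by (rule prod[OF ig' f])
  interpret finite_measure ?M
    by (rule finite_measure_lebesgue_on) auto
  interpret pair_sigma_finite ?M ?M ..
  have idm: "(\<lambda>x. x) \<in> borel_measurable ?M"
    using id_borel_measurable_lebesgue_on[of "{a..b}"] by (simp add: id_def)
  note [measurable] = borel_measurable_integrable[OF if'] borel_measurable_integrable[OF ig'] idm
  \<comment> \<open>Integrating over y first yields \<open>f' x * (g x - g a)\<close>, over x first
    \<open>g' y * (f b - f y)\<close>; their equality is the product formula up to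
    rearrangement.\<close>
  define h where "h x = f' (fst x) * (g' (snd x) * (if snd x \<le> fst x then 1 else 0))" for x
  have hm: "h \<in> borel_measurable (?M \<Otimes>\<^sub>M ?M)"
    unfolding h_def by measurable
  have ih: "integrable (?M \<Otimes>\<^sub>M ?M) h"
  proof (rule Bochner_Integration.integrable_bound[OF _ hm])
    show "integrable (?M \<Otimes>\<^sub>M ?M) (\<lambda>x. f' (fst x) * g' (snd x))"
    proof (rule Fubini_integrable)
      show "integrable ?M (\<lambda>x. LI a b (\<lambda>y. norm (f' (fst (x, y)) * g' (snd (x, y)))))"
        using if' by (simp add: abs_mult)
    qed (use ig' in auto)
    show "AE x in ?M \<Otimes>\<^sub>M ?M. norm (h x) \<le> norm (f' (fst x) * g' (snd x))"
      by (intro AE_I2) (auto simp: h_def)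
  qed
  have inner1: "LI a b (\<lambda>y. h (x, y)) = f' x * (g x - g a)" if "x \<in> {a..b}" for x
  proof -
    have "LI a b (\<lambda>y. h (x, y)) = LI a b (\<lambda>y. if y \<in> {a..x} then f' x * g' y else 0)"
      by (rule Bochner_Integration.integral_cong) (auto simp: h_def)
    also have "\<dots> = integral\<^sup>L (lebesgue_on {a..x}) (\<lambda>y. f' x * g' y)"
      by (rule Lebesgue_Measure.integral_restrict) (use that in auto)
    finally show ?thesis
      using primitive_onD(2)[OF g, of a x] that by simp
  qed
  have inner2: "LI a b (\<lambda>x. h (x, y)) = g' y * (f b - f y)" if "y \<in> {a..b}" for y
  proof -
    have "LI a b (\<lambda>x. h (x, y)) = LI a b (\<lambda>x. if x \<in> {y..b} then g' y * f' x else 0)"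
      by (rule Bochner_Integration.integral_cong) (auto simp: h_def)
    also have "\<dots> = integral\<^sup>L (lebesgue_on {y..b}) (\<lambda>x. g' y * f' x)"
      by (rule Lebesgue_Measure.integral_restrict) (use that in auto)
    finally show ?thesis
      using primitive_onD(2)[OF f, of y b] that by simp
  qed
  have "LI a b (\<lambda>x. LI a b (\<lambda>y. h (x, y))) = LI a b (\<lambda>y. LI a b (\<lambda>x. h (x, y)))"
    using Fubini_integral[of "\<lambda>x y. h (x, y)"] ih by simp
  then have "LI a b (\<lambda>x. f' x * (g x - g a)) = LI a b (\<lambda>y. g' y * (f b - f y))"
  proof -
    have "LI a b (\<lambda>x. LI a b (\<lambda>y. h (x, y))) = LI a b (\<lambda>x. f' x * (g x - g a))"
      "LI a b (\<lambda>y. LI a b (\<lambda>x. h (x, y))) = LI a b (\<lambda>y. g' y * (f b - f y))"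
      by (rule Bochner_Integration.integral_cong; simp add: inner1 inner2)+
    then show ?thesis
      using \<open>LI a b (\<lambda>x. LI a b (\<lambda>y. h (x, y))) = LI a b (\<lambda>y. LI a b (\<lambda>x. h (x, y)))\<close> by simp
  qed
  then have "LI a b (\<lambda>x. f' x * g x) - LI a b f' * g a = LI a b g' * f b - LI a b (\<lambda>x. g' x * f x)"
    using i1 i2 if' ig' by (simp add: right_diff_distrib mult.commute[of _ "g a"] mult.commute[of _ "f b"])
  moreover have "LI a b f' = f b - f a" "LI a b g' = g b - g a"
    using primitive_onD(2)[OF f, of a b] primitive_onD(2)[OF g, of a b] \<open>a \<le> b\<close> by auto
  moreover have "LI a b (\<lambda>x. f' x * g x + f x * g' x) = LI a b (\<lambda>x. f' x * g x) + LI a b (\<lambda>x. g' x * f x)"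
    using i1 i2 by (simp add: mult.commute[of "f _"])
  ultimately show "f b * g b - f a * g a = LI a b (\<lambda>x. f' x * g x + f x * g' x)"
    by (simp add: algebra_simps)
qed

lemma primitive_on_mult:
  assumes f: "primitive_on a b f f'" and g: "primitive_on a b g g'"
  shows "primitive_on a b (\<lambda>x. f x * g x) (\<lambda>x. f' x * g x + f x * g' x)"
proof (cases "a \<le> b")
  case True
  show ?thesis
    unfolding primitive_on_def
  proof (intro conjI allI impI)
    have "integrable (lebesgue_on {a..b}) (\<lambda>x. g' x * f x)"
      by (rule primitive_on_mult_ends(1)[OF g f True])
    then show "integrable (lebesgue_on {a..b}) (\<lambda>x. f' x * g x + f x * g' x)"
      using primitive_on_mult_ends(1)[OF f g True] by (simp add: mult.commute)
    fix s t assume "a \<le> s" "s \<le> t" "t \<le> b"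
    then show "f t * g t - f s * g s = LI s t (\<lambda>x. f' x * g x + f x * g' x)"
      by (intro primitive_on_mult_ends(2) primitive_on_subinterval[OF f] primitive_on_subinterval[OF g])
  qed
qed (auto simp: primitive_on_def)

lemma integral_nonneg_continuous_zero:
  assumes "continuous_on {a..b} f" "\<And>x. x \<in> {a..b} \<Longrightarrow> 0 \<le> f x" "LI a b f = 0" "x \<in> {a..b}" "a < b"
  shows "f x = (0::real)"
proof -
  have "integral {a..b} f = 0"
    using assms LI_eq_integral continuous_imp_integrable_real by metis
  then show ?thesis
    using assms integral_eq_0_iff[of a b f] by auto
qed

section \<open>Square integrable functions and weak derivatives\<close>

lemma L2_intervalD:
  assumes "f \<in> L2_interval l"
  shows "f \<in> borel_measurable (lebesgue_on {0..l})" "integrable (lebesgue_on {0..l}) (\<lambda>x. (f x)\<^sup>2)"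
  using assms by (auto simp: L2_interval_def)

lemma L2_mult_integrable:
  assumes "f \<in> L2_interval l" "g \<in> L2_interval l"
  shows "integrable (lebesgue_on {0..l}) (\<lambda>x. f x * g x)"
proof (rule Bochner_Integration.integrable_bound)
  show "integrable (lebesgue_on {0..l}) (\<lambda>x. (f x)\<^sup>2 + (g x)\<^sup>2)"
    using assms by (auto dest: L2_intervalD)
  show "(\<lambda>x. f x * g x) \<in> borel_measurable (lebesgue_on {0..l})"
    by (intro borel_measurable_times L2_intervalD[OF assms(1)] L2_intervalD[OF assms(2)])
  have "\<bar>a * b\<bar> \<le> a\<^sup>2 + b\<^sup>2" for a b :: real
    using sum_squares_bound[of "\<bar>a\<bar>" "\<bar>b\<bar>"] mult_nonneg_nonneg[of "\<bar>a\<bar>" "\<bar>b\<bar>"]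
    by (simp add: abs_mult del: mult_nonneg_nonneg)
  then show "AE x in lebesgue_on {0..l}. norm (f x * g x) \<le> norm ((f x)\<^sup>2 + (g x)\<^sup>2)"
    by (intro AE_I2) simp
qed

lemma L2_bounded:
  assumes "f \<in> borel_measurable (lebesgue_on {0..l})" "\<And>x. x \<in> {0..l} \<Longrightarrow> \<bar>f x\<bar> \<le> C"
  shows "f \<in> L2_interval l"
proof -
  have m: "(\<lambda>x. (f x)\<^sup>2) \<in> borel_measurable (lebesgue_on {0..l})" using assms by measurable
  have "\<bar>(f x)\<^sup>2\<bar> \<le> C\<^sup>2" if "x \<in> {0..l}" for x
    using power_mono[OF assms(2)[OF that] abs_ge_zero, of 2] by simp
  then have "integrable (lebesgue_on {0..l}) (\<lambda>x. (f x)\<^sup>2)"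
    by (rule integrable_bounded_interval[OF m])
  then show ?thesis using assms(1) by (simp add: L2_interval_def)
qed

lemma L2_const: "(\<lambda>x. c) \<in> L2_interval l"
  by (rule L2_bounded[where C = "\<bar>c\<bar>"]) auto

lemma continuous_bounded_interval:
  assumes "continuous_on {a..b} (f :: real \<Rightarrow> real)"
  obtains C where "\<And>x. x \<in> {a..b} \<Longrightarrow> \<bar>f x\<bar> \<le> C" "C > 0"
proof -
  have "bounded (f ` {a..b})"
    by (rule compact_imp_bounded[OF compact_continuous_image[OF assms]]) simp
  then obtain C where "C > 0" "\<forall>y\<in>f ` {a..b}. norm y \<le> C"
    by (auto simp: bounded_pos)
  then show ?thesis using that[of C] by simp
qed

lemma L2_continuous: "continuous_on {0..l} f \<Longrightarrow> f \<in> L2_interval l"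
  by (metis L2_bounded borel_measurable_continuous_interval continuous_bounded_interval)

lemma L2_integrable: "f \<in> L2_interval l \<Longrightarrow> integrable (lebesgue_on {0..l}) f"
  using L2_mult_integrable[OF _ L2_const[of 1]] by simp

lemma L2_cmul: "f \<in> L2_interval l \<Longrightarrow> (\<lambda>x. c * f x) \<in> L2_interval l"
  unfolding L2_interval_def by (auto simp: power_mult_distrib)

lemma L2_add:
  assumes "f \<in> L2_interval l" "g \<in> L2_interval l"
  shows "(\<lambda>x. f x + g x) \<in> L2_interval l"
proof -
  have "integrable (lebesgue_on {0..l}) (\<lambda>x. (f x)\<^sup>2 + (g x)\<^sup>2 + 2 * (f x * g x))"
    by (intro Bochner_Integration.integrable_add integrable_mult_right L2_mult_integrable[OF assms] L2_intervalD(2) assms)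
  then have "integrable (lebesgue_on {0..l}) (\<lambda>x. (f x + g x)\<^sup>2)"
    by (simp add: power2_sum mult.assoc)
  then show ?thesis
    using L2_intervalD(1)[OF assms(1)] L2_intervalD(1)[OF assms(2)] by (auto simp: L2_interval_def)
qed

lemma L2_diff:
  "f \<in> L2_interval l \<Longrightarrow> g \<in> L2_interval l \<Longrightarrow> (\<lambda>x. f x - g x) \<in> L2_interval l"
  using L2_add[of f l "\<lambda>x. -1 * g x"] L2_cmul[of g l "-1"] by simp

lemma L2_mult_bounded:
  assumes "f \<in> L2_interval l" "w \<in> borel_measurable (lebesgue_on {0..l})" "\<And>x. x \<in> {0..l} \<Longrightarrow> \<bar>w x\<bar> \<le> C"
  shows "(\<lambda>x. w x * f x) \<in> L2_interval l"
proof -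
  have m: "(\<lambda>x. w x * f x) \<in> borel_measurable (lebesgue_on {0..l})"
    using L2_intervalD(1)[OF assms(1)] assms(2) by measurable
  have "integrable (lebesgue_on {0..l}) (\<lambda>x. (w x * f x)\<^sup>2)"
  proof (rule Bochner_Integration.integrable_bound)
    show "integrable (lebesgue_on {0..l}) (\<lambda>x. C\<^sup>2 * (f x)\<^sup>2)"
      using L2_intervalD(2)[OF assms(1)] by simp
    have "(w x * f x)\<^sup>2 \<le> C\<^sup>2 * (f x)\<^sup>2" if "x \<in> {0..l}" for x
      using power_mono[OF assms(3)[OF that] abs_ge_zero, of 2]
      by (simp add: power_mult_distrib mult_right_mono)
    then show "AE x in lebesgue_on {0..l}. norm ((w x * f x)\<^sup>2) \<le> norm (C\<^sup>2 * (f x)\<^sup>2)"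
      by (intro AE_I2) simp
  qed (use m in measurable)
  with m show ?thesis by (simp add: L2_interval_def)
qed

text \<open>The integral of (g - c)^2 with \<open>c\<close> the mean of \<open>g\<close> is
  nonnegative; expanding it gives the claim.\<close>

lemma Cauchy_Schwarz_interval:
  assumes "integrable (lebesgue_on {s..t}) g" "integrable (lebesgue_on {s..t}) (\<lambda>x. (g x)\<^sup>2)" "s \<le> t"
  shows "(LI s t g)\<^sup>2 \<le> (t - s) * LI s t (\<lambda>x. (g x)\<^sup>2)"
proof (cases "s = t")
  case False
  define c where "c = LI s t g / (t - s)"
  have c: "c * (t - s) = LI s t g" using False assms(3) by (simp add: c_def)
  have "0 \<le> LI s t (\<lambda>x. (g x - c)\<^sup>2)"
    by (rule integral_nonneg_AE) simp
  also have "LI s t (\<lambda>x. (g x - c)\<^sup>2) = LI s t (\<lambda>x. (g x)\<^sup>2 - 2 * c * g x + c\<^sup>2)"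
    by (simp add: power2_diff algebra_simps)
  also have "\<dots> = LI s t (\<lambda>x. (g x)\<^sup>2) - 2 * c * LI s t g + c\<^sup>2 * (t - s)"
    using assms LI_eq_integral[of s t "\<lambda>x. c\<^sup>2"] by simp
  finally have "0 \<le> (t - s) * (LI s t (\<lambda>x. (g x)\<^sup>2) - 2 * c * (c * (t - s)) + c\<^sup>2 * (t - s))"
    unfolding c using assms(3) by simp
  also have "\<dots> = (t - s) * LI s t (\<lambda>x. (g x)\<^sup>2) - (c * (t - s))\<^sup>2"
    by (simp add: power2_eq_square algebra_simps)
  finally show ?thesis unfolding c by simp
qed simp

lemma LI_mono_interval:
  assumes "integrable (lebesgue_on {a..b}) f" "a \<le> s" "t \<le> b" "\<And>x. x \<in> {a..b} \<Longrightarrow> 0 \<le> f x"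
  shows "LI s t f \<le> LI a b f"
  by (rule integral_mono_lebesgue_on_AE) (use assms in \<open>auto intro!: AE_I2\<close>)

lemma test_functionD:
  assumes "test_function l \<eta>"
  shows "continuous_on UNIV (deriv \<eta>)" "(\<eta> has_real_derivative deriv \<eta> x) (at x)"
    "\<And>x. x \<le> 0 \<or> l \<le> x \<Longrightarrow> \<eta> x = 0"
proof -
  obtain D where D: "\<And>x. (\<eta> has_vector_derivative D x) (at x)" "continuous_on UNIV D"
    using assms by (auto simp: test_function_def C1_differentiable_on_def)
  then have r: "(\<eta> has_real_derivative D x) (at x)" for x
    by (simp add: has_real_derivative_iff_has_vector_derivative)
  then have "deriv \<eta> = D" by (auto intro: DERIV_imp_deriv)
  with D r show "continuous_on UNIV (deriv \<eta>)" "(\<eta> has_real_derivative deriv \<eta> x) (at x)" by auto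
  obtain K where "K \<subseteq> {0<..<l}" "\<And>x. x \<notin> K \<Longrightarrow> \<eta> x = 0"
    using assms unfolding test_function_def by blast
  then show "\<eta> x = 0" if "x \<le> 0 \<or> l \<le> x" for x
    using that by fastforce
qed

lemma primitive_on_test_function:
  assumes "test_function l \<eta>"
  shows "primitive_on 0 l \<eta> (deriv \<eta>)"
  using test_functionD[OF assms]
  by (intro primitive_on_C1) (auto intro: has_field_derivative_at_within continuous_on_subset)

lemma primitive_imp_weak_derivative:
  assumes f: "primitive_on 0 l f g" and "0 \<le> l"
  shows "weak_derivative l f g"
  unfolding weak_derivative_def
proof (intro allI impI)
  fix \<eta> assume \<eta>: "test_function l \<eta>"
  note p = primitive_on_test_function[OF \<eta>]
  have i: "integrable (lebesgue_on {0..l}) (\<lambda>x. g x * \<eta> x)" "integrable (lebesgue_on {0..l}) (\<lambda>x. deriv \<eta> x * f x)"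
    using primitive_on_mult_ends(1)[OF f p \<open>0 \<le> l\<close>] primitive_on_mult_ends(1)[OF p f \<open>0 \<le> l\<close>] by auto
  have "0 = LI 0 l (\<lambda>x. g x * \<eta> x + f x * deriv \<eta> x)"
    using primitive_on_mult_ends(2)[OF f p \<open>0 \<le> l\<close>] test_functionD(3)[OF \<eta>] by simp
  also have "\<dots> = LI 0 l (\<lambda>x. g x * \<eta> x) + LI 0 l (\<lambda>x. f x * deriv \<eta> x)"
    using i by (simp add: mult.commute[of "f _"])
  finally show "LI 0 l (\<lambda>x. f x * deriv \<eta> x) = - LI 0 l (\<lambda>x. g x * \<eta> x)" by simp
qed

text \<open>
  With a weight \<open>\<psi>\<close> vanishing at the ends of an interval, \<open>\<eta>' = (h - c) \<psi>\<close> is the derivative of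
  a test function as soon as \<open>c\<close> is the \<open>\<psi>\<close>-weighted mean of \<open>h\<close>; testing with \<open>\<eta>\<close> then gives
  \<open>\<integral> (h - c)\<^sup>2 \<psi> = 0\<close>.
\<close>

lemma weak_derivative_imp_primitive:
  assumes cf: "continuous_on {0..l} f" and g: "integrable (lebesgue_on {0..l}) g"
    and w: "weak_derivative l f g" and l: "0 < l"
  shows "primitive_on 0 l f g"
proof -
  define P where "P x = LI 0 x g" for x
  have pP: "primitive_on 0 l P g"
    by (rule primitive_onI[OF g]) (simp add: P_def)
  define h where "h x = f x - P x" for x
  have ch: "continuous_on {0..l} h"
    unfolding h_def by (intro continuous_intros cf primitive_on_continuous[OF pP])
  \<comment> \<open>Clamping the argument makes the function continuous on the whole line, so that
    the antiderivative built below is C^1 everywhere, as a test function has to be.\<close>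
  define h' where "h' x = h (max 0 (min l x))" for x
  have ch': "continuous_on UNIV h'"
    unfolding h'_def by (rule continuous_on_compose2[OF ch]) (use l in \<open>auto intro!: continuous_intros\<close>)
  have h'h: "h' x = h x" if "x \<in> {0..l}" for x using that by (auto simp: h'_def min_def max_def)
  have const: "\<exists>c. \<forall>x\<in>{a<..<b}. h x = c" if ab: "0 < a" "a < b" "b < l" for a b
  proof -
    \<comment> \<open>A weight that is positive exactly on the open interval (a, b), whose closure
      is a compact subset of (0, l).\<close>
    define \<psi> where "\<psi> x = max 0 ((x - a) * (b - x))" for x
    have c\<psi>: "continuous_on UNIV \<psi>" unfolding \<psi>_def by (intro continuous_intros)
    have \<psi>0: "\<psi> x = 0" if "x \<le> a \<or> b \<le> x" for x
      using that ab mult_le_0_iff[of "x - a" "b - x"] by (auto simp: \<psi>_def)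
    have \<psi>pos: "\<psi> x > 0" if "a < x" "x < b" for x using that by (simp add: \<psi>_def max_def)
    have \<psi>nn: "\<psi> x \<ge> 0" for x by (simp add: \<psi>_def)
    have ic: "integrable (lebesgue_on {a..b}) q" if "continuous_on UNIV q" for q :: "real \<Rightarrow> real"
      by (rule continuous_imp_integrable_real) (use that continuous_on_subset in blast)
    have "LI a b \<psi> \<noteq> 0"
      using integral_nonneg_continuous_zero[of a b \<psi> "(a+b)/2"] \<psi>pos[of "(a+b)/2"] \<psi>nn ab
        continuous_on_subset[OF c\<psi>, of "{a..b}"] by auto
    moreover define c where "c = LI a b (\<lambda>x. h' x * \<psi> x) / LI a b \<psi>"
    ultimately have c: "LI a b (\<lambda>x. h' x * \<psi> x) = c * LI a b \<psi>" by simp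
    define k where "k x = (h' x - c) * \<psi> x" for x
    have ck: "continuous_on UNIV k" unfolding k_def by (intro continuous_intros ch' c\<psi>)
    have k0: "LI a b k = 0"
    proof -
      have "LI a b k = LI a b (\<lambda>x. h' x * \<psi> x) - c * LI a b \<psi>"
        unfolding k_def left_diff_distrib
        using ic[of "\<lambda>x. h' x * \<psi> x"] ic[OF c\<psi>] ch' c\<psi> by (simp add: continuous_on_mult)
      with c show ?thesis by simp
    qed
    have "\<exists>F. \<forall>x. -\<infinity> < ereal x \<longrightarrow> ereal x < \<infinity> \<longrightarrow> (F has_vector_derivative k x) (at x)"
      by (rule einterval_antiderivative) (use ck in \<open>auto simp: continuous_on_eq_continuous_at\<close>)
    then obtain F where F: "\<And>x. (F has_real_derivative k x) (at x)"
      by (auto simp: has_real_derivative_iff_has_vector_derivative)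
    define \<eta> where "\<eta> x = F x - F a" for x
    have d\<eta>: "(\<eta> has_real_derivative k x) (at x)" for x
      unfolding \<eta>_def using F[of x] by (auto intro!: derivative_eq_intros)
    have p\<eta>: "primitive_on s t \<eta> k" for s t
      by (rule primitive_on_C1) (use d\<eta> ck in \<open>auto intro: has_field_derivative_at_within continuous_on_subset\<close>)
    have zero: "LI s t k = 0" if "\<And>x. x \<in> {s..t} \<Longrightarrow> k x = 0" for s t
      by (rule integral_eq_zero_AE) (use that in \<open>auto intro!: AE_I2\<close>)
    have \<eta>a: "\<eta> x = 0" if "x \<le> a" for x
      using primitive_onD(2)[OF p\<eta>, of x x a a] zero[of x a] \<psi>0 that by (simp add: \<eta>_def k_def)
    have \<eta>b: "\<eta> b = 0"
      using primitive_onD(2)[OF p\<eta>, of a a b b] k0 ab by (simp add: \<eta>_def)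
    have \<eta>b': "\<eta> x = 0" if "b \<le> x" for x
      using primitive_onD(2)[OF p\<eta>, of b b x x] zero[of b x] \<psi>0 that \<eta>b by (simp add: k_def)
    have t: "test_function l \<eta>"
      unfolding test_function_def
    proof
      show "\<eta> C1_differentiable_on UNIV"
        unfolding C1_differentiable_on_def
        using d\<eta> ck by (auto simp: has_real_derivative_iff_has_vector_derivative)
      show "\<exists>K. compact K \<and> K \<subseteq> {0<..<l} \<and> (\<forall>x. x \<notin> K \<longrightarrow> \<eta> x = 0)"
        by (rule exI[of _ "{a..b}"]) (use \<eta>a \<eta>b' ab in auto)
    qed
    have dk: "deriv \<eta> = k" using d\<eta> by (auto intro: DERIV_imp_deriv)
    \<comment> \<open>The primitive \<open>P\<close> obeys the same weak identity as
      \<open>f\<close>; subtracting leaves \<open>h = f - P\<close> orthogonal to the derivative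
      \<open>k\<close> of the test function.\<close>
    have wP: "weak_derivative l P g"
      by (rule primitive_imp_weak_derivative[OF pP]) (use l in simp)
    have e: "LI 0 l (\<lambda>x. f x * k x) = LI 0 l (\<lambda>x. P x * k x)"
      using w wP t unfolding weak_derivative_def dk[symmetric] by simp
    have ick: "integrable (lebesgue_on {0..l}) (\<lambda>x. q x * k x)" if "continuous_on {0..l} q" for q
      by (rule continuous_imp_integrable_real) (intro continuous_on_mult that continuous_on_subset[OF ck]; simp)
    have "LI 0 l (\<lambda>x. h x * k x) = 0"
      unfolding h_def left_diff_distrib
      using e ick[OF cf] ick[OF primitive_on_continuous[OF pP]] by simp
    moreover have "LI 0 l (\<lambda>x. h x * k x) = LI 0 l (\<lambda>x. if x \<in> {a..b} then h' x * k x else 0)"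
      by (rule Bochner_Integration.integral_cong) (use h'h \<psi>0 in \<open>auto simp: k_def\<close>)
    ultimately have hk: "LI a b (\<lambda>x. h' x * k x) = 0"
      using LI_extend(1)[of a b l "\<lambda>x. h' x * k x"] ab by simp
    have "LI a b (\<lambda>x. (h' x - c)\<^sup>2 * \<psi> x) = LI a b (\<lambda>x. h' x * k x - c * k x)"
      by (simp add: k_def power2_eq_square algebra_simps)
    also have "\<dots> = 0"
      using ic[of "\<lambda>x. h' x * k x"] ic[OF ck] ch' ck hk k0 by (simp add: continuous_on_mult)
    finally have z: "LI a b (\<lambda>x. (h' x - c)\<^sup>2 * \<psi> x) = 0" .
    have "(h' x - c)\<^sup>2 * \<psi> x = 0" if "x \<in> {a..b}" for x
    proof (rule integral_nonneg_continuous_zero[OF _ _ z that \<open>a < b\<close>])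
      show "continuous_on {a..b} (\<lambda>x. (h' x - c)\<^sup>2 * \<psi> x)"
        by (intro continuous_intros continuous_on_subset[OF ch'] continuous_on_subset[OF c\<psi>]) auto
    qed (use \<psi>nn in auto)
    then have "h x = c" if "x \<in> {a<..<b}" for x
      using that \<psi>pos[of x] h'h[of x] ab by (metis atLeastAtMost_iff greaterThanLessThan_iff less_eq_real_def
          mult_eq_0_iff order_less_imp_not_eq2 order_trans power2_eq_iff_nonneg right_minus_eq zero_eq_power2)
    then show ?thesis by blast
  qed
  have same: "h x = h y" if xy: "x \<in> {0<..<l}" "y \<in> {0<..<l}" for x y
  proof -
    have "0 < min x y / 2" "min x y / 2 < (max x y + l) / 2" "(max x y + l) / 2 < l"
      "x \<in> {min x y / 2<..<(max x y + l) / 2}" "y \<in> {min x y / 2<..<(max x y + l) / 2}"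
      using xy by auto
    then show ?thesis using const[of "min x y / 2" "(max x y + l) / 2"] by metis
  qed
  have h0: "h x = h 0" if "x \<in> {0..l}" for x
  proof -
    have cl: "closure {0<..<l} = {0..l}" using l by simp
    have "h y = h (l/2)" if "y \<in> {0..l}" for y
    proof (rule continuous_constant_on_closure[where f = h and S = "{0<..<l}"])
      show "continuous_on (closure {0<..<l}) h" unfolding cl by (rule ch)
      show "y \<in> closure {0<..<l}" unfolding cl by (rule that)
      show "h z = h (l/2)" if "z \<in> {0<..<l}" for z
        by (rule same[OF that]) (use l in simp)
    qed
    moreover have "0 \<in> {0..l}" using l by simp
    ultimately show ?thesis using that by metis
  qed
  show ?thesis
  proof (rule primitive_onI[OF g])
    show "f x = f 0 + LI 0 x g" if "x \<in> {0..l}" for x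
      using h0[OF that] by (simp add: h_def P_def)
  qed
qed

text \<open>\<open>wderiv\<close> is an arbitrary choice; for a continuous function every choice is
  a genuine density, and from here on weak derivatives are handled in that role.\<close>

lemma wderiv_primitive:
  assumes "f \<in> H1_interval l" "continuous_on {0..l} f" "0 < l"
  shows "wderiv l f \<in> L2_interval l" "primitive_on 0 l f (wderiv l f)"
proof -
  have "\<exists>g. g \<in> L2_interval l \<and> weak_derivative l f g"
    using assms(1) unfolding H1_interval_def by blast
  then have "wderiv l f \<in> L2_interval l \<and> weak_derivative l f (wderiv l f)"
    unfolding wderiv_def by (rule someI_ex)
  then show "wderiv l f \<in> L2_interval l" "primitive_on 0 l f (wderiv l f)"
    using weak_derivative_imp_primitive[OF assms(2) L2_integrable _ assms(3)] by auto
qed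

lemma primitive_imp_H1_interval:
  assumes "primitive_on 0 l f g" "g \<in> L2_interval l" "0 \<le> l"
  shows "f \<in> H1_interval l"
  using primitive_imp_weak_derivative[OF assms(1,3)] assms(2) L2_continuous[OF primitive_on_continuous[OF assms(1)]]
  by (auto simp: H1_interval_def)

text \<open>Identifies the chosen weak derivative of explicit functions such as sums, multiples and
  zero extensions.\<close>

lemma wderiv_unique:
  assumes "primitive_on 0 l f g" "g \<in> L2_interval l" "0 < l"
  shows "AE x in lebesgue_on {0..l}. wderiv l f x = g x"
proof -
  have "f \<in> H1_interval l" by (rule primitive_imp_H1_interval[OF assms(1,2)]) (use assms in simp)
  then have "primitive_on 0 l f (wderiv l f)"
    by (rule wderiv_primitive(2)) (use assms primitive_on_continuous in auto)
  then show ?thesis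
    by (rule primitive_on_unique) (rule assms(1))
qed

section \<open>Completeness\<close>

lemma L1_norm_le_L2_norm:
  assumes "f \<in> L2_interval l" "0 \<le> l"
  shows "LI 0 l (\<lambda>x. \<bar>f x\<bar>) \<le> sqrt (l * LI 0 l (\<lambda>x. (f x)\<^sup>2))"
proof -
  have "(LI 0 l (\<lambda>x. \<bar>f x\<bar>))\<^sup>2 \<le> (l - 0) * LI 0 l (\<lambda>x. \<bar>f x\<bar>\<^sup>2)"
    by (rule Cauchy_Schwarz_interval) (use L2_integrable[OF assms(1)] L2_intervalD[OF assms(1)] assms(2) in auto)
  then show ?thesis by (simp add: real_le_rsqrt)
qed

text \<open>Riesz-Fischer: along a fast subsequence the increments are summable in L^1, which gives
  a pointwise limit almost everywhere, and Fatou turns the Cauchy condition into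
  convergence.\<close>

lemma L2_complete:
  fixes g :: "nat \<Rightarrow> real \<Rightarrow> real"
  assumes g: "\<And>n. g n \<in> L2_interval l" and l: "0 \<le> l"
    and C: "\<And>\<epsilon>. \<epsilon> > 0 \<Longrightarrow> \<exists>N. \<forall>n\<ge>N. \<forall>k\<ge>N. LI 0 l (\<lambda>x. (g n x - g k x)\<^sup>2) < \<epsilon>"
  shows "\<exists>h\<in>L2_interval l. (\<lambda>n. LI 0 l (\<lambda>x. (g n x - h x)\<^sup>2)) \<longlonglongrightarrow> 0"
proof -
  let ?M = "lebesgue_on {0..l}"
  note gm[measurable] = L2_intervalD(1)[OF g]
  obtain N where N: "\<And>i n k. N i \<le> n \<Longrightarrow> N i \<le> k \<Longrightarrow> LI 0 l (\<lambda>x. (g n x - g k x)\<^sup>2) < (1/4) ^ i"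
    using C[of "(1/4) ^ i" for i] by (metis zero_less_power zero_less_divide_1_iff zero_less_numeral)
  \<comment> \<open>Adding up the thresholds makes \<open>r i\<close> and \<open>r (Suc i)\<close>
    both at least \<open>N i\<close>, and the summand \<open>i\<close> sends the indices to
    infinity.\<close>
  define r where "r i = (\<Sum>j\<le>i. N j) + i" for i
  have ri: "i \<le> r i" for i by (simp add: r_def)
  have "N i \<le> sum N {..i}" for i by (rule member_le_sum) auto
  then have rN: "N i \<le> r i" "N i \<le> r (Suc i)" for i
    unfolding r_def using le_add1 order_trans by (auto simp: trans_le_add1 le_SucI)
  define d where "d i x = \<bar>g (r (Suc i)) x - g (r i) x\<bar>" for i x
  have dL2: "(\<lambda>x. g (r (Suc i)) x - g (r i) x) \<in> L2_interval l" for i by (intro L2_diff g)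
  have di: "integrable ?M (d i)" for i
    unfolding d_def using L2_integrable[OF dL2] by auto
  have dint: "LI 0 l (d i) \<le> sqrt l * (1/2) ^ i" for i
  proof -
    have "LI 0 l (d i) \<le> sqrt (l * LI 0 l (\<lambda>x. (g (r (Suc i)) x - g (r i) x)\<^sup>2))"
      unfolding d_def by (rule L1_norm_le_L2_norm[OF dL2 l])
    also have "\<dots> \<le> sqrt (l * (1/4) ^ i)"
      using N[of i "r (Suc i)" "r i"] rN[of i] l by (intro real_sqrt_le_mono mult_left_mono) auto
    also have "\<dots> = sqrt l * (1/2) ^ i"
      by (simp add: real_sqrt_mult real_sqrt_power real_sqrt_divide)
    finally show ?thesis .
  qed
  have "(\<integral>\<^sup>+x. (\<Sum>i. ennreal (d i x)) \<partial>?M) = (\<Sum>i. \<integral>\<^sup>+x. ennreal (d i x) \<partial>?M)"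
    by (rule nn_integral_suminf) (simp add: d_def)
  also have "\<dots> = (\<Sum>i. ennreal (LI 0 l (d i)))"
    using nn_integral_eq_integral[OF di] by (simp add: d_def)
  also have "\<dots> \<le> (\<Sum>i. ennreal (sqrt l * (1/2) ^ i))"
    by (intro suminf_le ennreal_leI dint) auto
  also have "\<dots> = ennreal (\<Sum>i. sqrt l * (1/2) ^ i)"
    using l by (intro suminf_ennreal2) (auto intro: summable_mult summable_geometric)
  finally have "(\<integral>\<^sup>+x. (\<Sum>i. ennreal (d i x)) \<partial>?M) \<noteq> \<infinity>"
    by (auto simp: top_unique)
  then have "AE x in ?M. (\<Sum>i. ennreal (d i x)) \<noteq> \<infinity>"
    by (intro nn_integral_PInf_AE) (auto simp: d_def)
  then have AEc: "AE x in ?M. convergent (\<lambda>i. g (r i) x)"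
  proof (rule AE_mp, intro AE_I2 impI)
    fix x assume "(\<Sum>i. ennreal (d i x)) \<noteq> \<infinity>"
    then have "summable (\<lambda>i. d i x)"
      by (intro summable_suminf_not_top) (auto simp: d_def)
    then have "summable (\<lambda>i. g (r (Suc i)) x - g (r i) x)"
      unfolding d_def by (rule summable_rabs_cancel)
    then have "convergent (\<lambda>n. \<Sum>i<n. g (r (Suc i)) x - g (r i) x)"
      by (simp add: summable_iff_convergent)
    then have "convergent (\<lambda>n. (g (r n) x - g (r 0) x) + g (r 0) x)"
      unfolding sum_lessThan_telescope[of "\<lambda>i. g (r i) x"] by (intro convergent_add convergent_const)
    then show "convergent (\<lambda>i. g (r i) x)" by simp
  qed
  define h where "h x = lim (\<lambda>i. g (r i) x)" for x
  have hm[measurable]: "h \<in> borel_measurable ?M"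
    unfolding h_def by (rule borel_measurable_lim_metric) simp
  have AEl: "AE x in ?M. (\<lambda>i. g (r i) x) \<longlonglongrightarrow> h x"
    using AEc by (rule AE_mp) (auto simp: h_def convergent_LIMSEQ_iff)
  \<comment> \<open>Fatou in the second index: the bound for \<open>g n - g (r i)\<close> survives
    the limit in \<open>i\<close>.\<close>
  have main: "(\<integral>\<^sup>+x. ennreal ((g n x - h x)\<^sup>2) \<partial>?M) \<le> ennreal \<epsilon>"
    if eps: "\<epsilon> > 0" and K: "\<And>n k. K \<le> n \<Longrightarrow> K \<le> k \<Longrightarrow> LI 0 l (\<lambda>x. (g n x - g k x)\<^sup>2) < \<epsilon>" and n: "K \<le> n" for \<epsilon> K n
  proof -
    have "(\<integral>\<^sup>+x. ennreal ((g n x - h x)\<^sup>2) \<partial>?M) = (\<integral>\<^sup>+x. liminf (\<lambda>i. ennreal ((g n x - g (r (i + 0)) x)\<^sup>2)) \<partial>?M)"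
    proof (rule nn_integral_cong_AE, use AEl in eventually_elim)
      fix x assume "(\<lambda>i. g (r i) x) \<longlonglongrightarrow> h x"
      then have "(\<lambda>i. ennreal ((g n x - g (r (i+0)) x)\<^sup>2)) \<longlonglongrightarrow> ennreal ((g n x - h x)\<^sup>2)"
        by (intro tendsto_ennrealI tendsto_intros) auto
      then show "ennreal ((g n x - h x)\<^sup>2) = liminf (\<lambda>i. ennreal ((g n x - g (r (i+0)) x)\<^sup>2))"
        by (rule lim_imp_Liminf[symmetric, rotated]) simp
    qed
    also have "\<dots> \<le> liminf (\<lambda>i. \<integral>\<^sup>+x. ennreal ((g n x - g (r (i + 0)) x)\<^sup>2) \<partial>?M)"
      by (rule nn_integral_liminf) measurable
    also have "\<dots> \<le> ennreal \<epsilon>"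
    proof (rule Liminf_le)
      have "(\<integral>\<^sup>+x. ennreal ((g n x - g (r (i + 0)) x)\<^sup>2) \<partial>?M) \<le> ennreal \<epsilon>" if "K \<le> i" for i
      proof -
        have "(\<integral>\<^sup>+x. ennreal ((g n x - g (r (i + 0)) x)\<^sup>2) \<partial>?M) = ennreal (LI 0 l (\<lambda>x. (g n x - g (r i) x)\<^sup>2))"
          using nn_integral_eq_integral[OF L2_intervalD(2)[OF L2_diff[OF g[of n] g[of "r i"]]]] by simp
        also have "\<dots> \<le> ennreal \<epsilon>"
          using K[OF n order_trans[OF that ri]] by (intro ennreal_leI) simp
        finally show ?thesis .
      qed
      then show "\<forall>\<^sub>F i in sequentially. (\<integral>\<^sup>+x. ennreal ((g n x - g (r (i + 0)) x)\<^sup>2) \<partial>?M) \<le> ennreal \<epsilon>"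
        unfolding eventually_sequentially by blast
    qed simp
    finally show ?thesis .
  qed
  have diffL2: "(\<lambda>x. g n x - h x) \<in> L2_interval l \<and> LI 0 l (\<lambda>x. (g n x - h x)\<^sup>2) \<le> \<epsilon>"
    if "\<epsilon> > 0" "\<And>n k. K \<le> n \<Longrightarrow> K \<le> k \<Longrightarrow> LI 0 l (\<lambda>x. (g n x - g k x)\<^sup>2) < \<epsilon>" "K \<le> n" for \<epsilon> K n
  proof
    have le: "(\<integral>\<^sup>+x. ennreal ((g n x - h x)\<^sup>2) \<partial>?M) \<le> ennreal \<epsilon>"
      by (rule main[OF that])
    have i: "integrable ?M (\<lambda>x. (g n x - h x)\<^sup>2)"
      by (rule integrableI_nonneg) (use le in \<open>auto simp: order_le_less_trans\<close>)
    then show "(\<lambda>x. g n x - h x) \<in> L2_interval l"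
      by (simp add: L2_interval_def)
    show "LI 0 l (\<lambda>x. (g n x - h x)\<^sup>2) \<le> \<epsilon>"
      using le nn_integral_eq_integral[OF i] that(1) by simp
  qed
  obtain K where K: "\<forall>n\<ge>K. \<forall>k\<ge>K. LI 0 l (\<lambda>x. (g n x - g k x)\<^sup>2) < 1" using C[of 1] by auto
  have "(\<lambda>x. g K x - h x) \<in> L2_interval l"
    using diffL2[of 1 K K] K by simp
  then have hL2: "h \<in> L2_interval l"
    using L2_diff[OF g[of K], of "\<lambda>x. g K x - h x"] by simp
  have "(\<lambda>n. LI 0 l (\<lambda>x. (g n x - h x)\<^sup>2)) \<longlonglongrightarrow> 0"
  proof (rule LIMSEQ_I)
    fix \<epsilon> :: real assume e: "0 < \<epsilon>"
    then obtain K where K: "\<forall>n\<ge>K. \<forall>k\<ge>K. LI 0 l (\<lambda>x. (g n x - g k x)\<^sup>2) < \<epsilon>/2" using C[of "\<epsilon>/2"] by auto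
    have "norm (LI 0 l (\<lambda>x. (g n x - h x)\<^sup>2) - 0) < \<epsilon>" if "K \<le> n" for n
    proof -
      have "LI 0 l (\<lambda>x. (g n x - h x)\<^sup>2) \<le> \<epsilon>/2"
        using diffL2[of "\<epsilon>/2" K n] K that e by simp
      moreover have "0 \<le> LI 0 l (\<lambda>x. (g n x - h x)\<^sup>2)" by (rule integral_nonneg_AE) simp
      ultimately show ?thesis using e by simp
    qed
    then show "\<exists>no. \<forall>n\<ge>no. norm (LI 0 l (\<lambda>x. (g n x - h x)\<^sup>2) - 0) < \<epsilon>" by blast
  qed
  with hL2 show ?thesis by blast
qed

lemma L2_subinterval:
  assumes "g \<in> L2_interval l" "0 \<le> s" "t \<le> l"
  shows "integrable (lebesgue_on {s..t}) g" "integrable (lebesgue_on {s..t}) (\<lambda>x. (g x)\<^sup>2)"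
proof -
  have "{s..t} \<subseteq> {0..l}" using assms by auto
  then show "integrable (lebesgue_on {s..t}) g" "integrable (lebesgue_on {s..t}) (\<lambda>x. (g x)\<^sup>2)"
    by (rule integrable_subinterval[OF L2_integrable[OF assms(1)]], rule integrable_subinterval[OF L2_intervalD(2)[OF assms(1)]])
qed

lemma L2_interval_LI_bound:
  assumes "g \<in> L2_interval l" "0 \<le> s" "s \<le> t" "t \<le> l"
  shows "(LI s t g)\<^sup>2 \<le> (t - s) * LI 0 l (\<lambda>x. (g x)\<^sup>2)"
proof -
  note i = L2_subinterval[OF assms(1,2,4)]
  have "(LI s t g)\<^sup>2 \<le> (t - s) * LI s t (\<lambda>x. (g x)\<^sup>2)"
    by (rule Cauchy_Schwarz_interval[OF i assms(3)])
  also have "\<dots> \<le> (t - s) * LI 0 l (\<lambda>x. (g x)\<^sup>2)"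
    by (intro mult_left_mono LI_mono_interval[OF L2_intervalD(2)[OF assms(1)]]) (use assms in auto)
  finally show ?thesis .
qed

text \<open>The densities converge in L^2, hence by Cauchy-Schwarz their integrals over each
  subinterval converge, and the increments of the pointwise limit are integrals of the limit
  density.\<close>

lemma primitive_limit:
  fixes g :: "nat \<Rightarrow> real \<Rightarrow> real"
  assumes p: "\<And>n. primitive_on 0 l (f n) (g n)" and g: "\<And>n. g n \<in> L2_interval l" and l: "0 \<le> l"
    and C: "\<And>\<epsilon>. \<epsilon> > 0 \<Longrightarrow> \<exists>N. \<forall>n\<ge>N. \<forall>k\<ge>N. LI 0 l (\<lambda>x. (g n x - g k x)\<^sup>2) < \<epsilon>"
    and lim: "\<And>x. x \<in> {0..l} \<Longrightarrow> (\<lambda>n. f n x) \<longlonglongrightarrow> F x"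
  shows "\<exists>h\<in>L2_interval l. primitive_on 0 l F h \<and> (\<lambda>n. LI 0 l (\<lambda>x. (g n x - h x)\<^sup>2)) \<longlonglongrightarrow> 0"
proof -
  obtain h where h: "h \<in> L2_interval l" "(\<lambda>n. LI 0 l (\<lambda>x. (g n x - h x)\<^sup>2)) \<longlonglongrightarrow> 0"
    using L2_complete[OF g l C] by blast
  have "primitive_on 0 l F h"
    unfolding primitive_on_def
  proof (intro conjI allI impI L2_integrable[OF h(1)])
    fix s t assume st: "0 \<le> s" "s \<le> t" "t \<le> l"
    have "(\<lambda>n. f n t - f n s) \<longlonglongrightarrow> F t - F s"
      using lim[of s] lim[of t] st by (intro tendsto_intros) auto
    then have 1: "(\<lambda>n. LI s t (g n)) \<longlonglongrightarrow> F t - F s"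
      using primitive_onD(2)[OF p st] by simp
    have "(\<lambda>n. LI s t (g n) - LI s t h) \<longlonglongrightarrow> 0"
    proof (rule Lim_null_comparison)
      have b: "(LI s t (g n) - LI s t h)\<^sup>2 \<le> (t - s) * LI 0 l (\<lambda>x. (g n x - h x)\<^sup>2)" for n
        using L2_interval_LI_bound[OF L2_diff[OF g[of n] h(1)] st] L2_subinterval[OF g[of n] st(1,3)] L2_subinterval[OF h(1) st(1,3)]
        by simp
      show "\<forall>\<^sub>F n in sequentially. norm (LI s t (g n) - LI s t h) \<le> sqrt ((t - s) * LI 0 l (\<lambda>x. (g n x - h x)\<^sup>2))"
        by (intro always_eventually allI real_le_rsqrt) (use b in simp)
      have "(\<lambda>n. sqrt ((t - s) * LI 0 l (\<lambda>x. (g n x - h x)\<^sup>2))) \<longlonglongrightarrow> sqrt ((t - s) * 0)"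
        by (intro tendsto_intros h(2))
      then show "(\<lambda>n. sqrt ((t - s) * LI 0 l (\<lambda>x. (g n x - h x)\<^sup>2))) \<longlonglongrightarrow> 0" by simp
    qed
    then have "(\<lambda>n. LI s t (g n)) \<longlonglongrightarrow> LI s t h"
      by (simp add: LIM_zero_iff)
    with 1 show "F t - F s = LI s t h" by (rule LIMSEQ_unique)
  qed
  with h show ?thesis by blast
qed

section \<open>Oscillation of large solutions\<close>

text \<open>Take the least point of the compact sublevel set; the intermediate value theorem forces
  equality there.\<close>

lemma first_hit:
  fixes g :: "real \<Rightarrow> real"
  assumes "continuous_on {x..t} g" "x \<le> t" "g x \<ge> c" "g t \<le> c"
  shows "\<exists>s\<in>{x..t}. g s = c \<and> (\<forall>y\<in>{x..s}. g y \<ge> c)"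
proof -
  have "closed ({x..t} \<inter> g -` {..c})"
    by (rule continuous_closed_preimage[OF assms(1)]) auto
  then have "compact ({x..t} \<inter> g -` {..c})"
    by (metis Int_absorb Int_assoc compact_Icc compact_Int_closed)
  moreover have "{x..t} \<inter> g -` {..c} \<noteq> {}" using assms by auto
  ultimately obtain s where "s \<in> {x..t} \<inter> g -` {..c}" "\<forall>y\<in>{x..t} \<inter> g -` {..c}. s \<le> y"
    using compact_attains_inf[of "{x..t} \<inter> g -` {..c}"] by blast
  then have s: "s \<in> {x..t}" "g s \<le> c" "\<And>y. y \<in> {x..t} \<Longrightarrow> g y \<le> c \<Longrightarrow> s \<le> y"
    by auto
  have "\<exists>y\<ge>x. y \<le> s \<and> g y = c"
    by (rule IVT2') (use s assms continuous_on_subset[OF assms(1), of "{x..s}"] in auto)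
  then obtain y where "x \<le> y" "y \<le> s" "g y = c" by blast
  then have "g s = c" using s(3)[of y] s(1) by auto
  moreover have "g y \<ge> c" if "y \<in> {x..s}" for y
    using s(3)[of y] s(1) that calculation by (cases "g y \<le> c") auto
  ultimately show ?thesis using s(1) by blast
qed

text \<open>
  \<open>osc_system L A r0 r1 p u v\<close> says that \<open>v = u'\<close> and \<open>v' = w u - r |u|\<^bsup>p-2\<^esup> u\<close> on \<open>[0, L]\<close> with
  unspecified coefficients \<open>|w| \<le> A\<close> and \<open>r0 \<le> r \<le> r1\<close>; only increments of \<open>v\<close> appear, and the
  lower estimate for \<open>v\<close> is the upper one for \<open>-v\<close>.
\<close>

definition force_le :: "real \<Rightarrow> real \<Rightarrow> real \<Rightarrow> real \<Rightarrow> real \<Rightarrow> real \<Rightarrow> bool"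
  where "force_le A r0 r1 p y k \<longleftrightarrow>
    (\<forall>w r. \<bar>w\<bar> \<le> A \<longrightarrow> r0 \<le> r \<longrightarrow> r \<le> r1 \<longrightarrow> w * y - r * \<bar>y\<bar> powr (p - 2) * y \<le> k)"

definition osc_upper :: "real \<Rightarrow> real \<Rightarrow> real \<Rightarrow> real \<Rightarrow> real \<Rightarrow> (real \<Rightarrow> real) \<Rightarrow> (real \<Rightarrow> real) \<Rightarrow> bool"
  where "osc_upper L A r0 r1 p u v \<longleftrightarrow> (\<forall>s t k. 0 \<le> s \<longrightarrow> s \<le> t \<longrightarrow> t \<le> L \<longrightarrow>
    (\<forall>x\<in>{s..t}. force_le A r0 r1 p (u x) k) \<longrightarrow> v t - v s \<le> k * (t - s))"

definition osc_system :: "real \<Rightarrow> real \<Rightarrow> real \<Rightarrow> real \<Rightarrow> real \<Rightarrow> (real \<Rightarrow> real) \<Rightarrow> (real \<Rightarrow> real) \<Rightarrow> bool"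
  where "osc_system L A r0 r1 p u v \<longleftrightarrow> primitive_on 0 L u v \<and> continuous_on {0..L} v \<and>
    osc_upper L A r0 r1 p u v \<and> osc_upper L A r0 r1 p (\<lambda>x. - u x) (\<lambda>x. - v x)"

lemma osc_system_uminus:
  "osc_system L A r0 r1 p u v \<Longrightarrow> osc_system L A r0 r1 p (\<lambda>x. - u x) (\<lambda>x. - v x)"
  unfolding osc_system_def using primitive_on_cmul[of 0 L u v "-1"] by (auto intro: continuous_on_minus)

lemma osc_upper_mono: "osc_upper L A r0 r1 p u v \<Longrightarrow> A \<le> A' \<Longrightarrow> osc_upper L A' r0 r1 p u v"
  unfolding osc_upper_def force_le_def by (meson order_trans)

lemma osc_system_mono: "osc_system L A r0 r1 p u v \<Longrightarrow> A \<le> A' \<Longrightarrow> osc_system L A' r0 r1 p u v"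
  unfolding osc_system_def using osc_upper_mono by blast

lemma osc_system_increment_le:
  assumes "osc_system L A r0 r1 p u v" "0 \<le> s" "s \<le> t" "t \<le> L" "\<And>x. x \<in> {s..t} \<Longrightarrow> v x \<le> k"
  shows "u t - u s \<le> k * (t - s)"
proof -
  have p: "primitive_on 0 L u v" using assms(1) by (simp add: osc_system_def)
  have "integrable (lebesgue_on {s..t}) v"
    by (rule integrable_subinterval[OF primitive_onD(1)[OF p]]) (use assms in auto)
  then have "LI s t v \<le> k * (t - s)"
    using assms by (intro LI_le) auto
  then show ?thesis using primitive_onD(2)[OF p assms(2-4)] by simp
qed

text \<open>The smallness of \<alpha> lets half of the power term absorb the linear term; the other
  half drives \<open>v\<close> down at a uniform rate.\<close>

lemma osc_system_concave:
  assumes "osc_system L \<alpha> r0 r1 p u v" "0 \<le> s" "s \<le> t" "t \<le> L" "0 < \<mu>" "2 < p" "0 < r0"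
    and \<alpha>: "\<alpha> \<le> r0 * \<mu> powr (p - 2) / 2" and u: "\<And>x. x \<in> {s..t} \<Longrightarrow> \<mu> \<le> u x"
  shows "v t - v s \<le> - (\<mu> * (r0 * \<mu> powr (p - 2) / 2)) * (t - s)"
proof -
  have "force_le \<alpha> r0 r1 p (u x) (- (\<mu> * (r0 * \<mu> powr (p - 2) / 2)))" if x: "x \<in> {s..t}" for x
    unfolding force_le_def
  proof (intro allI impI)
    fix w r assume wr: "\<bar>w\<bar> \<le> \<alpha>" "r0 \<le> r" "r \<le> r1"
    let ?y = "u x"
    have y: "\<mu> \<le> ?y" "0 < ?y" using u[OF x] assms by auto
    have "\<mu> powr (p - 2) \<le> ?y powr (p - 2)" using y assms by (intro powr_mono2) auto
    then have "r0 * \<mu> powr (p - 2) \<le> r * ?y powr (p - 2)"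
      using wr assms by (intro mult_mono) auto
    then have "w - r * \<bar>?y\<bar> powr (p - 2) \<le> - (r0 * \<mu> powr (p - 2) / 2)"
      using wr \<alpha> y by simp
    then have "(w - r * \<bar>?y\<bar> powr (p - 2)) * ?y \<le> - (r0 * \<mu> powr (p - 2) / 2) * ?y"
      using y by (intro mult_right_mono) auto
    also have "\<dots> \<le> - (r0 * \<mu> powr (p - 2) / 2) * \<mu>"
      using y assms by (intro mult_left_mono_neg) auto
    finally show "w * ?y - r * \<bar>?y\<bar> powr (p - 2) * ?y \<le> - (\<mu> * (r0 * \<mu> powr (p - 2) / 2))"
      by (simp add: algebra_simps)
  qed
  then show ?thesis
    using assms(1-4) unfolding osc_system_def osc_upper_def by blast
qed

text \<open>For nonnegative \<open>u\<close> the power term only lowers \<open>v\<close>, so any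
  increase of \<open>v\<close> is due to the small linear coefficient. This controls the slope
  between the level \<theta>/2 and the zero.\<close>

lemma osc_system_nonneg:
  assumes "osc_system L \<alpha> r0 r1 p u v" "0 \<le> s" "s \<le> t" "t \<le> L" "0 < r0"
    and u: "\<And>x. x \<in> {s..t} \<Longrightarrow> 0 \<le> u x \<and> u x \<le> 1"
  shows "v t - v s \<le> \<alpha> * (t - s)"
proof -
  have "force_le \<alpha> r0 r1 p (u x) \<alpha>" if x: "x \<in> {s..t}" for x
    unfolding force_le_def
  proof (intro allI impI)
    fix w r assume wr: "\<bar>w\<bar> \<le> \<alpha>" "r0 \<le> r" "r \<le> r1"
    have "w * u x \<le> \<alpha> * 1" using wr u[OF x] by (intro mult_mono) auto
    moreover have "0 \<le> r * \<bar>u x\<bar> powr (p - 2) * u x" using wr assms u[OF x] by auto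
    ultimately show "w * u x - r * \<bar>u x\<bar> powr (p - 2) * u x \<le> \<alpha>" by linarith
  qed
  then show ?thesis
    using assms(1-4) unfolding osc_system_def osc_upper_def by blast
qed

text \<open>A crude rate that is valid whatever the sign of \<open>u\<close>; it is applied just
  past a zero.\<close>

lemma osc_system_bound:
  assumes "osc_system L \<alpha> r0 r1 p u v" "0 \<le> s" "s \<le> t" "t \<le> L" "0 < r0" "2 < p"
    and u: "\<And>x. x \<in> {s..t} \<Longrightarrow> \<bar>u x\<bar> \<le> 1"
  shows "v t - v s \<le> (\<alpha> + r1) * (t - s)"
proof -
  have "force_le \<alpha> r0 r1 p (u x) (\<alpha> + r1)" if x: "x \<in> {s..t}" for x
    unfolding force_le_def
  proof (intro allI impI)
    fix w r assume wr: "\<bar>w\<bar> \<le> \<alpha>" "r0 \<le> r" "r \<le> r1"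
    have "\<bar>u x\<bar> powr (p - 2) \<le> 1 powr (p - 2)" using u[OF x] assms by (intro powr_mono2) auto
    then have "r * \<bar>u x\<bar> powr (p - 2) \<le> r1 * 1" using wr assms by (intro mult_mono) auto
    moreover have "0 \<le> r * \<bar>u x\<bar> powr (p - 2)" using wr assms(5) by simp
    ultimately have "\<bar>w - r * \<bar>u x\<bar> powr (p - 2)\<bar> \<le> \<alpha> + r1" using wr assms(5) by linarith
    then have "\<bar>w - r * \<bar>u x\<bar> powr (p - 2)\<bar> * \<bar>u x\<bar> \<le> (\<alpha> + r1) * 1" using u[OF x] by (intro mult_mono) auto
    then have "\<bar>(w - r * \<bar>u x\<bar> powr (p - 2)) * u x\<bar> \<le> \<alpha> + r1" by (simp add: abs_mult)
    then show "w * u x - r * \<bar>u x\<bar> powr (p - 2) * u x \<le> \<alpha> + r1" by (simp add: algebra_simps abs_le_iff)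
  qed
  then show ?thesis
    using assms(1-4) unfolding osc_system_def osc_upper_def by blast
qed

text \<open>On the first half \<open>u\<close> does not grow, on the second half its slope is at
  most -c T / 2; hence the denominator 4.\<close>

lemma osc_system_drop:
  assumes o: "osc_system L A r0 r1 p u v" and x: "0 \<le> x" "0 \<le> T" "x + T \<le> L"
    and c: "0 \<le> c" "\<And>y. y \<in> {x..x+T} \<Longrightarrow> v y \<le> - c * (y - x)"
  shows "u (x + T) - u x \<le> - c * T\<^sup>2 / 4"
proof -
  have "v y \<le> 0" if "y \<in> {x..x+T/2}" for y
    using c(2)[of y] that x mult_nonneg_nonneg[OF c(1), of "y - x"] by auto
  then have "u (x + T/2) - u x \<le> 0 * (x + T/2 - x)"
    by (intro osc_system_increment_le[OF o]) (use x in auto)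
  moreover have "u (x + T) - u (x + T/2) \<le> (- c * (T/2)) * (x + T - (x + T/2))"
  proof (intro osc_system_increment_le[OF o])
    fix y assume y: "y \<in> {x + T/2..x+T}"
    have "c * (T/2) \<le> c * (y - x)" using y c(1) by (intro mult_left_mono) auto
    then show "v y \<le> - c * (T/2)" using c(2)[of y] y x by auto
  qed (use x in auto)
  ultimately show ?thesis by (simp add: power2_eq_square field_simps)
qed

lemma osc_system_continuous:
  assumes "osc_system L A r0 r1 p u v" "0 \<le> s" "t \<le> L"
  shows "continuous_on {s..t} u" "continuous_on {s..t} v"
  using assms primitive_on_continuous[of 0 L u v] unfolding osc_system_def
  by (auto intro: continuous_on_subset[of "{0..L}"])

text \<open>One half-oscillation with constants independent of the solution: a descent through a
  zero to a definite depth, followed until the slope is no longer negative. Seen through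
  \<open>-u\<close>, the final state has the form of the initial one with \<open>\<theta>'\<close>
  in place of \<theta>, which makes the lemma iterable.\<close>

lemma hump:
  assumes p: "2 < p" and r: "0 < r0" "r0 \<le> r1" and \<theta>: "0 < \<theta>" "\<theta> \<le> 1"
  shows "\<exists>\<alpha>>0. \<exists>T>0. \<exists>\<theta>'>0. \<theta>' \<le> 1 \<and> (\<forall>L u v x. osc_system L \<alpha> r0 r1 p u v \<longrightarrow> (\<forall>y\<in>{0..L}. \<bar>u y\<bar> \<le> 1) \<longrightarrow>
    0 \<le> x \<longrightarrow> x + T \<le> L \<longrightarrow> \<theta> \<le> u x \<longrightarrow> v x \<le> 0 \<longrightarrow>
    (\<exists>z y. x < z \<and> z < y \<and> y \<le> x + T \<and> u z = 0 \<and> u y \<le> - \<theta>' \<and> 0 \<le> v y))"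
proof -
  define c where "c = \<theta>/2 * (r0 * (\<theta>/2) powr (p - 2) / 2)"
  have c: "c > 0" using \<theta> r by (simp add: c_def)
  \<comment> \<open>\<open>T\<close> makes the drop \<open>c * T\<^sup>2 / 4\<close> equal to 2,
    more than |u| <= 1 allows while \<open>u\<close> stays above \<theta>/2.\<close>
  define T where "T = sqrt (8 / c)"
  have T: "T > 0" "c * T\<^sup>2 / 4 = 2" using c by (auto simp: T_def)
  \<comment> \<open>Falling from \<theta> to \<theta>/2 within time \<open>T\<close> forces a slope
    of at most \<open>- \<sigma>\<close>; if half of that slope is kept, time \<tau> suffices for
    the remaining \<theta>/2.\<close>
  define \<sigma> where "\<sigma> = \<theta> / (2 * T)"
  have \<sigma>: "\<sigma> > 0" using \<theta> T by (simp add: \<sigma>_def)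
  define \<tau> where "\<tau> = \<theta> / \<sigma>"
  have \<tau>: "\<tau> > 0" "\<sigma> * \<tau> = \<theta>" using \<theta> \<sigma> by (auto simp: \<tau>_def)
  \<comment> \<open>\<open>- s\<close> bounds the slope at the zero, \<delta> is a time during which
    the slope stays below \<open>- s / 2\<close>, and \<open>\<theta>'\<close> is a depth reached
    thereby.\<close>
  define s where "s = \<sigma> / 2"
  define \<delta> where "\<delta> = s / (2 * (1 + r1))"
  have s: "s > 0" using \<sigma> by (simp add: s_def)
  have \<delta>: "\<delta> > 0" "(1 + r1) * \<delta> = s / 2" using s r by (auto simp: \<delta>_def field_simps)
  define \<theta>' where "\<theta>' = min 1 (s * \<delta> / 2)"
  have \<theta>': "\<theta>' > 0" "\<theta>' \<le> 1" "\<theta>' \<le> s * \<delta> / 2" using s \<delta> by (auto simp: \<theta>'_def)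
  define c' where "c' = \<theta>' * (r0 * \<theta>' powr (p - 2) / 2)"
  have c': "c' > 0" using \<theta>' r by (simp add: c'_def)
  define T' where "T' = sqrt (8 / c')"
  have T': "T' > 0" "c' * T'\<^sup>2 / 4 = 2" using c' by (auto simp: T'_def)
  \<comment> \<open>The four terms serve, in order, the crude rate past the zero, concavity above
    \<theta>/2, convexity below \<open>- \<theta>'\<close>, and a loss of at most
    \<open>\<sigma> / 2\<close> of slope during the time \<tau>.\<close>
  define \<alpha> where "\<alpha> = min (min 1 (r0 * (\<theta>/2) powr (p - 2) / 2)) (min (r0 * \<theta>' powr (p - 2) / 2) (\<sigma> / (2 * \<tau>)))"
  have \<alpha>: "0 < \<alpha>" using r \<theta> \<theta>' \<sigma> \<tau> by (simp add: \<alpha>_def)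
  have \<alpha>le: "\<alpha> \<le> 1" "\<alpha> \<le> r0 * (\<theta>/2) powr (p - 2) / 2" "\<alpha> \<le> r0 * \<theta>' powr (p - 2) / 2" "\<alpha> \<le> \<sigma> / (2 * \<tau>)"
    by (auto simp: \<alpha>_def)
  have \<alpha>\<tau>: "\<alpha> * \<tau> \<le> \<sigma> / 2" using \<alpha>le(4) \<tau> by (simp add: field_simps)
  have "\<exists>z y. x < z \<and> z < y \<and> y \<le> x + (T + \<tau> + \<delta> + T') \<and> u z = 0 \<and> u y \<le> - \<theta>' \<and> 0 \<le> v y"
    if o: "osc_system L \<alpha> r0 r1 p u v" and u1: "\<And>y. y \<in> {0..L} \<Longrightarrow> \<bar>u y\<bar> \<le> 1"
      and x: "0 \<le> x" "x + (T + \<tau> + \<delta> + T') \<le> L" and ux: "\<theta> \<le> u x" "v x \<le> 0" for L u v x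
  proof -
    note cont = osc_system_continuous[OF o]
    have "\<exists>t\<in>{x..x+T}. u t \<le> \<theta>/2"
    proof (rule ccontr)
      assume "\<not> ?thesis"
      then have ge: "\<And>t. t \<in> {x..x+T} \<Longrightarrow> \<theta>/2 \<le> u t" by force
      have "v y \<le> - c * (y - x)" if "y \<in> {x..x+T}" for y
        using osc_system_concave[OF o, of x y "\<theta>/2"] ge that x T \<tau> \<delta> T' ux \<theta> p r \<alpha>le(2) by (force simp: c_def)
      then have "u (x + T) - u x \<le> - c * T\<^sup>2 / 4"
        by (intro osc_system_drop[OF o]) (use x T \<tau> \<delta> T' c in auto)
      moreover have "u x \<le> 1" using u1[of x] x T \<tau> \<delta> T' by auto
      ultimately show False using ge[of "x+T"] T \<theta> by simp
    qed
    then obtain t where t: "t \<in> {x..x+T}" "u t \<le> \<theta>/2" by blast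
    have "\<exists>t1\<in>{x..t}. u t1 = \<theta>/2 \<and> (\<forall>y\<in>{x..t1}. u y \<ge> \<theta>/2)"
      by (rule first_hit[OF cont(1)]) (use t x ux \<theta> T \<tau> \<delta> T' in auto)
    then obtain t1 where t1: "x \<le> t1" "t1 \<le> x + T" "u t1 = \<theta>/2" "\<And>y. y \<in> {x..t1} \<Longrightarrow> u y \<ge> \<theta>/2"
      using t by auto
    have "x \<noteq> t1" using t1 ux \<theta> by auto
    then have xt1: "x < t1" using t1 by simp
    have L1: "t1 + \<tau> + \<delta> + T' \<le> L" using t1 x by simp
    have vt1: "v t1 \<le> - \<sigma>"
    proof -
      \<comment> \<open>\<open>u\<close> is concave down to the level \<theta>/2, so the slope at
        the hit is the steepest one and at least as steep as the mean slope.\<close>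
      have "- v y \<le> - v t1" if y: "y \<in> {x..t1}" for y
      proof -
        have "v t1 - v y \<le> - c * (t1 - y)"
          unfolding c_def by (rule osc_system_concave[OF o]) (use y x L1 t1 \<tau> \<delta> T' \<theta> p r \<alpha>le(2) in auto)
        moreover have "0 \<le> c * (t1 - y)" using c y by simp
        ultimately show ?thesis by linarith
      qed
      then have "- u t1 - - u x \<le> - v t1 * (t1 - x)"
        by (intro osc_system_increment_le[OF osc_system_uminus[OF o]]) (use x t1 L1 \<tau> \<delta> T' in auto)
      then have 1: "\<theta>/2 \<le> - v t1 * (t1 - x)" using ux t1 by simp
      then have "0 < - v t1 * (t1 - x)" using \<theta> by linarith
      then have "0 \<le> - v t1" using zero_less_mult_pos2[of "- v t1" "t1 - x"] xt1 by linarith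
      then have "- v t1 * (t1 - x) \<le> - v t1 * T" using t1 by (intro mult_left_mono) auto
      with 1 show ?thesis using T by (simp add: \<sigma>_def field_simps)
    qed
    have "\<exists>t\<in>{t1..t1+\<tau>}. u t \<le> 0"
    proof (rule ccontr)
      assume "\<not> ?thesis"
      then have pos: "\<And>t. t \<in> {t1..t1+\<tau>} \<Longrightarrow> 0 < u t" by force
      have "v y \<le> - \<sigma>/2" if y: "y \<in> {t1..t1+\<tau>}" for y
      proof -
        have "v y - v t1 \<le> \<alpha> * (y - t1)"
        proof (rule osc_system_nonneg[OF o])
          fix xa assume "xa \<in> {t1..y}"
          then show "0 \<le> u xa \<and> u xa \<le> 1" using pos[of xa] u1[of xa] y x t1 L1 \<delta> T' by auto
        qed (use x y t1 L1 \<delta> T' r in auto)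
        also have "\<dots> \<le> \<alpha> * \<tau>" using y \<alpha> by (intro mult_left_mono) auto
        finally show ?thesis using \<alpha>\<tau> vt1 by simp
      qed
      then have "u (t1 + \<tau>) - u t1 \<le> - \<sigma>/2 * (t1 + \<tau> - t1)"
        by (intro osc_system_increment_le[OF o]) (use x t1 L1 \<tau> \<delta> T' in auto)
      then show False using pos[of "t1+\<tau>"] \<tau> t1 by simp
    qed
    then obtain t' where t': "t' \<in> {t1..t1+\<tau>}" "u t' \<le> 0" by blast
    have "\<exists>z\<in>{t1..t'}. u z = 0 \<and> (\<forall>y\<in>{t1..z}. u y \<ge> 0)"
      by (rule first_hit[OF cont(1)]) (use t' x t1 \<theta> L1 \<tau> \<delta> T' in auto)
    then obtain z where z: "t1 \<le> z" "z \<le> t1 + \<tau>" "u z = 0" "\<And>y. y \<in> {t1..z} \<Longrightarrow> u y \<ge> 0"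
      using t' by auto
    have vz: "v z \<le> - s"
    proof -
      have "v z - v t1 \<le> \<alpha> * (z - t1)"
      proof (rule osc_system_nonneg[OF o])
        fix xa assume "xa \<in> {t1..z}"
        then show "0 \<le> u xa \<and> u xa \<le> 1" using z(4)[of xa] u1[of xa] z x t1 L1 \<delta> T' by auto
      qed (use x z t1 L1 \<delta> T' r in auto)
      also have "\<dots> \<le> \<alpha> * \<tau>" using z \<alpha> by (intro mult_left_mono) auto
      finally show ?thesis using \<alpha>\<tau> vt1 by (simp add: s_def)
    qed
    define y1 where "y1 = z + \<delta>"
    have y1: "z < y1" "y1 + T' \<le> L" "0 \<le> y1" using z L1 \<delta> x t1 T' by (auto simp: y1_def)
    have uy1: "u y1 \<le> - \<theta>'"
    proof -
      have "v y \<le> - s/2" if y: "y \<in> {z..y1}" for y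
      proof -
        have "v y - v z \<le> (\<alpha> + r1) * (y - z)"
          by (rule osc_system_bound[OF o]) (use x y z y1 t1 T' r p u1 in auto)
        also have "\<dots> \<le> (1 + r1) * \<delta>" using y \<alpha>le r by (intro mult_mono) (auto simp: y1_def)
        finally show ?thesis using \<delta> vz by simp
      qed
      then have "u y1 - u z \<le> - s/2 * (y1 - z)"
        by (intro osc_system_increment_le[OF o]) (use x z t1 y1 T' in auto)
      then show ?thesis using z \<theta>' by (simp add: y1_def)
    qed
    have "\<exists>y\<in>{y1..y1+T'}. v y \<ge> 0"
    proof (rule ccontr)
      assume "\<not> ?thesis"
      then have neg: "\<And>t. t \<in> {y1..y1+T'} \<Longrightarrow> v t < 0" by (meson not_le)
      have le: "u y \<le> - \<theta>'" if "y \<in> {y1..y1+T'}" for y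
      proof -
        have "u y - u y1 \<le> 0 * (y - y1)"
          by (rule osc_system_increment_le[OF o]) (use that y1 neg in \<open>auto intro!: less_imp_le\<close>)
        then show ?thesis using uy1 by simp
      qed
      let ?h = "T'/2"
      have vv: "- v y - - v y0 \<le> - c' * (y - y0)" if "y1 \<le> y0" "y0 \<le> y" "y \<le> y1 + T'" for y y0
        unfolding c'_def
      proof (rule osc_system_concave[OF osc_system_uminus[OF o]])
        show "\<theta>' \<le> - u x" if "x \<in> {y0..y}" for x
          using le[of x] that \<open>y1 \<le> y0\<close> \<open>y \<le> y1 + T'\<close> by auto
      qed (use that y1 \<theta>' p r \<alpha>le(3) in auto)
      \<comment> \<open>Slopes are estimated backwards from the right end: \<open>v\<close> rises at
        rate \<open>c'\<close> and is still negative at \<open>y1 + T'\<close>, so on the first half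
        it lies below \<open>- c' * T' / 2\<close>.\<close>
      have "v y \<le> - c' * ?h" if y: "y \<in> {y1..y1 + ?h}" for y
      proof -
        have "c' * ?h \<le> c' * (y1 + T' - y)" using y c' by (intro mult_left_mono) auto
        then show ?thesis using vv[of y "y1 + T'"] neg[of "y1+T'"] y T' by auto
      qed
      then have "u (y1 + ?h) - u y1 \<le> - c' * ?h * (y1 + ?h - y1)"
        by (intro osc_system_increment_le[OF o]) (use y1 T' in auto)
      also have "\<dots> = - (c' * T'\<^sup>2 / 4)" by (simp add: power2_eq_square)
      also have "\<dots> = - 2" using T' by simp
      finally have "u (y1 + ?h) < - 1" using uy1 \<theta>' by simp
      then show False using u1[of "y1 + ?h"] y1 T' by auto
    qed
    then obtain y' where y': "y' \<in> {y1..y1+T'}" "v y' \<ge> 0" by blast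
    show ?thesis
    proof (cases "v y1 \<ge> 0")
      case True
      then show ?thesis
        using uy1 y1 z t1 xt1 T' by (intro exI[of _ z] exI[of _ y1]) (auto simp: y1_def)
    next
      case False
      \<comment> \<open>The first zero of the slope is taken, so that \<open>u\<close> has not
        increased since \<open>y1\<close>.\<close>
      have "\<exists>y\<in>{y1..y'}. - v y = 0 \<and> (\<forall>x\<in>{y1..y}. - v x \<ge> 0)"
        by (rule first_hit) (use y' y1 False cont(2)[of y1 y'] in \<open>auto intro!: continuous_on_minus\<close>)
      then obtain y where y: "y \<in> {y1..y'}" "v y = 0" "\<And>x. x \<in> {y1..y} \<Longrightarrow> v x \<le> 0" by auto
      have "u y - u y1 \<le> 0 * (y - y1)"
        by (rule osc_system_increment_le[OF o]) (use y y' y1 in auto)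
      then show ?thesis
        using uy1 y y' y1 z t1 xt1 by (intro exI[of _ z] exI[of _ y]) (auto simp: y1_def)
    qed
  qed
  then show ?thesis
    using \<alpha> \<theta>' T \<tau> \<delta> T' by (intro exI[of _ \<alpha>] conjI exI[of _ "T + \<tau> + \<delta> + T'"] exI[of _ \<theta>']) auto
qed

text \<open>\<open>hump\<close> is applied alternately to \<open>u\<close> and \<open>-u\<close>,
  the depth of each half-oscillation being the height of the next; the admissible \<alpha> shrinks
  and the times add up. The nonzero values in between make \<open>u\<close> nontrivial on the
  intervals bounded by consecutive zeros.\<close>

lemma zero_chain:
  assumes p: "2 < p" and r: "0 < r0" "r0 \<le> r1" and \<theta>: "0 < \<theta>" "\<theta> \<le> 1"
  shows "\<exists>\<alpha>>0. \<exists>T>0. \<forall>L u v x. osc_system L \<alpha> r0 r1 p u v \<longrightarrow> (\<forall>y\<in>{0..L}. \<bar>u y\<bar> \<le> 1) \<longrightarrow>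
    0 \<le> x \<longrightarrow> x + T \<le> L \<longrightarrow> \<theta> \<le> u x \<longrightarrow> v x \<le> 0 \<longrightarrow>
    (\<exists>z::nat \<Rightarrow> real. (\<forall>j\<le>k. x < z j \<and> z j \<le> x + T \<and> u (z j) = 0) \<and>
      (\<forall>j<k. \<exists>y. z j < y \<and> y < z (Suc j) \<and> u y \<noteq> 0))"
  using \<theta>
proof (induction k arbitrary: \<theta>)
  case 0
  obtain \<alpha> T where "\<alpha> > 0" "T > 0" and h: "\<And>L u v x. osc_system L \<alpha> r0 r1 p u v \<Longrightarrow> (\<forall>y\<in>{0..L}. \<bar>u y\<bar> \<le> 1) \<Longrightarrow>
    0 \<le> x \<Longrightarrow> x + T \<le> L \<Longrightarrow> \<theta> \<le> u x \<Longrightarrow> v x \<le> 0 \<Longrightarrow>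
    (\<exists>z y. x < z \<and> z < y \<and> y \<le> x + T \<and> u z = 0)"
    using hump[OF p r 0] by metis
  have "\<exists>z::nat \<Rightarrow> real. (\<forall>j\<le>0. x < z j \<and> z j \<le> x + T \<and> u (z j) = 0) \<and>
      (\<forall>j<0. \<exists>y. z j < y \<and> y < z (Suc j) \<and> u y \<noteq> 0)"
    if a: "osc_system L \<alpha> r0 r1 p u v" "\<forall>y\<in>{0..L}. \<bar>u y\<bar> \<le> 1" "0 \<le> x" "x + T \<le> L" "\<theta> \<le> u x" "v x \<le> 0" for L u v x
  proof -
    obtain z y where "x < z" "z < y" "y \<le> x + T" "u z = 0" using h[OF a] by blast
    then show ?thesis
      by (intro exI[of _ "\<lambda>_. z"]) auto
  qed
  with \<open>\<alpha> > 0\<close> \<open>T > 0\<close> show ?case by blast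
next
  case (Suc k)
  obtain \<alpha> T \<theta>' where 1: "\<alpha> > 0" "T > 0" "0 < \<theta>'" "\<theta>' \<le> 1" and h: "\<And>L u v x. osc_system L \<alpha> r0 r1 p u v \<Longrightarrow> (\<forall>y\<in>{0..L}. \<bar>u y\<bar> \<le> 1) \<Longrightarrow>
    0 \<le> x \<Longrightarrow> x + T \<le> L \<Longrightarrow> \<theta> \<le> u x \<Longrightarrow> v x \<le> 0 \<Longrightarrow>
    (\<exists>z y. x < z \<and> z < y \<and> y \<le> x + T \<and> u z = 0 \<and> u y \<le> - \<theta>' \<and> 0 \<le> v y)"
    using hump[OF p r Suc.prems] by metis
  obtain \<alpha>' T' where 2: "\<alpha>' > 0" "T' > 0" and h': "\<And>L u v x. osc_system L \<alpha>' r0 r1 p u v \<Longrightarrow> (\<forall>y\<in>{0..L}. \<bar>u y\<bar> \<le> 1) \<Longrightarrow>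
    0 \<le> x \<Longrightarrow> x + T' \<le> L \<Longrightarrow> \<theta>' \<le> u x \<Longrightarrow> v x \<le> 0 \<Longrightarrow>
    (\<exists>z::nat \<Rightarrow> real. (\<forall>j\<le>k. x < z j \<and> z j \<le> x + T' \<and> u (z j) = 0) \<and>
      (\<forall>j<k. \<exists>y. z j < y \<and> y < z (Suc j) \<and> u y \<noteq> 0))"
    using Suc.IH[OF 1(3,4)] by metis
  have "\<exists>z::nat \<Rightarrow> real. (\<forall>j\<le>Suc k. x < z j \<and> z j \<le> x + (T + T') \<and> u (z j) = 0) \<and>
      (\<forall>j<Suc k. \<exists>y. z j < y \<and> y < z (Suc j) \<and> u y \<noteq> 0)"
    if a: "osc_system L (min \<alpha> \<alpha>') r0 r1 p u v" "\<forall>y\<in>{0..L}. \<bar>u y\<bar> \<le> 1" "0 \<le> x" "x + (T + T') \<le> L" "\<theta> \<le> u x" "v x \<le> 0" for L u v x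
  proof -
    have o: "osc_system L \<alpha> r0 r1 p u v" "osc_system L \<alpha>' r0 r1 p u v"
      using osc_system_mono[OF a(1)] by auto
    obtain z y where zy: "x < z" "z < y" "y \<le> x + T" "u z = 0" "u y \<le> - \<theta>'" "0 \<le> v y"
      using h[OF o(1) a(2,3) _ a(5,6)] a(4) 2 by auto
    obtain z' :: "nat \<Rightarrow> real" where z': "\<And>j. j \<le> k \<Longrightarrow> y < z' j \<and> z' j \<le> y + T' \<and> u (z' j) = 0"
      "\<And>j. j < k \<Longrightarrow> \<exists>x. z' j < x \<and> x < z' (Suc j) \<and> u x \<noteq> 0"
      using h'[OF osc_system_uminus[OF o(2)], of y] a zy by auto
    \<comment> \<open>The new zero is put in front; the point \<open>y\<close>, where
      \<open>u\<close> is negative, separates it from the chain given by the induction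
      hypothesis.\<close>
    define Z where "Z j = (case j of 0 \<Rightarrow> z | Suc i \<Rightarrow> z' i)" for j
    show ?thesis
    proof (intro exI[of _ Z] conjI allI impI)
      fix j assume "j \<le> Suc k"
      then show "x < Z j" "Z j \<le> x + (T + T')" "u (Z j) = 0"
        using zy z'(1)[of "j - 1"] 2 by (auto simp: Z_def split: nat.splits)
    next
      fix j assume "j < Suc k"
      then show "\<exists>y. Z j < y \<and> y < Z (Suc j) \<and> u y \<noteq> 0"
        using zy z'(1)[of 0] z'(2)[of "j - 1"] 1 by (cases j) (auto simp: Z_def intro!: exI[of _ y])
    qed
  qed
  moreover have "0 < min \<alpha> \<alpha>'" "0 < T + T'" using 1 2 by auto
  ultimately show ?case by blast
qed

section \<open>Symmetric bilinear forms on subspaces\<close>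

text \<open>Bilinearity is demanded only on \<open>H\<close>: the forms are integrals, which are
  additive only on functions for which they converge.\<close>

definition sym_form :: "'a::real_vector set \<Rightarrow> ('a \<Rightarrow> 'a \<Rightarrow> real) \<Rightarrow> bool"
  where "sym_form H b \<longleftrightarrow> subspace H \<and> (\<forall>x\<in>H. \<forall>y\<in>H. b x y = b y x) \<and>
    (\<forall>x\<in>H. \<forall>y\<in>H. \<forall>z\<in>H. b (x + y) z = b x z + b y z) \<and> (\<forall>c. \<forall>x\<in>H. \<forall>z\<in>H. b (c *\<^sub>R x) z = c * b x z)"

lemma sym_formD:
  assumes "sym_form H b"
  shows "subspace H" "x \<in> H \<Longrightarrow> y \<in> H \<Longrightarrow> b x y = b y x"
    "x \<in> H \<Longrightarrow> y \<in> H \<Longrightarrow> z \<in> H \<Longrightarrow> b (x + y) z = b x z + b y z"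
    "x \<in> H \<Longrightarrow> z \<in> H \<Longrightarrow> b (c *\<^sub>R x) z = c * b x z"
  using assms by (auto simp: sym_form_def)

lemma sym_form_simps:
  assumes "sym_form H b" "x \<in> H" "y \<in> H" "z \<in> H"
  shows "b z (x + y) = b z x + b z y" "b z (c *\<^sub>R x) = c * b z x"
    "b (x - y) z = b x z - b y z" "b z (x - y) = b z x - b z y" "b 0 z = 0"
proof -
  note D = sym_formD[OF assms(1)]
  have s: "x + y \<in> H" "c *\<^sub>R x \<in> H" "-1 *\<^sub>R y \<in> H" "x - y \<in> H" "x + -1 *\<^sub>R y = x - y"
    using D(1) assms by (auto simp: subspace_add subspace_scale subspace_diff subspace_neg)
  show "b z (x + y) = b z x + b z y"
    using D(2)[OF assms(4) s(1)] D(2)[OF assms(4,2)] D(2)[OF assms(4,3)] D(3)[OF assms(2-4)] by simp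
  show "b z (c *\<^sub>R x) = c * b z x"
    using D(2)[OF assms(4) s(2)] D(2)[OF assms(4,2)] D(4)[OF assms(2,4)] by simp
  show 1: "b (x - y) z = b x z - b y z"
    using D(3)[OF assms(2) s(3) assms(4)] D(4)[OF assms(3,4), of "-1"] s(5) by simp
  show "b z (x - y) = b z x - b z y"
    using D(2)[OF assms(4) s(4)] D(2)[OF assms(4,2)] D(2)[OF assms(4,3)] 1 by simp
  show "b 0 z = 0" using D(4)[OF assms(2,4), of 0] by simp
qed

lemma sym_form_quadratic:
  assumes f: "sym_form H b" and x: "x \<in> H" and y: "y \<in> H"
  shows "b (x + t *\<^sub>R y) (x + t *\<^sub>R y) = b x x + 2 * t * b x y + t\<^sup>2 * b y y"
proof -
  have ty: "t *\<^sub>R y \<in> H" "x + t *\<^sub>R y \<in> H"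
    using sym_formD(1)[OF f] x y by (auto intro: subspace_add subspace_scale)
  show ?thesis
    using x y ty by (simp add: sym_formD(3)[OF f] sym_form_simps(1)[OF f x ty(1)] sym_formD(4)[OF f]
        sym_form_simps(2)[OF f y y] sym_formD(2)[OF f y x] power2_eq_square algebra_simps)
qed

lemma sym_form_sum:
  assumes "sym_form H b" "finite B" "B \<subseteq> H" "z \<in> H"
  shows "b (\<Sum>v\<in>B. c v *\<^sub>R v) z = (\<Sum>v\<in>B. c v * b v z)"
  using assms(2,3)
proof (induction B)
  case empty
  then show ?case using sym_form_simps(5)[OF assms(1) assms(4,4,4)] by simp
next
  case (insert v B)
  have "(\<Sum>v\<in>B. c v *\<^sub>R v) \<in> H"
    using insert sym_formD(1)[OF assms(1)] by (intro subspace_sum) (auto intro: subspace_scale)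
  then show ?case
    using insert sym_formD[OF assms(1)] assms(4) by (auto simp: subspace_scale)
qed

text \<open>Pairing a combination with a member of \<open>B\<close> recovers its coefficient, so the
  form on the span is the sum of the \<open>(c v)\<^sup>2 * b v v\<close>. Pairwise orthogonal
  negative vectors thus certify a Morse index of at least their number.\<close>

lemma orthogonal_negative_span:
  assumes f: "sym_form H b" and B: "finite B" "B \<subseteq> H"
    and orth: "\<And>x y. x \<in> B \<Longrightarrow> y \<in> B \<Longrightarrow> x \<noteq> y \<Longrightarrow> b x y = 0" and neg: "\<And>x. x \<in> B \<Longrightarrow> b x x < 0"
  shows "independent B" "\<And>x. x \<in> span B - {0} \<Longrightarrow> b x x < 0" "span B \<subseteq> H"
proof -
  show sub: "span B \<subseteq> H" by (rule span_minimal[OF B(2) sym_formD(1)[OF f]])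
  have coef: "b (\<Sum>v\<in>B. c v *\<^sub>R v) w = c w * b w w" if "w \<in> B" for c w
  proof -
    have "b (\<Sum>v\<in>B. c v *\<^sub>R v) w = (\<Sum>v\<in>B. c v * b v w)"
      using sym_form_sum[OF f B, of w c] that B by auto
    also have "\<dots> = (\<Sum>v\<in>B. if v = w then c w * b w w else 0)"
      by (rule sum.cong) (use orth that in auto)
    finally show ?thesis using that B by simp
  qed
  show "independent B"
  proof (rule independent_if_scalars_zero[OF B(1)])
    fix c w assume "(\<Sum>v\<in>B. c v *\<^sub>R v) = 0" "w \<in> B"
    then have "c w * b w w = 0"
      using coef[of w c] sym_form_simps(5)[OF f, of w w w] B by auto
    then show "c w = 0" using neg[OF \<open>w \<in> B\<close>] by auto
  qed
  fix x assume x: "x \<in> span B - {0}"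
  then obtain c where c: "x = (\<Sum>v\<in>B. c v *\<^sub>R v)" using span_finite[OF B(1)] by auto
  have "b x x = (\<Sum>v\<in>B. c v * b v x)"
    unfolding c using sym_form_sum[OF f B, of x c] x sub c by auto
  also have "\<dots> = (\<Sum>v\<in>B. (c v)\<^sup>2 * b v v)"
  proof (rule sum.cong)
    fix v assume v: "v \<in> B"
    then have "b v x = b x v" using sym_formD(2)[OF f] x sub B by auto
    also have "\<dots> = c v * b v v" unfolding c by (rule coef[OF v])
    finally show "c v * b v x = (c v)\<^sup>2 * b v v" by (simp add: power2_eq_square)
  qed simp
  also have "\<dots> < 0"
  proof -
    obtain w where w: "w \<in> B" "c w \<noteq> 0"
      using x c by (metis (no_types, lifting) DiffE insertI1 scale_eq_0_iff sum.neutral)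
    have "(\<Sum>v\<in>B. (c v)\<^sup>2 * b v v) = (c w)\<^sup>2 * b w w + (\<Sum>v\<in>B-{w}. (c v)\<^sup>2 * b v v)"
      by (rule sum.remove[OF B(1) w(1)])
    moreover have "(c w)\<^sup>2 * b w w < 0" using w neg by (simp add: mult_pos_neg)
    moreover have "(\<Sum>v\<in>B-{w}. (c v)\<^sup>2 * b v v) \<le> 0"
      by (rule sum_nonpos) (use neg in \<open>auto intro!: mult_nonneg_nonpos simp: less_imp_le\<close>)
    ultimately show ?thesis by linarith
  qed
  finally show "b x x < 0" .
qed

text \<open>Gram-Schmidt, one spanning vector at a time: negative definiteness permits division by
  the value of the form on the new orthogonal direction.\<close>

lemma negative_definite_projection:
  assumes f: "sym_form H b" and "finite B" "B \<subseteq> H"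
    and neg: "\<And>x. x \<in> span B - {0} \<Longrightarrow> b x x < 0" and "v \<in> H"
  shows "\<exists>y\<in>span B. \<forall>z\<in>span B. b (v - y) z = 0"
  using assms(2-5)
proof (induction B arbitrary: v)
  case empty
  then show ?case using sym_form_simps(4)[OF f] sym_form_simps(2)[OF f, of v v v 0] by auto
next
  case (insert w B)
  note H = sym_formD(1)[OF f]
  have sub: "span B \<subseteq> H" "span B \<subseteq> span (insert w B)"
    using span_minimal[of B H] insert.prems H span_mono[of B "insert w B"] by auto
  have negB: "\<And>x. x \<in> span B - {0} \<Longrightarrow> b x x < 0" using insert.prems sub by auto
  obtain y where y: "y \<in> span B" "\<And>z. z \<in> span B \<Longrightarrow> b (w - y) z = 0"
    using insert.IH[OF _ negB, of w] insert.prems by auto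
  obtain y' where y': "y' \<in> span B" "\<And>z. z \<in> span B \<Longrightarrow> b (v - y') z = 0"
    using insert.IH[OF _ negB, of v] insert.prems by auto
  define w1 where "w1 = w - y"
  have w1: "w1 \<in> span (insert w B)" unfolding w1_def
    by (rule span_diff[OF span_base subsetD[OF sub(2) y(1)]]) simp
  have dec: "\<exists>s t. s \<in> span B \<and> z = s + t *\<^sub>R w1" if z: "z \<in> span (insert w B)" for z
  proof -
    obtain t where "z - t *\<^sub>R w \<in> span B" using z by (auto simp: span_breakdown_eq)
    then have "z - t *\<^sub>R w + t *\<^sub>R y \<in> span B" using y by (intro span_add span_scale) auto
    then show ?thesis by (intro exI[of _ "z - t *\<^sub>R w + t *\<^sub>R y"] exI[of _ t]) (simp add: w1_def algebra_simps)
  qed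
  show ?case
  proof (cases "w1 = 0")
    case True
    then show ?thesis using y' dec sub by (intro bexI[of _ y']) force+
  next
    case False
    then have nz: "b w1 w1 < 0" using insert.prems w1 by auto
    define c where "c = b (v - y') w1 / b w1 w1"
    have inH: "w1 \<in> H" "v - y' \<in> H" "y' \<in> H" "c *\<^sub>R w1 \<in> H" "v - y' - c *\<^sub>R w1 \<in> H"
      using y y' sub insert.prems H by (auto simp: w1_def intro!: subspace_diff subspace_scale)
    have "b (v - (y' + c *\<^sub>R w1)) z = 0" if z: "z \<in> span (insert w B)" for z
    proof -
      obtain s t where st: "s \<in> span B" "z = s + t *\<^sub>R w1" using dec[OF z] by blast
      have sH: "s \<in> H" "t *\<^sub>R w1 \<in> H" using st sub inH H by (auto intro: subspace_scale)
      have "b (v - y' - c *\<^sub>R w1) z = b (v - y' - c *\<^sub>R w1) s + t * b (v - y' - c *\<^sub>R w1) w1"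
        using st sym_form_simps(1)[OF f sH inH(5)] sym_form_simps(2)[OF f inH(1,1,5)] by simp
      also have "b (v - y' - c *\<^sub>R w1) s = 0"
        using sym_form_simps(3)[OF f inH(2,4) sH(1)] sym_formD(4)[OF f inH(1) sH(1)] y'(2)[OF st(1)] y(2)[OF st(1)]
        by (simp add: w1_def)
      also have "b (v - y' - c *\<^sub>R w1) w1 = 0"
        using sym_form_simps(3)[OF f inH(2,4,1)] sym_formD(4)[OF f inH(1,1)] nz by (simp add: c_def)
      finally show ?thesis by (simp add: algebra_simps)
    qed
    moreover have "y' + c *\<^sub>R w1 \<in> span (insert w B)"
      using y' w1 sub by (intro span_add span_scale) auto
    ultimately show ?thesis by blast
  qed
qed

text \<open>Replaces compactness of the unit sphere of the span by induction: the new direction is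
  made orthogonal, so the form splits exactly while \<open>N\<close> splits up to a factor 2. The
  purpose is that strict negativity survives small perturbations of the form.\<close>

lemma negative_definite_coercive:
  assumes f: "sym_form H b" and "finite B" "B \<subseteq> H"
    and neg: "\<And>x. x \<in> span B - {0} \<Longrightarrow> b x x < 0"
    and N: "\<And>x y. x \<in> H \<Longrightarrow> y \<in> H \<Longrightarrow> N (x + y) \<le> 2 * N x + 2 * N y" "\<And>c x. x \<in> H \<Longrightarrow> N (c *\<^sub>R x) = c\<^sup>2 * N x"
  shows "\<exists>C>0. \<forall>x\<in>span B. N x \<le> C * (- b x x)"
  using assms(2-4)
proof (induction B)
  case empty
  have "0 \<in> H" using sym_formD(1)[OF f] by (rule subspace_0)
  then have "N 0 = 0" "b 0 0 = 0" using N(2)[of 0 0] sym_form_simps(5)[OF f, of 0 0 0] by auto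
  then show ?case by (intro exI[of _ 1]) auto
next
  case (insert w B)
  note H = sym_formD(1)[OF f]
  have sub: "span B \<subseteq> H" "span B \<subseteq> span (insert w B)"
    using span_minimal[of B H] insert.prems H span_mono[of B "insert w B"] by auto
  have negB: "\<And>x. x \<in> span B - {0} \<Longrightarrow> b x x < 0" using insert.prems sub by auto
  obtain C where C: "C > 0" "\<And>x. x \<in> span B \<Longrightarrow> N x \<le> C * (- b x x)"
    using insert.IH[OF _ negB] insert.prems by auto
  obtain y where y: "y \<in> span B" "\<And>z. z \<in> span B \<Longrightarrow> b (w - y) z = 0"
    using negative_definite_projection[OF f insert.hyps(1) _ negB, of w] insert.prems by auto
  define w1 where "w1 = w - y"
  have w1: "w1 \<in> span (insert w B)" unfolding w1_def
    by (rule span_diff[OF span_base subsetD[OF sub(2) y(1)]]) simp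
  have w1H: "w1 \<in> H" using w1 span_minimal[of "insert w B" H] insert.prems H by auto
  have dec: "\<exists>s t. s \<in> span B \<and> z = s + t *\<^sub>R w1" if z: "z \<in> span (insert w B)" for z
  proof -
    obtain t where "z - t *\<^sub>R w \<in> span B" using z by (auto simp: span_breakdown_eq)
    then have "z - t *\<^sub>R w + t *\<^sub>R y \<in> span B" using y by (intro span_add span_scale) auto
    then show ?thesis by (intro exI[of _ "z - t *\<^sub>R w + t *\<^sub>R y"] exI[of _ t]) (simp add: w1_def algebra_simps)
  qed
  show ?case
  proof (cases "w1 = 0")
    case True
    then show ?thesis using C dec by (intro exI[of _ C]) force
  next
    case False
    then have nz: "b w1 w1 < 0" using insert.prems w1 by auto
    \<comment> \<open>One bound for each summand of the splitting, doubled because of the factor 2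
      in the subadditivity of \<open>N\<close>.\<close>
    define K where "K = max (2 * C) (2 * N w1 / - b w1 w1)"
    have K: "K > 0" "2 * C \<le> K" "2 * N w1 \<le> K * (- b w1 w1)"
    proof -
      have "2 * N w1 / - b w1 w1 \<le> K" "0 < - b w1 w1" using nz by (auto simp: K_def)
      then show "2 * N w1 \<le> K * (- b w1 w1)" by (simp only: pos_divide_le_eq)
    qed (use C in \<open>auto simp: K_def\<close>)
    have "N x \<le> K * (- b x x)" if x: "x \<in> span (insert w B)" for x
    proof -
      obtain s t where st: "s \<in> span B" "x = s + t *\<^sub>R w1" using dec[OF x] by blast
      have sH: "s \<in> H" "t *\<^sub>R w1 \<in> H" "x \<in> H" using st sub w1H H by (auto intro: subspace_scale subspace_add)
      have b0: "b w1 s = 0" using y(2)[OF st(1)] by (simp add: w1_def)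
      then have b0': "b s w1 = 0" using sym_formD(2)[OF f w1H sH(1)] by simp
      have "b x x = b s s + t\<^sup>2 * b w1 w1"
        unfolding st(2) using sH w1H H
        by (simp add: sym_formD(3)[OF f] sym_form_simps(1)[OF f] sym_formD(4)[OF f] sym_form_simps(2)[OF f _ w1H] subspace_add b0 b0' power2_eq_square)
      have "N x \<le> 2 * N s + 2 * (t\<^sup>2 * N w1)"
        unfolding st(2) using N(1)[OF sH(1,2)] N(2)[OF w1H] by simp
      also have "2 * N s \<le> 2 * (C * (- b s s))" using C(2)[OF st(1)] by simp
      also have "2 * (C * (- b s s)) \<le> K * (- b s s)"
      proof -
        have "0 \<le> - b s s" using negB[of s] st sym_form_simps(5)[OF f sH(1) sH(1) sH(1)] by (cases "s = 0") auto
        then have "2 * C * (- b s s) \<le> K * (- b s s)" using K by (intro mult_right_mono) auto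
        then show ?thesis by (simp only: mult.assoc)
      qed
      also have "2 * (t\<^sup>2 * N w1) \<le> t\<^sup>2 * (K * (- b w1 w1))"
        using mult_left_mono[OF K(3), of "t\<^sup>2"] by (simp add: mult.left_commute)
      finally have "N x \<le> K * (- b s s) + t\<^sup>2 * (K * (- b w1 w1))" by simp
      also have "\<dots> = K * (- b x x)" unfolding \<open>b x x = b s s + t\<^sup>2 * b w1 w1\<close> by (simp add: algebra_simps)
      finally show ?thesis .
    qed
    then show ?thesis using K(1) by blast
  qed
qed

section \<open>Functions on the graph and their edge restrictions\<close>

lemma AE_subinterval:
  assumes "AE x in lebesgue_on {a..b}. P x" "{c..d} \<subseteq> {a..b::real}"
  shows "AE x in lebesgue_on {c..d}. P x"
proof -
  have "AE x in lebesgue. x \<in> {a..b} \<longrightarrow> P x"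
    using assms(1) by (simp add: AE_restrict_space_iff)
  then have "AE x in lebesgue. x \<in> {c..d} \<longrightarrow> P x"
    by (rule AE_mp) (use assms(2) in auto)
  then show ?thesis by (simp add: AE_restrict_space_iff)
qed

lemma AE_interval_neq: "AE x in lebesgue_on {a..b}. x \<noteq> (c::real)"
proof -
  have "AE x in lebesgue. x \<noteq> c"
    by (rule AE_completion) (rule AE_lborel_singleton)
  then show ?thesis by (auto simp: AE_restrict_space_iff elim: AE_mp)
qed

context compact_metric_graph
begin

abbreviation H1 :: "(('v, 'e) gpoint \<Rightarrow> real) set"
  where "H1 \<equiv> H1_graph G len"

abbreviation ue :: "(('v, 'e) gpoint \<Rightarrow> real) \<Rightarrow> 'e \<Rightarrow> real \<Rightarrow> real"
  where "ue \<equiv> on_edge G len"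

abbreviation De :: "(('v, 'e) gpoint \<Rightarrow> real) \<Rightarrow> 'e \<Rightarrow> real \<Rightarrow> real"
  where "De u e \<equiv> wderiv (len e) (on_edge G len u e)"

lemma edge_pt_in_gpoints: "e \<in> arcs G \<Longrightarrow> edge_pt G len e x \<in> gpoints G len"
  by (auto simp: edge_pt_def gpoints_def)

lemma H1_edge:
  assumes "u \<in> H1" "e \<in> arcs G"
  shows "continuous_on {0..len e} (ue u e)" "De u e \<in> L2_interval (len e)" "primitive_on 0 (len e) (ue u e) (De u e)"
proof -
  have "continuous_map (top_of_set {0..len e}) (graph_topology G len) (edge_pt G len e)"
    unfolding continuous_map_def topspace_graph_topology
    using assms(2) edge_pt_in_gpoints[OF assms(2)] by (auto simp: openin_graph_topology)
  then have "continuous_map (top_of_set {0..len e}) euclideanreal (u \<circ> edge_pt G len e)"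
    by (rule continuous_map_compose) (use assms(1) in \<open>simp add: H1_graph_def\<close>)
  then show c: "continuous_on {0..len e} (ue u e)"
    by (simp add: on_edge_def o_def continuous_map_iff_continuous)
  have "ue u e \<in> H1_interval (len e)" using assms by (simp add: H1_graph_def)
  then show "De u e \<in> L2_interval (len e)" "primitive_on 0 (len e) (ue u e) (De u e)"
    using wderiv_primitive c length_pos[OF assms(2)] by auto
qed

text \<open>A set is open in the gluing topology when its preimage on each closed edge is open, so
  continuity at the vertices is already contained in \<open>u\<close> being one function on the
  glued points.\<close>

lemma H1_graphI:
  assumes "\<And>P. P \<notin> gpoints G len \<Longrightarrow> u P = 0"
    and "\<And>e. e \<in> arcs G \<Longrightarrow> \<exists>g\<in>L2_interval (len e). primitive_on 0 (len e) (ue u e) g"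
  shows "u \<in> H1"
proof -
  have "continuous_map (graph_topology G len) euclideanreal u"
    unfolding continuous_map_def
  proof (intro conjI allI impI)
    fix U :: "real set" assume U: "openin euclideanreal U"
    show "openin (graph_topology G len) {x \<in> topspace (graph_topology G len). u x \<in> U}"
      unfolding openin_graph_topology topspace_graph_topology
    proof (intro conjI ballI)
      fix e assume e: "e \<in> arcs G"
      then have "continuous_on {0..len e} (ue u e)" using assms(2) primitive_on_continuous by blast
      then have "openin (top_of_set {0..len e}) ({0..len e} \<inter> ue u e -` U)"
        using U by (simp add: continuous_openin_preimage_gen)
      moreover have "{x \<in> {0..len e}. edge_pt G len e x \<in> {x \<in> gpoints G len. u x \<in> U}} = {0..len e} \<inter> ue u e -` U"
        using edge_pt_in_gpoints[OF e] by (auto simp: on_edge_def)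
      ultimately show "openin (top_of_set {0..len e}) {x \<in> {0..len e}. edge_pt G len e x \<in> {x \<in> gpoints G len. u x \<in> U}}"
        by simp
    qed auto
  qed auto
  moreover have "ue u e \<in> H1_interval (len e)" if "e \<in> arcs G" for e
    using assms(2)[OF that] primitive_imp_H1_interval length_pos[OF that] by (meson less_imp_le)
  ultimately show ?thesis using assms(1) by (simp add: H1_graph_def)
qed

lemma on_edge_add: "ue (u + v) e = (\<lambda>x. ue u e x + ue v e x)"
  and on_edge_scaleR: "ue (c *\<^sub>R u) e = (\<lambda>x. c * ue u e x)"
  and on_edge_zero: "ue 0 e = (\<lambda>x. 0)"
  by (auto simp: on_edge_def scaleR_fun_def)

lemma H1_outside: "u \<in> H1 \<Longrightarrow> P \<notin> gpoints G len \<Longrightarrow> u P = 0"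
  by (simp add: H1_graph_def)

lemma subspace_H1: "subspace H1"
proof (rule subspaceI)
  show "0 \<in> H1"
  proof (rule H1_graphI)
    show "\<exists>g\<in>L2_interval (len e). primitive_on 0 (len e) (ue 0 e) g" if "e \<in> arcs G" for e
      by (rule bexI[of _ "\<lambda>x. 0"]) (auto simp: on_edge_zero primitive_on_def L2_const)
  qed simp
  fix u v assume u: "u \<in> H1" and v: "v \<in> H1"
  show "u + v \<in> H1"
  proof (rule H1_graphI)
    show "\<exists>g\<in>L2_interval (len e). primitive_on 0 (len e) (ue (u + v) e) g" if "e \<in> arcs G" for e
      using primitive_on_add[OF H1_edge(3)[OF u that] H1_edge(3)[OF v that]] L2_add[OF H1_edge(2)[OF u that] H1_edge(2)[OF v that]]
      unfolding on_edge_add by blast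
  qed (simp add: H1_outside[OF u] H1_outside[OF v])
next
  fix c and u assume u: "u \<in> H1"
  show "c *\<^sub>R u \<in> H1"
  proof (rule H1_graphI)
    show "\<exists>g\<in>L2_interval (len e). primitive_on 0 (len e) (ue (c *\<^sub>R u) e) g" if "e \<in> arcs G" for e
      using primitive_on_cmul[OF H1_edge(3)[OF u that]] L2_cmul[OF H1_edge(2)[OF u that]]
      unfolding on_edge_scaleR by blast
  qed (simp add: H1_outside[OF u] scaleR_fun_def)
qed

lemma De_add:
  assumes "u \<in> H1" "v \<in> H1" "e \<in> arcs G"
  shows "AE x in lebesgue_on {0..len e}. De (u + v) e x = De u e x + De v e x"
  using wderiv_unique[OF primitive_on_add[OF H1_edge(3)[OF assms(1,3)] H1_edge(3)[OF assms(2,3)]]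
      L2_add[OF H1_edge(2)[OF assms(1,3)] H1_edge(2)[OF assms(2,3)]] length_pos[OF assms(3)]]
  by (simp add: on_edge_add)

lemma De_scaleR:
  assumes "u \<in> H1" "e \<in> arcs G"
  shows "AE x in lebesgue_on {0..len e}. De (c *\<^sub>R u) e x = c * De u e x"
  using wderiv_unique[OF primitive_on_cmul[OF H1_edge(3)[OF assms]] L2_cmul[OF H1_edge(2)[OF assms]] length_pos[OF assms(2)]]
  by (simp add: on_edge_scaleR)

text \<open>Connectedness together with the existence of an edge excludes isolated vertices; hence
  every point of the graph lies on a closed edge.\<close>

lemma vertex_incident:
  assumes "v \<in> verts G"
  shows "\<exists>e\<in>arcs G. tail G e = v \<or> head G e = v"
proof -
  obtain e0 where e0: "e0 \<in> arcs G" using arcs_nonempty by blast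
  show ?thesis
  proof (cases "v = tail G e0")
    case False
    have "tail G e0 \<in> verts G" using e0 by simp
    then have "v \<rightarrow>\<^sup>*\<^bsub>with_proj (mk_symmetric G)\<^esub> tail G e0"
      using connected_graph assms by (simp add: connected_def strongly_connected_def)
    then have "(v, tail G e0) \<in> (parcs (mk_symmetric G))\<^sup>*"
      by (auto simp: reachable_def dest: rtrancl_on_rtranclI)
    then obtain w where "(v, w) \<in> parcs (mk_symmetric G)"
      using False by (meson converse_rtranclE)
    then show ?thesis by (auto simp: mk_symmetric_def)
  qed (use e0 in auto)
qed

text \<open>Closed edges cover the graph, and members of \<open>H1\<close> vanish off it.\<close>

lemma edge_0_eq:
  assumes "u \<in> H1" "v \<in> H1" "\<And>e x. e \<in> arcs G \<Longrightarrow> x \<in> {0..len e} \<Longrightarrow> ue u e x = ue v e x"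
  shows "u = v"
proof
  fix P
  show "u P = v P"
  proof (cases "\<exists>e\<in>arcs G. \<exists>x\<in>{0..len e}. P = edge_pt G len e x")
    case True
    then show ?thesis using assms(3) by (auto simp: on_edge_def)
  next
    case False
    have "P \<notin> gpoints G len"
    proof
      assume "P \<in> gpoints G len"
      then consider v where "P = Vertex v" "v \<in> verts G" | e x where "P = Inner e x" "e \<in> arcs G" "0 < x" "x < len e"
        by (auto simp: gpoints_def)
      then show False
      proof cases
        case 1
        obtain e where e: "e \<in> arcs G" "tail G e = v \<or> head G e = v"
          using vertex_incident[OF 1(2)] by blast
        then have "P = edge_pt G len e 0 \<or> P = edge_pt G len e (len e)"
          using 1 length_pos[OF e(1)] by (auto simp: edge_pt_def)
        then show ?thesis using False e(1) length_pos[OF e(1)] by fastforce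
      next
        case 2
        then have "P = edge_pt G len e x" "x \<in> {0..len e}" by (auto simp: edge_pt_def)
        then show ?thesis using False 2(2) by blast
      qed
    qed
    then show ?thesis using H1_outside[OF assms(1)] H1_outside[OF assms(2)] by simp
  qed
qed

section \<open>Bilinear forms with bounded edge coefficients\<close>

definition coef :: "('e \<Rightarrow> real \<Rightarrow> real) \<Rightarrow> bool"
  where "coef c \<longleftrightarrow> (\<forall>e\<in>arcs G. c e \<in> borel_measurable (lebesgue_on {0..len e}) \<and> (\<exists>C. \<forall>x\<in>{0..len e}. \<bar>c e x\<bar> \<le> C))"

text \<open>One family for all forms that occur: with \<open>c\<close> zero it is the Dirichlet
  form, and suitable \<open>c\<close> give the linear part, the weak equation and the second
  variation.\<close>

definition bil :: "('e \<Rightarrow> real \<Rightarrow> real) \<Rightarrow> (('v, 'e) gpoint \<Rightarrow> real) \<Rightarrow> (('v, 'e) gpoint \<Rightarrow> real) \<Rightarrow> real"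
  where "bil c u v = (\<Sum>e\<in>arcs G. LI 0 (len e) (\<lambda>x. De u e x * De v e x + c e x * ue u e x * ue v e x))"

lemma coef_mult_integrable:
  assumes "coef c" "u \<in> H1" "v \<in> H1" "e \<in> arcs G"
  shows "integrable (lebesgue_on {0..len e}) (\<lambda>x. c e x * ue u e x * ue v e x)"
proof -
  obtain C where C: "\<And>x. x \<in> {0..len e} \<Longrightarrow> \<bar>c e x\<bar> \<le> C" using assms(1,4) unfolding coef_def by blast
  have "(\<lambda>x. c e x * ue u e x) \<in> L2_interval (len e)"
    by (rule L2_mult_bounded[OF L2_continuous[OF H1_edge(1)[OF assms(2,4)]] _ C]) (use assms in \<open>auto simp: coef_def\<close>)
  then show ?thesis
    by (rule L2_mult_integrable) (rule L2_continuous[OF H1_edge(1)[OF assms(3,4)]])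
qed

lemma bil_integrable:
  assumes "coef c" "u \<in> H1" "v \<in> H1" "e \<in> arcs G"
  shows "integrable (lebesgue_on {0..len e}) (\<lambda>x. De u e x * De v e x + c e x * ue u e x * ue v e x)"
  by (intro Bochner_Integration.integrable_add coef_mult_integrable[OF assms]
      L2_mult_integrable H1_edge(2)[OF assms(2,4)] H1_edge(2)[OF assms(3,4)])

lemma sym_form_bil:
  assumes c: "coef c"
  shows "sym_form H1 (bil c)"
  unfolding sym_form_def
proof (intro conjI ballI allI subspace_H1)
  fix u v w a assume u: "u \<in> H1" and v: "v \<in> H1" and w: "w \<in> H1"
  show "bil c u v = bil c v u"
    unfolding bil_def by (simp add: algebra_simps)
  have uv: "u + v \<in> H1" using subspace_H1 u v by (rule subspace_add)
  show "bil c (u + v) w = bil c u w + bil c v w"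
    unfolding bil_def sum.distrib[symmetric]
  proof (rule sum.cong)
    fix e assume e: "e \<in> arcs G"
    note i = bil_integrable[OF c u w e] bil_integrable[OF c v w e]
    have "LI 0 (len e) (\<lambda>x. De (u + v) e x * De w e x + c e x * ue (u + v) e x * ue w e x) =
      LI 0 (len e) (\<lambda>x. (De u e x * De w e x + c e x * ue u e x * ue w e x) + (De v e x * De w e x + c e x * ue v e x * ue w e x))"
    proof (rule integral_cong_AE)
      show "AE x in lebesgue_on {0..len e}. De (u + v) e x * De w e x + c e x * ue (u + v) e x * ue w e x =
        (De u e x * De w e x + c e x * ue u e x * ue w e x) + (De v e x * De w e x + c e x * ue v e x * ue w e x)"
        using De_add[OF u v e] by eventually_elim (simp add: on_edge_add algebra_simps)
    qed (use bil_integrable[OF c uv w e] borel_measurable_add[OF i[THEN borel_measurable_integrable]] in auto)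
    then show "LI 0 (len e) (\<lambda>x. De (u + v) e x * De w e x + c e x * ue (u + v) e x * ue w e x) =
      LI 0 (len e) (\<lambda>x. De u e x * De w e x + c e x * ue u e x * ue w e x) + LI 0 (len e) (\<lambda>x. De v e x * De w e x + c e x * ue v e x * ue w e x)"
      using i by simp
  qed simp
next
  fix a u w assume u: "u \<in> H1" and w: "w \<in> H1"
  have au: "a *\<^sub>R u \<in> H1" using subspace_H1 u by (rule subspace_scale)
  show "bil c (a *\<^sub>R u) w = a * bil c u w"
    unfolding bil_def sum_distrib_left
  proof (rule sum.cong)
    fix e assume e: "e \<in> arcs G"
    have "LI 0 (len e) (\<lambda>x. De (a *\<^sub>R u) e x * De w e x + c e x * ue (a *\<^sub>R u) e x * ue w e x) =
      LI 0 (len e) (\<lambda>x. a * (De u e x * De w e x + c e x * ue u e x * ue w e x))"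
    proof (rule integral_cong_AE)
      show "AE x in lebesgue_on {0..len e}. De (a *\<^sub>R u) e x * De w e x + c e x * ue (a *\<^sub>R u) e x * ue w e x =
        a * (De u e x * De w e x + c e x * ue u e x * ue w e x)"
        using De_scaleR[OF u e, of a] by eventually_elim (simp add: on_edge_scaleR algebra_simps)
    qed (use bil_integrable[OF c au w e] bil_integrable[OF c u w e] in auto)
    then show "LI 0 (len e) (\<lambda>x. De (a *\<^sub>R u) e x * De w e x + c e x * ue (a *\<^sub>R u) e x * ue w e x) =
      a * LI 0 (len e) (\<lambda>x. De u e x * De w e x + c e x * ue u e x * ue w e x)"
      by simp
  qed simp
qed

text \<open>Extension by zero from [a, b] on the edge \<open>e\<close>. Vertices always get the
  value 0, which agrees with \<open>F\<close> once \<open>F a = F b = 0\<close>, even if the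
  interval reaches an end of the edge.\<close>

definition bump :: "'e \<Rightarrow> real \<Rightarrow> real \<Rightarrow> (real \<Rightarrow> real) \<Rightarrow> ('v, 'e) gpoint \<Rightarrow> real"
  where "bump e a b F P = (case P of Vertex v \<Rightarrow> 0
    | Inner e' x \<Rightarrow> if e' = e \<and> 0 < x \<and> x < len e \<and> a \<le> x \<and> x \<le> b then F x else 0)"

lemma primitive_on_extend:
  assumes p: "primitive_on a b F F'" and F: "F a = 0" "F b = 0" and ab: "0 \<le> a" "a < b" "b \<le> l"
  shows "primitive_on 0 l (\<lambda>x. if x \<in> {a..b} then F x else 0) (\<lambda>x. if x \<in> {a..b} then F' x else 0)"
proof (rule primitive_onI)
  show "integrable (lebesgue_on {0..l}) (\<lambda>x. if x \<in> {a..b} then F' x else 0)"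
    using LI_extend(2)[of a b l F'] ab primitive_onD(1)[OF p] by simp
  fix x assume x: "x \<in> {0..l}"
  have F0: "(if 0 \<in> {a..b} then F 0 else 0) = 0" using ab F by auto
  have "LI 0 x (\<lambda>x. if x \<in> {a..b} then F' x else 0) = LI 0 x (\<lambda>y. if y \<in> {a..min x b} then F' y else 0)"
    by (rule Bochner_Integration.integral_cong) auto
  also have "\<dots> = LI a (min x b) F'" using ab x by (intro LI_extend) auto
  finally have L: "LI 0 x (\<lambda>x. if x \<in> {a..b} then F' x else 0) = LI a (min x b) F'" .
  have "(if x \<in> {a..b} then F x else 0) = LI a (min x b) F'"
  proof (cases "x < a")
    case True
    then show ?thesis using ab by simp
  next
    case False
    then show ?thesis
      using primitive_onD(2)[OF p, of a "min x b"] ab F by (auto simp: min_def)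
  qed
  then show "(if x \<in> {a..b} then F x else 0) = (if 0 \<in> {a..b} then F 0 else 0) + LI 0 x (\<lambda>x. if x \<in> {a..b} then F' x else 0)"
    unfolding L F0 by simp
qed

lemma on_edge_bump:
  assumes "e \<in> arcs G" "e' \<in> arcs G" "x \<in> {0..len e'}" "F a = 0" "F b = 0" "0 \<le> a" "a < b" "b \<le> len e"
  shows "ue (bump e a b F) e' x = (if e' = e \<and> x \<in> {a..b} then F x else 0)"
proof -
  consider "x = 0" | "x = len e'" | "0 < x" "x < len e'" using assms(3) by fastforce
  then show ?thesis
    using assms length_pos[OF assms(2)]
    by cases (auto simp: on_edge_def edge_pt_def bump_def dest: antisym)
qed

lemma primitive_on_cong:
  assumes "primitive_on a b f g" "\<And>x. x \<in> {a..b} \<Longrightarrow> f x = f' x"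
  shows "primitive_on a b f' g"
  using assms unfolding primitive_on_def by (metis atLeastAtMost_iff order_trans)

definition admissible :: "'e \<Rightarrow> real \<Rightarrow> real \<Rightarrow> (real \<Rightarrow> real) \<Rightarrow> (real \<Rightarrow> real) \<Rightarrow> bool"
  where "admissible e a b F F' \<longleftrightarrow> e \<in> arcs G \<and> 0 \<le> a \<and> a < b \<and> b \<le> len e \<and> primitive_on a b F F' \<and>
    F a = 0 \<and> F b = 0 \<and> (\<lambda>x. if x \<in> {a..b} then F' x else 0) \<in> L2_interval (len e)"

lemma bump_H1:
  assumes "admissible e a b F F'"
  shows "bump e a b F \<in> H1"
    "AE x in lebesgue_on {0..len e}. De (bump e a b F) e x = (if x \<in> {a..b} then F' x else 0)"
    "e' \<in> arcs G \<Longrightarrow> e' \<noteq> e \<Longrightarrow> AE x in lebesgue_on {0..len e'}. De (bump e a b F) e' x = 0"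
proof -
  have A: "e \<in> arcs G" "0 \<le> a" "a < b" "b \<le> len e" "primitive_on a b F F'"
    "F a = 0" "F b = 0" "(\<lambda>x. if x \<in> {a..b} then F' x else 0) \<in> L2_interval (len e)"
    using assms by (auto simp: admissible_def)
  have pe: "primitive_on 0 (len e) (ue (bump e a b F) e) (\<lambda>x. if x \<in> {a..b} then F' x else 0)"
    by (rule primitive_on_cong[OF primitive_on_extend[OF A(5,6,7,2,3,4)]]) (use on_edge_bump A in auto)
  have po: "primitive_on 0 (len e') (ue (bump e a b F) e') (\<lambda>x. 0)" if "e' \<in> arcs G" "e' \<noteq> e" for e'
    by (rule primitive_on_cong[where f = "\<lambda>x. 0"]) (use on_edge_bump A that in \<open>auto simp: primitive_on_def\<close>)
  show "bump e a b F \<in> H1"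
  proof (rule H1_graphI)
    show "bump e a b F P = 0" if "P \<notin> gpoints G len" for P
      using that A(1) by (auto simp: bump_def gpoints_def split: gpoint.splits)
    show "\<exists>g\<in>L2_interval (len e'). primitive_on 0 (len e') (ue (bump e a b F) e') g" if "e' \<in> arcs G" for e'
      using pe po[OF that] A(8) L2_const[of 0 "len e'"] by (cases "e' = e") auto
  qed
  show "AE x in lebesgue_on {0..len e}. De (bump e a b F) e x = (if x \<in> {a..b} then F' x else 0)"
    by (rule wderiv_unique[OF pe A(8) length_pos[OF A(1)]])
  show "AE x in lebesgue_on {0..len e'}. De (bump e a b F) e' x = 0" if "e' \<in> arcs G" "e' \<noteq> e"
    by (rule wderiv_unique[OF po[OF that] L2_const length_pos[OF that(1)]])
qed

lemma bil_bump:
  assumes ad: "admissible e a b F F'" and c: "coef c" and u: "u \<in> H1"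
  shows "bil c u (bump e a b F) = LI a b (\<lambda>x. De u e x * F' x + c e x * ue u e x * F x)"
proof -
  have A: "e \<in> arcs G" "0 \<le> a" "a < b" "b \<le> len e" "F a = 0" "F b = 0"
    "(\<lambda>x. if x \<in> {a..b} then F' x else 0) \<in> L2_interval (len e)"
    using ad by (auto simp: admissible_def)
  note B = bump_H1[OF ad]
  have zero: "LI 0 (len e') (\<lambda>x. De u e' x * De (bump e a b F) e' x + c e' x * ue u e' x * ue (bump e a b F) e' x) = 0"
    if "e' \<in> arcs G" "e' \<noteq> e" for e'
  proof (rule integral_eq_zero_AE)
    show "AE x in lebesgue_on {0..len e'}. De u e' x * De (bump e a b F) e' x + c e' x * ue u e' x * ue (bump e a b F) e' x = 0"
      using B(3)[OF that] by (rule AE_mp) (intro AE_I2, use on_edge_bump[OF A(1) that(1)] A that(2) in auto)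
  qed
  have "bil c u (bump e a b F) = LI 0 (len e) (\<lambda>x. De u e x * De (bump e a b F) e x + c e x * ue u e x * ue (bump e a b F) e x)"
    unfolding bil_def using A(1) zero by (subst sum.remove[of _ e]) auto
  also have "\<dots> = LI 0 (len e) (\<lambda>x. if x \<in> {a..b} then De u e x * F' x + c e x * ue u e x * F x else 0)"
  proof (rule integral_cong_AE)
    show "AE x in lebesgue_on {0..len e}. De u e x * De (bump e a b F) e x + c e x * ue u e x * ue (bump e a b F) e x =
      (if x \<in> {a..b} then De u e x * F' x + c e x * ue u e x * F x else 0)"
      using B(2) by (rule AE_mp) (intro AE_I2, use on_edge_bump[OF A(1) A(1)] A in auto)
    show "(\<lambda>x. De u e x * De (bump e a b F) e x + c e x * ue u e x * ue (bump e a b F) e x) \<in> borel_measurable (lebesgue_on {0..len e})"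
      using bil_integrable[OF c u B(1) A(1)] by auto
    have "(\<lambda>x. De u e x * (if x \<in> {a..b} then F' x else 0) + c e x * ue u e x * ue (bump e a b F) e x) \<in> borel_measurable (lebesgue_on {0..len e})"
      using coef_mult_integrable[OF c u B(1) A(1)] L2_mult_integrable[OF H1_edge(2)[OF u A(1)] A(7)] by auto
    then show "(\<lambda>x. if x \<in> {a..b} then De u e x * F' x + c e x * ue u e x * F x else 0) \<in> borel_measurable (lebesgue_on {0..len e})"
      by (rule measurable_cong[THEN iffD1, rotated]) (use on_edge_bump[OF A(1) A(1)] A in auto)
  qed
  also have "\<dots> = LI a b (\<lambda>x. De u e x * F' x + c e x * ue u e x * F x)"
    using A by (intro LI_extend) auto
  finally show ?thesis .
qed

lemma bil_bump_bump:
  assumes ad: "admissible e a b F F'" and c: "coef c"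
  shows "bil c (bump e a b F) (bump e a b F) = LI a b (\<lambda>x. (F' x)\<^sup>2 + c e x * (F x)\<^sup>2)"
proof -
  have A: "e \<in> arcs G" "0 \<le> a" "a < b" "b \<le> len e" "F a = 0" "F b = 0" "primitive_on a b F F'"
    using ad by (auto simp: admissible_def)
  have sub: "{a..b} \<subseteq> {0..len e}" using A by auto
  note B = bump_H1[OF ad]
  have m: "(\<lambda>x. c e x * ue (bump e a b F) e x) \<in> borel_measurable (lebesgue_on {a..b})"
    "De (bump e a b F) e \<in> borel_measurable (lebesgue_on {a..b})" "F \<in> borel_measurable (lebesgue_on {a..b})"
    "F' \<in> borel_measurable (lebesgue_on {a..b})" "c e \<in> borel_measurable (lebesgue_on {a..b})"
    using borel_measurable_subinterval[OF _ sub] c A(1) L2_intervalD(1)[OF H1_edge(2)[OF B(1) A(1)]]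
      borel_measurable_continuous_interval[OF H1_edge(1)[OF B(1) A(1)]] borel_measurable_continuous_interval[OF primitive_on_continuous[OF A(7)]]
      primitive_onD(1)[OF A(7)]
    by (auto simp: coef_def intro!: borel_measurable_times)
  show ?thesis
    unfolding bil_bump[OF ad c B(1)]
  proof (rule integral_cong_AE)
    show "AE x in lebesgue_on {a..b}. De (bump e a b F) e x * F' x + c e x * ue (bump e a b F) e x * F x = (F' x)\<^sup>2 + c e x * (F x)\<^sup>2"
      using AE_subinterval[OF B(2) sub]
    proof (rule AE_mp, intro AE_I2 impI)
      fix x assume x: "x \<in> space (lebesgue_on {a..b})" "De (bump e a b F) e x = (if x \<in> {a..b} then F' x else 0)"
      then have "ue (bump e a b F) e x = F x"
        using on_edge_bump[OF A(1) A(1) _ A(5,6,2,3,4), of x] sub by auto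
      then show "De (bump e a b F) e x * F' x + c e x * ue (bump e a b F) e x * F x = (F' x)\<^sup>2 + c e x * (F x)\<^sup>2"
        using x by (simp add: power2_eq_square)
    qed
  qed (use m in measurable)
qed

lemma bil_bump_disjoint:
  assumes ad: "admissible e a b F F'" "admissible e a' b' K K'" and c: "coef c" and disj: "b \<le> a' \<or> b' \<le> a"
  shows "bil c (bump e a b F) (bump e a' b' K) = 0"
proof -
  have A: "e \<in> arcs G" "0 \<le> a" "a < b" "b \<le> len e" "F a = 0" "F b = 0"
    using ad(1) by (auto simp: admissible_def)
  have sub: "{a'..b'} \<subseteq> {0..len e}" using ad(2) by (auto simp: admissible_def)
  note B = bump_H1[OF ad(1)]
  show ?thesis
    unfolding bil_bump[OF ad(2) c B(1)]
  proof (rule integral_eq_zero_AE)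
    \<comment> \<open>Adjacent intervals may share an endpoint, which is discarded as a null
      set.\<close>
    have "AE x in lebesgue_on {a'..b'}. x \<noteq> a' \<and> x \<noteq> b'"
      by (intro AE_conjI AE_interval_neq)
    moreover note AE_subinterval[OF B(2) sub]
    moreover have "AE x in lebesgue_on {a'..b'}. x \<in> {a'..b'}" by (intro AE_I2) simp
    ultimately show "AE x in lebesgue_on {a'..b'}. De (bump e a b F) e x * K' x + c e x * ue (bump e a b F) e x * K x = 0"
    proof eventually_elim
      case (elim x)
      then have "x \<notin> {a..b}" using disj by auto
      then show ?case using elim on_edge_bump[OF A(1) A(1) _ A(5,6,2,3,4), of x] sub by auto
    qed
  qed
qed

end

section \<open>The equation edge by edge\<close>

text \<open>
  \<open>Wt\<close> and \<open>rt\<close> are representatives of \<open>W\<close> and \<open>\<rho>\<close> that satisfy the essential bounds everywhere.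
\<close>

locale nls_graph = compact_metric_graph G len
  for G :: "('v, 'e) pre_digraph" and len :: "'e \<Rightarrow> real" +
  fixes W \<rho> :: "('v, 'e) gpoint \<Rightarrow> real" and p :: real and m :: nat
    and w1 r0 r1 :: real and Wt rt :: "'e \<Rightarrow> real \<Rightarrow> real"
  assumes p2: "2 < p" and w1: "0 \<le> w1" and r0: "0 < r0" and r01: "r0 \<le> r1"
    and W_meas: "e \<in> arcs G \<Longrightarrow> on_edge G len W e \<in> borel_measurable (lebesgue_on {0..len e})"
    and \<rho>_meas: "e \<in> arcs G \<Longrightarrow> on_edge G len \<rho> e \<in> borel_measurable (lebesgue_on {0..len e})"
    and Wt_meas: "e \<in> arcs G \<Longrightarrow> Wt e \<in> borel_measurable (lebesgue_on {0..len e})"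
    and rt_meas: "e \<in> arcs G \<Longrightarrow> rt e \<in> borel_measurable (lebesgue_on {0..len e})"
    and Wt_bound: "\<bar>Wt e x\<bar> \<le> w1" and rt_bound: "r0 \<le> rt e x" "rt e x \<le> r1"
    and Wt_AE: "e \<in> arcs G \<Longrightarrow> AE x in lebesgue_on {0..len e}. on_edge G len W e x = Wt e x"
    and rt_AE: "e \<in> arcs G \<Longrightarrow> AE x in lebesgue_on {0..len e}. on_edge G len \<rho> e x = rt e x"
begin

definition cB :: "real \<Rightarrow> 'e \<Rightarrow> real \<Rightarrow> real"
  where "cB lam e x = Wt e x + lam"

text \<open>Freezing |u|^(p-2) as a potential makes the weak equation linear in appearance:
  \<open>bil (cS lam u) u v = 0\<close> for all \<open>v\<close>.\<close>

definition cS :: "real \<Rightarrow> (('v, 'e) gpoint \<Rightarrow> real) \<Rightarrow> 'e \<Rightarrow> real \<Rightarrow> real"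
  where "cS lam u e x = Wt e x + lam - rt e x * \<bar>ue u e x\<bar> powr (p - 2)"

definition cQ :: "real \<Rightarrow> (('v, 'e) gpoint \<Rightarrow> real) \<Rightarrow> 'e \<Rightarrow> real \<Rightarrow> real"
  where "cQ lam u e x = Wt e x + lam - (p - 1) * rt e x * \<bar>ue u e x\<bar> powr (p - 2)"

lemma powr_ue_coef:
  assumes "u \<in> H1" "e \<in> arcs G"
  shows "(\<lambda>x. rt e x * \<bar>ue u e x\<bar> powr (p - 2)) \<in> borel_measurable (lebesgue_on {0..len e})"
    "\<exists>C>0. \<forall>x\<in>{0..len e}. \<bar>ue u e x\<bar> \<le> C \<and> \<bar>rt e x * \<bar>ue u e x\<bar> powr (p - 2)\<bar> \<le> r1 * C powr (p - 2)"
proof -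
  note c = H1_edge(1)[OF assms]
  show "(\<lambda>x. rt e x * \<bar>ue u e x\<bar> powr (p - 2)) \<in> borel_measurable (lebesgue_on {0..len e})"
    using rt_meas[OF assms(2)] borel_measurable_continuous_interval[OF c] by measurable
  obtain C where C: "\<And>x. x \<in> {0..len e} \<Longrightarrow> \<bar>ue u e x\<bar> \<le> C" "C > 0"
    using continuous_bounded_interval[OF c] by blast
  have "\<bar>rt e x * \<bar>ue u e x\<bar> powr (p - 2)\<bar> \<le> r1 * C powr (p - 2)" if "x \<in> {0..len e}" for x
  proof -
    have "\<bar>rt e x\<bar> \<le> r1" using rt_bound[of e x] r0 by simp
    moreover have "\<bar>ue u e x\<bar> powr (p - 2) \<le> C powr (p - 2)"
      using C(1)[OF that] p2 by (intro powr_mono2) auto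
    ultimately show ?thesis unfolding abs_mult by (intro mult_mono) auto
  qed
  with C show "\<exists>C>0. \<forall>x\<in>{0..len e}. \<bar>ue u e x\<bar> \<le> C \<and> \<bar>rt e x * \<bar>ue u e x\<bar> powr (p - 2)\<bar> \<le> r1 * C powr (p - 2)"
    by blast
qed

lemma coef_gen:
  assumes "u \<in> H1"
  shows "coef (\<lambda>e x. Wt e x + lam - k * (rt e x * \<bar>ue u e x\<bar> powr (p - 2)))"
  unfolding coef_def
proof (intro ballI conjI)
  fix e assume e: "e \<in> arcs G"
  note P = powr_ue_coef[OF assms e]
  show "(\<lambda>x. Wt e x + lam - k * (rt e x * \<bar>ue u e x\<bar> powr (p - 2))) \<in> borel_measurable (lebesgue_on {0..len e})"
    using Wt_meas[OF e] P(1) by measurable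
  obtain C where C: "\<And>x. x \<in> {0..len e} \<Longrightarrow> \<bar>rt e x * \<bar>ue u e x\<bar> powr (p - 2)\<bar> \<le> r1 * C powr (p - 2)"
    using P(2) by blast
  have "\<bar>Wt e x + lam - k * (rt e x * \<bar>ue u e x\<bar> powr (p - 2))\<bar> \<le> w1 + \<bar>lam\<bar> + \<bar>k\<bar> * (r1 * C powr (p - 2))"
    if "x \<in> {0..len e}" for x
  proof -
    have "\<bar>k * (rt e x * \<bar>ue u e x\<bar> powr (p - 2))\<bar> \<le> \<bar>k\<bar> * (r1 * C powr (p - 2))"
      unfolding abs_mult[of k] by (rule mult_left_mono[OF C[OF that]]) simp
    then show ?thesis using Wt_bound[of e x] by linarith
  qed
  then show "\<exists>C. \<forall>x\<in>{0..len e}. \<bar>Wt e x + lam - k * (rt e x * \<bar>ue u e x\<bar> powr (p - 2))\<bar> \<le> C" by blast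
qed

lemma coef_cB: "coef (cB lam)" and coef_cS: "u \<in> H1 \<Longrightarrow> coef (cS lam u)" and coef_cQ: "u \<in> H1 \<Longrightarrow> coef (cQ lam u)"
  using coef_gen[OF subspace_0[OF subspace_H1], of lam 0] coef_gen[of u lam 1] coef_gen[of u lam "p - 1"]
  unfolding cB_def[abs_def] cS_def[abs_def] cQ_def[abs_def] by (auto simp: mult.assoc)

lemma graph_deriv_edge:
  assumes "e \<in> arcs G"
  shows "on_edge G len (graph_deriv G len u) e x = (if 0 < x \<and> x < len e then De u e x else 0)"
  by (auto simp: on_edge_def edge_pt_def graph_deriv_def)

lemma graph_deriv_AE:
  assumes "e \<in> arcs G"
  shows "AE x in lebesgue_on {0..len e}. on_edge G len (graph_deriv G len u) e x = De u e x"
proof -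
  have "AE x in lebesgue_on {0..len e}. x \<in> {0..len e}" by (intro AE_I2) simp
  with AE_interval_neq[where a = 0 and b = "len e" and c = 0] AE_interval_neq[where a = 0 and b = "len e" and c = "len e"] show ?thesis
    by eventually_elim (auto simp: graph_deriv_edge[OF assms])
qed

lemma graph_deriv_meas:
  assumes "u \<in> H1" "e \<in> arcs G"
  shows "on_edge G len (graph_deriv G len u) e \<in> borel_measurable (lebesgue_on {0..len e})"
proof -
  have idm: "(\<lambda>x. x) \<in> borel_measurable (lebesgue_on {0..len e})"
    using id_borel_measurable_lebesgue_on[of "{0..len e}"] by (simp add: id_def)
  have "(\<lambda>x. if 0 < x \<and> x < len e then De u e x else 0) \<in> borel_measurable (lebesgue_on {0..len e})"
    using L2_intervalD(1)[OF H1_edge(2)[OF assms]] idm by measurable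
  moreover have "on_edge G len (graph_deriv G len u) e = (\<lambda>x. if 0 < x \<and> x < len e then De u e x else 0)"
    by (rule ext) (rule graph_deriv_edge[OF assms(2)])
  ultimately show ?thesis by simp
qed

lemma ue_meas: "u \<in> H1 \<Longrightarrow> e \<in> arcs G \<Longrightarrow> ue u e \<in> borel_measurable (lebesgue_on {0..len e})"
  by (rule borel_measurable_continuous_interval[OF H1_edge(1)])

lemma second_variation_eq:
  assumes "u \<in> H1" "v \<in> H1"
  shows "second_variation G len W \<rho> p lam u v = bil (cQ lam u) v v"
  unfolding second_variation_def graph_integral_def bil_def
proof (rule sum.cong)
  fix e assume e: "e \<in> arcs G"
  note [measurable] = graph_deriv_meas[OF assms(2) e] ue_meas[OF assms(1) e] ue_meas[OF assms(2) e] W_meas[OF e] \<rho>_meas[OF e]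
  show "LI 0 (len e) (ue (\<lambda>P. \<bar>graph_deriv G len v P\<bar>\<^sup>2 + (W P + lam) * (v P)\<^sup>2 - (p - 1) * \<rho> P * \<bar>u P\<bar> powr (p - 2) * (v P)\<^sup>2) e) =
    LI 0 (len e) (\<lambda>x. De v e x * De v e x + cQ lam u e x * ue v e x * ue v e x)"
  proof (rule integral_cong_AE)
    have eq: "ue (\<lambda>P. \<bar>graph_deriv G len v P\<bar>\<^sup>2 + (W P + lam) * (v P)\<^sup>2 - (p - 1) * \<rho> P * \<bar>u P\<bar> powr (p - 2) * (v P)\<^sup>2) e =
      (\<lambda>x. \<bar>ue (graph_deriv G len v) e x\<bar>\<^sup>2 + (ue W e x + lam) * (ue v e x)\<^sup>2 - (p - 1) * ue \<rho> e x * \<bar>ue u e x\<bar> powr (p - 2) * (ue v e x)\<^sup>2)"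
      by (simp add: on_edge_def)
    show "ue (\<lambda>P. \<bar>graph_deriv G len v P\<bar>\<^sup>2 + (W P + lam) * (v P)\<^sup>2 - (p - 1) * \<rho> P * \<bar>u P\<bar> powr (p - 2) * (v P)\<^sup>2) e \<in> borel_measurable (lebesgue_on {0..len e})"
      unfolding eq by measurable
    show "(\<lambda>x. De v e x * De v e x + cQ lam u e x * ue v e x * ue v e x) \<in> borel_measurable (lebesgue_on {0..len e})"
      using bil_integrable[OF coef_cQ[OF assms(1)] assms(2,2) e] by auto
    show "AE x in lebesgue_on {0..len e}. ue (\<lambda>P. \<bar>graph_deriv G len v P\<bar>\<^sup>2 + (W P + lam) * (v P)\<^sup>2 - (p - 1) * \<rho> P * \<bar>u P\<bar> powr (p - 2) * (v P)\<^sup>2) e x =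
      De v e x * De v e x + cQ lam u e x * ue v e x * ue v e x"
      unfolding eq using graph_deriv_AE[OF e, of v] Wt_AE[OF e] rt_AE[OF e]
      by eventually_elim (simp add: cQ_def power2_eq_square algebra_simps)
  qed
qed simp

lemma solves_E_iff:
  "solves_E G len W \<rho> p lam u \<longleftrightarrow> u \<in> H1 \<and> (\<forall>v\<in>H1. bil (cS lam u) u v = 0)"
proof -
  have "graph_integral G len (\<lambda>P. graph_deriv G len u P * graph_deriv G len v P + (W P + lam) * u P * v P) -
      graph_integral G len (\<lambda>P. \<rho> P * \<bar>u P\<bar> powr (p - 2) * u P * v P) = bil (cS lam u) u v"
    if u: "u \<in> H1" and v: "v \<in> H1" for v
    unfolding graph_integral_def bil_def sum_subtractf[symmetric]
  proof (rule sum.cong)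
    fix e assume e: "e \<in> arcs G"
    note [measurable] = graph_deriv_meas[OF u e] graph_deriv_meas[OF v e] ue_meas[OF u e] ue_meas[OF v e] W_meas[OF e] \<rho>_meas[OF e]
    have 1: "LI 0 (len e) (ue (\<lambda>P. graph_deriv G len u P * graph_deriv G len v P + (W P + lam) * u P * v P) e) =
      LI 0 (len e) (\<lambda>x. De u e x * De v e x + cB lam e x * ue u e x * ue v e x)"
    proof (rule integral_cong_AE)
      have eq: "ue (\<lambda>P. graph_deriv G len u P * graph_deriv G len v P + (W P + lam) * u P * v P) e =
        (\<lambda>x. ue (graph_deriv G len u) e x * ue (graph_deriv G len v) e x + (ue W e x + lam) * ue u e x * ue v e x)"
        by (simp add: on_edge_def)
      show "ue (\<lambda>P. graph_deriv G len u P * graph_deriv G len v P + (W P + lam) * u P * v P) e \<in> borel_measurable (lebesgue_on {0..len e})"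
        unfolding eq by measurable
      show "(\<lambda>x. De u e x * De v e x + cB lam e x * ue u e x * ue v e x) \<in> borel_measurable (lebesgue_on {0..len e})"
        using bil_integrable[OF coef_cB u v e] by auto
      show "AE x in lebesgue_on {0..len e}. ue (\<lambda>P. graph_deriv G len u P * graph_deriv G len v P + (W P + lam) * u P * v P) e x =
        De u e x * De v e x + cB lam e x * ue u e x * ue v e x"
        unfolding eq using graph_deriv_AE[OF e, of v] graph_deriv_AE[OF e, of u] Wt_AE[OF e]
        by eventually_elim (simp add: cB_def)
    qed
    have i: "integrable (lebesgue_on {0..len e}) (\<lambda>x. rt e x * \<bar>ue u e x\<bar> powr (p - 2) * ue u e x * ue v e x)"
      using Bochner_Integration.integrable_diff[OF bil_integrable[OF coef_cB u v e] bil_integrable[OF coef_cS[OF u] u v e], of lam lam]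
      by (simp add: cB_def cS_def algebra_simps)
    have 2: "LI 0 (len e) (ue (\<lambda>P. \<rho> P * \<bar>u P\<bar> powr (p - 2) * u P * v P) e) =
      LI 0 (len e) (\<lambda>x. rt e x * \<bar>ue u e x\<bar> powr (p - 2) * ue u e x * ue v e x)"
    proof (rule integral_cong_AE)
      have eq: "ue (\<lambda>P. \<rho> P * \<bar>u P\<bar> powr (p - 2) * u P * v P) e = (\<lambda>x. ue \<rho> e x * \<bar>ue u e x\<bar> powr (p - 2) * ue u e x * ue v e x)"
        by (simp add: on_edge_def)
      show "ue (\<lambda>P. \<rho> P * \<bar>u P\<bar> powr (p - 2) * u P * v P) e \<in> borel_measurable (lebesgue_on {0..len e})"
        unfolding eq by measurable
      show "AE x in lebesgue_on {0..len e}. ue (\<lambda>P. \<rho> P * \<bar>u P\<bar> powr (p - 2) * u P * v P) e x =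
        rt e x * \<bar>ue u e x\<bar> powr (p - 2) * ue u e x * ue v e x"
        unfolding eq using rt_AE[OF e] by eventually_elim simp
    qed (use i in auto)
    have "(\<lambda>x. De u e x * De v e x + cS lam u e x * ue u e x * ue v e x) =
      (\<lambda>x. (De u e x * De v e x + cB lam e x * ue u e x * ue v e x) - rt e x * \<bar>ue u e x\<bar> powr (p - 2) * ue u e x * ue v e x)"
      by (simp add: cB_def cS_def algebra_simps)
    then show "LI 0 (len e) (ue (\<lambda>P. graph_deriv G len u P * graph_deriv G len v P + (W P + lam) * u P * v P) e) -
      LI 0 (len e) (ue (\<lambda>P. \<rho> P * \<bar>u P\<bar> powr (p - 2) * u P * v P) e) =
      LI 0 (len e) (\<lambda>x. De u e x * De v e x + cS lam u e x * ue u e x * ue v e x)"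
      unfolding 1 2 using bil_integrable[OF coef_cB u v e] i by simp
  qed simp
  then show ?thesis
    unfolding solves_E_def by (metis (no_types, lifting) eq_iff_diff_eq_0)
qed

section \<open>Negative subspaces and the counting principle for bumps\<close>

definition negative_space :: "real \<Rightarrow> (('v, 'e) gpoint \<Rightarrow> real) \<Rightarrow> (('v, 'e) gpoint \<Rightarrow> real) set \<Rightarrow> bool"
  where "negative_space lam u X \<longleftrightarrow> subspace X \<and> (\<exists>B. finite B \<and> span B = X) \<and> X \<subseteq> H1 \<and>
    (\<forall>v\<in>X - {0}. bil (cQ lam u) v v < 0)"

lemma morse_index_le_iff:
  assumes "u \<in> H1"
  shows "morse_index G len W \<rho> p lam u \<le> enat k \<longleftrightarrow> (\<forall>X. negative_space lam u X \<longrightarrow> dim X \<le> k)"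
proof -
  have "subspace X \<and> (\<exists>B. finite B \<and> span B = X) \<and> X \<subseteq> H1 \<and> (\<forall>v\<in>X - {0}. second_variation G len W \<rho> p lam u v < 0)
    \<longleftrightarrow> negative_space lam u X" for X
    unfolding negative_space_def using second_variation_eq[OF assms] by (metis DiffD1 subsetD)
  then show ?thesis
    unfolding morse_index_def by (auto simp: Sup_le_iff)
qed

text \<open>Bumps on nonoverlapping intervals of one edge are orthogonal for the second variation,
  so those with negative value span a negative space of dimension \<open>card J\<close>.\<close>

lemma index_card:
  assumes u: "u \<in> H1" and M: "morse_index G len W \<rho> p lam u \<le> enat k"
    and J: "finite J" and ad: "\<And>j. j \<in> J \<Longrightarrow> admissible e (a j) (b j) (F j) (F' j)"
    and disj: "\<And>i j. i \<in> J \<Longrightarrow> j \<in> J \<Longrightarrow> i \<noteq> j \<Longrightarrow> b i \<le> a j \<or> b j \<le> a i"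
    and neg: "\<And>j. j \<in> J \<Longrightarrow> LI (a j) (b j) (\<lambda>x. (F' j x)\<^sup>2 + cQ lam u e x * (F j x)\<^sup>2) < 0"
  shows "card J \<le> k"
proof -
  let ?b = "bil (cQ lam u)" and ?\<phi> = "\<lambda>j. bump e (a j) (b j) (F j)"
  note c = coef_cQ[OF u, of lam]
  have nn: "?b (?\<phi> j) (?\<phi> j) < 0" if "j \<in> J" for j
    using bil_bump_bump[OF ad[OF that] c] neg[OF that] by simp
  have or: "?b (?\<phi> i) (?\<phi> j) = 0" if "i \<in> J" "j \<in> J" "i \<noteq> j" for i j
    by (rule bil_bump_disjoint[OF ad[OF that(1)] ad[OF that(2)] c disj[OF that]])
  \<comment> \<open>Two indices with the same bump would make one value of the form both zero and
    negative.\<close>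
  have inj: "inj_on ?\<phi> J"
    by (rule inj_onI) (use nn or in force)
  note S = orthogonal_negative_span[OF sym_form_bil[OF c], of "?\<phi> ` J"]
  have B: "finite (?\<phi> ` J)" "?\<phi> ` J \<subseteq> H1" using J bump_H1(1)[OF ad] by auto
  have o: "\<And>x y. x \<in> ?\<phi> ` J \<Longrightarrow> y \<in> ?\<phi> ` J \<Longrightarrow> x \<noteq> y \<Longrightarrow> ?b x y = 0" using or by auto
  have n: "\<And>x. x \<in> ?\<phi> ` J \<Longrightarrow> ?b x x < 0" using nn by auto
  have "negative_space lam u (span (?\<phi> ` J))"
    unfolding negative_space_def using S(2,3)[OF B o n] B(1) by blast
  then have "dim (span (?\<phi> ` J)) \<le> k" using M morse_index_le_iff[OF u] by blast
  moreover have "dim (span (?\<phi> ` J)) = card (?\<phi> ` J)"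
    using dim_span_eq_card_independent[OF S(1)[OF B o n]] by simp
  ultimately show ?thesis using card_image[OF inj] by simp
qed

text \<open>
  The weak equation on an edge says that \<open>u'\<close> differs from a primitive of the right-hand side by
  a function \<open>h\<close> that is orthogonal to all mean-zero functions, in particular to \<open>h\<close> minus its mean.
\<close>

lemma solution_C1:
  assumes sol: "solves_E G len W \<rho> p lam u" and e: "e \<in> arcs G"
  shows "\<exists>v. primitive_on 0 (len e) (ue u e) v \<and> primitive_on 0 (len e) v (\<lambda>x. cS lam u e x * ue u e x)"
proof -
  have u: "u \<in> H1" and weak: "\<And>v. v \<in> H1 \<Longrightarrow> bil (cS lam u) u v = 0"
    using sol solves_E_iff by auto
  let ?l = "len e"
  note l = length_pos[OF e]
  define f where "f x = cS lam u e x * ue u e x" for x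
  have fL2: "f \<in> L2_interval ?l"
  proof -
    obtain C where C: "\<And>x. x \<in> {0..?l} \<Longrightarrow> \<bar>cS lam u e x\<bar> \<le> C"
      using coef_cS[OF u, of lam] e unfolding coef_def by blast
    show ?thesis
      unfolding f_def
      by (rule L2_mult_bounded[OF L2_continuous[OF H1_edge(1)[OF u e]] _ C])
        (use coef_cS[OF u, of lam] e in \<open>auto simp: coef_def\<close>)
  qed
  define P where "P x = LI 0 x f" for x
  have pP: "primitive_on 0 ?l P f"
    by (rule primitive_onI[OF L2_integrable[OF fL2]]) (simp add: P_def)
  define h where "h x = De u e x - P x" for x
  have hL2: "h \<in> L2_interval ?l"
    unfolding h_def by (intro L2_diff H1_edge(2)[OF u e] L2_continuous primitive_on_continuous[OF pP])
  define c where "c = LI 0 ?l h / ?l"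
  have c: "LI 0 ?l h = c * ?l" using l by (simp add: c_def)
  define k where "k x = h x - c" for x
  have kL2: "k \<in> L2_interval ?l" unfolding k_def by (intro L2_diff hL2 L2_const)
  have k0: "LI 0 ?l k = 0"
    unfolding k_def using L2_integrable[OF hL2] c l by simp
  \<comment> \<open>Mean zero of \<open>k\<close> makes its primitive vanish at both ends, so it is
    an admissible bump on the whole edge.\<close>
  define K where "K x = LI 0 x k" for x
  have pK: "primitive_on 0 ?l K k"
    by (rule primitive_onI[OF L2_integrable[OF kL2]]) (simp add: K_def)
  have K0: "K 0 = 0" "K ?l = 0" using k0 by (auto simp: K_def)
  have "(\<lambda>x. if x \<in> {0..?l} then k x else 0) \<in> L2_interval ?l"
  proof -
    have "(\<lambda>x. if x \<in> {0..?l} then k x else 0) \<in> borel_measurable (lebesgue_on {0..?l}) \<longleftrightarrow> k \<in> borel_measurable (lebesgue_on {0..?l})"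
      by (rule measurable_cong) simp
    moreover have "integrable (lebesgue_on {0..?l}) (\<lambda>x. (if x \<in> {0..?l} then k x else 0)\<^sup>2) \<longleftrightarrow> integrable (lebesgue_on {0..?l}) (\<lambda>x. (k x)\<^sup>2)"
      by (rule Bochner_Integration.integrable_cong) auto
    ultimately show ?thesis using kL2 by (simp add: L2_interval_def)
  qed
  then have ad: "admissible e 0 ?l K k"
    using e l pK K0 by (simp add: admissible_def)
  have 1: "LI 0 ?l (\<lambda>x. De u e x * k x + f x * K x) = 0"
    using bil_bump[OF ad coef_cS[OF u] u, of lam] weak[OF bump_H1(1)[OF ad]] by (simp add: f_def)
  have 2: "LI 0 ?l (\<lambda>x. f x * K x + P x * k x) = 0"
    using primitive_on_mult_ends(2)[OF pP pK] l K0 by simp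
  have PL2: "P \<in> L2_interval ?l" "K \<in> L2_interval ?l"
    using L2_continuous primitive_on_continuous pP pK by blast+
  have i: "integrable (lebesgue_on {0..?l}) (\<lambda>x. De u e x * k x)" "integrable (lebesgue_on {0..?l}) (\<lambda>x. f x * K x)"
    "integrable (lebesgue_on {0..?l}) (\<lambda>x. P x * k x)" "integrable (lebesgue_on {0..?l}) k"
    using L2_mult_integrable H1_edge(2)[OF u e] kL2 fL2 PL2 L2_integrable by auto
  \<comment> \<open>The three groups have integral zero by the equation, by integration by parts and
    by mean zero, respectively.\<close>
  have "LI 0 ?l (\<lambda>x. (k x)\<^sup>2) = LI 0 ?l (\<lambda>x. (De u e x * k x + f x * K x) - (f x * K x + P x * k x) - c * k x)"
    by (rule Bochner_Integration.integral_cong) (auto simp: k_def h_def power2_eq_square algebra_simps)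
  also have "\<dots> = LI 0 ?l (\<lambda>x. De u e x * k x + f x * K x) - LI 0 ?l (\<lambda>x. f x * K x + P x * k x) - c * LI 0 ?l k"
    using i by simp
  finally have "LI 0 ?l (\<lambda>x. (k x)\<^sup>2) = 0" using 1 2 k0 by simp
  then have kAE: "AE x in lebesgue_on {0..?l}. k x = 0"
    using integral_nonneg_eq_0_iff_AE[OF L2_intervalD(2)[OF kL2]] by simp
  \<comment> \<open>The continuous representative of the derivative; it equals \<open>De u e\<close>
    almost everywhere because \<open>k\<close> vanishes almost everywhere.\<close>
  define v where "v x = P x + c" for x
  have pv: "primitive_on 0 ?l v f"
    using pP by (simp add: primitive_on_def v_def)
  have "primitive_on 0 ?l (ue u e) v"
    by (rule primitive_on_cong_AE[OF H1_edge(3)[OF u e]])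
      (use kAE borel_measurable_continuous_interval[OF primitive_on_continuous[OF pv]] in \<open>auto simp: k_def h_def v_def elim: AE_mp\<close>)
  with pv show ?thesis unfolding f_def by blast
qed

end

section \<open>Scaling and reflection of oscillating systems\<close>

lemma osc_systemI:
  assumes "\<And>x. x \<in> {0..L} \<Longrightarrow> (u has_real_derivative v x) (at x within {0..L})" "continuous_on {0..L} v"
    "osc_upper L A r0 r1 p u v" "osc_upper L A r0 r1 p (\<lambda>x. - u x) (\<lambda>x. - v x)"
  shows "osc_system L A r0 r1 p u v"
  unfolding osc_system_def using assms primitive_on_C1[of 0 L u v] by blast

lemma osc_system_derivative:
  "osc_system L A r0 r1 p u v \<Longrightarrow> x \<in> {0..L} \<Longrightarrow> (u has_real_derivative v x) (at x within {0..L})"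
  unfolding osc_system_def by (blast intro: primitive_on_derivative)

lemma osc_upper_reflect:
  assumes "osc_upper L A r0 r1 p u v"
  shows "osc_upper L A r0 r1 p (\<lambda>x. u (L - x)) (\<lambda>x. - v (L - x))"
  unfolding osc_upper_def
proof (intro allI impI)
  fix s t k assume st: "0 \<le> s" "s \<le> t" "t \<le> L" "\<forall>x\<in>{s..t}. force_le A r0 r1 p (u (L - x)) k"
  have "force_le A r0 r1 p (u x) k" if "x \<in> {L - t..L - s}" for x
    using st(4)[rule_format, of "L - x"] that by simp
  moreover have "0 \<le> L - t" "L - t \<le> L - s" "L - s \<le> L" using st by auto
  ultimately have "v (L - s) - v (L - t) \<le> k * ((L - s) - (L - t))"
    using assms unfolding osc_upper_def by blast
  then show "- v (L - t) - - v (L - s) \<le> k * (t - s)" by simp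
qed

text \<open>Moves a maximum from the right half of an edge to the left half, where there is room to
  follow the oscillation to the right.\<close>

lemma osc_system_reflect:
  assumes o: "osc_system L A r0 r1 p u v"
  shows "osc_system L A r0 r1 p (\<lambda>x. u (L - x)) (\<lambda>x. - v (L - x))"
proof (rule osc_systemI)
  have im: "(\<lambda>x. L - x) ` {0..L} = {0..L}" by auto
  fix x assume x: "x \<in> {0..L}"
  have "(u has_real_derivative v (L - x)) (at (L - x) within (\<lambda>x. L - x) ` {0..L})"
    unfolding im by (rule osc_system_derivative[OF o]) (use x in auto)
  moreover have "((\<lambda>x. L - x) has_real_derivative -1) (at x within {0..L})"
    by (auto intro!: derivative_eq_intros)
  ultimately have "(u \<circ> (\<lambda>x. L - x) has_real_derivative v (L - x) * -1) (at x within {0..L})"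
    by (rule DERIV_image_chain)
  then show "((\<lambda>x. u (L - x)) has_real_derivative - v (L - x)) (at x within {0..L})"
    by (simp add: o_def)
next
  show "continuous_on {0..L} (\<lambda>x. - v (L - x))"
    by (intro continuous_on_minus continuous_on_compose2[OF osc_system_continuous(2)[OF o order_refl order_refl]] continuous_intros) auto
  show "osc_upper L A r0 r1 p (\<lambda>x. u (L - x)) (\<lambda>x. - v (L - x))"
    "osc_upper L A r0 r1 p (\<lambda>x. - u (L - x)) (\<lambda>x. - (- v (L - x)))"
    using o osc_upper_reflect[of L A r0 r1 p u v] osc_upper_reflect[of L A r0 r1 p "\<lambda>x. - u x" "\<lambda>x. - v x"]
    by (auto simp: osc_system_def)
qed

text \<open>With \<open>\<Omega>\<^sup>2 = M powr (p - 2)\<close> the power term is invariant under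
  the scaling, while the linear coefficient is divided by \<open>\<Omega>\<^sup>2\<close>: a large
  solution becomes an oscillator with small linear part on a long interval.\<close>

lemma osc_upper_scale:
  assumes o: "osc_upper L A r0 r1 p u v" and M: "0 < M" "0 < \<Omega>" "\<Omega>\<^sup>2 = M powr (p - 2)"
  shows "osc_upper (\<Omega> * L) (A / \<Omega>\<^sup>2) r0 r1 p (\<lambda>t. u (t / \<Omega>) / M) (\<lambda>t. v (t / \<Omega>) / (M * \<Omega>))"
  unfolding osc_upper_def
proof (intro allI impI)
  fix s t k assume st: "0 \<le> s" "s \<le> t" "t \<le> \<Omega> * L" "\<forall>x\<in>{s..t}. force_le (A / \<Omega>\<^sup>2) r0 r1 p (u (x / \<Omega>) / M) k"
  have "force_le A r0 r1 p (u y) (k * M * \<Omega>\<^sup>2)" if y: "y \<in> {s / \<Omega>..t / \<Omega>}" for y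
    unfolding force_le_def
  proof (intro allI impI)
    fix w r assume wr: "\<bar>w\<bar> \<le> A" "r0 \<le> r" "r \<le> r1"
    let ?y = "u y / M"
    have "\<Omega> * y \<in> {s..t}" using y M by (auto simp: field_simps)
    then have "force_le (A / \<Omega>\<^sup>2) r0 r1 p ?y k" using st(4)[rule_format, of "\<Omega> * y"] M by simp
    moreover have "\<bar>w / \<Omega>\<^sup>2\<bar> \<le> A / \<Omega>\<^sup>2" using wr M by (simp add: divide_right_mono)
    ultimately have "w / \<Omega>\<^sup>2 * ?y - r * \<bar>?y\<bar> powr (p - 2) * ?y \<le> k"
      using wr unfolding force_le_def by blast
    then have "(w / \<Omega>\<^sup>2 * ?y - r * \<bar>?y\<bar> powr (p - 2) * ?y) * (M * \<Omega>\<^sup>2) \<le> k * (M * \<Omega>\<^sup>2)"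
      using M by (intro mult_right_mono) auto
    moreover have "(w / \<Omega>\<^sup>2 * ?y - r * \<bar>?y\<bar> powr (p - 2) * ?y) * (M * \<Omega>\<^sup>2) = w * u y - r * (\<Omega>\<^sup>2 * \<bar>?y\<bar> powr (p - 2)) * u y"
      using M by (simp add: field_simps)
    moreover have "\<Omega>\<^sup>2 * \<bar>?y\<bar> powr (p - 2) = \<bar>u y\<bar> powr (p - 2)"
      using M by (simp add: powr_mult[symmetric])
    ultimately show "w * u y - r * \<bar>u y\<bar> powr (p - 2) * u y \<le> k * M * \<Omega>\<^sup>2" by (simp only: mult.assoc)
  qed
  moreover have "0 \<le> s / \<Omega>" "s / \<Omega> \<le> t / \<Omega>" "t / \<Omega> \<le> L" using st M by (auto simp: divide_right_mono field_simps)
  ultimately have "v (t / \<Omega>) - v (s / \<Omega>) \<le> k * M * \<Omega>\<^sup>2 * (t / \<Omega> - s / \<Omega>)"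
    using o unfolding osc_upper_def by blast
  also have "t / \<Omega> - s / \<Omega> = (t - s) / \<Omega>" by (simp add: diff_divide_distrib)
  also have "k * M * \<Omega>\<^sup>2 * ((t - s) / \<Omega>) = (k * (t - s)) * (M * \<Omega>)" using M(2) by (simp add: power2_eq_square)
  finally show "v (t / \<Omega>) / (M * \<Omega>) - v (s / \<Omega>) / (M * \<Omega>) \<le> k * (t - s)"
    using M by (simp add: diff_divide_distrib[symmetric] pos_divide_le_eq)
qed

lemma osc_system_scale:
  assumes o: "osc_system L A r0 r1 p u v" and M: "0 < M" "0 < \<Omega>" "\<Omega>\<^sup>2 = M powr (p - 2)"
  shows "osc_system (\<Omega> * L) (A / \<Omega>\<^sup>2) r0 r1 p (\<lambda>t. u (t / \<Omega>) / M) (\<lambda>t. v (t / \<Omega>) / (M * \<Omega>))"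
proof (rule osc_systemI)
  have im: "(\<lambda>x. x / \<Omega>) ` {0..\<Omega> * L} = {0..L}"
  proof
    show "{0..L} \<subseteq> (\<lambda>x. x / \<Omega>) ` {0..\<Omega> * L}"
    proof
      fix x assume "x \<in> {0..L}"
      then show "x \<in> (\<lambda>x. x / \<Omega>) ` {0..\<Omega> * L}" using M by (intro image_eqI[of _ _ "\<Omega> * x"]) auto
    qed
  qed (use M in \<open>auto simp: field_simps\<close>)
  fix x assume x: "x \<in> {0..\<Omega> * L}"
  have "(u has_real_derivative v (x / \<Omega>)) (at (x / \<Omega>) within (\<lambda>x. x / \<Omega>) ` {0..\<Omega> * L})"
    unfolding im by (rule osc_system_derivative[OF o]) (use x M in \<open>auto simp: field_simps\<close>)
  moreover have "((\<lambda>x. x / \<Omega>) has_real_derivative 1 / \<Omega>) (at x within {0..\<Omega> * L})"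
    by (rule DERIV_cdivide) (rule DERIV_ident)
  ultimately have "(u \<circ> (\<lambda>x. x / \<Omega>) has_real_derivative v (x / \<Omega>) * (1 / \<Omega>)) (at x within {0..\<Omega> * L})"
    by (rule DERIV_image_chain)
  from DERIV_cdivide[OF this, of M] show "((\<lambda>t. u (t / \<Omega>) / M) has_real_derivative v (x / \<Omega>) / (M * \<Omega>)) (at x within {0..\<Omega> * L})"
    by (simp add: o_def mult.commute)
next
  show "continuous_on {0..\<Omega> * L} (\<lambda>t. v (t / \<Omega>) / (M * \<Omega>))"
    by (intro continuous_intros continuous_on_compose2[OF osc_system_continuous(2)[OF o order_refl order_refl]])
      (use M in \<open>auto simp: field_simps\<close>)
  show "osc_upper (\<Omega> * L) (A / \<Omega>\<^sup>2) r0 r1 p (\<lambda>t. u (t / \<Omega>) / M) (\<lambda>t. v (t / \<Omega>) / (M * \<Omega>))"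
    "osc_upper (\<Omega> * L) (A / \<Omega>\<^sup>2) r0 r1 p (\<lambda>t. - (u (t / \<Omega>) / M)) (\<lambda>t. - (v (t / \<Omega>) / (M * \<Omega>)))"
    using o osc_upper_scale[OF _ M, of L A r0 r1 u v] osc_upper_scale[OF _ M, of L A r0 r1 "\<lambda>x. - u x" "\<lambda>x. - v x"]
    by (auto simp: osc_system_def)
qed

text \<open>The passage from edgewise constants to one constant for the graph, by taking
  maxima.\<close>

lemma finite_uniform_bound:
  assumes "finite A" "\<And>e. e \<in> A \<Longrightarrow> \<exists>C::real. P e C" "\<And>e C C'. P e C \<Longrightarrow> C \<le> C' \<Longrightarrow> P e C'"
  shows "\<exists>C>0. \<forall>e\<in>A. P e C"
  using assms(1,2)
proof (induction A)
  case (insert e A)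
  obtain C where C: "C > 0" "\<forall>e\<in>A. P e C" using insert by auto
  obtain C' where "P e C'" using insert.prems by blast
  then show ?case using C assms(3) by (intro exI[of _ "max C C'"]) (auto intro: assms(3))
qed (auto intro: exI[of _ 1])

section \<open>Bounds for solutions of bounded Morse index\<close>

context nls_graph
begin

definition solution :: "real \<Rightarrow> (('v, 'e) gpoint \<Rightarrow> real) \<Rightarrow> bool"
  where "solution lam u \<longleftrightarrow> solves_E G len W \<rho> p lam u \<and> morse_index G len W \<rho> p lam u \<le> enat m"

lemma solutionD:
  assumes "solution lam u"
  shows "u \<in> H1" "solves_E G len W \<rho> p lam u" "morse_index G len W \<rho> p lam u \<le> enat m"
  using assms by (auto simp: solution_def solves_E_def)

lemma admissibleI:
  assumes "e \<in> arcs G" "0 \<le> a" "a < b" "b \<le> len e" "primitive_on a b F F'" "F a = 0" "F b = 0" "continuous_on {a..b} F'"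
  shows "admissible e a b F F'"
proof -
  obtain C where C: "\<And>x. x \<in> {a..b} \<Longrightarrow> \<bar>F' x\<bar> \<le> C" "C > 0"
    using continuous_bounded_interval[OF assms(8)] by blast
  have "(\<lambda>x. if x \<in> {a..b} then F' x else 0) \<in> L2_interval (len e)"
  proof (rule L2_bounded)
    have "integrable (lebesgue_on {0..len e}) (\<lambda>x. if x \<in> {a..b} then F' x else 0)"
      using LI_extend(2)[of a b "len e" F'] assms primitive_onD(1)[OF assms(5)] by simp
    then show "(\<lambda>x. if x \<in> {a..b} then F' x else 0) \<in> borel_measurable (lebesgue_on {0..len e})" by auto
    show "\<bar>if x \<in> {a..b} then F' x else 0\<bar> \<le> C" for x using C by auto
  qed
  then show ?thesis using assms by (simp add: admissible_def)
qed

text \<open>Serves both as a test function and as a cutoff. A polynomial without a plateau avoids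
  gluing pieces; its size on the middle third plays the part of the plateau.\<close>

lemma parabola:
  assumes "a < b"
  shows "primitive_on a b (\<lambda>x. (x - a) * (b - x)) (\<lambda>x. a + b - 2 * x)" "continuous_on {a..b} (\<lambda>x. a + b - 2 * x)"
    "\<And>x. x \<in> {a..b} \<Longrightarrow> \<bar>a + b - 2 * x\<bar> \<le> b - a"
    "\<And>x. x \<in> {a + (b - a) / 3..b - (b - a) / 3} \<Longrightarrow> ((b - a) / 3)\<^sup>2 \<le> (x - a) * (b - x)"
    "\<And>x. x \<in> {a..b} \<Longrightarrow> 0 \<le> (x - a) * (b - x)"
proof -
  show "primitive_on a b (\<lambda>x. (x - a) * (b - x)) (\<lambda>x. a + b - 2 * x)"
    by (rule primitive_on_C1) (auto intro!: derivative_eq_intros continuous_intros)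
  show "continuous_on {a..b} (\<lambda>x. a + b - 2 * x)" by (intro continuous_intros)
  show "\<And>x. x \<in> {a..b} \<Longrightarrow> \<bar>a + b - 2 * x\<bar> \<le> b - a" by auto
  show "((b - a) / 3)\<^sup>2 \<le> (x - a) * (b - x)" if "x \<in> {a + (b - a) / 3..b - (b - a) / 3}" for x
    unfolding power2_eq_square by (rule mult_mono) (use that assms in \<open>auto simp: field_simps\<close>)
qed auto

lemma LI_mono_cont:
  assumes "continuous_on {a..b} f" "a \<le> s" "t \<le> b" "\<And>x. x \<in> {a..b} \<Longrightarrow> 0 \<le> f x"
  shows "LI s t f \<le> LI a b f"
  by (rule LI_mono_interval[OF continuous_imp_integrable_real[OF assms(1)] assms(2-4)])

lemma cQ_integrable:
  assumes "u \<in> H1" "e \<in> arcs G" "0 \<le> a" "b \<le> len e" "continuous_on {a..b} F"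
  shows "integrable (lebesgue_on {a..b}) (\<lambda>x. cQ lam u e x * F x)" "integrable (lebesgue_on {a..b}) (\<lambda>x. cS lam u e x * F x)"
    "integrable (lebesgue_on {a..b}) (\<lambda>x. cB lam e x * F x)"
    "integrable (lebesgue_on {a..b}) (\<lambda>x. rt e x * \<bar>ue u e x\<bar> powr (p - 2) * F x)"
proof -
  have sub: "{a..b} \<subseteq> {0..len e}" using assms by auto
  obtain D where D: "\<And>x. x \<in> {a..b} \<Longrightarrow> \<bar>F x\<bar> \<le> D" "D > 0" using continuous_bounded_interval[OF assms(5)] by blast
  have gen: "integrable (lebesgue_on {a..b}) (\<lambda>x. c e x * F x)" if "coef c" for c
  proof -
    have "\<exists>C. \<forall>x\<in>{0..len e}. \<bar>c e x\<bar> \<le> C" using that assms(2) unfolding coef_def by simp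
    then obtain C where C: "\<And>x. x \<in> {0..len e} \<Longrightarrow> \<bar>c e x\<bar> \<le> C" by fast
    show ?thesis
    proof (rule integrable_bounded_interval)
      show "(\<lambda>x. c e x * F x) \<in> borel_measurable (lebesgue_on {a..b})"
        using borel_measurable_subinterval[OF _ sub, of "c e"] that assms(2) borel_measurable_continuous_interval[OF assms(5)]
        by (auto simp: coef_def)
      show "\<bar>c e x * F x\<bar> \<le> C * D" if "x \<in> {a..b}" for x
        unfolding abs_mult using C[of x] D(1)[OF that] sub that by (intro mult_mono) force+
    qed
  qed
  show "integrable (lebesgue_on {a..b}) (\<lambda>x. cQ lam u e x * F x)" "integrable (lebesgue_on {a..b}) (\<lambda>x. cS lam u e x * F x)"
    and B: "integrable (lebesgue_on {a..b}) (\<lambda>x. cB lam e x * F x)"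
    using gen coef_cQ coef_cS coef_cB assms(1) by auto
  from Bochner_Integration.integrable_diff[OF gen[OF coef_cB] gen[OF coef_cS[OF assms(1)]], of lam lam]
  show "integrable (lebesgue_on {a..b}) (\<lambda>x. rt e x * \<bar>ue u e x\<bar> powr (p - 2) * F x)"
    by (simp add: cB_def cS_def algebra_simps)
qed

text \<open>Below \<open>L\<close> the potential outweighs the Dirichlet energy of each of
  \<open>m + 1\<close> adjacent parabolas on one edge, which is one negative direction too many; the
  power term can only lower these values further.\<close>

lemma frequency_lower_bound: "\<exists>L. \<forall>lam u. solution lam u \<longrightarrow> L \<le> lam"
proof -
  obtain e where e: "e \<in> arcs G" using arcs_nonempty by blast
  define h where "h = len e / real (Suc m)"
  have h: "h > 0" using length_pos[OF e] by (simp add: h_def)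
  \<comment> \<open>243 = 3^5: the squared parabola has integral at least (h/3)^4 times h/3, against
    at most h^3 for its squared derivative.\<close>
  define L where "L = - (w1 + 243 / h\<^sup>2)"
  have "L \<le> lam" if s: "solution lam u" for lam u
  proof (rule ccontr)
    assume "\<not> L \<le> lam"
    then have neg: "lam + w1 < - (243 / h\<^sup>2)" by (simp add: L_def)
    note S = solutionD[OF s]
    define a where "a j = real j * h" for j :: nat
    define F where "F j x = (x - a j) * (a (Suc j) - x)" for j x
    define F' where "F' j x = a j + a (Suc j) - 2 * x" for j x
    have step: "a (Suc j) - a j = h" "a j < a (Suc j)" for j using h by (auto simp: a_def algebra_simps)
    have aN: "a (Suc m) = len e" using h by (simp add: a_def h_def)
    have amono: "a i \<le> a j" if "i \<le> j" for i j using that h by (simp add: a_def mult_right_mono)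
    have a0: "0 \<le> a j" for j using h by (simp add: a_def)
    have ab: "a (Suc j) \<le> len e" if "j \<in> {..m}" for j using amono[of "Suc j" "Suc m"] that aN by simp
    have ad: "admissible e (a j) (a (Suc j)) (F j) (F' j)" if "j \<in> {..m}" for j
      unfolding F_def F'_def
      by (rule admissibleI[OF e a0 step(2) ab[OF that] parabola(1)[OF step(2)] _ _ parabola(2)[OF step(2)]]) auto
    have "card {..m} \<le> m"
    proof (rule index_card[OF S(1,3) _ ad])
      show "a (Suc i) \<le> a j \<or> a (Suc j) \<le> a i" if "i \<noteq> j" for i j
        using amono[of "Suc i" j] amono[of "Suc j" i] that by (cases "i < j") auto
      fix j assume j: "j \<in> {..m}"
      let ?a = "a j" and ?b = "a (Suc j)"
      have cF: "continuous_on {?a..?b} (\<lambda>x. (F j x)\<^sup>2)" "continuous_on {?a..?b} (\<lambda>x. (F' j x)\<^sup>2)"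
        unfolding F_def F'_def by (intro continuous_intros)+
      have i1: "integrable (lebesgue_on {?a..?b}) (\<lambda>x. (F j x)\<^sup>2)" "integrable (lebesgue_on {?a..?b}) (\<lambda>x. (F' j x)\<^sup>2)"
        using cF by (auto intro: continuous_imp_integrable_real)
      have i2: "integrable (lebesgue_on {?a..?b}) (\<lambda>x. cQ lam u e x * (F j x)\<^sup>2)"
        by (rule cQ_integrable[OF S(1) e a0 ab[OF j] cF(1)])
      have "LI ?a ?b (\<lambda>x. (F' j x)\<^sup>2 + cQ lam u e x * (F j x)\<^sup>2) \<le> LI ?a ?b (\<lambda>x. h\<^sup>2 + (lam + w1) * (F j x)\<^sup>2)"
      proof (rule integral_mono)
        fix x assume "x \<in> space (lebesgue_on {?a..?b})"
        then have x: "x \<in> {?a..?b}" by simp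
        have "(F' j x)\<^sup>2 \<le> h\<^sup>2"
          using parabola(3)[OF step(2)[of j] x] step(1)[of j] unfolding F'_def
          by (metis abs_ge_zero power2_abs power_mono)
        moreover have "0 \<le> (p - 1) * rt e x * \<bar>ue u e x\<bar> powr (p - 2)"
          using p2 rt_bound[of e x] r0 by (intro mult_nonneg_nonneg) auto
        then have "cQ lam u e x \<le> lam + w1" using Wt_bound[of e x] unfolding cQ_def by linarith
        ultimately show "(F' j x)\<^sup>2 + cQ lam u e x * (F j x)\<^sup>2 \<le> h\<^sup>2 + (lam + w1) * (F j x)\<^sup>2"
          by (intro add_mono mult_right_mono) auto
      qed (use i1 i2 in auto)
      also have "\<dots> = h\<^sup>2 * h + (lam + w1) * LI ?a ?b (\<lambda>x. (F j x)\<^sup>2)"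
        using i1 step by (simp add: less_imp_le)
      also have "\<dots> \<le> h\<^sup>2 * h + (lam + w1) * (h ^ 5 / 243)"
      proof -
        have "h ^ 5 / 243 = ((h / 3)\<^sup>2)\<^sup>2 * (?b - h / 3 - (?a + h / 3))" using step[of j]
          by (simp add: field_simps power2_eq_square power_numeral_reduce)
        also have "\<dots> \<le> LI (?a + h / 3) (?b - h / 3) (\<lambda>x. (F j x)\<^sup>2)"
        proof (rule LI_ge)
          show "integrable (lebesgue_on {?a + h / 3..?b - h / 3}) (\<lambda>x. (F j x)\<^sup>2)"
            by (rule integrable_subinterval[OF i1(1)]) (use h in auto)
          show "((h / 3)\<^sup>2)\<^sup>2 \<le> (F j x)\<^sup>2" if "x \<in> {?a + h / 3..?b - h / 3}" for x
            using parabola(4)[OF step(2)[of j], of x] that step(1)[of j] unfolding F_def by (intro power_mono) auto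
        qed (use h step(1)[of j] in auto)
        also have "\<dots> \<le> LI ?a ?b (\<lambda>x. (F j x)\<^sup>2)" by (rule LI_mono_cont[OF cF(1)]) (use h in auto)
        finally have "h ^ 5 / 243 \<le> LI ?a ?b (\<lambda>x. (F j x)\<^sup>2)" .
        moreover have "lam + w1 \<le> 0" using neg h by (smt (verit) divide_nonneg_nonneg zero_le_power2)
        ultimately show ?thesis using mult_left_mono_neg add_left_mono by blast
      qed
      also have "\<dots> < 0"
      proof -
        have "(lam + w1) * (h ^ 5 / 243) < - (243 / h\<^sup>2) * (h ^ 5 / 243)"
          using neg h by (intro mult_strict_right_mono) auto
        also have "\<dots> = - (h\<^sup>2 * h)" using h by (simp add: field_simps power2_eq_square power_numeral_reduce)
        finally show ?thesis by simp
      qed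
      finally show "LI ?a ?b (\<lambda>x. (F' j x)\<^sup>2 + cQ lam u e x * (F j x)\<^sup>2) < 0" .
    qed auto
    then show False by simp
  qed
  then show ?thesis by blast
qed

section \<open>Nodal intervals and the uniform bound\<close>

lemma solution_osc_system:
  assumes sol: "solves_E G len W \<rho> p lam u" and e: "e \<in> arcs G"
  shows "\<exists>v. osc_system (len e) (w1 + \<bar>lam\<bar>) r0 r1 p (ue u e) v \<and> primitive_on 0 (len e) v (\<lambda>x. cS lam u e x * ue u e x)"
proof -
  obtain v where v: "primitive_on 0 (len e) (ue u e) v" "primitive_on 0 (len e) v (\<lambda>x. cS lam u e x * ue u e x)"
    using solution_C1[OF sol e] by blast
  have cw: "\<bar>Wt e x + lam\<bar> \<le> w1 + \<bar>lam\<bar>" for x using Wt_bound[of e x] by linarith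
  have "osc_upper (len e) (w1 + \<bar>lam\<bar>) r0 r1 p (ue u e) v"
    unfolding osc_upper_def
  proof (intro allI impI)
    fix s t k assume st: "0 \<le> s" "s \<le> t" "t \<le> len e" and f: "\<forall>x\<in>{s..t}. force_le (w1 + \<bar>lam\<bar>) r0 r1 p (ue u e x) k"
    have "LI s t (\<lambda>x. cS lam u e x * ue u e x) \<le> k * (t - s)"
    proof (rule LI_le)
      show "integrable (lebesgue_on {s..t}) (\<lambda>x. cS lam u e x * ue u e x)"
        by (rule integrable_subinterval[OF primitive_onD(1)[OF v(2)]]) (use st in auto)
      show "cS lam u e x * ue u e x \<le> k" if "x \<in> {s..t}" for x
        using f[rule_format, OF that] cw[of x] rt_bound[of e x] unfolding force_le_def cS_def left_diff_distrib by blast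
    qed fact
    then show "v t - v s \<le> k * (t - s)" using primitive_onD(2)[OF v(2) st] by simp
  qed
  moreover have "osc_upper (len e) (w1 + \<bar>lam\<bar>) r0 r1 p (\<lambda>x. - ue u e x) (\<lambda>x. - v x)"
    unfolding osc_upper_def
  proof (intro allI impI)
    fix s t k assume st: "0 \<le> s" "s \<le> t" "t \<le> len e" and f: "\<forall>x\<in>{s..t}. force_le (w1 + \<bar>lam\<bar>) r0 r1 p (- ue u e x) k"
    have i: "integrable (lebesgue_on {s..t}) (\<lambda>x. cS lam u e x * ue u e x)"
      by (rule integrable_subinterval[OF primitive_onD(1)[OF v(2)]]) (use st in auto)
    have "LI s t (\<lambda>x. - (cS lam u e x * ue u e x)) \<le> k * (t - s)"
    proof (rule LI_le)
      show "- (cS lam u e x * ue u e x) \<le> k" if "x \<in> {s..t}" for x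
      proof -
        have "(Wt e x + lam) * (- ue u e x) - rt e x * \<bar>- ue u e x\<bar> powr (p - 2) * (- ue u e x) \<le> k"
          using f[rule_format, OF that] cw[of x] rt_bound[of e x] unfolding force_le_def by blast
        then show ?thesis by (simp add: cS_def left_diff_distrib)
      qed
    qed (use i st in auto)
    then show "- v t - - v s \<le> k * (t - s)" using primitive_onD(2)[OF v(2) st] by simp
  qed
  ultimately show ?thesis
    using v primitive_on_continuous[OF v(2)] unfolding osc_system_def by blast
qed

text \<open>Testing the equation with \<open>u\<close> itself on the interval gives zero for
  \<open>cS\<close>; passing to \<open>cQ\<close> subtracts (p - 2) times the integral of rt |u|^p,
  which is positive.\<close>

lemma nodal_interval_negative:
  assumes u: "u \<in> H1" and e: "e \<in> arcs G" and ab: "0 \<le> a" "a < b" "b \<le> len e"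
    and pu: "primitive_on 0 (len e) (ue u e) v" and pv: "primitive_on 0 (len e) v (\<lambda>x. cS lam u e x * ue u e x)"
    and z: "ue u e a = 0" "ue u e b = 0" and nz: "\<exists>y\<in>{a..b}. ue u e y \<noteq> 0"
  shows "LI a b (\<lambda>x. (v x)\<^sup>2 + cQ lam u e x * (ue u e x)\<^sup>2) < 0"
proof -
  let ?u = "ue u e"
  have cu: "continuous_on {a..b} ?u" "continuous_on {a..b} v"
    by (rule continuous_on_subset[OF primitive_on_continuous[OF pu]], use ab in force)
      (rule continuous_on_subset[OF primitive_on_continuous[OF pv]], use ab in force)
  have cu2: "continuous_on {a..b} (\<lambda>x. (?u x)\<^sup>2)" "continuous_on {a..b} (\<lambda>x. (v x)\<^sup>2)"
    by (intro continuous_intros cu)+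
  note i = cQ_integrable[OF u e ab(1,3) cu2(1)]
  have iv: "integrable (lebesgue_on {a..b}) (\<lambda>x. (v x)\<^sup>2)" by (rule continuous_imp_integrable_real[OF cu2(2)])
  have "LI a b (\<lambda>x. cS lam u e x * ?u x * ?u x + v x * v x) = 0"
    using primitive_on_mult_ends(2)[OF primitive_on_subinterval[OF pv ab(1,3)] primitive_on_subinterval[OF pu ab(1,3)]] ab z by simp
  then have "LI a b (\<lambda>x. (v x)\<^sup>2 + cS lam u e x * (?u x)\<^sup>2) = 0"
    by (simp add: power2_eq_square algebra_simps)
  then have 1: "LI a b (\<lambda>x. (v x)\<^sup>2) + LI a b (\<lambda>x. cS lam u e x * (?u x)\<^sup>2) = 0"
    using i iv by simp
  have "LI a b (\<lambda>x. (v x)\<^sup>2 + cQ lam u e x * (?u x)\<^sup>2) =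
    LI a b (\<lambda>x. (v x)\<^sup>2 + cS lam u e x * (?u x)\<^sup>2 - (p - 2) * (rt e x * \<bar>?u x\<bar> powr (p - 2) * (?u x)\<^sup>2))"
    by (rule Bochner_Integration.integral_cong) (auto simp: cQ_def cS_def algebra_simps)
  also have "\<dots> = - ((p - 2) * LI a b (\<lambda>x. rt e x * \<bar>?u x\<bar> powr (p - 2) * (?u x)\<^sup>2))"
    using i iv 1 by simp
  finally have eq: "LI a b (\<lambda>x. (v x)\<^sup>2 + cQ lam u e x * (?u x)\<^sup>2) = - ((p - 2) * LI a b (\<lambda>x. rt e x * \<bar>?u x\<bar> powr (p - 2) * (?u x)\<^sup>2))" .
  have cg: "continuous_on {a..b} (\<lambda>x. r0 * \<bar>?u x\<bar> powr (p - 2) * (?u x)\<^sup>2)"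
    using p2 by (intro continuous_on_mult continuous_on_const continuous_on_powr' continuous_on_rabs cu cu2) auto
  have "LI a b (\<lambda>x. r0 * \<bar>?u x\<bar> powr (p - 2) * (?u x)\<^sup>2) \<noteq> 0"
    using integral_nonneg_continuous_zero[OF cg] nz r0 ab(2) by fastforce
  moreover have "0 \<le> LI a b (\<lambda>x. r0 * \<bar>?u x\<bar> powr (p - 2) * (?u x)\<^sup>2)"
    by (rule integral_nonneg_AE) (use r0 in auto)
  moreover have "LI a b (\<lambda>x. r0 * \<bar>?u x\<bar> powr (p - 2) * (?u x)\<^sup>2) \<le> LI a b (\<lambda>x. rt e x * \<bar>?u x\<bar> powr (p - 2) * (?u x)\<^sup>2)"
    by (rule integral_mono) (use i(4) continuous_imp_integrable_real[OF cg] rt_bound in \<open>auto intro!: mult_right_mono\<close>)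
  ultimately show ?thesis unfolding eq using p2 by (simp add: mult_neg_pos)
qed

lemma zeros_contradiction:
  assumes s: "solution lam u" and e: "e \<in> arcs G"
    and pu: "primitive_on 0 (len e) (ue u e) v" and pv: "primitive_on 0 (len e) v (\<lambda>x. cS lam u e x * ue u e x)"
    and ab: "\<And>j. j \<le> m \<Longrightarrow> 0 \<le> a j \<and> a j < b j \<and> b j \<le> len e \<and> ue u e (a j) = 0 \<and> ue u e (b j) = 0 \<and> (\<exists>y\<in>{a j..b j}. ue u e y \<noteq> 0)"
    and disj: "\<And>i j. i \<le> m \<Longrightarrow> j \<le> m \<Longrightarrow> i < j \<Longrightarrow> b i \<le> a j \<or> b j \<le> a i"
  shows False
proof -
  note S = solutionD[OF s]
  have "card {..m} \<le> m"
  proof (rule index_card[OF S(1,3), where F = "\<lambda>j. ue u e" and F' = "\<lambda>j. v" and a = a and b = b])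
    fix j assume "j \<in> {..m}"
    then have j: "0 \<le> a j" "a j < b j" "b j \<le> len e" "ue u e (a j) = 0" "ue u e (b j) = 0" "\<exists>y\<in>{a j..b j}. ue u e y \<noteq> 0"
      using ab[of j] by auto
    show "admissible e (a j) (b j) (ue u e) v"
      by (rule admissibleI[OF e j(1,2,3) primitive_on_subinterval[OF pu j(1,3)] j(4,5)
          primitive_on_continuous[OF primitive_on_subinterval[OF pv j(1,3)]]])
    show "LI (a j) (b j) (\<lambda>x. (v x)\<^sup>2 + cQ lam u e x * (ue u e x)\<^sup>2) < 0"
      by (rule nodal_interval_negative[OF S(1) e j(1,2,3) pu pv j(4,5,6)])
  next
    fix i j assume "i \<in> {..m}" "j \<in> {..m}" "i \<noteq> j"
    then show "b i \<le> a j \<or> b j \<le> a i" using disj[of i j] disj[of j i] by (cases "i < j") auto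
  qed simp
  then show False by simp
qed

lemma edge_sup_bound:
  assumes e: "e \<in> arcs G"
  shows "\<exists>C. \<forall>lam u. solution lam u \<longrightarrow> (\<forall>x\<in>{0..len e}. \<bar>ue u e x\<bar> powr (p - 2) \<le> C * (1 + \<bar>lam\<bar>))"
proof -
  let ?l = "len e"
  note l = length_pos[OF e]
  obtain \<alpha> T where \<alpha>: "\<alpha> > 0" "T > 0" and chain: "\<And>L u v x. osc_system L \<alpha> r0 r1 p u v \<Longrightarrow> \<forall>y\<in>{0..L}. \<bar>u y\<bar> \<le> 1 \<Longrightarrow>
    0 \<le> x \<Longrightarrow> x + T \<le> L \<Longrightarrow> 1 \<le> u x \<Longrightarrow> v x \<le> 0 \<Longrightarrow>
    (\<exists>z::nat \<Rightarrow> real. (\<forall>j\<le>Suc m. x < z j \<and> z j \<le> x + T \<and> u (z j) = 0) \<and>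
      (\<forall>j<Suc m. \<exists>y. z j < y \<and> y < z (Suc j) \<and> u y \<noteq> 0))"
    using zero_chain[OF p2 r0 r01, of 1 "Suc m"] by auto
  \<comment> \<open>The first summand brings the rescaled linear coefficient below \<alpha>, the
    second stretches half of the edge to length at least \<open>T\<close>.\<close>
  define C where "C = (w1 + 1) / \<alpha> + (2 * T / ?l)\<^sup>2"
  have "\<bar>ue u e x\<bar> powr (p - 2) \<le> C * (1 + \<bar>lam\<bar>)" if s: "solution lam u" and x: "x \<in> {0..?l}" for lam u x
  proof (rule ccontr)
    assume big: "\<not> \<bar>ue u e x\<bar> powr (p - 2) \<le> C * (1 + \<bar>lam\<bar>)"
    note S = solutionD[OF s]
    obtain v where o: "osc_system ?l (w1 + \<bar>lam\<bar>) r0 r1 p (ue u e) v" and pv: "primitive_on 0 ?l v (\<lambda>x. cS lam u e x * ue u e x)"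
      using solution_osc_system[OF S(2) e] by blast
    have pu: "primitive_on 0 ?l (ue u e) v" using o by (simp add: osc_system_def)
    have "continuous_on {0..?l} (\<lambda>x. \<bar>ue u e x\<bar>)" by (intro continuous_intros H1_edge(1)[OF S(1) e])
    then obtain x0 where x0: "x0 \<in> {0..?l}" "\<And>y. y \<in> {0..?l} \<Longrightarrow> \<bar>ue u e y\<bar> \<le> \<bar>ue u e x0\<bar>"
      using continuous_attains_sup[of "{0..?l}" "\<lambda>x. \<bar>ue u e x\<bar>"] l by auto
    define M where "M = \<bar>ue u e x0\<bar>"
    have Mbig: "C * (1 + \<bar>lam\<bar>) < M powr (p - 2)"
    proof -
      have "\<bar>ue u e x\<bar> powr (p - 2) \<le> M powr (p - 2)"
        unfolding M_def using x0(2)[OF x] p2 by (intro powr_mono2) auto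
      with big show ?thesis by linarith
    qed
    have Ceq: "C * (1 + \<bar>lam\<bar>) = (w1 + 1) * (1 + \<bar>lam\<bar>) / \<alpha> + (2 * T / ?l)\<^sup>2 * (1 + \<bar>lam\<bar>)"
      unfolding C_def by (simp only: distrib_right times_divide_eq_left)
    have C1: "(w1 + \<bar>lam\<bar>) / \<alpha> \<le> C * (1 + \<bar>lam\<bar>)" "(2 * T / ?l)\<^sup>2 \<le> C * (1 + \<bar>lam\<bar>)"
    proof -
      have "(w1 + \<bar>lam\<bar>) / \<alpha> \<le> ((w1 + 1) * (1 + \<bar>lam\<bar>)) / \<alpha>"
        using \<alpha> w1 by (intro divide_right_mono) (auto simp: algebra_simps)
      moreover have "0 \<le> (2 * T / ?l)\<^sup>2 * (1 + \<bar>lam\<bar>)" by simp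
      ultimately show "(w1 + \<bar>lam\<bar>) / \<alpha> \<le> C * (1 + \<bar>lam\<bar>)" unfolding Ceq by linarith
      have "(2 * T / ?l)\<^sup>2 * 1 \<le> (2 * T / ?l)\<^sup>2 * (1 + \<bar>lam\<bar>)" by (rule mult_left_mono) auto
      moreover have "0 \<le> (w1 + 1) * (1 + \<bar>lam\<bar>) / \<alpha>" using w1 \<alpha> by simp
      ultimately show "(2 * T / ?l)\<^sup>2 \<le> C * (1 + \<bar>lam\<bar>)" unfolding Ceq by linarith
    qed
    have "0 \<le> C * (1 + \<bar>lam\<bar>)" using C1(2) zero_le_power2[of "2 * T / ?l"] by linarith
    then have Mpos: "M powr (p - 2) > 0" using Mbig by linarith
    then have M0: "M > 0" unfolding M_def by (metis abs_0 abs_ge_zero less_eq_real_def powr_0 less_irrefl powr_eq_0_iff)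
    define \<Omega> where "\<Omega> = sqrt (M powr (p - 2))"
    have \<Omega>: "\<Omega> > 0" "\<Omega>\<^sup>2 = M powr (p - 2)" using Mpos by (auto simp: \<Omega>_def)
    have A: "(w1 + \<bar>lam\<bar>) / \<Omega>\<^sup>2 \<le> \<alpha>"
    proof -
      have "(w1 + \<bar>lam\<bar>) / \<alpha> \<le> M powr (p - 2)" using C1(1) Mbig by linarith
      then show ?thesis using \<alpha>(1) Mpos unfolding \<Omega>(2) by (simp add: pos_divide_le_eq mult.commute)
    qed
    have "2 * T / ?l < \<Omega>"
      using C1(2) Mbig \<Omega> by (intro power2_less_imp_less[of _ \<Omega>]) auto
    then have T: "T \<le> \<Omega> * (?l / 2)" using l by (simp add: field_simps)
    text \<open>The claim for a function which is \<open>u\<close> up to sign and reflection, so that its maximum lies in the left half.\<close>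
    have core: "\<exists>z::nat \<Rightarrow> real. (\<forall>j\<le>Suc m. 0 \<le> z j \<and> z j \<le> ?l \<and> f (z j) = 0) \<and>
        (\<forall>j<Suc m. \<exists>y. z j < y \<and> y < z (Suc j) \<and> f y \<noteq> 0)"
      if o: "osc_system ?l (w1 + \<bar>lam\<bar>) r0 r1 p f g" and f: "\<And>y. y \<in> {0..?l} \<Longrightarrow> \<bar>f y\<bar> \<le> M" "f c = M"
        and c: "0 \<le> c" "c \<le> ?l / 2" for f g c
    proof -
      \<comment> \<open>A positive slope would push \<open>f\<close> above its maximum just to the
        right of \<open>c\<close>, where there is room because \<open>c\<close> lies in the left
        half.\<close>
      have "g c \<le> 0"
      proof (rule ccontr)
        assume "\<not> g c \<le> 0"
        then obtain d where d: "d > 0" "\<And>h. h > 0 \<Longrightarrow> c + h \<in> {0..?l} \<Longrightarrow> h < d \<Longrightarrow> f c < f (c + h)"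
          using has_real_derivative_pos_inc_right[OF osc_system_derivative[OF o, of c]] c l by auto
        define h where "h = min (d / 2) (?l / 2)"
        have h: "0 < h" "h < d" "c + h \<in> {0..?l}" using c d(1) l by (auto simp: h_def min_def)
        have "f c < f (c + h)" by (rule d(2)) (use h in auto)
        moreover have "f (c + h) \<le> M" using f(1)[OF h(3)] by simp
        ultimately show False using f(2) by simp
      qed
      have "\<exists>z::nat \<Rightarrow> real. (\<forall>j\<le>Suc m. \<Omega> * c < z j \<and> z j \<le> \<Omega> * c + T \<and> f (z j / \<Omega>) / M = 0) \<and>
        (\<forall>j<Suc m. \<exists>y. z j < y \<and> y < z (Suc j) \<and> f (y / \<Omega>) / M \<noteq> 0)"
      proof (rule chain[OF osc_system_mono[OF osc_system_scale[OF o M0 \<Omega>] A]])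
        show "\<forall>y\<in>{0..\<Omega> * ?l}. \<bar>f (y / \<Omega>) / M\<bar> \<le> 1"
          using f(1) M0 \<Omega> by (auto simp: field_simps)
        have "\<Omega> * c \<le> \<Omega> * (?l / 2)" using c \<Omega> by (intro mult_left_mono) auto
        then show "\<Omega> * c + T \<le> \<Omega> * ?l" using T by (simp add: field_simps)
        show "g (\<Omega> * c / \<Omega>) / (M * \<Omega>) \<le> 0" using \<open>g c \<le> 0\<close> M0 \<Omega>(1) by (simp add: divide_nonpos_pos)
      qed (use c \<Omega> M0 f in auto)
      then obtain z :: "nat \<Rightarrow> real" where z: "\<And>j. j \<le> Suc m \<Longrightarrow> \<Omega> * c < z j \<and> z j \<le> \<Omega> * c + T \<and> f (z j / \<Omega>) = 0"
        "\<And>j. j < Suc m \<Longrightarrow> \<exists>y. z j < y \<and> y < z (Suc j) \<and> f (y / \<Omega>) \<noteq> 0" using M0 by auto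
      show ?thesis
      proof (intro exI[of _ "\<lambda>j. z j / \<Omega>"] conjI allI impI)
        fix j assume j: "j \<le> Suc m"
        have "0 \<le> \<Omega> * c" using c \<Omega> by simp
        then show "0 \<le> z j / \<Omega>" using z(1)[OF j] \<Omega> by simp
        have "\<Omega> * c \<le> \<Omega> * (?l / 2)" using c \<Omega> by (intro mult_left_mono) auto
        then have "z j \<le> \<Omega> * ?l" using z(1)[OF j] T by (simp add: field_simps)
        then show "z j / \<Omega> \<le> ?l" using \<Omega> by (simp add: field_simps)
        show "f (z j / \<Omega>) = 0" using z(1)[OF j] by simp
      next
        fix j assume "j < Suc m"
        then obtain y where "z j < y" "y < z (Suc j)" "f (y / \<Omega>) \<noteq> 0" using z(2) by blast
        then show "\<exists>y. z j / \<Omega> < y \<and> y < z (Suc j) / \<Omega> \<and> f y \<noteq> 0"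
          using \<Omega> by (intro exI[of _ "y / \<Omega>"]) (simp add: divide_strict_right_mono)
      qed
    qed
    \<comment> \<open>The sign that turns the extremum of \<open>u\<close> into a positive
      maximum.\<close>
    define \<sigma> :: real where "\<sigma> = (if ue u e x0 < 0 then -1 else 1)"
    have \<sigma>: "\<sigma> \<noteq> 0" "\<bar>\<sigma>\<bar> = 1" "\<sigma> * ue u e x0 = M" by (auto simp: \<sigma>_def M_def)
    have o\<sigma>: "osc_system ?l (w1 + \<bar>lam\<bar>) r0 r1 p (\<lambda>x. \<sigma> * ue u e x) (\<lambda>x. \<sigma> * v x)"
      using o osc_system_uminus[OF o] by (simp add: \<sigma>_def)
    have b\<sigma>: "\<bar>\<sigma> * ue u e y\<bar> \<le> M" if "y \<in> {0..?l}" for y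
      using x0(2)[OF that] \<sigma> by (simp add: abs_mult M_def)
    show False
    proof (cases "x0 \<le> ?l / 2")
      case True
      then obtain z :: "nat \<Rightarrow> real" where z: "\<And>j. j \<le> Suc m \<Longrightarrow> 0 \<le> z j \<and> z j \<le> ?l \<and> ue u e (z j) = 0"
        "\<And>j. j < Suc m \<Longrightarrow> \<exists>y. z j < y \<and> y < z (Suc j) \<and> ue u e y \<noteq> 0"
        using core[OF o\<sigma> b\<sigma> \<sigma>(3)] x0(1) \<sigma>(1) by auto
      have mono: "z i \<le> z j" if "i \<le> j" "j \<le> Suc m" for i j
        using that
      proof (induction j rule: dec_induct)
        case (step n)
        then show ?case using z(2)[of n] by force
      qed simp
      show False
      proof (rule zeros_contradiction[OF s e pu pv, where a = z and b = "\<lambda>j. z (Suc j)"])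
        fix j assume j: "j \<le> m"
        then obtain y where "z j < y" "y < z (Suc j)" "ue u e y \<noteq> 0" using z(2)[of j] by auto
        then show "0 \<le> z j \<and> z j < z (Suc j) \<and> z (Suc j) \<le> ?l \<and> ue u e (z j) = 0 \<and> ue u e (z (Suc j)) = 0 \<and>
          (\<exists>y\<in>{z j..z (Suc j)}. ue u e y \<noteq> 0)"
          using z(1)[of j] z(1)[of "Suc j"] j by (auto intro!: bexI[of _ y])
      next
        fix i j assume "i \<le> m" "j \<le> m" "i < j"
        then show "z (Suc i) \<le> z j \<or> z (Suc j) \<le> z i" using mono[of "Suc i" j] by auto
      qed
    next
      case False
      \<comment> \<open>The maximum lies in the right half, so the reflected function is used; its
        zeros come back in reverse order.\<close>
      have "\<exists>z::nat \<Rightarrow> real. (\<forall>j\<le>Suc m. 0 \<le> z j \<and> z j \<le> ?l \<and> \<sigma> * ue u e (?l - z j) = 0) \<and>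
        (\<forall>j<Suc m. \<exists>y. z j < y \<and> y < z (Suc j) \<and> \<sigma> * ue u e (?l - y) \<noteq> 0)"
        by (rule core[OF osc_system_reflect[OF o\<sigma>], of "?l - x0"]) (use b\<sigma> \<sigma> x0(1) False in auto)
      then obtain z :: "nat \<Rightarrow> real" where z: "\<And>j. j \<le> Suc m \<Longrightarrow> 0 \<le> z j \<and> z j \<le> ?l \<and> ue u e (?l - z j) = 0"
        "\<And>j. j < Suc m \<Longrightarrow> \<exists>y. z j < y \<and> y < z (Suc j) \<and> ue u e (?l - y) \<noteq> 0"
        using \<sigma>(1) by auto
      have mono: "z i \<le> z j" if "i \<le> j" "j \<le> Suc m" for i j
        using that
      proof (induction j rule: dec_induct)
        case (step n)
        then show ?case using z(2)[of n] by force
      qed simp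
      show False
      proof (rule zeros_contradiction[OF s e pu pv, where a = "\<lambda>j. ?l - z (Suc j)" and b = "\<lambda>j. ?l - z j"])
        fix j assume j: "j \<le> m"
        then obtain y where "z j < y" "y < z (Suc j)" "ue u e (?l - y) \<noteq> 0" using z(2)[of j] by auto
        then show "0 \<le> ?l - z (Suc j) \<and> ?l - z (Suc j) < ?l - z j \<and> ?l - z j \<le> ?l \<and> ue u e (?l - z (Suc j)) = 0 \<and> ue u e (?l - z j) = 0 \<and>
          (\<exists>y\<in>{?l - z (Suc j)..?l - z j}. ue u e y \<noteq> 0)"
          using z(1)[of j] z(1)[of "Suc j"] j by (auto intro!: bexI[of _ "?l - y"])
      next
        fix i j assume "i \<le> m" "j \<le> m" "i < j"
        then show "?l - z i \<le> ?l - z (Suc j) \<or> ?l - z j \<le> ?l - z (Suc i)" using mono[of "Suc i" j] by auto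
      qed
    qed
  qed
  then show ?thesis by blast
qed

lemma sup_bound:
  "\<exists>C>0. \<forall>lam u. solution lam u \<longrightarrow> (\<forall>e\<in>arcs G. \<forall>x\<in>{0..len e}. \<bar>ue u e x\<bar> powr (p - 2) \<le> C * (1 + \<bar>lam\<bar>))"
proof -
  have "\<exists>C>0. \<forall>e\<in>arcs G. \<forall>lam u. solution lam u \<longrightarrow> (\<forall>x\<in>{0..len e}. \<bar>ue u e x\<bar> powr (p - 2) \<le> C * (1 + \<bar>lam\<bar>))"
  proof (rule finite_uniform_bound[OF finite_arcs edge_sup_bound])
    fix e and C C' :: real
    assume *: "\<forall>lam u. solution lam u \<longrightarrow> (\<forall>x\<in>{0..len e}. \<bar>ue u e x\<bar> powr (p - 2) \<le> C * (1 + \<bar>lam\<bar>))" and "C \<le> C'"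
    then have "C * (1 + \<bar>lam\<bar>) \<le> C' * (1 + \<bar>lam\<bar>)" for lam by (intro mult_right_mono) auto
    then show "\<forall>lam u. solution lam u \<longrightarrow> (\<forall>x\<in>{0..len e}. \<bar>ue u e x\<bar> powr (p - 2) \<le> C' * (1 + \<bar>lam\<bar>))"
      using * order_trans by blast
  qed
  then show ?thesis by blast
qed

text \<open>With \<eta> the parabola, ((u \<eta>)')^2 = u' (u \<eta>^2)' + u^2 (\<eta>')^2. The
  equation tested with u \<eta>^2 eliminates the first term, and stability, the assumption
  \<open>q\<close>, bounds the power term by the cutoff error: (p - 2) I2 <= I1. What remains bounds
  lam times the mass by a multiple of I1.\<close>

lemma cutoff_estimate:
  assumes s: "solves_E G len W \<rho> p lam u" and e: "e \<in> arcs G" and ab: "0 \<le> a" "a < b" "b \<le> len e"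
    and pu: "primitive_on 0 (len e) (ue u e) v" and pv: "primitive_on 0 (len e) v (\<lambda>x. cS lam u e x * ue u e x)"
    and lam: "0 < lam" "2 * w1 \<le> lam" and h: "h = (b - a) / 3"
    and q: "0 \<le> LI a b (\<lambda>x. (v x * ((x - a) * (b - x)) + ue u e x * (a + b - 2 * x))\<^sup>2 + cQ lam u e x * (ue u e x * ((x - a) * (b - x)))\<^sup>2)"
  shows "LI (a + h) (b - h) (\<lambda>x. (ue u e x)\<^sup>2) \<le> 18 * ((p - 1) / (p - 2)) / (lam * h\<^sup>2) * LI a b (\<lambda>x. (ue u e x)\<^sup>2)"
proof -
  let ?u = "ue u e"
  have u: "u \<in> H1" using s by (simp add: solves_E_def)
  define \<eta> where "\<eta> x = (x - a) * (b - x)" for x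
  define \<eta>' where "\<eta>' x = a + b - 2 * x" for x
  note par = parabola[OF ab(2), folded \<eta>_def \<eta>'_def]
  have h0: "h > 0" using h ab by simp
  note pu' = primitive_on_subinterval[OF pu ab(1,3)] and pv' = primitive_on_subinterval[OF pv ab(1,3)]
  note cu = primitive_on_continuous[OF pu'] and cv = primitive_on_continuous[OF pv'] and c\<eta> = primitive_on_continuous[OF par(1)]
  have cc: "continuous_on {a..b} (\<lambda>x. (?u x * \<eta> x)\<^sup>2)" "continuous_on {a..b} (\<lambda>x. (v x * \<eta> x + ?u x * \<eta>' x)\<^sup>2)"
    "continuous_on {a..b} (\<lambda>x. (?u x * \<eta>' x)\<^sup>2)" "continuous_on {a..b} (\<lambda>x. (?u x)\<^sup>2)"
    by (intro continuous_intros cu cv c\<eta> par(2))+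
  note ii = continuous_imp_integrable_real[OF cc(1)] continuous_imp_integrable_real[OF cc(2)]
    continuous_imp_integrable_real[OF cc(3)] continuous_imp_integrable_real[OF cc(4)]
  note i = cQ_integrable[OF u e ab(1,3) cc(1)]
  define K where "K x = ?u x * (\<eta> x * \<eta> x)" for x
  define K' where "K' x = v x * (\<eta> x * \<eta> x) + ?u x * (\<eta>' x * \<eta> x + \<eta> x * \<eta>' x)" for x
  have pK: "primitive_on a b K K'"
    unfolding K_def K'_def by (rule primitive_on_mult[OF pu' primitive_on_mult[OF par(1) par(1)]])
  \<comment> \<open>The integrand of the equation tested with \<open>K\<close>, that is with u
    \<eta>^2; both quadratic forms below differ from it by explicit terms.\<close>
  define Z where "Z x = cS lam u e x * ?u x * K x + v x * K' x" for x
  have Z0: "LI a b Z = 0"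
    unfolding Z_def using primitive_on_mult_ends(2)[OF pv' pK] ab by (simp add: K_def \<eta>_def)
  have iZ: "integrable (lebesgue_on {a..b}) Z"
    using primitive_onD(1)[OF primitive_on_mult[OF pv' pK]] by (simp add: Z_def[abs_def])
  define I1 where "I1 = LI a b (\<lambda>x. (?u x * \<eta>' x)\<^sup>2)"
  define I2 where "I2 = LI a b (\<lambda>x. rt e x * \<bar>?u x\<bar> powr (p - 2) * (?u x * \<eta> x)\<^sup>2)"
  have "LI a b (\<lambda>x. (v x * \<eta> x + ?u x * \<eta>' x)\<^sup>2 + cQ lam u e x * (?u x * \<eta> x)\<^sup>2) =
    LI a b (\<lambda>x. Z x + (?u x * \<eta>' x)\<^sup>2 - (p - 2) * (rt e x * \<bar>?u x\<bar> powr (p - 2) * (?u x * \<eta> x)\<^sup>2))"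
    by (rule Bochner_Integration.integral_cong) (auto simp: Z_def K_def K'_def cQ_def cS_def algebra_simps power2_eq_square)
  also have "\<dots> = I1 - (p - 2) * I2"
    unfolding I1_def I2_def using iZ ii i Z0 by simp
  finally have q1: "(p - 2) * I2 \<le> I1" using q by (simp add: \<eta>_def \<eta>'_def)
  have "LI a b (\<lambda>x. (v x * \<eta> x + ?u x * \<eta>' x)\<^sup>2 + cB lam e x * (?u x * \<eta> x)\<^sup>2) =
    LI a b (\<lambda>x. Z x + (?u x * \<eta>' x)\<^sup>2 + rt e x * \<bar>?u x\<bar> powr (p - 2) * (?u x * \<eta> x)\<^sup>2)"
    by (rule Bochner_Integration.integral_cong) (auto simp: Z_def K_def K'_def cB_def cS_def algebra_simps power2_eq_square)
  also have "\<dots> = I1 + I2"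
    unfolding I1_def I2_def using iZ ii i Z0 by simp
  finally have "LI a b (\<lambda>x. (v x * \<eta> x + ?u x * \<eta>' x)\<^sup>2) + LI a b (\<lambda>x. cB lam e x * (?u x * \<eta> x)\<^sup>2) = I1 + I2"
    using ii i by simp
  moreover have "0 \<le> LI a b (\<lambda>x. (v x * \<eta> x + ?u x * \<eta>' x)\<^sup>2)" by (rule integral_nonneg_AE) simp
  moreover have "LI a b (\<lambda>x. lam / 2 * (?u x * \<eta> x)\<^sup>2) \<le> LI a b (\<lambda>x. cB lam e x * (?u x * \<eta> x)\<^sup>2)"
  proof (rule integral_mono)
    fix x
    have "lam / 2 \<le> cB lam e x" using Wt_bound[of e x] lam unfolding cB_def by linarith
    then show "lam / 2 * (?u x * \<eta> x)\<^sup>2 \<le> cB lam e x * (?u x * \<eta> x)\<^sup>2" by (intro mult_right_mono) auto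
  qed (use ii i in auto)
  moreover have "LI a b (\<lambda>x. lam / 2 * (?u x * \<eta> x)\<^sup>2) = lam / 2 * LI a b (\<lambda>x. (?u x * \<eta> x)\<^sup>2)" by simp
  ultimately have 1: "lam / 2 * LI a b (\<lambda>x. (?u x * \<eta> x)\<^sup>2) \<le> I1 + I2" by linarith
  have "I2 \<le> I1 / (p - 2)" using q1 p2 by (simp add: pos_le_divide_eq mult.commute)
  then have 2: "I1 + I2 \<le> (p - 1) / (p - 2) * I1" using p2 by (simp add: field_simps)
  have 3: "I1 \<le> 9 * h\<^sup>2 * LI a b (\<lambda>x. (?u x)\<^sup>2)"
  proof -
    have "I1 \<le> LI a b (\<lambda>x. 9 * h\<^sup>2 * (?u x)\<^sup>2)"
      unfolding I1_def
    proof (rule integral_mono)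
      fix x assume "x \<in> space (lebesgue_on {a..b})"
      then have "\<bar>\<eta>' x\<bar> \<le> 3 * h" using par(3)[of x] h by simp
      then have "\<bar>\<eta>' x\<bar>\<^sup>2 \<le> (3 * h)\<^sup>2" by (rule power_mono) simp
      then have "(\<eta>' x)\<^sup>2 * (?u x)\<^sup>2 \<le> 9 * h\<^sup>2 * (?u x)\<^sup>2" by (intro mult_right_mono) (auto simp: power_mult_distrib)
      then show "(?u x * \<eta>' x)\<^sup>2 \<le> 9 * h\<^sup>2 * (?u x)\<^sup>2" by (simp add: power_mult_distrib mult.commute)
    qed (use ii in auto)
    then show ?thesis by simp
  qed
  have 4: "(h\<^sup>2)\<^sup>2 * LI (a + h) (b - h) (\<lambda>x. (?u x)\<^sup>2) \<le> LI a b (\<lambda>x. (?u x * \<eta> x)\<^sup>2)"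
  proof -
    have sub: "{a + h..b - h} \<subseteq> {a..b}" using h0 by auto
    have "LI (a + h) (b - h) (\<lambda>x. (h\<^sup>2)\<^sup>2 * (?u x)\<^sup>2) \<le> LI (a + h) (b - h) (\<lambda>x. (?u x * \<eta> x)\<^sup>2)"
    proof (rule integral_mono)
      fix x assume "x \<in> space (lebesgue_on {a + h..b - h})"
      then have "h\<^sup>2 \<le> \<eta> x" using par(4)[of x] unfolding h by simp
      then have "(h\<^sup>2)\<^sup>2 \<le> (\<eta> x)\<^sup>2" by (rule power_mono) simp
      then have "(h\<^sup>2)\<^sup>2 * (?u x)\<^sup>2 \<le> (\<eta> x)\<^sup>2 * (?u x)\<^sup>2" by (rule mult_right_mono) simp
      then show "(h\<^sup>2)\<^sup>2 * (?u x)\<^sup>2 \<le> (?u x * \<eta> x)\<^sup>2" by (simp add: power_mult_distrib mult.commute)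
    qed (use integrable_subinterval[OF ii(4) sub] integrable_subinterval[OF ii(1) sub] in auto)
    also have "\<dots> \<le> LI a b (\<lambda>x. (?u x * \<eta> x)\<^sup>2)" by (rule LI_mono_cont[OF cc(1)]) (use h0 in auto)
    finally show ?thesis by simp
  qed
  \<comment> \<open>The final factor 18 is 2, from W + lam >= lam / 2, times 9, from |\<eta>'| <= 3
    h; that \<eta> >= h^2 on the middle third gives h^4 against h^2.\<close>
  define \<kappa> where "\<kappa> = (p - 1) / (p - 2)"
  have \<kappa>: "\<kappa> > 0" using p2 by (simp add: \<kappa>_def)
  have "lam / 2 * ((h\<^sup>2)\<^sup>2 * LI (a + h) (b - h) (\<lambda>x. (?u x)\<^sup>2)) \<le> lam / 2 * LI a b (\<lambda>x. (?u x * \<eta> x)\<^sup>2)"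
    by (rule mult_left_mono[OF 4]) (use lam in simp)
  also have "\<dots> \<le> \<kappa> * I1" using 1 2 unfolding \<kappa>_def by (rule order_trans)
  also have "\<dots> \<le> \<kappa> * (9 * h\<^sup>2 * LI a b (\<lambda>x. (?u x)\<^sup>2))" by (rule mult_left_mono[OF 3]) (use \<kappa> in simp)
  finally have "((lam * h\<^sup>2) * LI (a + h) (b - h) (\<lambda>x. (?u x)\<^sup>2)) * h\<^sup>2 \<le> 18 * \<kappa> * LI a b (\<lambda>x. (?u x)\<^sup>2) * h\<^sup>2"
    by (simp add: power2_eq_square algebra_simps)
  then have "(lam * h\<^sup>2) * LI (a + h) (b - h) (\<lambda>x. (?u x)\<^sup>2) \<le> 18 * \<kappa> * LI a b (\<lambda>x. (?u x)\<^sup>2)"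
    by (rule mult_right_le_imp_le) (use h0 in simp)
  then show ?thesis
    using lam h0 unfolding \<kappa>_def[symmetric] by (simp add: pos_le_divide_eq mult.commute)
qed

lemma edge_L2_bound:
  assumes e: "e \<in> arcs G"
  shows "\<exists>C>0. \<exists>lam0>0. \<forall>lam\<ge>lam0. \<forall>u. solution lam u \<longrightarrow> (\<forall>M. (\<forall>x\<in>{0..len e}. \<bar>ue u e x\<bar> \<le> M) \<longrightarrow>
    LI 0 (len e) (\<lambda>x. (ue u e x)\<^sup>2) \<le> C * M\<^sup>2 / sqrt lam)"
proof -
  let ?l = "len e"
  note l = length_pos[OF e]
  define \<kappa> where "\<kappa> = (p - 1) / (p - 2)"
  have \<kappa>: "\<kappa> > 0" using p2 by (simp add: \<kappa>_def)
  \<comment> \<open>108 = 6 * 18: pieces of length at least \<open>K / sqrt lam\<close> bring the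
    factor of the cutoff estimate down to 1/6.\<close>
  define K where "K = sqrt (108 * \<kappa>)"
  have K: "K > 0" "K\<^sup>2 = 108 * \<kappa>" using \<kappa> by (auto simp: K_def)
  \<comment> \<open>Ensures W + lam >= lam / 2 and that at least one piece of length
    \<open>K / sqrt lam\<close> fits into the edge.\<close>
  define lam0 where "lam0 = 2 * w1 + (K / ?l)\<^sup>2 + 1"
  define C where "C = 4 * K * (3 * real m + 2)"
  have "LI 0 ?l (\<lambda>x. (ue u e x)\<^sup>2) \<le> C * M\<^sup>2 / sqrt lam"
    if lam: "lam0 \<le> lam" and s: "solution lam u" and M: "\<And>x. x \<in> {0..?l} \<Longrightarrow> \<bar>ue u e x\<bar> \<le> M" for lam u M
  proof -
    note S = solutionD[OF s]
    have lam1: "2 * w1 \<le> lam" "(K / ?l)\<^sup>2 \<le> lam" "0 < lam"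
      using lam[unfolded lam0_def] w1 zero_le_power2[of "K / ?l"] by linarith+
    obtain v where pu: "primitive_on 0 ?l (ue u e) v" and pv: "primitive_on 0 ?l v (\<lambda>x. cS lam u e x * ue u e x)"
      using solution_C1[OF S(2) e] by blast
    define y where "y = ?l * sqrt lam / K"
    have y1: "1 \<le> y"
    proof -
      have "K / ?l \<le> sqrt lam" using lam1(2) by (rule real_le_rsqrt)
      then show ?thesis using l K(1) by (simp add: y_def field_simps)
    qed
    \<comment> \<open>Rounding down keeps \<open>h\<close> between \<open>K / sqrt lam\<close> and
      twice that length.\<close>
    define N where "N = nat \<lfloor>y\<rfloor>"
    have N: "real N \<le> y" "y / 2 \<le> real N" "N \<ge> 1" 
    proof -
      have "1 \<le> \<lfloor>y\<rfloor>" using y1 by simp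
      then have "real N = of_int \<lfloor>y\<rfloor>" "1 \<le> real N" by (simp_all add: N_def)
      moreover have "of_int \<lfloor>y\<rfloor> \<le> y" "y < of_int \<lfloor>y\<rfloor> + 1" using floor_correct[of y] by simp_all
      ultimately show "real N \<le> y" "y / 2 \<le> real N" "N \<ge> 1" by linarith+
    qed
    define h where "h = ?l / real N"
    have h: "h > 0" "real N * h = ?l" using N l by (auto simp: h_def)
    have hle: "h \<le> 2 * K / sqrt lam"
    proof -
      have "h \<le> ?l / (y / 2)" unfolding h_def using N y1 l by (intro divide_left_mono) auto
      also have "\<dots> = 2 * K / sqrt lam" using l K(1) lam1 by (simp add: y_def field_simps)
      finally show ?thesis .
    qed
    have hge: "18 * \<kappa> / (lam * h\<^sup>2) \<le> 1 / 6"
    proof -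
      have "(real N)\<^sup>2 \<le> y\<^sup>2" using N by (intro power_mono) auto
      also have "y\<^sup>2 = ?l\<^sup>2 * lam / K\<^sup>2" using lam1 by (simp add: y_def power_divide power_mult_distrib)
      finally have "108 * \<kappa> * (real N)\<^sup>2 \<le> ?l\<^sup>2 * lam" using K(2) \<kappa> by (simp add: field_simps)
      moreover have "lam * h\<^sup>2 = ?l\<^sup>2 * lam / (real N)\<^sup>2" by (simp add: h_def power_divide)
      moreover have "0 < (real N)\<^sup>2" using N by simp
      ultimately have "108 * \<kappa> \<le> lam * h\<^sup>2" by (simp only: pos_le_divide_eq)
      then show ?thesis using lam1 h by (simp add: field_simps)
    qed
    have cu: "continuous_on {0..?l} (\<lambda>x. (ue u e x)\<^sup>2)" by (intro continuous_intros H1_edge(1)[OF S(1) e])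
    have iu: "integrable (lebesgue_on {0..?l}) (\<lambda>x. (ue u e x)\<^sup>2)" by (rule continuous_imp_integrable_real[OF cu])
    define A where "A i = LI (real i * h) (real (Suc i) * h) (\<lambda>x. (ue u e x)\<^sup>2)" for i
    have nh: "real n * h \<le> ?l" if "n \<le> N" for n
      using h that by (metis mult_right_mono of_nat_le_iff less_imp_le)
    have mono: "real i * h \<le> real j * h" if "i \<le> j" for i j :: nat using that h by (simp add: mult_right_mono)
    have A0: "0 \<le> A i" for i unfolding A_def by (rule integral_nonneg_AE) simp
    have AM: "A i \<le> M\<^sup>2 * h" if "i < N" for i
    proof -
      have "A i \<le> M\<^sup>2 * (real (Suc i) * h - real i * h)"
        unfolding A_def
      proof (rule LI_le)
        have sub: "{real i * h..real (Suc i) * h} \<subseteq> {0..?l}" using nh[of "Suc i"] that h by auto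
        show "integrable (lebesgue_on {real i * h..real (Suc i) * h}) (\<lambda>x. (ue u e x)\<^sup>2)"
          by (rule integrable_subinterval[OF iu sub])
        fix x assume "x \<in> {real i * h..real (Suc i) * h}"
        then have "\<bar>ue u e x\<bar>\<^sup>2 \<le> M\<^sup>2" using sub by (intro power_mono M) auto
        then show "(ue u e x)\<^sup>2 \<le> M\<^sup>2" by simp
      qed (use mono[of i "Suc i"] in simp)
      then show ?thesis by (simp add: algebra_simps)
    qed
    have sumA: "(\<Sum>i<n. A i) = LI 0 (real n * h) (\<lambda>x. (ue u e x)\<^sup>2)" if "n \<le> N" for n
      using that
    proof (induction n)
      case (Suc n)
      have "LI 0 (real (Suc n) * h) (\<lambda>x. (ue u e x)\<^sup>2) = LI 0 (real n * h) (\<lambda>x. (ue u e x)\<^sup>2) + A n"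
        unfolding A_def by (rule LI_combine[OF iu]) (use h nh[of "Suc n"] Suc.prems mono[of n "Suc n"] in auto)
      then show ?case using Suc by simp
    qed simp
    define S where "S = (\<Sum>i<N. A i)"
    have S_eq: "S = LI 0 ?l (\<lambda>x. (ue u e x)\<^sup>2)" unfolding S_def using sumA[of N] h by simp
    \<comment> \<open>Indices of triples of consecutive pieces; the cutoff estimate controls the
      middle piece by all three.\<close>
    define I where "I = {k. k + 2 < N}"
    have fI: "finite I" unfolding I_def by (rule finite_subset[of _ "{..<N}"]) auto
    define a where "a k = real k * h" for k :: nat
    define F where "F k x = ue u e x * ((x - a k) * (a (k + 3) - x))" for k x
    define F' where "F' k x = v x * ((x - a k) * (a (k + 3) - x)) + ue u e x * (a k + a (k + 3) - 2 * x)" for k x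
    define q where "q k = LI (a k) (a (k + 3)) (\<lambda>x. (F' k x)\<^sup>2 + cQ lam u e x * (F k x)\<^sup>2)" for k
    define bad where "bad = {k \<in> I. q k < 0}"
    have a3: "0 \<le> a k" "a k < a (k + 3)" for k using h by (auto simp: a_def algebra_simps)
    have al: "a (k + 3) \<le> ?l" if "k \<in> I" for k using nh[of "k + 3"] that by (simp add: a_def I_def)
    have ad: "admissible e (a k) (a (k + 3)) (F k) (F' k)" if "k \<in> I" for k
      unfolding F_def F'_def
    proof (rule admissibleI[OF e a3 al[OF that] primitive_on_mult[OF primitive_on_subinterval[OF pu a3(1) al[OF that]] parabola(1)[OF a3(2)]]])
      show "continuous_on {a k..a (k + 3)} (\<lambda>x. v x * ((x - a k) * (a (k + 3) - x)) + ue u e x * (a k + a (k + 3) - 2 * x))"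
        by (intro continuous_intros primitive_on_continuous[OF primitive_on_subinterval[OF pu a3(1) al[OF that]]]
            primitive_on_continuous[OF primitive_on_subinterval[OF pv a3(1) al[OF that]]])
    qed auto
    \<comment> \<open>Triples whose indices agree modulo 3 do not overlap, so each residue class
      contains at most \<open>m\<close> bad ones.\<close>
    have "card {k \<in> bad. k mod 3 = r} \<le> m" for r
    proof (rule index_card[OF S(1,3), where a = a and b = "\<lambda>k. a (k + 3)"])
      show "finite {k \<in> bad. k mod 3 = r}" using fI by (simp add: bad_def)
      show "admissible e (a j) (a (j + 3)) (F j) (F' j)" if "j \<in> {k \<in> bad. k mod 3 = r}" for j
        using that by (intro ad) (simp add: bad_def)
      show "LI (a j) (a (j + 3)) (\<lambda>x. (F' j x)\<^sup>2 + cQ lam u e x * (F j x)\<^sup>2) < 0" if "j \<in> {k \<in> bad. k mod 3 = r}" for j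
        using that by (simp add: bad_def q_def)
      fix i j assume ij: "i \<in> {k \<in> bad. k mod 3 = r}" "j \<in> {k \<in> bad. k mod 3 = r}" "i \<noteq> j"
      then have "i mod 3 = j mod 3" by simp
      with \<open>i \<noteq> j\<close> have "i + 3 \<le> j \<or> j + 3 \<le> i" by presburger
      then show "a (i + 3) \<le> a j \<or> a (j + 3) \<le> a i" using mono[of "i + 3" j] mono[of "j + 3" i] by (auto simp: a_def)
    qed
    moreover have "bad = (\<Union>r\<in>{..<3::nat}. {k \<in> bad. k mod 3 = r})" by auto
    ultimately have cb: "card bad \<le> 3 * m"
      using card_UN_le[of "{..<3::nat}" "\<lambda>r. {k \<in> bad. k mod 3 = r}"] sum_mono[of "{..<3::nat}" "\<lambda>r. card {k \<in> bad. k mod 3 = r}" "\<lambda>_. m"]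
      by simp
    have good: "A (k + 1) \<le> 1 / 6 * (A k + A (k + 1) + A (k + 2))" if k: "k \<in> I" "\<not> q k < 0" for k
    proof -
      have "h = (a (k + 3) - a k) / 3" by (simp add: a_def algebra_simps)
      then have "LI (a k + h) (a (k + 3) - h) (\<lambda>x. (ue u e x)\<^sup>2) \<le> 18 * ((p - 1) / (p - 2)) / (lam * h\<^sup>2) * LI (a k) (a (k + 3)) (\<lambda>x. (ue u e x)\<^sup>2)"
        using k(2) unfolding q_def F_def F'_def
        by (intro cutoff_estimate[OF S(2) e a3 al[OF k(1)] pu pv lam1(3,1)]) auto
      also have "\<dots> \<le> 1 / 6 * LI (a k) (a (k + 3)) (\<lambda>x. (ue u e x)\<^sup>2)"
        using hge unfolding \<kappa>_def by (intro mult_right_mono integral_nonneg_AE) auto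
      also have "LI (a k) (a (k + 3)) (\<lambda>x. (ue u e x)\<^sup>2) = A k + A (k + 1) + A (k + 2)"
      proof -
        have o: "a k \<le> a (k + 1)" "a (k + 1) \<le> a (k + 2)" "a (k + 2) \<le> a (k + 3)" "a (k + 3) \<le> ?l" "0 \<le> a k"
          using mono al[OF k(1)] a3 by (auto simp: a_def simp del: of_nat_add of_nat_Suc)
        show ?thesis
          using LI_combine[OF iu o(5) o(1) _ o(4)] LI_combine[OF iu _ o(2) o(3) o(4)] o
          by (simp add: A_def a_def numeral_eq_Suc)
      qed
      finally show ?thesis by (simp add: A_def a_def algebra_simps numeral_eq_Suc)
    qed
    have shift: "(\<Sum>k\<in>I. A (k + j)) \<le> S" if "j \<le> 2" for j
    proof -
      have "(\<Sum>k\<in>I. A (k + j)) = (\<Sum>i\<in>(\<lambda>k. k + j) ` I. A i)" by (subst sum.reindex) (auto simp: inj_on_def)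
      also have "\<dots> \<le> S" unfolding S_def by (rule sum_mono2) (use A0 that in \<open>auto simp: I_def\<close>)
      finally show ?thesis .
    qed
    \<comment> \<open>Every piece is the middle of a triple, apart from the first and the last
      one.\<close>
    have "{..<N} \<subseteq> {0, N - 1} \<union> Suc ` I"
    proof
      fix i assume i: "i \<in> {..<N}"
      show "i \<in> {0, N - 1} \<union> Suc ` I"
      proof (cases i)
        case (Suc k)
        then show ?thesis using i by (cases "i = N - 1") (auto simp: I_def image_iff)
      qed simp
    qed
    then have "S \<le> (\<Sum>i\<in>{0, N - 1} \<union> Suc ` I. A i)"
      unfolding S_def by (intro sum_mono2) (use A0 fI in auto)
    also have "\<dots> \<le> (\<Sum>i\<in>{0, N - 1}. A i) + (\<Sum>i\<in>Suc ` I. A i)"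
      using sum.union_inter[of "{0, N - 1}" "Suc ` I" A] fI sum_nonneg[of "{0, N - 1} \<inter> Suc ` I" A] A0 by simp
    also have "(\<Sum>i\<in>{0, N - 1}. A i) \<le> (\<Sum>i\<in>{0, N - 1}. M\<^sup>2 * h)"
      by (rule sum_mono) (use AM N in auto)
    also have "(\<Sum>i\<in>{0, N - 1}. M\<^sup>2 * h) \<le> 2 * (M\<^sup>2 * h)"
    proof -
      have "card {0, N - 1} \<le> 2" by (rule card_insert_le_m1) auto
      then show ?thesis using h by (simp add: mult_right_mono)
    qed
    also have "(\<Sum>i\<in>Suc ` I. A i) = (\<Sum>k\<in>bad. A (k + 1)) + (\<Sum>k\<in>I - bad. A (k + 1))"
      using sum.subset_diff[of bad I "\<lambda>k. A (k + 1)"] fI by (subst sum.reindex) (auto simp: bad_def)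
    also have "(\<Sum>k\<in>bad. A (k + 1)) \<le> (\<Sum>k\<in>bad. M\<^sup>2 * h)"
      by (rule sum_mono) (use AM in \<open>auto simp: bad_def I_def\<close>)
    also have "(\<Sum>k\<in>bad. M\<^sup>2 * h) \<le> 3 * real m * (M\<^sup>2 * h)"
    proof -
      have "real (card bad) \<le> 3 * real m" using cb by linarith
      then show ?thesis using h by (simp add: mult_right_mono)
    qed
    also have "(\<Sum>k\<in>I - bad. A (k + 1)) \<le> (\<Sum>k\<in>I - bad. 1 / 6 * (A k + A (k + 1) + A (k + 2)))"
      by (rule sum_mono) (use good in \<open>auto simp: bad_def\<close>)
    also have "\<dots> \<le> (\<Sum>k\<in>I. 1 / 6 * (A k + A (k + 1) + A (k + 2)))"
      by (rule sum_mono2) (use A0 fI in auto)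
    also have "\<dots> = 1 / 6 * ((\<Sum>k\<in>I. A (k + 0)) + (\<Sum>k\<in>I. A (k + 1)) + (\<Sum>k\<in>I. A (k + 2)))"
      unfolding sum_distrib_left[symmetric] sum.distrib by simp
    \<comment> \<open>The good triples contribute at most S/2, which is absorbed on the left; this
      doubles the count 2 + 3m of the other pieces, each of mass at most
      \<open>M\<^sup>2 * h\<close>.\<close>
    also have "\<dots> \<le> 1 / 6 * (S + S + S)"
      using shift[of 0] shift[of 1] shift[of 2] by (intro mult_left_mono add_mono) auto
    finally have "S \<le> 2 * (3 * real m + 2) * M\<^sup>2 * h" by (simp add: algebra_simps)
    also have "\<dots> \<le> 2 * (3 * real m + 2) * M\<^sup>2 * (2 * K / sqrt lam)" by (rule mult_left_mono[OF hle]) simp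
    also have "\<dots> = C * M\<^sup>2 / sqrt lam" by (simp add: C_def algebra_simps add_divide_distrib)
    finally show ?thesis unfolding S_eq .
  qed
  moreover have "C > 0" "lam0 > 0" using K w1 by (auto simp: C_def lam0_def add_nonneg_pos)
  ultimately show ?thesis by blast
qed

end

section \<open>Compactness\<close>

lemma sym_form_Cauchy_Schwarz:
  assumes f: "sym_form H b" and psd: "\<And>x. x \<in> H \<Longrightarrow> 0 \<le> b x x" and x: "x \<in> H" and y: "y \<in> H"
  shows "(b x y)\<^sup>2 \<le> b x x * b y y"
proof -
  have quad: "0 \<le> b x x + 2 * t * b x y + t\<^sup>2 * b y y" for t
  proof -
    have "x + t *\<^sub>R y \<in> H" using sym_formD(1)[OF f] x y by (intro subspace_add subspace_scale)
    from psd[OF this] show ?thesis by (simp add: sym_form_quadratic[OF f x y])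
  qed
  show ?thesis
  proof (cases "b y y = 0")
    case True
    \<comment> \<open>If \<open>b y y\<close> vanishes, the polynomial in t is affine and can stay
      nonnegative only with slope zero.\<close>
    have "b x y = 0"
    proof (rule ccontr)
      assume "b x y \<noteq> 0"
      then show False using quad[of "- (b x x + 1) / (2 * b x y)"] True psd[OF x] by (simp add: field_simps)
    qed
    then show ?thesis using True by simp
  next
    case False
    then have "0 < b y y" using psd[OF y] by simp
    then show ?thesis
      using quad[of "- (b x y / b y y)"] by (simp add: power2_eq_square field_simps)
  qed
qed

lemma powr_uniformly_continuous:
  fixes q :: real
  assumes "0 < q" "0 < \<epsilon>"
  shows "\<exists>\<delta>>0. \<forall>y z. \<bar>y\<bar> \<le> C \<longrightarrow> \<bar>z\<bar> \<le> C \<longrightarrow> \<bar>y - z\<bar> < \<delta> \<longrightarrow> \<bar>\<bar>y\<bar> powr q - \<bar>z\<bar> powr q\<bar> < (\<epsilon>::real)"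
proof -
  have "continuous_on {-C..C} (\<lambda>y::real. \<bar>y\<bar> powr q)"
    using assms by (intro continuous_on_powr' continuous_on_rabs continuous_on_id continuous_on_const) auto
  then have "uniformly_continuous_on {-C..C} (\<lambda>y::real. \<bar>y\<bar> powr q)"
    by (rule compact_uniformly_continuous) simp
  then obtain \<delta> where "\<delta> > 0" "\<And>y z. y \<in> {-C..C} \<Longrightarrow> z \<in> {-C..C} \<Longrightarrow> dist z y < \<delta> \<Longrightarrow> dist (\<bar>z\<bar> powr q) (\<bar>y\<bar> powr q) < \<epsilon>"
    using assms(2) unfolding uniformly_continuous_on_def by blast
  then show ?thesis by (intro exI[of _ \<delta>]) (auto simp: dist_real_def abs_le_iff)
qed

text \<open>Derivatives bounded in L^2 give a common Hoelder modulus of exponent 1/2, so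
  Arzela-Ascoli applies.\<close>

lemma equicontinuous_subsequence:
  fixes f :: "nat \<Rightarrow> real \<Rightarrow> real"
  assumes p: "\<And>n. primitive_on 0 l (f n) (g n)" "\<And>n. g n \<in> L2_interval l"
    and b: "\<And>n x. x \<in> {0..l} \<Longrightarrow> \<bar>f n x\<bar> \<le> C" "\<And>n. LI 0 l (\<lambda>x. (g n x)\<^sup>2) \<le> D"
  shows "\<exists>r F. strict_mono (r :: nat \<Rightarrow> nat) \<and> uniform_limit {0..l} (\<lambda>n. f (r n)) F sequentially"
proof -
  have holder: "\<bar>f n y - f n x\<bar> \<le> sqrt (\<bar>y - x\<bar> * D)" if xy: "x \<in> {0..l}" "y \<in> {0..l}" for n x y
  proof -
    have *: "(f n t - f n s)\<^sup>2 \<le> \<bar>t - s\<bar> * D" if st: "0 \<le> s" "s \<le> t" "t \<le> l" for s t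
    proof -
      have "(f n t - f n s)\<^sup>2 = (LI s t (g n))\<^sup>2" using primitive_onD(2)[OF p(1) st] by simp
      also have "\<dots> \<le> (t - s) * LI 0 l (\<lambda>x. (g n x)\<^sup>2)" by (rule L2_interval_LI_bound[OF p(2) st])
      also have "\<dots> \<le> (t - s) * D" using st b(2) by (intro mult_left_mono) auto
      finally show ?thesis using st by simp
    qed
    have "(f n y - f n x)\<^sup>2 \<le> \<bar>y - x\<bar> * D"
    proof (cases "x \<le> y")
      case False
      then show ?thesis using *[of y x] xy by (simp add: power2_commute abs_minus_commute)
    qed (use * xy in auto)
    then show ?thesis by (simp add: real_le_rsqrt)
  qed
  have D: "0 \<le> D" using b(2)[of 0] order_trans[OF integral_nonneg_AE b(2)[of 0]] by simp
  obtain F r where Fr: "strict_mono (r :: nat \<Rightarrow> nat)"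
    "\<And>e. 0 < e \<Longrightarrow> \<exists>N. \<forall>n x. n \<ge> N \<and> x \<in> {0..l} \<longrightarrow> norm (f (r n) x - F x) < e"
  proof (rule Arzela_Ascoli[of "{0..l}" f C])
    fix x e :: real assume x: "x \<in> {0..l}" and e: "0 < e"
    show "\<exists>d. 0 < d \<and> (\<forall>n y. y \<in> {0..l} \<and> norm (x - y) < d \<longrightarrow> norm (f n x - f n y) < e)"
    proof (intro exI[of _ "e\<^sup>2 / (D + 1)"] conjI allI impI)
      fix n y assume y: "y \<in> {0..l} \<and> norm (x - y) < e\<^sup>2 / (D + 1)"
      have "\<bar>x - y\<bar> * D \<le> \<bar>x - y\<bar> * (D + 1)" by (rule mult_left_mono) auto
      also have "\<dots> < e\<^sup>2" using y D by (simp add: pos_less_divide_eq)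
      finally have "sqrt (\<bar>x - y\<bar> * D) < e" using e by (intro real_less_lsqrt) auto
      then show "norm (f n x - f n y) < e" using holder[of y x n] x y by simp
    qed (use D e in simp)
  qed (use b(1) in auto)
  have "uniform_limit {0..l} (\<lambda>n. f (r n)) F sequentially"
    unfolding uniform_limit_sequentially_iff dist_real_def using Fr(2) by (metis real_norm_def)
  with Fr(1) show ?thesis by blast
qed

lemma uniform_limit_subseq:
  assumes "uniform_limit S f F sequentially" "strict_mono (r :: nat \<Rightarrow> nat)"
  shows "uniform_limit S (\<lambda>n. f (r n)) F sequentially"
  by (rule filterlim_compose[OF assms(1) filterlim_subseq[OF assms(2)]])

context compact_metric_graph
begin

section \<open>Dirichlet energy, mass and uniform convergence on the edges\<close>

abbreviation Dir :: "(('v, 'e) gpoint \<Rightarrow> real) \<Rightarrow> (('v, 'e) gpoint \<Rightarrow> real) \<Rightarrow> real"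
  where "Dir \<equiv> bil (\<lambda>e x. 0)"

definition mass :: "(('v, 'e) gpoint \<Rightarrow> real) \<Rightarrow> real"
  where "mass u = (\<Sum>e\<in>arcs G. LI 0 (len e) (\<lambda>x. (ue u e x)\<^sup>2))"

lemma coef_const: "coef (\<lambda>e x. k)"
  by (auto simp: coef_def)

lemma Dir_eq: "Dir u u = (\<Sum>e\<in>arcs G. LI 0 (len e) (\<lambda>x. (De u e x)\<^sup>2))"
  by (simp add: bil_def power2_eq_square)

lemma LI_square_nonneg: "0 \<le> LI a b (\<lambda>x. (f x)\<^sup>2)"
  by (rule integral_nonneg_AE) simp

lemma Dir_nonneg: "0 \<le> Dir u u"
  unfolding Dir_eq by (intro sum_nonneg LI_square_nonneg)

lemma LI_De_le_Dir: "e \<in> arcs G \<Longrightarrow> LI 0 (len e) (\<lambda>x. (De u e x)\<^sup>2) \<le> Dir u u"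
  unfolding Dir_eq by (rule member_le_sum) (auto simp: LI_square_nonneg)

lemma De_diff:
  assumes "u \<in> H1" "v \<in> H1" "e \<in> arcs G"
  shows "AE x in lebesgue_on {0..len e}. De (u - v) e x = De u e x - De v e x"
proof -
  have "-1 *\<^sub>R v \<in> H1" using subspace_H1 assms(2) by (rule subspace_scale)
  from De_add[OF assms(1) this assms(3)] De_scaleR[OF assms(2,3), of "-1"] show ?thesis
    by eventually_elim simp
qed

lemma LI_De_diff:
  assumes "u \<in> H1" "v \<in> H1" "e \<in> arcs G"
  shows "LI 0 (len e) (\<lambda>x. (De (u - v) e x)\<^sup>2) = LI 0 (len e) (\<lambda>x. (De u e x - De v e x)\<^sup>2)"
proof (rule integral_cong_AE)
  show "AE x in lebesgue_on {0..len e}. (De (u - v) e x)\<^sup>2 = (De u e x - De v e x)\<^sup>2"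
    using De_diff[OF assms] by eventually_elim simp
  have "u - v \<in> H1" using subspace_H1 assms by (simp add: subspace_diff)
  then show "(\<lambda>x. (De (u - v) e x)\<^sup>2) \<in> borel_measurable (lebesgue_on {0..len e})"
    using L2_intervalD(2)[OF H1_edge(2)[OF _ assms(3)]] by auto
  show "(\<lambda>x. (De u e x - De v e x)\<^sup>2) \<in> borel_measurable (lebesgue_on {0..len e})"
    using L2_intervalD(2)[OF L2_diff[OF H1_edge(2)[OF assms(1,3)] H1_edge(2)[OF assms(2,3)]]] by auto
qed

text \<open>Membership of the limit in \<open>H1\<close> is deliberately left out: it is obtained
  later, once the sequence is known to be Cauchy in the Dirichlet energy.\<close>

definition edge_limit :: "(nat \<Rightarrow> ('v, 'e) gpoint \<Rightarrow> real) \<Rightarrow> (('v, 'e) gpoint \<Rightarrow> real) \<Rightarrow> bool"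
  where "edge_limit U u \<longleftrightarrow> (\<forall>P. P \<notin> gpoints G len \<longrightarrow> u P = 0) \<and>
    (\<forall>e\<in>arcs G. uniform_limit {0..len e} (\<lambda>n. ue (U n) e) (ue u e) sequentially)"

lemma edge_limitD:
  assumes "edge_limit U u" "e \<in> arcs G"
  shows "\<And>\<epsilon>. \<epsilon> > 0 \<Longrightarrow> \<exists>N. \<forall>n\<ge>N. \<forall>x\<in>{0..len e}. \<bar>ue (U n) e x - ue u e x\<bar> < \<epsilon>"
    "\<And>x. x \<in> {0..len e} \<Longrightarrow> (\<lambda>n. ue (U n) e x) \<longlonglongrightarrow> ue u e x"
proof -
  have u: "uniform_limit {0..len e} (\<lambda>n. ue (U n) e) (ue u e) sequentially" using assms by (simp add: edge_limit_def)
  show "\<And>\<epsilon>. \<epsilon> > 0 \<Longrightarrow> \<exists>N. \<forall>n\<ge>N. \<forall>x\<in>{0..len e}. \<bar>ue (U n) e x - ue u e x\<bar> < \<epsilon>"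
    using u unfolding uniform_limit_sequentially_iff dist_real_def by blast
  show "\<And>x. x \<in> {0..len e} \<Longrightarrow> (\<lambda>n. ue (U n) e x) \<longlonglongrightarrow> ue u e x"
    using tendsto_uniform_limitI[OF u] by blast
qed

lemma edge_limit_uniform:
  assumes "edge_limit U u" "\<epsilon> > 0"
  shows "\<exists>N. \<forall>n\<ge>N. \<forall>e\<in>arcs G. \<forall>x\<in>{0..len e}. \<bar>ue (U n) e x - ue u e x\<bar> < \<epsilon>"
proof -
  have "\<exists>C>0. \<forall>e\<in>arcs G. \<forall>n. real n \<ge> C \<longrightarrow> (\<forall>x\<in>{0..len e}. \<bar>ue (U n) e x - ue u e x\<bar> < \<epsilon>)"
  proof (rule finite_uniform_bound[OF finite_arcs])
    fix e assume "e \<in> arcs G"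
    then obtain N where "\<forall>n\<ge>N. \<forall>x\<in>{0..len e}. \<bar>ue (U n) e x - ue u e x\<bar> < \<epsilon>"
      using edge_limitD(1)[OF assms(1) _ assms(2)] by blast
    then show "\<exists>C. \<forall>n. real n \<ge> C \<longrightarrow> (\<forall>x\<in>{0..len e}. \<bar>ue (U n) e x - ue u e x\<bar> < \<epsilon>)"
      by (intro exI[of _ "real N"]) auto
  qed auto
  then obtain C where C: "\<And>e n. e \<in> arcs G \<Longrightarrow> real n \<ge> C \<Longrightarrow> \<forall>x\<in>{0..len e}. \<bar>ue (U n) e x - ue u e x\<bar> < \<epsilon>" by blast
  obtain N :: nat where "C \<le> real N" using real_arch_simple by blast
  then show ?thesis using C by (intro exI[of _ N]) (meson of_nat_le_iff order_trans)
qed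

lemma compactness:
  fixes U :: "nat \<Rightarrow> ('v, 'e) gpoint \<Rightarrow> real"
  assumes U: "\<And>n. U n \<in> H1" and b: "\<And>n e x. e \<in> arcs G \<Longrightarrow> x \<in> {0..len e} \<Longrightarrow> \<bar>ue (U n) e x\<bar> \<le> C"
    and D: "\<And>n. Dir (U n) (U n) \<le> D"
  shows "\<exists>r u. strict_mono (r :: nat \<Rightarrow> nat) \<and> edge_limit (\<lambda>n. U (r n)) u"
proof -
  have "\<exists>r F. strict_mono (r :: nat \<Rightarrow> nat) \<and> (\<forall>e\<in>E. uniform_limit {0..len e} (\<lambda>n. ue (U (r n)) e) (F e) sequentially)"
    if "finite E" "E \<subseteq> arcs G" for E
    using that
  proof (induction E)
    case empty
    show ?case by (intro exI[of _ id]) (auto simp: strict_mono_def)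
  next
    case (insert e E)
    then obtain r F where r: "strict_mono (r :: nat \<Rightarrow> nat)" "\<And>e. e \<in> E \<Longrightarrow> uniform_limit {0..len e} (\<lambda>n. ue (U (r n)) e) (F e) sequentially"
      by auto
    have e: "e \<in> arcs G" using insert by simp
    obtain s K where s: "strict_mono (s :: nat \<Rightarrow> nat)" "uniform_limit {0..len e} (\<lambda>n. ue (U (r (s n))) e) K sequentially"
      using equicontinuous_subsequence[where f = "\<lambda>n. ue (U (r n)) e" and l = "len e", OF H1_edge(3)[OF U e] H1_edge(2)[OF U e] b[OF e]
          order_trans[OF LI_De_le_Dir[OF e] D]] by blast
    show ?case
    proof (intro exI[of _ "r \<circ> s"] exI[of _ "F(e := K)"] conjI ballI)
      show "strict_mono (r \<circ> s)" using r(1) s(1) by (rule strict_mono_o)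
      fix e' assume "e' \<in> insert e E"
      then show "uniform_limit {0..len e'} (\<lambda>n. ue (U ((r \<circ> s) n)) e') ((F(e := K)) e') sequentially"
        using s(2) uniform_limit_subseq[OF r(2) s(1), of e'] by (cases "e' = e") auto
    qed
  qed
  from this[OF finite_arcs order_refl] obtain r F where r: "strict_mono (r :: nat \<Rightarrow> nat)"
    "\<And>e. e \<in> arcs G \<Longrightarrow> uniform_limit {0..len e} (\<lambda>n. ue (U (r n)) e) (F e) sequentially" by blast
  \<comment> \<open>Defined by pointwise limits at points of the graph rather than edge by edge, so
    that the limits on adjacent edges agree at common vertices.\<close>
  define u where "u P = (if P \<in> gpoints G len then lim (\<lambda>n. U (r n) P) else 0)" for P
  have ueF: "F e x = ue u e x" if "e \<in> arcs G" "x \<in> {0..len e}" for e x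
  proof -
    have "(\<lambda>n. ue (U (r n)) e x) \<longlonglongrightarrow> F e x" using tendsto_uniform_limitI[OF r(2)[OF that(1)] that(2)] .
    then have "lim (\<lambda>n. U (r n) (edge_pt G len e x)) = F e x" unfolding on_edge_def by (rule limI)
    then show ?thesis using edge_pt_in_gpoints[OF that(1)] by (simp add: on_edge_def u_def)
  qed
  have "edge_limit (\<lambda>n. U (r n)) u"
    unfolding edge_limit_def
  proof (intro conjI allI impI ballI)
    fix e assume e: "e \<in> arcs G"
    show "uniform_limit {0..len e} (\<lambda>n. ue (U (r n)) e) (ue u e) sequentially"
      using uniform_limit_cong'[of "{0..len e}" "\<lambda>n. ue (U (r n)) e" "\<lambda>n. ue (U (r n)) e" "F e" "ue u e" sequentially] r(2)[OF e] ueF[OF e]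
      by simp
  qed (simp add: u_def)
  with r(1) show ?thesis by blast
qed

text \<open>On each edge the derivatives are Cauchy in L^2, so the uniform limit has their L^2 limit
  as density; this is how it is seen to belong to \<open>H1\<close>.\<close>

lemma strong_limit:
  assumes U: "\<And>n. U n \<in> H1" and lim: "edge_limit U u"
    and C: "\<And>\<epsilon>. \<epsilon> > 0 \<Longrightarrow> \<exists>N. \<forall>n\<ge>N. \<forall>k\<ge>N. Dir (U n - U k) (U n - U k) < \<epsilon>"
  shows "u \<in> H1" "(\<lambda>n. Dir (U n - u) (U n - u)) \<longlonglongrightarrow> 0"
proof -
  have ex: "\<exists>h\<in>L2_interval (len e). primitive_on 0 (len e) (ue u e) h \<and> (\<lambda>n. LI 0 (len e) (\<lambda>x. (De (U n) e x - h x)\<^sup>2)) \<longlonglongrightarrow> 0"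
    if e: "e \<in> arcs G" for e
  proof (rule primitive_limit[OF H1_edge(3)[OF U e] H1_edge(2)[OF U e] less_imp_le[OF length_pos[OF e]] _ edge_limitD(2)[OF lim e]])
    fix \<epsilon> :: real assume "\<epsilon> > 0"
    then obtain N where N: "\<forall>n\<ge>N. \<forall>k\<ge>N. Dir (U n - U k) (U n - U k) < \<epsilon>" using C by blast
    have "LI 0 (len e) (\<lambda>x. (De (U n) e x - De (U k) e x)\<^sup>2) \<le> Dir (U n - U k) (U n - U k)" for n k
      using LI_De_le_Dir[OF e, of "U n - U k"] LI_De_diff[OF U U e, of n k] by simp
    then show "\<exists>N. \<forall>n\<ge>N. \<forall>k\<ge>N. LI 0 (len e) (\<lambda>x. (De (U n) e x - De (U k) e x)\<^sup>2) < \<epsilon>"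
      using N by (meson le_less_trans)
  qed
  show u: "u \<in> H1"
  proof (rule H1_graphI)
    show "\<exists>g\<in>L2_interval (len e). primitive_on 0 (len e) (ue u e) g" if "e \<in> arcs G" for e
      using ex[OF that] by blast
  qed (use lim in \<open>simp add: edge_limit_def\<close>)
  have "(\<lambda>n. LI 0 (len e) (\<lambda>x. (De (U n - u) e x)\<^sup>2)) \<longlonglongrightarrow> 0" if e: "e \<in> arcs G" for e
  proof -
    obtain h where h: "h \<in> L2_interval (len e)" "primitive_on 0 (len e) (ue u e) h" "(\<lambda>n. LI 0 (len e) (\<lambda>x. (De (U n) e x - h x)\<^sup>2)) \<longlonglongrightarrow> 0"
      using ex[OF e] by blast
    have ae: "AE x in lebesgue_on {0..len e}. De u e x = h x" by (rule wderiv_unique[OF h(2,1) length_pos[OF e]])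
    have "LI 0 (len e) (\<lambda>x. (De (U n - u) e x)\<^sup>2) = LI 0 (len e) (\<lambda>x. (De (U n) e x - h x)\<^sup>2)" for n
      unfolding LI_De_diff[OF U u e]
    proof (rule integral_cong_AE)
      show "AE x in lebesgue_on {0..len e}. (De (U n) e x - De u e x)\<^sup>2 = (De (U n) e x - h x)\<^sup>2"
        using ae by eventually_elim simp
    qed (use L2_intervalD(2)[OF L2_diff[OF H1_edge(2)[OF U e] H1_edge(2)[OF u e]]] L2_intervalD(2)[OF L2_diff[OF H1_edge(2)[OF U e] h(1)]] in auto)
    then show ?thesis using h(3) by simp
  qed
  then have "(\<lambda>n. Dir (U n - u) (U n - u)) \<longlonglongrightarrow> (\<Sum>e\<in>arcs G. 0)"
    unfolding Dir_eq by (intro tendsto_sum)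
  then show "(\<lambda>n. Dir (U n - u) (U n - u)) \<longlonglongrightarrow> 0" by simp
qed

lemma Dir_limit:
  assumes U: "\<And>n. U n \<in> H1" and u: "u \<in> H1" and lim: "(\<lambda>n. Dir (U n - u) (U n - u)) \<longlonglongrightarrow> 0" and v: "v \<in> H1"
  shows "(\<lambda>n. Dir (U n) v) \<longlonglongrightarrow> Dir u v"
proof -
  note f = sym_form_bil[OF coef_const[of 0]]
  have "(\<lambda>n. Dir (U n) v - Dir u v) \<longlonglongrightarrow> 0"
  proof (rule Lim_null_comparison)
    show "\<forall>\<^sub>F n in sequentially. norm (Dir (U n) v - Dir u v) \<le> sqrt (Dir (U n - u) (U n - u) * Dir v v)"
    proof (intro always_eventually allI)
      fix n
      have d: "U n - u \<in> H1" using subspace_H1 U u by (simp add: subspace_diff)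
      have "(Dir (U n - u) v)\<^sup>2 \<le> Dir (U n - u) (U n - u) * Dir v v"
        by (rule sym_form_Cauchy_Schwarz[OF f Dir_nonneg d v])
      then have "\<bar>Dir (U n - u) v\<bar> \<le> sqrt (Dir (U n - u) (U n - u) * Dir v v)" by (simp add: real_le_rsqrt)
      then show "norm (Dir (U n) v - Dir u v) \<le> sqrt (Dir (U n - u) (U n - u) * Dir v v)"
        using sym_form_simps(3)[OF f U u v, of n] by simp
    qed
    have "(\<lambda>n. sqrt (Dir (U n - u) (U n - u) * Dir v v)) \<longlonglongrightarrow> sqrt (0 * Dir v v)" by (intro tendsto_intros lim)
    then show "(\<lambda>n. sqrt (Dir (U n - u) (U n - u) * Dir v v)) \<longlonglongrightarrow> 0" by simp
  qed
  then show ?thesis by (simp add: LIM_zero_iff)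
qed

lemma bil_split:
  assumes c: "coef c" and u: "u \<in> H1" and v: "v \<in> H1"
  shows "bil c u v = Dir u v + (\<Sum>e\<in>arcs G. LI 0 (len e) (\<lambda>x. c e x * ue u e x * ue v e x))"
  unfolding bil_def sum.distrib[symmetric]
proof (rule sum.cong)
  fix e assume e: "e \<in> arcs G"
  show "LI 0 (len e) (\<lambda>x. De u e x * De v e x + c e x * ue u e x * ue v e x) =
    LI 0 (len e) (\<lambda>x. De u e x * De v e x + 0 * ue u e x * ue v e x) + LI 0 (len e) (\<lambda>x. c e x * ue u e x * ue v e x)"
    using coef_mult_integrable[OF c u v e] L2_mult_integrable[OF H1_edge(2)[OF u e] H1_edge(2)[OF v e]] by simp
qed simp

end

context compact_metric_graph
begin

section \<open>Integrals over the whole graph\<close>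

definition total_length :: real
  where "total_length = (\<Sum>e\<in>arcs G. len e)"

lemma total_length_nonneg: "0 \<le> total_length"
  unfolding total_length_def by (intro sum_nonneg less_imp_le length_pos)

lemma edges_abs_bound:
  assumes "\<And>e. e \<in> arcs G \<Longrightarrow> integrable (lebesgue_on {0..len e}) (f e)"
    and "\<And>e x. e \<in> arcs G \<Longrightarrow> x \<in> {0..len e} \<Longrightarrow> \<bar>f e x\<bar> \<le> K"
  shows "\<bar>\<Sum>e\<in>arcs G. LI 0 (len e) (f e)\<bar> \<le> K * total_length"
proof -
  have "\<bar>\<Sum>e\<in>arcs G. LI 0 (len e) (f e)\<bar> \<le> (\<Sum>e\<in>arcs G. \<bar>LI 0 (len e) (f e)\<bar>)" by (rule sum_abs)
  also have "\<dots> \<le> (\<Sum>e\<in>arcs G. K * len e)"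
  proof (rule sum_mono)
    fix e assume e: "e \<in> arcs G"
    note l = less_imp_le[OF length_pos[OF e]]
    have "LI 0 (len e) (f e) \<le> K * (len e - 0)" by (rule LI_le[OF assms(1)[OF e] l]) (use assms(2)[OF e] in \<open>auto simp: abs_le_iff\<close>)
    moreover have "- K * (len e - 0) \<le> LI 0 (len e) (f e)"
      by (rule LI_ge[OF assms(1)[OF e] l]) (use assms(2)[OF e] abs_le_iff in \<open>fastforce\<close>)
    ultimately show "\<bar>LI 0 (len e) (f e)\<bar> \<le> K * len e" by (simp add: abs_le_iff)
  qed
  also have "\<dots> = K * total_length" by (simp add: total_length_def sum_distrib_left)
  finally show ?thesis .
qed

text \<open>Dominated convergence on each edge, the integrands being bounded by a constant.\<close>

lemma weighted_limit:
  assumes c: "\<And>n e. e \<in> arcs G \<Longrightarrow> c n e \<in> borel_measurable (lebesgue_on {0..len e})"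
    "\<And>e. e \<in> arcs G \<Longrightarrow> c' e \<in> borel_measurable (lebesgue_on {0..len e})"
    "\<And>n e x. e \<in> arcs G \<Longrightarrow> x \<in> {0..len e} \<Longrightarrow> \<bar>c n e x\<bar> \<le> K"
    "\<And>e x. e \<in> arcs G \<Longrightarrow> x \<in> {0..len e} \<Longrightarrow> (\<lambda>n. c n e x) \<longlonglongrightarrow> c' e x"
    and H: "\<And>n. U n \<in> H1" "\<And>n. V n \<in> H1" "u \<in> H1" "v \<in> H1"
    and b: "\<And>n e x. e \<in> arcs G \<Longrightarrow> x \<in> {0..len e} \<Longrightarrow> \<bar>ue (U n) e x\<bar> \<le> C"
    "\<And>n e x. e \<in> arcs G \<Longrightarrow> x \<in> {0..len e} \<Longrightarrow> \<bar>ue (V n) e x\<bar> \<le> C'"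
    and l: "\<And>e x. e \<in> arcs G \<Longrightarrow> x \<in> {0..len e} \<Longrightarrow> (\<lambda>n. ue (U n) e x) \<longlonglongrightarrow> ue u e x"
    "\<And>e x. e \<in> arcs G \<Longrightarrow> x \<in> {0..len e} \<Longrightarrow> (\<lambda>n. ue (V n) e x) \<longlonglongrightarrow> ue v e x"
  shows "(\<lambda>n. \<Sum>e\<in>arcs G. LI 0 (len e) (\<lambda>x. c n e x * ue (U n) e x * ue (V n) e x)) \<longlonglongrightarrow>
    (\<Sum>e\<in>arcs G. LI 0 (len e) (\<lambda>x. c' e x * ue u e x * ue v e x))"
proof (rule tendsto_sum)
  fix e assume e: "e \<in> arcs G"
  have m: "ue w e \<in> borel_measurable (lebesgue_on {0..len e})" if "w \<in> H1" for w
    by (rule borel_measurable_continuous_interval[OF H1_edge(1)[OF that e]])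
  note [measurable] = c(1)[OF e] c(2)[OF e] m[OF H(1)] m[OF H(2)] m[OF H(3)] m[OF H(4)]
  show "(\<lambda>n. LI 0 (len e) (\<lambda>x. c n e x * ue (U n) e x * ue (V n) e x)) \<longlonglongrightarrow> LI 0 (len e) (\<lambda>x. c' e x * ue u e x * ue v e x)"
  proof (rule integral_dominated_convergence[where w = "\<lambda>x. K * C * C'"])
    show "AE x in lebesgue_on {0..len e}. (\<lambda>n. c n e x * ue (U n) e x * ue (V n) e x) \<longlonglongrightarrow> c' e x * ue u e x * ue v e x"
      by (intro AE_I2 tendsto_mult c(4)[OF e] l(1)[OF e] l(2)[OF e]) auto
    show "AE x in lebesgue_on {0..len e}. norm (c n e x * ue (U n) e x * ue (V n) e x) \<le> K * C * C'" for n
    proof (intro AE_I2)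
      fix x assume "x \<in> space (lebesgue_on {0..len e})"
      then have x: "x \<in> {0..len e}" by simp
      have "\<bar>c n e x\<bar> * \<bar>ue (U n) e x\<bar> * \<bar>ue (V n) e x\<bar> \<le> K * C * C'"
        using c(3)[OF e x, of n] b(1)[OF e x, of n] b(2)[OF e x, of n]
        by (intro mult_mono mult_nonneg_nonneg) auto
      then show "norm (c n e x * ue (U n) e x * ue (V n) e x) \<le> K * C * C'" by (simp add: abs_mult)
    qed
  qed measurable
qed

lemma H1_bounded:
  assumes "u \<in> H1"
  shows "\<exists>C>0. \<forall>e\<in>arcs G. \<forall>x\<in>{0..len e}. \<bar>ue u e x\<bar> \<le> C"
proof (rule finite_uniform_bound[OF finite_arcs])
  show "\<exists>C. \<forall>x\<in>{0..len e}. \<bar>ue u e x\<bar> \<le> C" if "e \<in> arcs G" for e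
    by (rule continuous_bounded_interval[OF H1_edge(1)[OF assms that]]) blast
  show "\<forall>x\<in>{0..len e}. \<bar>ue u e x\<bar> \<le> C'" if "\<forall>x\<in>{0..len e}. \<bar>ue u e x\<bar> \<le> C" "C \<le> C'" for e and C C' :: real
    using that by fastforce
qed

lemma mass_add:
  assumes "u \<in> H1" "v \<in> H1"
  shows "mass (u + v) \<le> 2 * mass u + 2 * mass v"
  unfolding mass_def sum_distrib_left sum.distrib[symmetric]
proof (rule sum_mono)
  fix e assume e: "e \<in> arcs G"
  have i: "integrable (lebesgue_on {0..len e}) (\<lambda>x. (ue w e x)\<^sup>2)" if "w \<in> H1" for w
    by (rule L2_intervalD(2)[OF L2_continuous[OF H1_edge(1)[OF that e]]])
  have "LI 0 (len e) (\<lambda>x. (ue (u + v) e x)\<^sup>2) \<le> LI 0 (len e) (\<lambda>x. 2 * (ue u e x)\<^sup>2 + 2 * (ue v e x)\<^sup>2)"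
  proof (rule integral_mono)
    fix x
    show "(ue (u + v) e x)\<^sup>2 \<le> 2 * (ue u e x)\<^sup>2 + 2 * (ue v e x)\<^sup>2"
      using zero_le_power2[of "ue u e x - ue v e x"] by (simp add: on_edge_add power2_sum power2_diff)
  qed (use i[OF assms(1)] i[OF assms(2)] i[OF subspace_add[OF subspace_H1 assms]] in auto)
  then show "LI 0 (len e) (\<lambda>x. (ue (u + v) e x)\<^sup>2) \<le> 2 * LI 0 (len e) (\<lambda>x. (ue u e x)\<^sup>2) + 2 * LI 0 (len e) (\<lambda>x. (ue v e x)\<^sup>2)"
    using i[OF assms(1)] i[OF assms(2)] by simp
qed

lemma mass_scaleR: "mass (c *\<^sub>R u) = c\<^sup>2 * mass u"
  unfolding mass_def sum_distrib_left by (simp add: on_edge_scaleR power_mult_distrib)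

lemma mass_nonneg: "0 \<le> mass u"
  unfolding mass_def by (intro sum_nonneg LI_square_nonneg)

lemma mass_limit:
  assumes "\<And>n. U n \<in> H1" "u \<in> H1" "edge_limit U u"
    and "\<And>n e x. e \<in> arcs G \<Longrightarrow> x \<in> {0..len e} \<Longrightarrow> \<bar>ue (U n) e x\<bar> \<le> C"
  shows "(\<lambda>n. mass (U n)) \<longlonglongrightarrow> mass u"
  using weighted_limit[of "\<lambda>n e x. 1" "\<lambda>e x. 1" 1 U U u u C C] assms edge_limitD(2)[OF assms(3)]
  by (simp add: mass_def power2_eq_square)

lemma edge_limit_bound:
  assumes "edge_limit U u" "\<And>n. \<bar>ue (U n) e x\<bar> \<le> C" "e \<in> arcs G" "x \<in> {0..len e}"
  shows "\<bar>ue u e x\<bar> \<le> C"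
  by (rule LIMSEQ_le_const2[OF tendsto_rabs[OF edge_limitD(2)[OF assms(1,3,4)]]]) (use assms(2) in auto)

lemma mass_pos:
  assumes "u \<in> H1" "u \<noteq> 0"
  shows "0 < mass u" "\<exists>e\<in>arcs G. \<exists>x\<in>{0..len e}. ue u e x \<noteq> 0"
proof -
  show ex: "\<exists>e\<in>arcs G. \<exists>x\<in>{0..len e}. ue u e x \<noteq> 0"
    using edge_0_eq[OF assms(1) subspace_0[OF subspace_H1]] assms(2) by (auto simp: on_edge_zero)
  then obtain e x where e: "e \<in> arcs G" and x: "x \<in> {0..len e}" "ue u e x \<noteq> 0" by blast
  have c: "continuous_on {0..len e} (\<lambda>x. (ue u e x)\<^sup>2)" by (intro continuous_intros H1_edge(1)[OF assms(1) e])
  have "LI 0 (len e) (\<lambda>x. (ue u e x)\<^sup>2) \<noteq> 0"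
    using integral_nonneg_continuous_zero[OF c _ _ x(1) length_pos[OF e]] x(2) by auto
  then have "0 < LI 0 (len e) (\<lambda>x. (ue u e x)\<^sup>2)" by (metis LI_square_nonneg order_le_less)
  also have "\<dots> \<le> mass u" unfolding mass_def by (rule member_le_sum[OF e]) (auto simp: LI_square_nonneg)
  finally show "0 < mass u" .
qed

end

context nls_graph
begin

section \<open>Limits of solutions\<close>

lemma cS_bound:
  assumes "\<bar>ue u e x\<bar> \<le> C" "\<bar>lam\<bar> \<le> L"
  shows "\<bar>cS lam u e x\<bar> \<le> w1 + L + r1 * C powr (p - 2)"
proof -
  have "\<bar>ue u e x\<bar> powr (p - 2) \<le> C powr (p - 2)" using assms(1) p2 by (intro powr_mono2) auto
  then have "rt e x * \<bar>ue u e x\<bar> powr (p - 2) \<le> r1 * C powr (p - 2)"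
    using rt_bound[of e x] r0 by (intro mult_mono) auto
  moreover have "0 \<le> rt e x * \<bar>ue u e x\<bar> powr (p - 2)" using rt_bound[of e x] r0 by simp
  ultimately show ?thesis using Wt_bound[of e x] assms(2) unfolding cS_def by linarith
qed

lemma cS_meas: "u \<in> H1 \<Longrightarrow> e \<in> arcs G \<Longrightarrow> cS lam u e \<in> borel_measurable (lebesgue_on {0..len e})"
  using coef_cS[of u lam] by (simp add: coef_def)

lemma cS_limit:
  assumes "L \<longlonglongrightarrow> lam" "(\<lambda>n. ue (U n) e x) \<longlonglongrightarrow> ue u e x"
  shows "(\<lambda>n. cS (L n) (U n) e x) \<longlonglongrightarrow> cS lam u e x"
  unfolding cS_def
  by (intro tendsto_intros assms tendsto_powr') (use p2 in auto)

text \<open>Uniformity in \<open>x\<close> turns closeness of the potentials into an error of at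
  most \<epsilon> times the mass in the quadratic form.\<close>

lemma cQ_uniform_limit:
  assumes L: "L \<longlonglongrightarrow> lam" and lim: "edge_limit U u"
    and b: "\<And>n e x. e \<in> arcs G \<Longrightarrow> x \<in> {0..len e} \<Longrightarrow> \<bar>ue (U n) e x\<bar> \<le> C" and eps: "0 < \<epsilon>"
  shows "\<exists>N. \<forall>n\<ge>N. \<forall>e\<in>arcs G. \<forall>x\<in>{0..len e}. cQ (L n) (U n) e x \<le> cQ lam u e x + \<epsilon>"
proof -
  define k where "k = (p - 1) * r1"
  have k: "0 < k" using p2 r0 r01 by (simp add: k_def)
  obtain \<delta> where \<delta>: "\<delta> > 0" "\<And>y z. \<bar>y\<bar> \<le> C \<Longrightarrow> \<bar>z\<bar> \<le> C \<Longrightarrow> \<bar>y - z\<bar> < \<delta> \<Longrightarrow> \<bar>\<bar>y\<bar> powr (p - 2) - \<bar>z\<bar> powr (p - 2)\<bar> < \<epsilon> / (2 * k)"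
    using powr_uniformly_continuous[of "p - 2" "\<epsilon> / (2 * k)" C] p2 k eps by auto
  obtain N1 where N1: "\<And>n e x. n \<ge> N1 \<Longrightarrow> e \<in> arcs G \<Longrightarrow> x \<in> {0..len e} \<Longrightarrow> \<bar>ue (U n) e x - ue u e x\<bar> < \<delta>"
    using edge_limit_uniform[OF lim \<delta>(1)] by blast
  obtain N2 where N2: "\<And>n. n \<ge> N2 \<Longrightarrow> \<bar>L n - lam\<bar> < \<epsilon> / 2"
    using LIMSEQ_D[OF L, of "\<epsilon> / 2"] eps by auto
  show ?thesis
  proof (intro exI[of _ "max N1 N2"] allI impI ballI)
    fix n e x assume n: "max N1 N2 \<le> n" and e: "e \<in> arcs G" and x: "x \<in> {0..len e}"
    let ?y = "\<bar>ue (U n) e x\<bar> powr (p - 2)" and ?z = "\<bar>ue u e x\<bar> powr (p - 2)"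
    have "\<bar>?y - ?z\<bar> < \<epsilon> / (2 * k)"
      by (rule \<delta>(2)[OF b[OF e x] edge_limit_bound[OF lim b[OF e x] e x] N1[OF _ e x]]) (use n in simp)
    then have yz: "?z - ?y \<le> \<epsilon> / (2 * k)" by simp
    have rk: "0 \<le> (p - 1) * rt e x" "(p - 1) * rt e x \<le> k"
      using p2 rt_bound[of e x] r0 by (auto simp: k_def intro!: mult_nonneg_nonneg mult_left_mono)
    have "((p - 1) * rt e x) * (?z - ?y) \<le> k * (\<epsilon> / (2 * k))"
    proof -
      have "((p - 1) * rt e x) * (?z - ?y) \<le> ((p - 1) * rt e x) * (\<epsilon> / (2 * k))" by (rule mult_left_mono[OF yz rk(1)])
      also have "\<dots> \<le> k * (\<epsilon> / (2 * k))" using rk k eps by (intro mult_right_mono) auto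
      finally show ?thesis .
    qed
    also have "\<dots> = \<epsilon> / 2" using k by simp
    finally have "(p - 1) * rt e x * ?z - (p - 1) * rt e x * ?y \<le> \<epsilon> / 2" by (simp add: right_diff_distrib)
    moreover have "L n - lam < \<epsilon> / 2"
    proof -
      have "N2 \<le> n" using n by simp
      from N2[OF this] show ?thesis by linarith
    qed
    ultimately show "cQ (L n) (U n) e x \<le> cQ lam u e x + \<epsilon>" unfolding cQ_def by linarith
  qed
qed

lemma solutions_limit:
  fixes U :: "nat \<Rightarrow> ('v, 'e) gpoint \<Rightarrow> real"
  assumes L: "L \<longlonglongrightarrow> lam" and sol: "\<And>n. solution (L n) (U n)"
    and b: "\<And>n e x. e \<in> arcs G \<Longrightarrow> x \<in> {0..len e} \<Longrightarrow> \<bar>ue (U n) e x\<bar> \<le> C"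
    and mass: "\<And>n. \<epsilon> \<le> mass (U n)" and eps: "0 < \<epsilon>"
  shows "\<exists>u. solution lam u \<and> u \<noteq> 0"
proof -
  note UH = solutionD(1)[OF sol]
  obtain Lb where Lb: "\<And>n. \<bar>L n\<bar> \<le> Lb" using convergent_imp_Bseq[of L] L by (auto simp: convergent_def Bseq_def)
  define K where "K = w1 + Lb + r1 * C powr (p - 2)"
  have cK: "\<bar>cS (L n) (U n) e x\<bar> \<le> K" if "e \<in> arcs G" "x \<in> {0..len e}" for n e x
    unfolding K_def by (rule cS_bound[OF b[OF that] Lb])
  let ?Z = "\<lambda>n v. \<Sum>e\<in>arcs G. LI 0 (len e) (\<lambda>x. cS (L n) (U n) e x * ue (U n) e x * ue v e x)"
  \<comment> \<open>The equation trades the Dirichlet pairing for a term without derivatives, which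
    sup norms control.\<close>
  have weak: "Dir (U n) v = - ?Z n v" if "v \<in> H1" for n v
    using bil_split[OF coef_cS[OF UH] UH that, of "L n" n n] solutionD(2)[OF sol[of n]] that by (simp add: solves_E_iff)
  have Zb: "\<bar>?Z n v\<bar> \<le> K * C * d * total_length" if v: "v \<in> H1" and d: "\<And>e x. e \<in> arcs G \<Longrightarrow> x \<in> {0..len e} \<Longrightarrow> \<bar>ue v e x\<bar> \<le> d" for n v d
  proof (rule edges_abs_bound)
    fix e x assume e: "e \<in> arcs G" and x: "x \<in> {0..len e}"
    have "\<bar>cS (L n) (U n) e x\<bar> * \<bar>ue (U n) e x\<bar> * \<bar>ue v e x\<bar> \<le> K * C * d"
      using cK[OF e x, of n] b[OF e x, of n] d[OF e x] by (intro mult_mono mult_nonneg_nonneg) auto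
    then show "\<bar>cS (L n) (U n) e x * ue (U n) e x * ue v e x\<bar> \<le> K * C * d" by (simp add: abs_mult)
  qed (rule coef_mult_integrable[OF coef_cS[OF UH] UH v])
  have Db: "Dir (U n) (U n) \<le> K * C * C * total_length" for n
    using weak[OF UH, of n n] Zb[OF UH b, of n n] by linarith
  have "\<exists>r u. strict_mono (r :: nat \<Rightarrow> nat) \<and> edge_limit (\<lambda>n. U (r n)) u"
    by (rule compactness[OF UH b Db])
  then obtain r u where r: "strict_mono (r :: nat \<Rightarrow> nat)" and lim: "edge_limit (\<lambda>n. U (r n)) u"
    by (elim exE conjE) (rule that)
  have Lr: "(\<lambda>n. L (r n)) \<longlonglongrightarrow> lam" using LIMSEQ_subseq_LIMSEQ[OF L r] by (simp add: o_def)
  obtain e0 where e0: "e0 \<in> arcs G" using arcs_nonempty by blast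
  have K0: "0 \<le> K" "0 \<le> C"
    using order_trans[OF abs_ge_zero cK[OF e0, of 0 0]] order_trans[OF abs_ge_zero b[OF e0, of 0 0]] length_pos[OF e0] by auto
  have u: "u \<in> H1" and Dlim: "(\<lambda>n. Dir (U (r n) - u) (U (r n) - u)) \<longlonglongrightarrow> 0"
  proof -
    \<comment> \<open>Subtracting the equations of two members and testing with their difference
      bounds its Dirichlet energy by its sup norm.\<close>
    have "\<exists>N. \<forall>n\<ge>N. \<forall>k\<ge>N. Dir (U (r n) - U (r k)) (U (r n) - U (r k)) < \<eta>" if \<eta>: "\<eta> > 0" for \<eta>
    proof -
      \<comment> \<open>The 4 collects two error terms with sup norm at most 2 d each; the summand 1
        keeps the divisor positive.\<close>
      define D where "D = 4 * K * C * total_length + 1"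
      have D: "D > 0" unfolding D_def using K0 total_length_nonneg by (simp add: add_nonneg_pos)
      define d where "d = \<eta> / D"
      have d: "d > 0" using \<eta> D by (simp add: d_def)
      obtain N where N: "\<And>n e x. n \<ge> N \<Longrightarrow> e \<in> arcs G \<Longrightarrow> x \<in> {0..len e} \<Longrightarrow> \<bar>ue (U (r n)) e x - ue u e x\<bar> < d"
        using edge_limit_uniform[OF lim d] by blast
      have "Dir (U (r n) - U (r k)) (U (r n) - U (r k)) < \<eta>" if nk: "n \<ge> N" "k \<ge> N" for n k
      proof -
        define \<phi> where "\<phi> = U (r n) - U (r k)"
        have \<phi>: "\<phi> \<in> H1" unfolding \<phi>_def by (rule subspace_diff[OF subspace_H1 UH UH])
        have \<phi>b: "\<bar>ue \<phi> e x\<bar> \<le> 2 * d" if "e \<in> arcs G" "x \<in> {0..len e}" for e x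
        proof -
          have "ue \<phi> e x = ue (U (r n)) e x - ue (U (r k)) e x" by (simp add: \<phi>_def on_edge_def)
          then show ?thesis using N[OF nk(1) that] N[OF nk(2) that] by linarith
        qed
        have "Dir \<phi> \<phi> = Dir (U (r n)) \<phi> - Dir (U (r k)) \<phi>"
          using sym_form_simps(3)[OF sym_form_bil[OF coef_const[of 0]] UH UH \<phi>, of "r n" "r k"] by (simp add: \<phi>_def)
        also have "\<dots> = ?Z (r k) \<phi> - ?Z (r n) \<phi>" using weak[OF \<phi>] by simp
        also have "\<dots> \<le> K * C * (2 * d) * total_length + K * C * (2 * d) * total_length"
          using Zb[OF \<phi> \<phi>b, of "r k"] Zb[OF \<phi> \<phi>b, of "r n"] by linarith
        also have "\<dots> = d * (D - 1)" by (simp add: D_def algebra_simps)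
        also have "\<dots> < d * D" using d by simp
        also have "\<dots> = \<eta>" using D by (simp add: d_def)
        finally show ?thesis by (simp add: \<phi>_def)
      qed
      then show ?thesis by blast
    qed
    from strong_limit[OF UH lim this] show "u \<in> H1" "(\<lambda>n. Dir (U (r n) - u) (U (r n) - u)) \<longlonglongrightarrow> 0" by auto
  qed
  have "bil (cS lam u) u v = 0" if v: "v \<in> H1" for v
  proof -
    obtain Cv where Cv: "\<And>e x. e \<in> arcs G \<Longrightarrow> x \<in> {0..len e} \<Longrightarrow> \<bar>ue v e x\<bar> \<le> Cv"
      using H1_bounded[OF v] by blast
    have "(\<lambda>n. ?Z (r n) v) \<longlonglongrightarrow> (\<Sum>e\<in>arcs G. LI 0 (len e) (\<lambda>x. cS lam u e x * ue u e x * ue v e x))"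
      by (rule weighted_limit[where K = K and C = C and C' = Cv])
        (use cS_meas UH u v cK b Cv edge_limitD(2)[OF lim] cS_limit[OF Lr] in auto)
    moreover have "(\<lambda>n. Dir (U (r n)) v) \<longlonglongrightarrow> Dir u v" by (rule Dir_limit[OF UH u Dlim v])
    ultimately have "(\<lambda>n. Dir (U (r n)) v + ?Z (r n) v) \<longlonglongrightarrow> bil (cS lam u) u v"
      unfolding bil_split[OF coef_cS[OF u] u v] by (intro tendsto_add)
    then show ?thesis using weak[OF v] by (simp add: LIMSEQ_const_iff)
  qed
  then have eq: "solves_E G len W \<rho> p lam u" using u by (simp add: solves_E_iff)
  \<comment> \<open>Mass is continuous under uniform convergence, so the lower bound prevents the
    limit from being zero.\<close>
  have "\<epsilon> \<le> mass u"
    using mass_limit[OF UH u lim b] mass by (intro LIMSEQ_le_const[of "\<lambda>n. mass (U (r n))"]) auto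
  then have "u \<noteq> 0" using eps mass_scaleR[of 0 u] by auto
  moreover have "morse_index G len W \<rho> p lam u \<le> enat m"
    unfolding morse_index_le_iff[OF u]
  proof (intro allI impI)
    fix X assume X: "negative_space lam u X"
    then obtain B where B: "finite B" "span B = X" and XH: "X \<subseteq> H1" and neg: "\<And>v. v \<in> X - {0} \<Longrightarrow> bil (cQ lam u) v v < 0"
      by (auto simp: negative_space_def)
    have BH: "B \<subseteq> H1" using B(2) span_superset[of B] XH by auto
    obtain K where K: "K > 0" "\<And>v. v \<in> X \<Longrightarrow> mass v \<le> K * (- bil (cQ lam u) v v)"
    proof -
      have "\<exists>C>0. \<forall>v\<in>span B. mass v \<le> C * (- bil (cQ lam u) v v)"
      proof (rule negative_definite_coercive[where H = H1 and N = mass and b = "bil (cQ lam u)"])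
        show "bil (cQ lam u) v v < 0" if "v \<in> span B - {0}" for v using neg that B(2) by simp
      qed (use B(1) BH sym_form_bil[OF coef_cQ[OF u]] mass_add mass_scaleR in auto)
      then show ?thesis using that B(2) by blast
    qed
    \<comment> \<open>An error of \<open>1 / (2 * K)\<close> times the mass uses up at most half of
      the negativity granted by coercivity.\<close>
    have "0 < 1 / (2 * K)" using K by simp
    from cQ_uniform_limit[OF Lr lim b this]
    obtain N where N: "\<And>n e x. n \<ge> N \<Longrightarrow> e \<in> arcs G \<Longrightarrow> x \<in> {0..len e} \<Longrightarrow> cQ (L (r n)) (U (r n)) e x \<le> cQ lam u e x + 1 / (2 * K)"
      by blast
    have "bil (cQ (L (r N)) (U (r N))) v v < 0" if v: "v \<in> X - {0}" for v
    proof -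
      have vH: "v \<in> H1" using v XH by auto
      have cc: "coef (cQ (L (r N)) (U (r N)))" "coef (cQ lam u)" by (intro coef_cQ UH u)+
      have "bil (cQ (L (r N)) (U (r N))) v v \<le> bil (cQ lam u) v v + 1 / (2 * K) * mass v"
        unfolding bil_split[OF cc(1) vH vH] bil_split[OF cc(2) vH vH] mass_def sum_distrib_left add.assoc sum.distrib[symmetric]
      proof (rule add_left_mono, rule sum_mono)
        fix e assume e: "e \<in> arcs G"
        have i: "integrable (lebesgue_on {0..len e}) (\<lambda>x. (ue v e x)\<^sup>2)"
          by (rule L2_intervalD(2)[OF L2_continuous[OF H1_edge(1)[OF vH e]]])
        note j = coef_mult_integrable[OF cc(1) vH vH e] coef_mult_integrable[OF cc(2) vH vH e]
        have "LI 0 (len e) (\<lambda>x. cQ (L (r N)) (U (r N)) e x * ue v e x * ue v e x) \<le>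
          LI 0 (len e) (\<lambda>x. cQ lam u e x * ue v e x * ue v e x + 1 / (2 * K) * (ue v e x)\<^sup>2)"
        proof (rule integral_mono)
          fix x assume "x \<in> space (lebesgue_on {0..len e})"
          then have "cQ (L (r N)) (U (r N)) e x * (ue v e x)\<^sup>2 \<le> (cQ lam u e x + 1 / (2 * K)) * (ue v e x)\<^sup>2"
            using N[OF order_refl e, of x] by (intro mult_right_mono) auto
          then show "cQ (L (r N)) (U (r N)) e x * ue v e x * ue v e x \<le> cQ lam u e x * ue v e x * ue v e x + 1 / (2 * K) * (ue v e x)\<^sup>2"
            by (simp add: power2_eq_square algebra_simps)
        qed (use i j in auto)
        then show "LI 0 (len e) (\<lambda>x. cQ (L (r N)) (U (r N)) e x * ue v e x * ue v e x) \<le>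
          LI 0 (len e) (\<lambda>x. cQ lam u e x * ue v e x * ue v e x) + 1 / (2 * K) * LI 0 (len e) (\<lambda>x. (ue v e x)\<^sup>2)"
          using i j by simp
      qed
      also have "1 / (2 * K) * mass v \<le> 1 / (2 * K) * (K * (- bil (cQ lam u) v v))"
        using K v by (intro mult_left_mono) auto
      also have "\<dots> = - bil (cQ lam u) v v / 2" using K(1) by simp
      finally show ?thesis using neg[OF v] by simp
    qed
    then have "negative_space (L (r N)) (U (r N)) X"
      using X by (simp add: negative_space_def)
    then show "dim X \<le> m"
      using solutionD(3)[OF sol[of "r N"]] morse_index_le_iff[OF UH] by blast
  qed
  ultimately show ?thesis using eq by (auto simp: solution_def)
qed

end

section \<open>Existence of a solution of Morse index at most one\<close>

text \<open>Each sign is treated separately; at 0 the difference quotient is bounded by |h|^(q-1),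
  which tends to 0.\<close>

lemma abs_powr_has_derivative:
  fixes q y :: real
  assumes "1 < q"
  shows "((\<lambda>y. \<bar>y\<bar> powr q) has_real_derivative q * (\<bar>y\<bar> powr (q - 2) * y)) (at y)"
proof -
  have pos: "((\<lambda>y. \<bar>y\<bar> powr q) has_real_derivative q * (y powr (q - 2) * y)) (at y)" if "y > 0" for y
  proof -
    have "((\<lambda>y. y powr q) has_real_derivative q * y powr (q - 1)) (at y)"
      by (rule has_real_derivative_powr[OF that])
    moreover have "y powr (q - 1) = y powr (q - 2) * y" using that powr_mult_base[of y "q - 2"] by (simp add: mult.commute)
    ultimately have "((\<lambda>y. y powr q) has_real_derivative q * (y powr (q - 2) * y)) (at y)" by simp
    then show ?thesis
      by (rule has_field_derivative_transform_within[OF _ that]) (use that in \<open>auto simp: dist_real_def\<close>)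
  qed
  consider "y > 0" | "y < 0" | "y = 0" by linarith
  then show ?thesis
  proof cases
    case 1
    then show ?thesis using pos[of y] by simp
  next
    case 2
    have "((\<lambda>y. \<bar>- y\<bar> powr q) has_real_derivative (q * ((- y) powr (q - 2) * (- y))) * -1) (at y)"
      by (rule DERIV_chain2[where f = "\<lambda>y. \<bar>y\<bar> powr q" and g = uminus, OF pos[of "- y"]]) (use 2 in \<open>auto intro!: derivative_eq_intros\<close>)
    then show ?thesis using 2 by simp
  next
    case 3
    have "((\<lambda>h::real. \<bar>h\<bar> powr q / h) \<longlongrightarrow> 0) (at 0)"
    proof (rule Lim_null_comparison)
      have "\<bar>h\<bar> powr q / \<bar>h\<bar> = \<bar>h\<bar> powr (q - 1)" if "h \<noteq> 0" for h :: real
        using that powr_mult_base[of "\<bar>h\<bar>" "q - 1"] by (simp add: field_simps)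
      then show "\<forall>\<^sub>F h in at (0::real). norm (\<bar>h\<bar> powr q / h) \<le> \<bar>h\<bar> powr (q - 1)"
        by (auto simp: eventually_at_filter intro!: always_eventually)
      have "((\<lambda>h::real. \<bar>h\<bar> powr (q - 1)) \<longlongrightarrow> \<bar>0\<bar> powr (q - 1)) (at 0)"
        using assms by (intro tendsto_powr' tendsto_intros) auto
      then show "((\<lambda>h::real. \<bar>h\<bar> powr (q - 1)) \<longlongrightarrow> 0) (at 0)" by simp
    qed
    then show ?thesis using 3 by (simp add: DERIV_def)
  qed
qed

lemma abs_powr_mult_has_derivative:
  fixes q y :: real
  assumes "0 < q"
  shows "((\<lambda>y. \<bar>y\<bar> powr q * y) has_real_derivative (q + 1) * \<bar>y\<bar> powr q) (at y)"
proof -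
  have pos: "((\<lambda>y. \<bar>y\<bar> powr q * y) has_real_derivative (q + 1) * y powr q) (at y)" if "y > 0" for y
  proof -
    have "((\<lambda>y. y powr (q + 1)) has_real_derivative (q + 1) * y powr (q + 1 - 1)) (at y)"
      by (rule has_real_derivative_powr[OF that])
    then have "((\<lambda>y. y powr (q + 1)) has_real_derivative (q + 1) * y powr q) (at y)" by simp
    then show ?thesis
    proof (rule has_field_derivative_transform_within[OF _ that])
      fix x assume "dist x y < y"
      then have "x > 0" by (auto simp: dist_real_def)
      then show "x powr (q + 1) = \<bar>x\<bar> powr q * x" using powr_mult_base[of x q] by (simp add: mult.commute add.commute)
    qed simp
  qed
  consider "y > 0" | "y < 0" | "y = 0" by linarith
  then show ?thesis
  proof cases
    case 1
    then show ?thesis using pos[of y] by simp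
  next
    case 2
    have "((\<lambda>y. \<bar>- y\<bar> powr q * - y) has_real_derivative ((q + 1) * (- y) powr q) * -1) (at y)"
      by (rule DERIV_chain2[where f = "\<lambda>y. \<bar>y\<bar> powr q * y" and g = uminus, OF pos[of "- y"]]) (use 2 in \<open>auto intro!: derivative_eq_intros\<close>)
    from DERIV_minus[OF this] show ?thesis using 2 by simp
  next
    case 3
    have "((\<lambda>h::real. \<bar>h\<bar> powr q) \<longlongrightarrow> \<bar>0\<bar> powr q) (at 0)"
      using assms by (intro tendsto_powr' tendsto_intros) auto
    then have "((\<lambda>h::real. \<bar>h\<bar> powr q * h / h) \<longlongrightarrow> 0) (at 0)"
      using assms by (auto elim!: Lim_transform_eventually simp: eventually_at_filter)
    then show ?thesis using 3 by (simp add: DERIV_def)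
  qed
qed

text \<open>Near \<open>a\<close> the function |z|^p minus the quadratic term has nonnegative second
  derivative, hence is convex and lies above its tangent. This is a one-sided Taylor formula with
  explicit range.\<close>

lemma abs_powr_second_order:
  fixes p a s k d :: real
  assumes p: "2 < p" and s: "\<bar>s\<bar> < d" and k: "\<And>z. \<bar>z - a\<bar> < d \<Longrightarrow> k \<le> \<bar>z\<bar> powr (p - 2)"
  shows "\<bar>a\<bar> powr p + p * (\<bar>a\<bar> powr (p - 2) * a) * s + p * (p - 1) / 2 * k * s\<^sup>2 \<le> \<bar>a + s\<bar> powr p"
proof -
  define A where "A = {a - d<..<a + d}"
  define f where "f z = \<bar>z\<bar> powr p - p * (p - 1) / 2 * k * (z - a)\<^sup>2" for z
  define f' where "f' z = p * (\<bar>z\<bar> powr (p - 2) * z) - p * (p - 1) * k * (z - a)" for z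
  have d1: "(f has_real_derivative f' z) (at z)" for z
    unfolding f_def f'_def
  proof (rule DERIV_diff)
    show "((\<lambda>z. \<bar>z\<bar> powr p) has_real_derivative p * (\<bar>z\<bar> powr (p - 2) * z)) (at z)"
      using p by (intro abs_powr_has_derivative) simp
    show "((\<lambda>z. p * (p - 1) / 2 * k * (z - a)\<^sup>2) has_real_derivative p * (p - 1) * k * (z - a)) (at z)"
      by (auto intro!: derivative_eq_intros)
  qed
  have d2: "(f' has_real_derivative p * ((p - 1) * \<bar>z\<bar> powr (p - 2)) - p * (p - 1) * k) (at z)" for z
    unfolding f'_def
  proof (rule DERIV_diff)
    have "((\<lambda>z. \<bar>z\<bar> powr (p - 2) * z) has_real_derivative (p - 1) * \<bar>z\<bar> powr (p - 2)) (at z)"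
      using abs_powr_mult_has_derivative[of "p - 2" z] p by simp
    then show "((\<lambda>z. p * (\<bar>z\<bar> powr (p - 2) * z)) has_real_derivative p * ((p - 1) * \<bar>z\<bar> powr (p - 2))) (at z)"
      by (rule DERIV_cmult)
    show "((\<lambda>z. p * (p - 1) * k * (z - a)) has_real_derivative p * (p - 1) * k) (at z)"
      by (auto intro!: derivative_eq_intros)
  qed
  have cA: "convex A" by (simp add: A_def)
  have "convex_on A f"
  proof (rule f''_ge0_imp_convex[OF _ d1 d2])
    show "convex A" by (rule cA)
    show "0 \<le> p * ((p - 1) * \<bar>z\<bar> powr (p - 2)) - p * (p - 1) * k" if "z \<in> A" for z
    proof -
      have "k \<le> \<bar>z\<bar> powr (p - 2)" by (rule k) (use that in \<open>auto simp: A_def\<close>)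
      then have "(p * (p - 1)) * k \<le> (p * (p - 1)) * \<bar>z\<bar> powr (p - 2)" using p by (intro mult_left_mono) auto
      then show ?thesis by simp
    qed
  qed
  then have "f (a + s) - f a \<ge> f' a * (a + s - a)"
  proof (rule convex_on_imp_above_tangent[OF _ convex_connected[OF cA]])
    show "a \<in> interior A" "a + s \<in> A" using s by (auto simp: A_def)
    show "(f has_real_derivative f' a) (at a within A)" by (rule has_field_derivative_at_within[OF d1])
  qed
  then show ?thesis by (simp add: f_def f'_def algebra_simps)
qed

context nls_graph
begin

section \<open>The maximization problem on the unit sphere\<close>

definition react :: "(('v, 'e) gpoint \<Rightarrow> real) \<Rightarrow> 'e \<Rightarrow> real \<Rightarrow> real"
  where "react w e x = rt e x * \<bar>ue w e x\<bar> powr (p - 2)"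

text \<open>The weight is frozen at \<open>w\<close>, so that \<open>T w w w\<close> is the integral
  of rho |w|^p and, up to the factors p and p (p - 1), \<open>T u u f\<close> and
  \<open>T u f f\<close> are its first and second derivatives at \<open>u\<close> in the direction
  \<open>f\<close>.\<close>

definition T :: "(('v, 'e) gpoint \<Rightarrow> real) \<Rightarrow> (('v, 'e) gpoint \<Rightarrow> real) \<Rightarrow> (('v, 'e) gpoint \<Rightarrow> real) \<Rightarrow> real"
  where "T w f g = (\<Sum>e\<in>arcs G. LI 0 (len e) (\<lambda>x. react w e x * ue f e x * ue g e x))"

text \<open>At the frequency \<open>w1 + 1\<close> the coefficient W + lam is at least 1, so this
  form dominates Dirichlet energy plus mass.\<close>

abbreviation B :: "(('v, 'e) gpoint \<Rightarrow> real) \<Rightarrow> (('v, 'e) gpoint \<Rightarrow> real) \<Rightarrow> real"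
  where "B \<equiv> bil (cB (w1 + 1))"

lemma coef_react: "w \<in> H1 \<Longrightarrow> coef (react w)"
  unfolding coef_def react_def using powr_ue_coef by blast

lemma T_integrable:
  "w \<in> H1 \<Longrightarrow> f \<in> H1 \<Longrightarrow> g \<in> H1 \<Longrightarrow> e \<in> arcs G \<Longrightarrow> integrable (lebesgue_on {0..len e}) (\<lambda>x. react w e x * ue f e x * ue g e x)"
  by (rule coef_mult_integrable[OF coef_react])

lemma react_diag: "react w e x * ue w e x * ue w e x = rt e x * \<bar>ue w e x\<bar> powr p"
proof (cases "ue w e x = 0")
  case False
  have "\<bar>ue w e x\<bar> powr p = \<bar>ue w e x\<bar> powr ((p - 2) + 2)" by simp
  also have "\<dots> = \<bar>ue w e x\<bar> powr (p - 2) * \<bar>ue w e x\<bar> powr 2" by (rule powr_add)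
  also have "\<bar>ue w e x\<bar> powr 2 = ue w e x * ue w e x" using False by (simp add: powr_numeral power2_eq_square)
  finally show ?thesis by (simp add: react_def)
qed simp

lemma T_scale: "T (c *\<^sub>R w) f g = \<bar>c\<bar> powr (p - 2) * T w f g"
  unfolding T_def sum_distrib_left react_def on_edge_scaleR
  by (simp add: abs_mult powr_mult algebra_simps flip: integral_mult_right_zero)

lemma T_bilinear:
  assumes "w \<in> H1" "f \<in> H1" "g \<in> H1"
  shows "T w (c *\<^sub>R f) g = c * T w f g" "T w f (c *\<^sub>R g) = c * T w f g"
  unfolding T_def sum_distrib_left on_edge_scaleR
  by (simp_all add: algebra_simps flip: integral_mult_right_zero)

lemma cS_react: "bil (cS (w1 + 1) u) f g = B f g - T u f g" if "u \<in> H1" "f \<in> H1" "g \<in> H1"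
proof -
  have "(\<Sum>e\<in>arcs G. LI 0 (len e) (\<lambda>x. cS (w1 + 1) u e x * ue f e x * ue g e x)) =
    (\<Sum>e\<in>arcs G. LI 0 (len e) (\<lambda>x. cB (w1 + 1) e x * ue f e x * ue g e x) - LI 0 (len e) (\<lambda>x. react u e x * ue f e x * ue g e x))"
  proof (rule sum.cong)
    fix e assume e: "e \<in> arcs G"
    have "(\<lambda>x. cS (w1 + 1) u e x * ue f e x * ue g e x) =
      (\<lambda>x. cB (w1 + 1) e x * ue f e x * ue g e x - react u e x * ue f e x * ue g e x)"
      by (simp add: cS_def cB_def react_def algebra_simps)
    then show "LI 0 (len e) (\<lambda>x. cS (w1 + 1) u e x * ue f e x * ue g e x) =
      LI 0 (len e) (\<lambda>x. cB (w1 + 1) e x * ue f e x * ue g e x) - LI 0 (len e) (\<lambda>x. react u e x * ue f e x * ue g e x)"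
      using coef_mult_integrable[OF coef_cB that(2,3) e] T_integrable[OF that e] by simp
  qed simp
  then show ?thesis
    unfolding bil_split[OF coef_cS[OF that(1)] that(2,3)] bil_split[OF coef_cB that(2,3)] T_def sum_subtractf by simp
qed

lemma cQ_react: "bil (cQ (w1 + 1) u) f f = B f f - (p - 1) * T u f f" if "u \<in> H1" "f \<in> H1"
proof -
  have "(\<Sum>e\<in>arcs G. LI 0 (len e) (\<lambda>x. cQ (w1 + 1) u e x * ue f e x * ue f e x)) =
    (\<Sum>e\<in>arcs G. LI 0 (len e) (\<lambda>x. cB (w1 + 1) e x * ue f e x * ue f e x) - (p - 1) * LI 0 (len e) (\<lambda>x. react u e x * ue f e x * ue f e x))"
  proof (rule sum.cong)
    fix e assume e: "e \<in> arcs G"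
    have "(\<lambda>x. cQ (w1 + 1) u e x * ue f e x * ue f e x) =
      (\<lambda>x. cB (w1 + 1) e x * ue f e x * ue f e x - (p - 1) * (react u e x * ue f e x * ue f e x))"
      by (simp add: cQ_def cB_def react_def algebra_simps)
    then show "LI 0 (len e) (\<lambda>x. cQ (w1 + 1) u e x * ue f e x * ue f e x) =
      LI 0 (len e) (\<lambda>x. cB (w1 + 1) e x * ue f e x * ue f e x) - (p - 1) * LI 0 (len e) (\<lambda>x. react u e x * ue f e x * ue f e x)"
      using coef_mult_integrable[OF coef_cB that(2,2) e] T_integrable[OF that that(2) e] by simp
  qed simp
  then show ?thesis
    unfolding bil_split[OF coef_cQ[OF that(1)] that(2,2)] bil_split[OF coef_cB that(2,2)] T_def sum_subtractf sum_distrib_left by simp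
qed

lemma B_ge:
  assumes "w \<in> H1"
  shows "Dir w w + mass w \<le> B w w"
  unfolding bil_split[OF coef_cB assms assms] mass_def
proof (intro add_left_mono sum_mono)
  fix e assume e: "e \<in> arcs G"
  show "LI 0 (len e) (\<lambda>x. (ue w e x)\<^sup>2) \<le> LI 0 (len e) (\<lambda>x. cB (w1 + 1) e x * ue w e x * ue w e x)"
  proof (rule integral_mono)
    fix x
    have "1 \<le> cB (w1 + 1) e x" using Wt_bound[of e x] unfolding cB_def by linarith
    then have "1 * (ue w e x)\<^sup>2 \<le> cB (w1 + 1) e x * (ue w e x)\<^sup>2" by (intro mult_right_mono) auto
    then show "(ue w e x)\<^sup>2 \<le> cB (w1 + 1) e x * ue w e x * ue w e x" by (simp add: power2_eq_square mult.assoc)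
  qed (use L2_intervalD(2)[OF L2_continuous[OF H1_edge(1)[OF assms e]]] coef_mult_integrable[OF coef_cB assms assms e] in auto)
qed

lemma B_pos: "w \<in> H1 \<Longrightarrow> w \<noteq> 0 \<Longrightarrow> 0 < B w w" and B_nonneg: "w \<in> H1 \<Longrightarrow> 0 \<le> B w w"
  using B_ge[of w] mass_pos(1)[of w] mass_nonneg[of w] Dir_nonneg[of w] by linarith+

text \<open>On each edge, u(x)^2 <= 2 u(y)^2 + 2 (u(x) - u(y))^2 is averaged over y, and
  Cauchy-Schwarz bounds the difference by the Dirichlet energy.\<close>

lemma Sobolev: "\<exists>K>0. \<forall>w\<in>H1. \<forall>e\<in>arcs G. \<forall>x\<in>{0..len e}. (ue w e x)\<^sup>2 \<le> K * B w w"
proof -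
  have "\<exists>K>0. \<forall>e\<in>arcs G. \<forall>w\<in>H1. \<forall>x\<in>{0..len e}. (ue w e x)\<^sup>2 \<le> K * B w w"
  proof (rule finite_uniform_bound[OF finite_arcs])
    fix e assume e: "e \<in> arcs G"
    let ?l = "len e"
    note l = length_pos[OF e]
    have "(ue w e x)\<^sup>2 \<le> (2 / ?l + 2 * ?l) * B w w" if w: "w \<in> H1" and x: "x \<in> {0..?l}" for w x
    proof -
      let ?D = "LI 0 ?l (\<lambda>x. (De w e x)\<^sup>2)" and ?M = "LI 0 ?l (\<lambda>x. (ue w e x)\<^sup>2)"
      note g = H1_edge(2)[OF w e] and pr = H1_edge(3)[OF w e]
      have i: "integrable (lebesgue_on {0..?l}) (\<lambda>x. (ue w e x)\<^sup>2)"
        by (rule L2_intervalD(2)[OF L2_continuous[OF H1_edge(1)[OF w e]]])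
      have D0: "0 \<le> ?D" by (rule LI_square_nonneg)
      have inc: "(ue w e t - ue w e s)\<^sup>2 \<le> ?l * ?D" if st: "0 \<le> s" "s \<le> t" "t \<le> ?l" for s t
      proof -
        have "(ue w e t - ue w e s)\<^sup>2 \<le> (t - s) * ?D"
          using L2_interval_LI_bound[OF g st] primitive_onD(2)[OF pr st] by simp
        also have "\<dots> \<le> ?l * ?D" using st D0 by (intro mult_right_mono) auto
        finally show ?thesis .
      qed
      have "(ue w e x)\<^sup>2 * (?l - 0) \<le> LI 0 ?l (\<lambda>y. 2 * (ue w e y)\<^sup>2 + 2 * (?l * ?D))"
      proof (rule LI_ge)
        fix y assume y: "y \<in> {0..?l}"
        have "(ue w e x - ue w e y)\<^sup>2 \<le> ?l * ?D"
          using inc[of x y] inc[of y x] x y by (cases "x \<le> y") (auto simp: power2_commute)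
        moreover have "(ue w e x)\<^sup>2 \<le> 2 * (ue w e y)\<^sup>2 + 2 * (ue w e x - ue w e y)\<^sup>2"
          using zero_le_power2[of "ue w e x - 2 * ue w e y"] by (simp add: power2_eq_square algebra_simps)
        ultimately show "(ue w e x)\<^sup>2 \<le> 2 * (ue w e y)\<^sup>2 + 2 * (?l * ?D)" by linarith
      qed (use i l in auto)
      also have "\<dots> = 2 * ?M + 2 * (?l * ?D) * ?l" using i l by simp
      finally have "(ue w e x)\<^sup>2 \<le> 2 / ?l * ?M + 2 * ?l * ?D"
        using l by (simp add: field_simps power2_eq_square)
      moreover have "?M \<le> B w w" "?D \<le> B w w"
      proof -
        have "?M \<le> mass w" unfolding mass_def by (rule member_le_sum[OF e]) (auto simp: LI_square_nonneg)
        then show "?M \<le> B w w" "?D \<le> B w w"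
          using B_ge[OF w] LI_De_le_Dir[OF e, of w] mass_nonneg[of w] Dir_nonneg[of w] by linarith+
      qed
      then have "2 / ?l * ?M \<le> 2 / ?l * B w w" "2 * ?l * ?D \<le> 2 * ?l * B w w"
        using l by (auto intro!: mult_left_mono divide_right_mono)
      ultimately show ?thesis by (simp add: distrib_right)
    qed
    then show "\<exists>C. \<forall>w\<in>H1. \<forall>x\<in>{0..?l}. (ue w e x)\<^sup>2 \<le> C * B w w" by blast
  next
    fix e and C C' :: real assume *: "\<forall>w\<in>H1. \<forall>x\<in>{0..len e}. (ue w e x)\<^sup>2 \<le> C * B w w" and "C \<le> C'"
    then have "C * B w w \<le> C' * B w w" if "w \<in> H1" for w using B_nonneg[OF that] by (intro mult_right_mono)
    then show "\<forall>w\<in>H1. \<forall>x\<in>{0..len e}. (ue w e x)\<^sup>2 \<le> C' * B w w" using * by (meson order_trans)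
  qed
  then show ?thesis by blast
qed

lemma T_diag_pos:
  assumes "w \<in> H1" "w \<noteq> 0"
  shows "0 < T w w w"
proof -
  obtain e x where e: "e \<in> arcs G" and x: "x \<in> {0..len e}" "ue w e x \<noteq> 0" using mass_pos(2)[OF assms] by blast
  let ?f = "\<lambda>x. r0 * \<bar>ue w e x\<bar> powr p"
  have c: "continuous_on {0..len e} ?f"
    using p2 by (intro continuous_on_mult continuous_on_const continuous_on_powr' continuous_on_rabs H1_edge(1)[OF assms(1) e]) auto
  have "LI 0 (len e) ?f \<noteq> 0"
    using integral_nonneg_continuous_zero[OF c _ _ x(1) length_pos[OF e]] x(2) r0 by auto
  moreover have "0 \<le> LI 0 (len e) ?f" by (rule integral_nonneg_AE) (use r0 in auto)
  moreover have "LI 0 (len e) ?f \<le> LI 0 (len e) (\<lambda>x. react w e x * ue w e x * ue w e x)"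
    by (rule integral_mono)
      (use T_integrable[OF assms(1,1,1) e] continuous_imp_integrable_real[OF c] rt_bound in \<open>auto simp: react_diag intro!: mult_right_mono\<close>)
  ultimately have "0 < LI 0 (len e) (\<lambda>x. react w e x * ue w e x * ue w e x)" by linarith
  also have "\<dots> \<le> T w w w"
    unfolding T_def
  proof (rule member_le_sum[OF e])
    show "0 \<le> LI 0 (len f) (\<lambda>x. react w f x * ue w f x * ue w f x)" for f
      unfolding react_diag
      by (intro integral_nonneg_AE AE_I2 mult_nonneg_nonneg) (use rt_bound r0 in \<open>auto intro: order_trans less_imp_le\<close>)
  qed auto
  finally show ?thesis .
qed

text \<open>The pointwise Taylor bound is integrated; uniform continuity of |z|^(p-2) on a bounded
  range makes the loss in the second-order coefficient at most \<eta>.\<close>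

lemma T_expansion:
  assumes u: "u \<in> H1" and f: "f \<in> H1" and \<eta>: "\<eta> > 0"
  shows "\<exists>\<delta>>0. \<forall>t. \<bar>t\<bar> < \<delta> \<longrightarrow>
    T u u u + t * (p * T u u f) + t\<^sup>2 * (p * (p - 1) / 2 * (T u f f - \<eta>)) \<le> T (u + t *\<^sub>R f) (u + t *\<^sub>R f) (u + t *\<^sub>R f)"
proof -
  obtain C where C: "C > 0" "\<And>e x. e \<in> arcs G \<Longrightarrow> x \<in> {0..len e} \<Longrightarrow> \<bar>ue u e x\<bar> \<le> C" using H1_bounded[OF u] by blast
  obtain D where D: "D > 0" "\<And>e x. e \<in> arcs G \<Longrightarrow> x \<in> {0..len e} \<Longrightarrow> \<bar>ue f e x\<bar> \<le> D" using H1_bounded[OF f] by blast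
  \<comment> \<open>Chosen so that the pointwise losses add up to at most \<eta> over the graph; the
    summand 1 keeps the divisor positive.\<close>
  define q where "q = r1 * D\<^sup>2 * total_length + 1"
  have q: "q > 0" using r0 r01 total_length_nonneg by (simp add: q_def add_nonneg_pos)
  define \<epsilon> where "\<epsilon> = \<eta> / q"
  have \<epsilon>: "\<epsilon> > 0" using \<eta> q by (simp add: \<epsilon>_def)
  have \<epsilon>\<eta>: "r1 * D\<^sup>2 * \<epsilon> * total_length \<le> \<eta>"
  proof -
    have "r1 * D\<^sup>2 * \<epsilon> * total_length = \<epsilon> * (q - 1)" by (simp add: q_def)
    also have "\<dots> \<le> \<epsilon> * q" using \<epsilon> by simp
    also have "\<dots> = \<eta>" using q by (simp add: \<epsilon>_def)
    finally show ?thesis .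
  qed
  obtain \<delta>0 where \<delta>0: "\<delta>0 > 0" "\<And>y z. \<bar>y\<bar> \<le> C + 1 \<Longrightarrow> \<bar>z\<bar> \<le> C + 1 \<Longrightarrow> \<bar>y - z\<bar> < \<delta>0 \<Longrightarrow> \<bar>\<bar>y\<bar> powr (p - 2) - \<bar>z\<bar> powr (p - 2)\<bar> < \<epsilon>"
    using powr_uniformly_continuous[of "p - 2" \<epsilon> "C + 1"] p2 \<epsilon> by auto
  \<comment> \<open>The cap 1 keeps all intermediate values within \<open>C + 1\<close>, the range
    on which uniform continuity was taken.\<close>
  define d where "d = min \<delta>0 1"
  have d: "d > 0" "d \<le> \<delta>0" "d \<le> 1" using \<delta>0 by (auto simp: d_def)
  define k where "k = p * (p - 1) / 2"
  have k: "k > 0" using p2 by (simp add: k_def)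
  have "T u u u + t * (p * T u u f) + t\<^sup>2 * (k * (T u f f - \<eta>)) \<le> T (u + t *\<^sub>R f) (u + t *\<^sub>R f) (u + t *\<^sub>R f)" if t: "\<bar>t\<bar> < d / D" for t
  proof -
    have w: "u + t *\<^sub>R f \<in> H1" using subspace_H1 u f by (intro subspace_add subspace_scale)
    have "(\<Sum>e\<in>arcs G. LI 0 (len e) (\<lambda>x. react u e x * ue u e x * ue u e x) + t * p * LI 0 (len e) (\<lambda>x. react u e x * ue u e x * ue f e x)
        + t\<^sup>2 * k * (LI 0 (len e) (\<lambda>x. react u e x * ue f e x * ue f e x) - r1 * D\<^sup>2 * \<epsilon> * len e)) \<le> T (u + t *\<^sub>R f) (u + t *\<^sub>R f) (u + t *\<^sub>R f)"
      unfolding T_def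
    proof (rule sum_mono)
      fix e assume e: "e \<in> arcs G"
      note ii = T_integrable[OF u u u e] T_integrable[OF u u f e] T_integrable[OF u f f e]
      have "LI 0 (len e) (\<lambda>x. react u e x * ue u e x * ue u e x + t * p * (react u e x * ue u e x * ue f e x)
          + t\<^sup>2 * k * (react u e x * ue f e x * ue f e x - r1 * D\<^sup>2 * \<epsilon>)) \<le>
        LI 0 (len e) (\<lambda>x. react (u + t *\<^sub>R f) e x * ue (u + t *\<^sub>R f) e x * ue (u + t *\<^sub>R f) e x)"
      proof (rule integral_mono)
        fix x assume "x \<in> space (lebesgue_on {0..len e})"
        then have x: "x \<in> {0..len e}" by simp
        let ?a = "ue u e x" and ?f = "ue f e x" and ?r = "rt e x"
        have s: "\<bar>t * ?f\<bar> < d"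
        proof -
          have "\<bar>t\<bar> * \<bar>?f\<bar> \<le> \<bar>t\<bar> * D" by (rule mult_left_mono[OF D(2)[OF e x]]) simp
          also have "\<dots> < d" using t D(1) by (simp add: pos_less_divide_eq)
          finally show ?thesis by (simp add: abs_mult)
        qed
        have "\<bar>?a\<bar> powr p + p * (\<bar>?a\<bar> powr (p - 2) * ?a) * (t * ?f) + p * (p - 1) / 2 * (\<bar>?a\<bar> powr (p - 2) - \<epsilon>) * (t * ?f)\<^sup>2 \<le> \<bar>?a + t * ?f\<bar> powr p"
        proof (rule abs_powr_second_order[OF p2 s])
          fix z assume z: "\<bar>z - ?a\<bar> < d"
          have "\<bar>\<bar>z\<bar> powr (p - 2) - \<bar>?a\<bar> powr (p - 2)\<bar> < \<epsilon>"
            by (rule \<delta>0(2)) (use z C(2)[OF e x] d in linarith)+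
          then show "\<bar>?a\<bar> powr (p - 2) - \<epsilon> \<le> \<bar>z\<bar> powr (p - 2)" by linarith
        qed
        then have "?r * (\<bar>?a\<bar> powr p + p * (\<bar>?a\<bar> powr (p - 2) * ?a) * (t * ?f) + k * (\<bar>?a\<bar> powr (p - 2) - \<epsilon>) * (t * ?f)\<^sup>2) \<le> ?r * \<bar>?a + t * ?f\<bar> powr p"
          unfolding k_def by (rule mult_left_mono) (use rt_bound[of e x] r0 in simp)
        moreover have "t\<^sup>2 * k * (?r * ?f\<^sup>2 * \<epsilon>) \<le> t\<^sup>2 * k * (r1 * D\<^sup>2 * \<epsilon>)"
        proof -
          have "\<bar>?f\<bar>\<^sup>2 \<le> D\<^sup>2" by (rule power_mono[OF D(2)[OF e x]]) simp
          then have "?r * ?f\<^sup>2 \<le> r1 * D\<^sup>2" using rt_bound[of e x] r0 r01 by (intro mult_mono) auto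
          then show ?thesis using \<epsilon> k by (intro mult_left_mono mult_right_mono) auto
        qed
        moreover have "ue (u + t *\<^sub>R f) e x = ?a + t * ?f" by (simp add: on_edge_add on_edge_scaleR)
        ultimately show "react u e x * ?a * ?a + t * p * (react u e x * ?a * ?f) + t\<^sup>2 * k * (react u e x * ?f * ?f - r1 * D\<^sup>2 * \<epsilon>)
          \<le> react (u + t *\<^sub>R f) e x * ue (u + t *\<^sub>R f) e x * ue (u + t *\<^sub>R f) e x"
          unfolding react_diag by (simp add: react_def power2_eq_square algebra_simps)
      qed (use ii T_integrable[OF w w w e] in auto)
      then show "LI 0 (len e) (\<lambda>x. react u e x * ue u e x * ue u e x) + t * p * LI 0 (len e) (\<lambda>x. react u e x * ue u e x * ue f e x)
        + t\<^sup>2 * k * (LI 0 (len e) (\<lambda>x. react u e x * ue f e x * ue f e x) - r1 * D\<^sup>2 * \<epsilon> * len e)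
        \<le> LI 0 (len e) (\<lambda>x. react (u + t *\<^sub>R f) e x * ue (u + t *\<^sub>R f) e x * ue (u + t *\<^sub>R f) e x)"
        using ii length_pos[OF e] by (simp add: mult_ac)
    qed
    also have "(\<Sum>e\<in>arcs G. LI 0 (len e) (\<lambda>x. react u e x * ue u e x * ue u e x) + t * p * LI 0 (len e) (\<lambda>x. react u e x * ue u e x * ue f e x)
        + t\<^sup>2 * k * (LI 0 (len e) (\<lambda>x. react u e x * ue f e x * ue f e x) - r1 * D\<^sup>2 * \<epsilon> * len e)) =
        T u u u + t * p * T u u f + t\<^sup>2 * k * (T u f f - r1 * D\<^sup>2 * \<epsilon> * total_length)"
      unfolding sum.distrib sum_distrib_left[symmetric] sum_subtractf T_def total_length_def ..
    finally have 1: "T u u u + t * p * T u u f + t\<^sup>2 * k * (T u f f - r1 * D\<^sup>2 * \<epsilon> * total_length) \<le> T (u + t *\<^sub>R f) (u + t *\<^sub>R f) (u + t *\<^sub>R f)" .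
    have "t\<^sup>2 * k * (T u f f - \<eta>) \<le> t\<^sup>2 * k * (T u f f - r1 * D\<^sup>2 * \<epsilon> * total_length)"
      using \<epsilon>\<eta> k by (intro mult_left_mono) auto
    with 1 show ?thesis by (simp add: mult.assoc)
  qed
  then show ?thesis using d(1) D(1) unfolding k_def by (intro exI[of _ "d / D"]) auto
qed

lemma T_cube_scale: "w \<in> H1 \<Longrightarrow> T (c *\<^sub>R w) (c *\<^sub>R w) (c *\<^sub>R w) = \<bar>c\<bar> powr p * T w w w"
proof -
  assume w: "w \<in> H1"
  have cw: "c *\<^sub>R w \<in> H1" using subspace_H1 w by (rule subspace_scale)
  have "\<bar>c\<bar> powr p = \<bar>c\<bar> powr (p - 2) * c * c"
  proof (cases "c = 0")
    case False
    have "\<bar>c\<bar> powr p = \<bar>c\<bar> powr ((p - 2) + 2)" by simp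
    also have "\<dots> = \<bar>c\<bar> powr (p - 2) * \<bar>c\<bar> powr 2" by (rule powr_add)
    finally show ?thesis using False by (simp add: powr_numeral power2_eq_square)
  qed simp
  then show ?thesis
    using T_scale[of c w] T_bilinear[OF w] w cw by (simp add: T_bilinear)
qed

lemma B_scale: "w \<in> H1 \<Longrightarrow> B (c *\<^sub>R w) (c *\<^sub>R w) = c\<^sup>2 * B w w"
  using sym_formD(4)[OF sym_form_bil[OF coef_cB], of w "c *\<^sub>R w" "w1 + 1" c]
    sym_form_simps(2)[OF sym_form_bil[OF coef_cB], of w w w "w1 + 1" c] subspace_scale[OF subspace_H1, of w c]
  by (simp add: power2_eq_square)

lemma normalize:
  assumes "w \<in> H1" "w \<noteq> 0"
  shows "(1 / sqrt (B w w)) *\<^sub>R w \<in> H1" "B ((1 / sqrt (B w w)) *\<^sub>R w) ((1 / sqrt (B w w)) *\<^sub>R w) = 1"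
  using subspace_scale[OF subspace_H1 assms(1)] B_scale[OF assms(1)] B_pos[OF assms] by (auto simp: power_divide)

lemma H1_nontrivial: "\<exists>w\<in>H1. w \<noteq> 0"
proof -
  obtain e where e: "e \<in> arcs G" using arcs_nonempty by blast
  note l = length_pos[OF e]
  have ad: "admissible e 0 (len e) (\<lambda>x. (x - 0) * (len e - x)) (\<lambda>x. 0 + len e - 2 * x)"
    by (rule admissibleI[OF e order_refl l order_refl parabola(1)[OF l] _ _ parabola(2)[OF l]]) auto
  have "ue (bump e 0 (len e) (\<lambda>x. (x - 0) * (len e - x))) e (len e / 2) = len e / 2 * (len e / 2)"
    using l by (subst on_edge_bump[OF e e]) auto
  then have "bump e 0 (len e) (\<lambda>x. (x - 0) * (len e - x)) \<noteq> 0"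
    using l by (auto simp: on_edge_zero)
  with bump_H1(1)[OF ad] show ?thesis by blast
qed

text \<open>
  By the parallelogram identity a maximizing sequence of \<open>w \<mapsto> \<integral> \<rho> |w|\<^sup>p\<close> on the unit sphere of \<open>B\<close>
  is a Cauchy sequence as soon as it converges uniformly.
\<close>

lemma maximizer_exists:
  "\<exists>u\<in>H1. B u u = 1 \<and> 0 < T u u u \<and> (\<forall>w\<in>H1. T w w w \<le> T u u u * B w w powr (p / 2))"
proof -
  obtain K where K: "K > 0" "\<And>w e x. w \<in> H1 \<Longrightarrow> e \<in> arcs G \<Longrightarrow> x \<in> {0..len e} \<Longrightarrow> (ue w e x)\<^sup>2 \<le> K * B w w"
    using Sobolev by blast
  define C where "C = sqrt K"
  have ub: "\<bar>ue w e x\<bar> \<le> C" if "w \<in> H1" "B w w = 1" "e \<in> arcs G" "x \<in> {0..len e}" for w e x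
    unfolding C_def using K(2)[OF that(1,3,4)] that(2) by (intro real_le_rsqrt) simp
  have C0: "0 < C" using K by (simp add: C_def)
  have reactb: "\<bar>react w e x\<bar> \<le> r1 * c powr (p - 2)" if "\<bar>ue w e x\<bar> \<le> c" for w e x c
  proof -
    have "\<bar>ue w e x\<bar> powr (p - 2) \<le> c powr (p - 2)" using that p2 by (intro powr_mono2) auto
    then have "rt e x * \<bar>ue w e x\<bar> powr (p - 2) \<le> r1 * c powr (p - 2)" using rt_bound[of e x] r0 by (intro mult_mono) auto
    moreover have "0 \<le> rt e x * \<bar>ue w e x\<bar> powr (p - 2)" using rt_bound[of e x] r0 by simp
    ultimately show ?thesis by (simp add: react_def)
  qed
  define A where "A = {T w w w |w. w \<in> H1 \<and> B w w = 1}"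
  have bdd: "bdd_above A"
  proof (rule bdd_aboveI)
    fix y assume "y \<in> A"
    then obtain w where w: "w \<in> H1" "B w w = 1" "y = T w w w" by (auto simp: A_def)
    have "\<bar>T w w w\<bar> \<le> (r1 * C powr (p - 2)) * C * C * total_length"
      unfolding T_def
    proof (rule edges_abs_bound[OF T_integrable[OF w(1,1,1)]])
      fix e x assume e: "e \<in> arcs G" and x: "x \<in> {0..len e}"
      note b = ub[OF w(1,2) e x]
      have "\<bar>react w e x\<bar> * \<bar>ue w e x\<bar> * \<bar>ue w e x\<bar> \<le> (r1 * C powr (p - 2)) * C * C"
        using b reactb[OF b] C0 r0 r01 by (intro mult_mono mult_nonneg_nonneg) auto
      then show "\<bar>react w e x * ue w e x * ue w e x\<bar> \<le> (r1 * C powr (p - 2)) * C * C" by (simp add: abs_mult)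
    qed
    then show "y \<le> (r1 * C powr (p - 2)) * C * C * total_length" using w(3) by linarith
  qed
  obtain w0 where w0: "w0 \<in> H1" "w0 \<noteq> 0" using H1_nontrivial by blast
  define w0' where "w0' = (1 / sqrt (B w0 w0)) *\<^sub>R w0"
  have w0': "w0' \<in> H1" "B w0' w0' = 1" "w0' \<noteq> 0"
    using normalize[OF w0] w0(2) B_pos[OF w0] unfolding w0'_def by auto
  then have A0: "T w0' w0' w0' \<in> A" by (auto simp: A_def)
  define S where "S = Sup A"
  have Sup: "y \<le> S" if "y \<in> A" for y unfolding S_def by (rule cSup_upper[OF that bdd])
  have Spos: "0 < S" using T_diag_pos[OF w0'(1,3)] Sup[OF A0] by linarith
  \<comment> \<open>Homogeneity of degree p, against degree 2 for \<open>B\<close>, carries the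
    bound from the sphere to all of \<open>H1\<close>.\<close>
  have star: "T w w w \<le> S * B w w powr (p / 2)" if w: "w \<in> H1" for w
  proof (cases "w = 0")
    case True
    have "T 0 0 0 = \<bar>0\<bar> powr p * T w0 w0 w0" using T_cube_scale[OF w0(1), of 0] by simp
    then show ?thesis using True Spos by simp
  next
    case False
    let ?c = "1 / sqrt (B w w)"
    note n = normalize[OF w False] and b = B_pos[OF w False]
    have "T (?c *\<^sub>R w) (?c *\<^sub>R w) (?c *\<^sub>R w) \<le> S" using n by (intro Sup) (auto simp: A_def)
    then have "\<bar>?c\<bar> powr p * T w w w \<le> S" unfolding T_cube_scale[OF w] .
    moreover have "\<bar>?c\<bar> powr p = 1 / B w w powr (p / 2)"
      using b by (simp add: powr_divide powr_half_sqrt[symmetric] powr_powr)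
    ultimately have "T w w w / B w w powr (p / 2) \<le> S" by simp
    then show ?thesis using b by (simp add: pos_divide_le_eq)
  qed
  have "\<exists>w. w \<in> H1 \<and> B w w = 1 \<and> S - 1 / (real n + 1) < T w w w" for n :: nat
  proof -
    have "S - 1 / (real n + 1) < Sup A" by (simp add: S_def)
    then obtain y where "y \<in> A" "S - 1 / (real n + 1) < y" using less_cSupD[of A] A0 by blast
    then show ?thesis by (auto simp: A_def)
  qed
  then obtain U where U: "\<And>n. U n \<in> H1" "\<And>n. B (U n) (U n) = 1" "\<And>n::nat. S - 1 / (real n + 1) < T (U n) (U n) (U n)"
    by metis
  have TU: "T (U n) (U n) (U n) \<le> S" for n using U by (intro Sup) (auto simp: A_def)
  have Ub: "\<bar>ue (U n) e x\<bar> \<le> C" if "e \<in> arcs G" "x \<in> {0..len e}" for n e x by (rule ub[OF U(1,2) that])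
  have Db: "Dir (U n) (U n) \<le> 1" for n using B_ge[OF U(1), of n] mass_nonneg[of "U n"] U(2) by simp
  have "\<exists>r u. strict_mono (r :: nat \<Rightarrow> nat) \<and> edge_limit (\<lambda>n. U (r n)) u"
    by (rule compactness[OF U(1) Ub Db])
  then obtain r u where r: "strict_mono (r :: nat \<Rightarrow> nat)" and lim: "edge_limit (\<lambda>n. U (r n)) u"
    by (elim exE conjE) (rule that)
  have rn: "n \<le> r n" for n by (rule seq_suble[OF r])
  define V where "V n = U (r n)" for n
  have VH: "V n \<in> H1" and VB: "B (V n) (V n) = 1" and Vb: "\<And>e x. e \<in> arcs G \<Longrightarrow> x \<in> {0..len e} \<Longrightarrow> \<bar>ue (V n) e x\<bar> \<le> C"
    and VT: "S - 1 / (real n + 1) < T (V n) (V n) (V n)" and VS: "T (V n) (V n) (V n) \<le> S" for n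
  proof -
    have "1 / (real (r n) + 1) \<le> 1 / (real n + 1)" using rn[of n] by (intro divide_left_mono) auto
    then show "S - 1 / (real n + 1) < T (V n) (V n) (V n)" using U(3)[of "r n"] by (simp add: V_def)
  qed (use U Ub TU in \<open>auto simp: V_def\<close>)
  note fB = sym_form_bil[OF coef_cB[of "w1 + 1"]]
  have cauchy: "\<exists>N. \<forall>n\<ge>N. \<forall>k\<ge>N. Dir (V n - V k) (V n - V k) < \<epsilon>" if "\<epsilon> > 0" for \<epsilon>
  proof -
    define \<epsilon>' where "\<epsilon>' = min \<epsilon> 2"
    have \<epsilon>': "0 < \<epsilon>'" "\<epsilon>' < 4" "\<epsilon>' \<le> \<epsilon>" using that by (auto simp: \<epsilon>'_def)
    \<comment> \<open>The loss in the bound for \<open>T\<close> when the square norm of a sum of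
      two unit vectors is at most 4 - \<epsilon>' instead of 4.\<close>
    define g where "g = S * (4 powr (p / 2) - (4 - \<epsilon>') powr (p / 2))"
    have "(4 - \<epsilon>') powr (p / 2) < 4 powr (p / 2)" using \<epsilon>' p2 by (intro powr_less_mono2) auto
    then have g: "g > 0" unfolding g_def using Spos by (intro mult_pos_pos) (simp_all only: diff_gt_0_iff_gt)
    define q where "q = r1 * total_length + 1"
    have q: "q > 0" using r0 r01 total_length_nonneg by (simp add: q_def add_nonneg_pos)
    define \<eta> where "\<eta> = g / (2 * q)"
    have \<eta>: "\<eta> > 0" using g q by (simp add: \<eta>_def)
    have \<eta>g: "r1 * \<eta> * total_length < g / 2"
    proof -
      have "r1 * \<eta> * total_length = \<eta> * (q - 1)" by (simp add: q_def)
      also have "\<dots> < \<eta> * q" using \<eta> by simp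
      also have "\<dots> = g / 2" using q by (simp add: \<eta>_def)
      finally show ?thesis .
    qed
    obtain \<delta> where \<delta>: "\<delta> > 0" "\<And>y z. \<bar>y\<bar> \<le> 2 * C \<Longrightarrow> \<bar>z\<bar> \<le> 2 * C \<Longrightarrow> \<bar>y - z\<bar> < \<delta> \<Longrightarrow> \<bar>\<bar>y\<bar> powr p - \<bar>z\<bar> powr p\<bar> < \<eta>"
      using powr_uniformly_continuous[of p \<eta> "2 * C"] p2 \<eta> by auto
    have "\<delta> / 2 > 0" using \<delta> by simp
    from edge_limit_uniform[OF lim this]
    obtain N1 where N1: "\<And>n e x. n \<ge> N1 \<Longrightarrow> e \<in> arcs G \<Longrightarrow> x \<in> {0..len e} \<Longrightarrow> \<bar>ue (V n) e x - ue u e x\<bar> < \<delta> / 2"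
      unfolding V_def by blast
    obtain N2 :: nat where N2: "2 powr p / (g / 2) < real N2" using reals_Archimedean2 by blast
    have "Dir (V n - V k) (V n - V k) < \<epsilon>" if nk: "n \<ge> max N1 N2" "k \<ge> max N1 N2" for n k
    proof (rule ccontr)
      assume "\<not> Dir (V n - V k) (V n - V k) < \<epsilon>"
      define f where "f = V n - V k"
      define w where "w = V n + V k"
      have H: "f \<in> H1" "w \<in> H1" "2 *\<^sub>R V n \<in> H1"
        unfolding f_def w_def using VH subspace_H1 by (auto intro: subspace_diff subspace_add subspace_scale)
      \<comment> \<open>The parallelogram identity for unit vectors, from the quadratic expansion at
        t = 1 and t = -1.\<close>
      have "B w w + B f f = 4"
        using sym_form_quadratic[OF fB VH[of n] VH[of k], of 1] sym_form_quadratic[OF fB VH[of n] VH[of k], of "-1"] VB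
        by (simp add: f_def w_def)
      moreover have "\<epsilon>' \<le> B f f"
        using B_ge[OF H(1)] mass_nonneg[of f] \<epsilon>'(3) \<open>\<not> Dir (V n - V k) (V n - V k) < \<epsilon>\<close> by (simp add: f_def)
      ultimately have "B w w \<le> 4 - \<epsilon>'" by simp
      then have "B w w powr (p / 2) \<le> (4 - \<epsilon>') powr (p / 2)" using p2 B_nonneg[OF H(2)] by (intro powr_mono2) auto
      then have "T w w w \<le> S * (4 - \<epsilon>') powr (p / 2)"
        using star[OF H(2)] Spos by (meson mult_left_mono less_imp_le order_trans)
      also have "\<dots> = S * 4 powr (p / 2) - g" by (simp add: g_def algebra_simps)
      finally have 1: "T w w w \<le> S * 4 powr (p / 2) - g" .
      have four: "4 powr (p / 2) = 2 powr p"
      proof -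
        have "(4::real) = 2 powr 2" by simp
        then show ?thesis by (simp only: powr_powr) simp
      qed
      \<comment> \<open>Uniform closeness puts \<open>V n + V k\<close> near
        \<open>2 *\<^sub>R V n\<close>, whose value of \<open>T\<close> is 2^p times nearly
        \<open>S\<close>; that leaves no room for the loss \<open>g\<close>.\<close>
      have "\<bar>\<Sum>e\<in>arcs G. LI 0 (len e) (\<lambda>x. react w e x * ue w e x * ue w e x - react (2 *\<^sub>R V n) e x * ue (2 *\<^sub>R V n) e x * ue (2 *\<^sub>R V n) e x)\<bar> \<le> r1 * \<eta> * total_length"
      proof (rule edges_abs_bound)
        fix e x assume e: "e \<in> arcs G" and x: "x \<in> {0..len e}"
        have eq: "ue w e x = ue (V n) e x + ue (V k) e x" "ue (2 *\<^sub>R V n) e x = 2 * ue (V n) e x"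
          by (simp_all add: w_def on_edge_add on_edge_scaleR)
        have "N1 \<le> n" "N1 \<le> k" using nk by auto
        then have "\<bar>\<bar>ue w e x\<bar> powr p - \<bar>ue (2 *\<^sub>R V n) e x\<bar> powr p\<bar> < \<eta>"
          unfolding eq using Vb[OF e x, of n] Vb[OF e x, of k] N1[OF _ e x, of n] N1[OF _ e x, of k]
          by (intro \<delta>(2)) linarith+
        then have "rt e x * \<bar>\<bar>ue w e x\<bar> powr p - \<bar>ue (2 *\<^sub>R V n) e x\<bar> powr p\<bar> \<le> r1 * \<eta>"
          using rt_bound[of e x] r0 r01 by (intro mult_mono) auto
        moreover have "\<bar>rt e x\<bar> = rt e x" using rt_bound[of e x] r0 by simp
        ultimately show "\<bar>react w e x * ue w e x * ue w e x - react (2 *\<^sub>R V n) e x * ue (2 *\<^sub>R V n) e x * ue (2 *\<^sub>R V n) e x\<bar> \<le> r1 * \<eta>"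
          unfolding react_diag right_diff_distrib[symmetric] abs_mult by simp
      qed (use T_integrable[OF H(2,2,2)] T_integrable[OF H(3,3,3)] in auto)
      then have "\<bar>T w w w - T (2 *\<^sub>R V n) (2 *\<^sub>R V n) (2 *\<^sub>R V n)\<bar> \<le> r1 * \<eta> * total_length"
        unfolding T_def sum_subtractf[symmetric] using T_integrable[OF H(2,2,2)] T_integrable[OF H(3,3,3)] by simp
      then have 2: "2 powr p * T (V n) (V n) (V n) - g / 2 < T w w w"
        using \<eta>g T_cube_scale[OF VH, of 2 n] by (simp add: abs_le_iff)
      have "2 powr p * (S - 1 / (real n + 1)) \<le> 2 powr p * T (V n) (V n) (V n)"
        using VT[of n] by (intro mult_left_mono) auto
      with 1 2 four have "2 powr p * S - 2 powr p / (real n + 1) - g / 2 < 2 powr p * S - g"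
        by (simp add: right_diff_distrib mult.commute)
      then have "g / 2 < 2 powr p / (real n + 1)" by simp
      moreover have "2 powr p / (real n + 1) \<le> g / 2"
      proof -
        have "2 powr p / (g / 2) < real n + 1" using N2 nk by simp
        then have "2 powr p < (real n + 1) * (g / 2)" using g by (simp only: pos_divide_less_eq)
        then have "2 powr p / (real n + 1) < g / 2" by (simp add: pos_divide_less_eq mult.commute)
        then show ?thesis by simp
      qed
      ultimately show False by simp
    qed
    then show ?thesis by blast
  qed
  have limV: "edge_limit V u" using lim by (simp add: V_def[abs_def])
  have u: "u \<in> H1" and Dlim: "(\<lambda>n. Dir (V n - u) (V n - u)) \<longlonglongrightarrow> 0"
    using strong_limit[OF VH limV cauchy] by auto
  note f0 = sym_form_bil[OF coef_const[of 0]]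
  \<comment> \<open>Expanding the square reduces convergence of the energies to convergence of the
    pairing with the fixed \<open>u\<close>.\<close>
  have "Dir (V n) (V n) = Dir (V n - u) (V n - u) + 2 * Dir (V n) u - Dir u u" for n
  proof -
    have "V n - u \<in> H1" using subspace_H1 VH u by (simp add: subspace_diff)
    then show ?thesis
      using sym_form_simps(3)[OF f0 VH[of n] u] sym_form_simps(4)[OF f0 VH[of n] u] sym_formD(2)[OF f0 u VH[of n]] VH u by simp
  qed
  moreover have "(\<lambda>n. Dir (V n - u) (V n - u) + 2 * Dir (V n) u - Dir u u) \<longlonglongrightarrow> 0 + 2 * Dir u u - Dir u u"
    by (intro tendsto_intros Dlim Dir_limit[OF VH u Dlim u])
  ultimately have DV: "(\<lambda>n. Dir (V n) (V n)) \<longlonglongrightarrow> Dir u u" by simp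
  have "(\<lambda>n. \<Sum>e\<in>arcs G. LI 0 (len e) (\<lambda>x. cB (w1 + 1) e x * ue (V n) e x * ue (V n) e x)) \<longlonglongrightarrow>
    (\<Sum>e\<in>arcs G. LI 0 (len e) (\<lambda>x. cB (w1 + 1) e x * ue u e x * ue u e x))"
  proof (rule weighted_limit[where K = "2 * w1 + 1" and C = C and C' = C])
    show "cB (w1 + 1) e \<in> borel_measurable (lebesgue_on {0..len e})" if "e \<in> arcs G" for e
      using coef_cB[of "w1 + 1"] that by (simp add: coef_def)
    then show "cB (w1 + 1) e \<in> borel_measurable (lebesgue_on {0..len e})" if "e \<in> arcs G" for e using that .
    show "\<bar>cB (w1 + 1) e x\<bar> \<le> 2 * w1 + 1" for e x using Wt_bound[of e x] unfolding cB_def by linarith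
  qed (use VH u Vb edge_limitD(2)[OF limV] in auto)
  with DV have "(\<lambda>n. B (V n) (V n)) \<longlonglongrightarrow> B u u"
    unfolding bil_split[OF coef_cB VH VH] bil_split[OF coef_cB u u] by (intro tendsto_add)
  then have Bu: "B u u = 1" using VB by (simp add: LIMSEQ_const_iff)
  have "(\<lambda>n. T (V n) (V n) (V n)) \<longlonglongrightarrow> T u u u"
    unfolding T_def
  proof (rule weighted_limit[where K = "r1 * C powr (p - 2)" and C = C and C' = C])
    show "react (V n) e \<in> borel_measurable (lebesgue_on {0..len e})" "react u e \<in> borel_measurable (lebesgue_on {0..len e})" if "e \<in> arcs G" for n e
      using coef_react[OF VH] coef_react[OF u] that by (simp_all add: coef_def)
    show "\<bar>react (V n) e x\<bar> \<le> r1 * C powr (p - 2)" if "e \<in> arcs G" "x \<in> {0..len e}" for n e x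
      by (rule reactb[OF Vb[OF that]])
    show "(\<lambda>n. react (V n) e x) \<longlonglongrightarrow> react u e x" if "e \<in> arcs G" "x \<in> {0..len e}" for e x
      unfolding react_def by (intro tendsto_intros tendsto_powr' edge_limitD(2)[OF limV that]) (use p2 in auto)
  qed (use VH u Vb edge_limitD(2)[OF limV] in auto)
  moreover have "(\<lambda>n. T (V n) (V n) (V n)) \<longlonglongrightarrow> S"
  proof (rule tendsto_sandwich)
    show "\<forall>\<^sub>F n in sequentially. S - 1 / (real n + 1) \<le> T (V n) (V n) (V n)"
      using VT by (auto intro: always_eventually less_imp_le)
    show "\<forall>\<^sub>F n in sequentially. T (V n) (V n) (V n) \<le> S" using VS by auto
    have "(\<lambda>n. S - 1 / real (Suc n)) \<longlonglongrightarrow> S - 0" by (intro tendsto_diff tendsto_const LIMSEQ_Suc[OF lim_1_over_n])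
    then show "(\<lambda>n. S - 1 / (real n + 1)) \<longlonglongrightarrow> S" by (simp add: add.commute)
  qed simp
  ultimately have "T u u u = S" by (rule LIMSEQ_unique)
  then show ?thesis using u Bu Spos star by auto
qed

text \<open>With S the maximum, S B^(p/2) - T is nonnegative along u + t f and vanishes at t = 0.
  Its first-order term gives the Euler-Lagrange equation, its second-order term the inequality on
  the tangent space B u f = 0.\<close>

lemma maximizer_critical:
  assumes u: "u \<in> H1" and Bu: "B u u = 1" and S: "0 < T u u u"
    and max: "\<And>w. w \<in> H1 \<Longrightarrow> T w w w \<le> T u u u * B w w powr (p / 2)" and f: "f \<in> H1"
  shows "T u u f = T u u u * B u f" "B u f = 0 \<Longrightarrow> (p - 1) * T u f f \<le> T u u u * B f f"
proof -
  note fB = sym_form_bil[OF coef_cB[of "w1 + 1"]]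
  let ?S = "T u u u" and ?\<beta> = "B u f" and ?\<gamma> = "B f f"
  have Bt: "B (u + t *\<^sub>R f) (u + t *\<^sub>R f) = 1 + 2 * t * ?\<beta> + t\<^sup>2 * ?\<gamma>" for t
    unfolding sym_form_quadratic[OF fB u f] Bu ..
  have ineq: "\<exists>\<delta>>0. \<forall>t. \<bar>t\<bar> < \<delta> \<longrightarrow> ?S + t * (p * T u u f) + t\<^sup>2 * (p * (p - 1) / 2 * (T u f f - \<eta>)) \<le> ?S * (1 + 2 * t * ?\<beta> + t\<^sup>2 * ?\<gamma>) powr (p / 2)"
    if "\<eta> > 0" for \<eta>
  proof -
    obtain \<delta> where \<delta>: "\<delta> > 0" "\<And>t. \<bar>t\<bar> < \<delta> \<Longrightarrow> ?S + t * (p * T u u f) + t\<^sup>2 * (p * (p - 1) / 2 * (T u f f - \<eta>)) \<le> T (u + t *\<^sub>R f) (u + t *\<^sub>R f) (u + t *\<^sub>R f)"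
      using T_expansion[OF u f \<open>\<eta> > 0\<close>] by blast
    have "T (u + t *\<^sub>R f) (u + t *\<^sub>R f) (u + t *\<^sub>R f) \<le> ?S * (1 + 2 * t * ?\<beta> + t\<^sup>2 * ?\<gamma>) powr (p / 2)" for t
      using max[of "u + t *\<^sub>R f"] Bt[of t] subspace_H1 u f by (simp add: subspace_add subspace_scale)
    then show ?thesis using \<delta> by (meson order_trans)
  qed
  show first: "T u u f = ?S * ?\<beta>"
  proof -
    define c where "c = p * (p - 1) / 2 * (T u f f - 1)"
    obtain \<delta> where \<delta>: "\<delta> > 0" "\<And>t. \<bar>t\<bar> < \<delta> \<Longrightarrow> ?S + t * (p * T u u f) + t\<^sup>2 * c \<le> ?S * (1 + 2 * t * ?\<beta> + t\<^sup>2 * ?\<gamma>) powr (p / 2)"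
      using ineq[of 1] unfolding c_def by auto
    define h where "h t = ?S * (1 + 2 * t * ?\<beta> + t\<^sup>2 * ?\<gamma>) powr (p / 2) - ?S - t * (p * T u u f) - t\<^sup>2 * c" for t
    have "((\<lambda>t. 1 + 2 * t * ?\<beta> + t\<^sup>2 * ?\<gamma>) has_real_derivative 2 * ?\<beta>) (at 0)"
      by (auto intro!: derivative_eq_intros)
    then have d1: "((\<lambda>t. (1 + 2 * t * ?\<beta> + t\<^sup>2 * ?\<gamma>) powr (p / 2)) has_real_derivative p * ?\<beta>) (at 0)"
      by (rule DERIV_powr[THEN DERIV_cong, OF _ _ DERIV_const]) auto
    have "(h has_real_derivative ?S * (p * ?\<beta>) - p * T u u f) (at 0)"
      unfolding h_def by (rule derivative_eq_intros d1 refl)+ auto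
    then have "?S * (p * ?\<beta>) - p * T u u f = 0"
    proof (rule DERIV_local_min[OF _ \<delta>(1)])
      have "0 \<le> h t" if "\<bar>t\<bar> < \<delta>" for t using \<delta>(2)[OF that] unfolding h_def by linarith
      then show "\<forall>y. \<bar>0 - y\<bar> < \<delta> \<longrightarrow> h 0 \<le> h y" by (simp add: h_def)
    qed
    then show ?thesis using p2 by (simp add: algebra_simps)
  qed
  show "(p - 1) * T u f f \<le> ?S * ?\<gamma>" if \<beta>: "?\<beta> = 0"
  proof (rule field_le_epsilon)
    fix \<eta>' :: real assume "0 < \<eta>'"
    define \<eta> where "\<eta> = \<eta>' / (p - 1)"
    have \<eta>: "\<eta> > 0" "(p - 1) * \<eta> = \<eta>'" using \<open>0 < \<eta>'\<close> p2 by (auto simp: \<eta>_def)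
    define c where "c = p * (p - 1) / 2 * (T u f f - \<eta>)"
    obtain \<delta> where \<delta>: "\<delta> > 0" "\<And>t. \<bar>t\<bar> < \<delta> \<Longrightarrow> ?S + t\<^sup>2 * c \<le> ?S * (1 + t\<^sup>2 * ?\<gamma>) powr (p / 2)"
      using ineq[OF \<eta>(1)] first \<beta> unfolding c_def by auto
    \<comment> \<open>With both first-order terms gone the inequality depends only on x = t^2 >= 0,
      so a one-sided derivative at 0 decides.\<close>
    define h where "h x = ?S * (1 + x * ?\<gamma>) powr (p / 2) - ?S - x * c" for x
    have "((\<lambda>x. 1 + x * ?\<gamma>) has_real_derivative ?\<gamma>) (at 0)" by (auto intro!: derivative_eq_intros)
    then have d1: "((\<lambda>x. (1 + x * ?\<gamma>) powr (p / 2)) has_real_derivative p / 2 * ?\<gamma>) (at 0)"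
      by (rule DERIV_powr[THEN DERIV_cong, OF _ _ DERIV_const]) auto
    have dh: "(h has_real_derivative ?S * (p / 2 * ?\<gamma>) - c) (at 0)"
      unfolding h_def by (rule derivative_eq_intros d1 refl)+ auto
    have "0 \<le> ?S * (p / 2 * ?\<gamma>) - c"
    proof (rule ccontr)
      assume "\<not> ?thesis"
      then obtain d where d: "d > 0" "\<And>x. 0 < x \<Longrightarrow> x < d \<Longrightarrow> h (0 + x) < h 0"
        using DERIV_neg_dec_right[OF dh] by auto
      define x where "x = min (d / 2) (\<delta>\<^sup>2 / 4)"
      have x: "0 < x" "x < d" "x \<le> \<delta>\<^sup>2 / 4" using d(1) \<delta>(1) by (auto simp: x_def)
      have "sqrt x \<le> \<delta> / 2" using x(3) \<delta>(1) by (intro real_le_lsqrt) (auto simp: power_divide)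
      then have "\<bar>sqrt x\<bar> < \<delta>" using \<delta>(1) x(1) by simp
      from \<delta>(2)[OF this] have "h x \<ge> 0" using x(1) by (simp add: h_def)
      moreover have "h x < h 0" using d(2)[OF x(1,2)] by simp
      moreover have "h 0 = 0" by (simp add: h_def)
      ultimately show False by simp
    qed
    then have "p / 2 * ((p - 1) * (T u f f - \<eta>)) \<le> p / 2 * (?S * ?\<gamma>)"
    proof -
      have "p / 2 * ((p - 1) * (T u f f - \<eta>)) = c" by (simp add: c_def)
      moreover have "p / 2 * (?S * ?\<gamma>) = ?S * (p / 2 * ?\<gamma>)" by (simp only: mult.left_commute)
      ultimately show ?thesis using \<open>0 \<le> ?S * (p / 2 * ?\<gamma>) - c\<close> by linarith
    qed
    then have "(p - 1) * (T u f f - \<eta>) \<le> ?S * ?\<gamma>" using p2 by (simp only: mult_le_cancel_left_pos)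
    then show "(p - 1) * T u f f \<le> ?S * ?\<gamma> + \<eta>'" using \<eta>(2) by (simp add: right_diff_distrib)
  qed
qed

text \<open>The second variation is nonnegative on the tangent space of the sphere at the maximizer,
  which has codimension one; hence the index is at most 1, and 1 <= m.\<close>

lemma solution_exists:
  assumes "0 < m"
  shows "\<exists>lam u. solution lam u \<and> u \<noteq> 0"
proof -
  obtain u where u: "u \<in> H1" "B u u = 1" "0 < T u u u" and max: "\<And>w. w \<in> H1 \<Longrightarrow> T w w w \<le> T u u u * B w w powr (p / 2)"
    using maximizer_exists by blast
  have crit: "T u u f = T u u u * B u f" "B u f = 0 \<Longrightarrow> (p - 1) * T u f f \<le> T u u u * B f f" if "f \<in> H1" for f
    using maximizer_critical[OF u _ that] max by blast+
  note fB = sym_form_bil[OF coef_cB[of "w1 + 1"]]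
  define S where "S = T u u u"
  \<comment> \<open>Rescaling removes the Lagrange multiplier \<open>S\<close>: the weight in
    \<open>T\<close> is multiplied by c^(p-2) = 1/S.\<close>
  define c where "c = S powr (- 1 / (p - 2))"
  have S: "S > 0" using u by (simp add: S_def)
  have c: "c > 0" "\<bar>c\<bar> powr (p - 2) = 1 / S"
  proof -
    show c0: "c > 0" using S by (simp add: c_def)
    have "\<bar>c\<bar> powr (p - 2) = S powr (- 1 / (p - 2) * (p - 2))" using c0 by (simp add: c_def powr_powr)
    also have "- 1 / (p - 2) * (p - 2) = - 1" using p2 by simp
    finally show "\<bar>c\<bar> powr (p - 2) = 1 / S" using S by (simp add: powr_minus_divide)
  qed
  define v where "v = c *\<^sub>R u"
  have v: "v \<in> H1" unfolding v_def using subspace_H1 u(1) by (rule subspace_scale)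
  have Tv: "T v f g = T u f g / S" for f g unfolding v_def T_scale c(2) by simp
  have "u \<noteq> 0" using u(2) sym_form_simps(5)[OF fB u(1) u(1) u(1)] by auto
  then have v0: "v \<noteq> 0" using c by (simp add: v_def)
  have "bil (cS (w1 + 1) v) v f = 0" if f: "f \<in> H1" for f
  proof -
    have "B v f = c * B u f" unfolding v_def by (rule sym_formD(4)[OF fB u(1) f])
    moreover have "T v v f = c * T u u f / S" unfolding Tv by (simp add: v_def T_bilinear[OF u(1) u(1) f])
    ultimately show ?thesis unfolding cS_react[OF v v f] using crit(1)[OF f] S by (simp add: S_def)
  qed
  then have eq: "solves_E G len W \<rho> p (w1 + 1) v" using v by (simp add: solves_E_iff)
  have nonneg: "0 \<le> bil (cQ (w1 + 1) v) f f" if f: "f \<in> H1" "B u f = 0" for f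
    using crit(2)[OF f] S unfolding cQ_react[OF v f(1)] Tv by (simp add: S_def field_simps)
  have "dim X \<le> 1" if X: "negative_space (w1 + 1) v X" for X
  proof (rule ccontr)
    assume "\<not> dim X \<le> 1"
    have XH: "X \<subseteq> H1" and sX: "subspace X" and neg: "\<And>f. f \<in> X - {0} \<Longrightarrow> bil (cQ (w1 + 1) v) f f < 0"
      using X by (auto simp: negative_space_def)
    obtain D where D: "D \<subseteq> X" "independent D" "card D = dim X" using basis_exists[of X] by metis
    then have "\<not> card D \<le> 1" using \<open>\<not> dim X \<le> 1\<close> by simp
    then obtain x y where xy: "x \<in> D" "y \<in> D" "x \<noteq> y"
      using card_le_Suc0_iff_eq[of D] by (metis One_nat_def card.infinite le0)
    have xyX: "x \<in> X" "y \<in> X" "x \<in> H1" "y \<in> H1" using xy D XH by auto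
    have x0: "x \<noteq> 0" using D(2) xy(1) dependent_zero by blast
    \<comment> \<open>Two independent vectors have a nonzero combination in the kernel of the linear
      functional \<open>B u\<close>.\<close>
    have "\<exists>f\<in>X - {0}. B u f = 0"
    proof (cases "B u x = 0")
      case True
      then show ?thesis using xyX x0 by auto
    next
      case False
      define k where "k = B u y / B u x"
      have "y - k *\<^sub>R x \<in> X" using sX xyX by (intro subspace_diff subspace_scale)
      moreover have "y - k *\<^sub>R x \<noteq> 0"
      proof
        assume "y - k *\<^sub>R x = 0"
        then have "y = k *\<^sub>R x" by simp
        moreover have "k *\<^sub>R x \<in> span (D - {y})" using xy by (intro span_scale span_base) auto
        ultimately show False using D(2) xy(2) by (metis dependent_def)
      qed
      moreover have "B u (y - k *\<^sub>R x) = 0"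
      proof -
        have kx: "k *\<^sub>R x \<in> H1" using subspace_H1 xyX by (intro subspace_scale)
        show ?thesis
          using sym_form_simps(4)[OF fB xyX(4) kx u(1)] sym_form_simps(2)[OF fB xyX(3,3) u(1)] False by (simp add: k_def)
      qed
      ultimately show ?thesis by blast
    qed
    then show False using neg nonneg XH by (metis DiffD1 not_less subsetD)
  qed
  then have "morse_index G len W \<rho> p (w1 + 1) v \<le> enat m"
    unfolding morse_index_le_iff[OF v] using assms by fastforce
  with eq v0 show ?thesis unfolding solution_def by blast
qed

end

section \<open>The mass of solutions of bounded Morse index\<close>

context nls_graph
begin

abbreviation \<theta> :: real
  where "\<theta> \<equiv> (6 - p) / (4 * (p - 2))"

lemma L2_norm_mass: "L2_norm_graph G len u = sqrt (mass u)"
  by (simp add: L2_norm_graph_def graph_integral_def mass_def on_edge_def)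

lemma low_index_solutions_iff:
  "u \<in> low_index_solutions G len W \<rho> p m lam \<longleftrightarrow> solution lam u \<and> u \<noteq> 0"
  by (auto simp: low_index_solutions_def solution_def solves_E_def)

lemma low_index_frequencies_iff:
  "lam \<in> low_index_frequencies G len W \<rho> p m \<longleftrightarrow> (\<exists>u. solution lam u \<and> u \<noteq> 0)"
  by (simp add: low_index_frequencies_def low_index_solutions_iff)

section \<open>Bounds for the norm of solutions\<close>

lemma sup_bound_powr:
  "\<exists>C>0. \<forall>lam u e x. solution lam u \<longrightarrow> e \<in> arcs G \<longrightarrow> x \<in> {0..len e} \<longrightarrow>
    \<bar>ue u e x\<bar> \<le> (C * (1 + \<bar>lam\<bar>)) powr (1 / (p - 2))"
proof -
  obtain C where C: "C > 0" "\<And>lam u e x. solution lam u \<Longrightarrow> e \<in> arcs G \<Longrightarrow> x \<in> {0..len e} \<Longrightarrow> \<bar>ue u e x\<bar> powr (p - 2) \<le> C * (1 + \<bar>lam\<bar>)"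
    using sup_bound by blast
  have "\<bar>ue u e x\<bar> \<le> (C * (1 + \<bar>lam\<bar>)) powr (1 / (p - 2))" if "solution lam u" "e \<in> arcs G" "x \<in> {0..len e}" for lam u e x
  proof -
    have "\<bar>ue u e x\<bar> = (\<bar>ue u e x\<bar> powr (p - 2)) powr (1 / (p - 2))" using p2 by (simp add: powr_powr)
    also have "\<dots> \<le> (C * (1 + \<bar>lam\<bar>)) powr (1 / (p - 2))" using C(2)[OF that] p2 by (intro powr_mono2) auto
    finally show ?thesis .
  qed
  with C(1) show ?thesis by blast
qed

lemma mass_le:
  assumes "u \<in> H1" "\<And>e x. e \<in> arcs G \<Longrightarrow> x \<in> {0..len e} \<Longrightarrow> \<bar>ue u e x\<bar> \<le> M"
  shows "mass u \<le> M\<^sup>2 * total_length"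
proof -
  have "\<bar>mass u\<bar> \<le> M\<^sup>2 * total_length"
    unfolding mass_def
  proof (rule edges_abs_bound)
    show "integrable (lebesgue_on {0..len e}) (\<lambda>x. (ue u e x)\<^sup>2)" if "e \<in> arcs G" for e
      by (rule L2_intervalD(2)[OF L2_continuous[OF H1_edge(1)[OF assms(1) that]]])
    show "\<bar>(ue u e x)\<^sup>2\<bar> \<le> M\<^sup>2" if "e \<in> arcs G" "x \<in> {0..len e}" for e x
      using power_mono[OF assms(2)[OF that] abs_ge_zero, of 2] by simp
  qed
  then show ?thesis by simp
qed

text \<open>The norm bound is for the estimate of \<open>q_sup\<close>; the pointwise bound supplies
  the hypothesis of the compactness argument.\<close>

lemma norm_bound_bounded_frequency:
  "\<exists>C>0. \<forall>lam u. \<bar>lam\<bar> \<le> L \<longrightarrow> solution lam u \<longrightarrow> (L2_norm_graph G len u \<le> C \<and>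
    (\<forall>e\<in>arcs G. \<forall>x\<in>{0..len e}. \<bar>ue u e x\<bar> \<le> C))"
proof -
  obtain C where C: "C > 0" "\<And>lam u e x. solution lam u \<Longrightarrow> e \<in> arcs G \<Longrightarrow> x \<in> {0..len e} \<Longrightarrow>
    \<bar>ue u e x\<bar> \<le> (C * (1 + \<bar>lam\<bar>)) powr (1 / (p - 2))"
    using sup_bound_powr by blast
  define M where "M = (C * (1 + L)) powr (1 / (p - 2))"
  have M0: "0 \<le> M" by (simp add: M_def)
  have "L2_norm_graph G len u \<le> M * sqrt total_length + M + 1 \<and> (\<forall>e\<in>arcs G. \<forall>x\<in>{0..len e}. \<bar>ue u e x\<bar> \<le> M * sqrt total_length + M + 1)"
    if lam: "\<bar>lam\<bar> \<le> L" and s: "solution lam u" for lam u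
  proof -
    have b: "\<bar>ue u e x\<bar> \<le> M" if "e \<in> arcs G" "x \<in> {0..len e}" for e x
    proof -
      have "\<bar>ue u e x\<bar> \<le> (C * (1 + \<bar>lam\<bar>)) powr (1 / (p - 2))" by (rule C(2)[OF s that])
      also have "\<dots> \<le> M" unfolding M_def using C(1) lam p2 by (intro powr_mono2 mult_left_mono) auto
      finally show ?thesis .
    qed
    have "sqrt (mass u) \<le> sqrt (M\<^sup>2 * total_length)"
      using mass_le[OF solutionD(1)[OF s] b] by (rule real_sqrt_le_mono)
    then have "sqrt (mass u) \<le> M * sqrt total_length" using M0 by (simp add: real_sqrt_mult)
    moreover have "0 \<le> M * sqrt total_length" using M0 total_length_nonneg by simp
    ultimately show ?thesis unfolding L2_norm_mass using b M0 by fastforce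
  qed
  moreover have "0 < M * sqrt total_length + M + 1"
    using M0 total_length_nonneg by (intro add_nonneg_pos add_nonneg_nonneg mult_nonneg_nonneg) auto
  ultimately show ?thesis by blast
qed

lemma norm_bound_large_frequency:
  "\<exists>K>0. \<exists>lam1\<ge>1. \<forall>lam\<ge>lam1. \<forall>u. solution lam u \<longrightarrow> L2_norm_graph G len u \<le> K * lam powr \<theta>"
proof -
  \<comment> \<open>One number is both the constant and the frequency threshold, which makes the
    property monotone in it and lets it pass to all edges.\<close>
  have "\<exists>c>0. \<forall>e\<in>arcs G. 0 < c \<and> (\<forall>lam\<ge>c. \<forall>u. solution lam u \<longrightarrow> (\<forall>M. (\<forall>x\<in>{0..len e}. \<bar>ue u e x\<bar> \<le> M) \<longrightarrow>
    LI 0 (len e) (\<lambda>x. (ue u e x)\<^sup>2) \<le> c * M\<^sup>2 / sqrt lam))"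
  proof (rule finite_uniform_bound[OF finite_arcs])
    have mono: "C * M\<^sup>2 / sqrt lam \<le> C' * M\<^sup>2 / sqrt lam" if "C \<le> C'" "0 \<le> lam" for C C' M lam :: real
      using that by (intro divide_right_mono mult_right_mono) auto
    fix e
    {
      assume "e \<in> arcs G"
      from edge_L2_bound[OF this] obtain C lam0 where C: "C > 0" "lam0 > 0"
        and b: "\<And>lam u M. lam \<ge> lam0 \<Longrightarrow> solution lam u \<Longrightarrow> (\<forall>x\<in>{0..len e}. \<bar>ue u e x\<bar> \<le> M) \<Longrightarrow>
          LI 0 (len e) (\<lambda>x. (ue u e x)\<^sup>2) \<le> C * M\<^sup>2 / sqrt lam" by blast
      show "\<exists>c. 0 < c \<and> (\<forall>lam\<ge>c. \<forall>u. solution lam u \<longrightarrow> (\<forall>M. (\<forall>x\<in>{0..len e}. \<bar>ue u e x\<bar> \<le> M) \<longrightarrow>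
        LI 0 (len e) (\<lambda>x. (ue u e x)\<^sup>2) \<le> c * M\<^sup>2 / sqrt lam))"
      proof (intro exI[of _ "max C lam0"] conjI allI impI)
        fix lam u M assume a: "max C lam0 \<le> lam" "solution lam u" "\<forall>x\<in>{0..len e}. \<bar>ue u e x\<bar> \<le> M"
        then have "LI 0 (len e) (\<lambda>x. (ue u e x)\<^sup>2) \<le> C * M\<^sup>2 / sqrt lam" by (intro b) auto
        also have "\<dots> \<le> max C lam0 * M\<^sup>2 / sqrt lam" using a C by (intro mono) auto
        finally show "LI 0 (len e) (\<lambda>x. (ue u e x)\<^sup>2) \<le> max C lam0 * M\<^sup>2 / sqrt lam" .
      qed (use C in auto)
    }
    fix C C' :: real
    assume *: "0 < C \<and> (\<forall>lam\<ge>C. \<forall>u. solution lam u \<longrightarrow> (\<forall>M. (\<forall>x\<in>{0..len e}. \<bar>ue u e x\<bar> \<le> M) \<longrightarrow>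
      LI 0 (len e) (\<lambda>x. (ue u e x)\<^sup>2) \<le> C * M\<^sup>2 / sqrt lam))" and CC: "C \<le> C'"
    show "0 < C' \<and> (\<forall>lam\<ge>C'. \<forall>u. solution lam u \<longrightarrow> (\<forall>M. (\<forall>x\<in>{0..len e}. \<bar>ue u e x\<bar> \<le> M) \<longrightarrow>
      LI 0 (len e) (\<lambda>x. (ue u e x)\<^sup>2) \<le> C' * M\<^sup>2 / sqrt lam))"
    proof (intro conjI allI impI)
      fix lam u M assume a: "C' \<le> lam" "solution lam u" "\<forall>x\<in>{0..len e}. \<bar>ue u e x\<bar> \<le> M"
      then have "LI 0 (len e) (\<lambda>x. (ue u e x)\<^sup>2) \<le> C * M\<^sup>2 / sqrt lam" using * CC by auto
      also have "\<dots> \<le> C' * M\<^sup>2 / sqrt lam" using a * CC by (intro mono) auto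
      finally show "LI 0 (len e) (\<lambda>x. (ue u e x)\<^sup>2) \<le> C' * M\<^sup>2 / sqrt lam" .
    qed (use * CC in auto)
  qed
  then obtain c where c: "c > 0" "\<And>e lam u M. e \<in> arcs G \<Longrightarrow> lam \<ge> c \<Longrightarrow> solution lam u \<Longrightarrow> (\<forall>x\<in>{0..len e}. \<bar>ue u e x\<bar> \<le> M) \<Longrightarrow>
    LI 0 (len e) (\<lambda>x. (ue u e x)\<^sup>2) \<le> c * M\<^sup>2 / sqrt lam" by blast
  obtain C where C: "C > 0" "\<And>lam u e x. solution lam u \<Longrightarrow> e \<in> arcs G \<Longrightarrow> x \<in> {0..len e} \<Longrightarrow>
    \<bar>ue u e x\<bar> \<le> (C * (1 + \<bar>lam\<bar>)) powr (1 / (p - 2))"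
    using sup_bound_powr by blast
  define N where "N = real (card (arcs G))"
  have N: "N > 0" using arcs_nonempty finite_arcs by (simp add: N_def card_gt_0_iff)
  define D where "D = (2 * C) powr (1 / (p - 2))"
  have D: "D > 0" using C by (simp add: D_def)
  have "L2_norm_graph G len u \<le> (sqrt (N * c) * D) * lam powr \<theta>" if lam: "lam \<ge> max 1 c" and s: "solution lam u" for lam u
  proof -
    define M where "M = D * lam powr (1 / (p - 2))"
    have b: "\<forall>x\<in>{0..len e}. \<bar>ue u e x\<bar> \<le> M" if e: "e \<in> arcs G" for e
    proof
      fix x assume x: "x \<in> {0..len e}"
      have "\<bar>ue u e x\<bar> \<le> (C * (1 + \<bar>lam\<bar>)) powr (1 / (p - 2))" by (rule C(2)[OF s e x])
      also have "\<dots> \<le> (2 * C * lam) powr (1 / (p - 2))"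
      proof (intro powr_mono2)
        have "C * (1 + \<bar>lam\<bar>) \<le> C * (2 * lam)" using C lam by (intro mult_left_mono) auto
        then show "C * (1 + \<bar>lam\<bar>) \<le> 2 * C * lam" by simp
      qed (use C p2 in auto)
      also have "\<dots> = M" using C lam by (simp add: M_def D_def powr_mult)
      finally show "\<bar>ue u e x\<bar> \<le> M" .
    qed
    have "mass u \<le> (\<Sum>e\<in>arcs G. c * M\<^sup>2 / sqrt lam)"
      unfolding mass_def by (rule sum_mono) (use c(2)[OF _ _ s] b lam in auto)
    also have "\<dots> = N * c * M\<^sup>2 / sqrt lam" by (simp add: N_def)
    finally have "sqrt (mass u) \<le> sqrt (N * c * M\<^sup>2 / sqrt lam)" by (rule real_sqrt_le_mono)
    also have "\<dots> = sqrt (N * c) * M / sqrt (sqrt lam)"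
      using D by (simp add: real_sqrt_mult real_sqrt_divide M_def)
    also have "sqrt (sqrt lam) = lam powr (1 / 4)" using lam by (simp add: powr_half_sqrt[symmetric] powr_powr)
    also have "sqrt (N * c) * M / lam powr (1 / 4) = (sqrt (N * c) * D) * (lam powr (1 / (p - 2)) / lam powr (1 / 4))"
      by (simp add: M_def)
    also have "lam powr (1 / (p - 2)) / lam powr (1 / 4) = lam powr \<theta>"
    proof -
      have "1 / (p - 2) - 1 / 4 = \<theta>" using p2 by (simp add: field_simps)
      then show ?thesis by (simp only: powr_diff[symmetric])
    qed
    finally show ?thesis unfolding L2_norm_mass .
  qed
  moreover have "0 < sqrt (N * c) * D" using N c D by simp
  ultimately show ?thesis by (intro exI[of _ "sqrt (N * c) * D"] conjI exI[of _ "max 1 c"]) auto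
qed

section \<open>The supremum of the norms as a function of the frequency\<close>

lemma q_sup_le:
  assumes "\<And>u. solution lam u \<Longrightarrow> L2_norm_graph G len u \<le> K"
  shows "q_sup G len W \<rho> p m lam \<le> ennreal K"
  unfolding q_sup_def by (rule SUP_least) (use assms low_index_solutions_iff in \<open>auto intro: ennreal_leI\<close>)

lemma q_sup_empty: "lam \<notin> low_index_frequencies G len W \<rho> p m \<Longrightarrow> q_sup G len W \<rho> p m lam = 0"
  by (simp add: q_sup_def low_index_frequencies_def bot_ennreal)

lemma q_sup_pos_iff: "0 < q_sup G len W \<rho> p m lam \<longleftrightarrow> lam \<in> low_index_frequencies G len W \<rho> p m"
proof
  assume "lam \<in> low_index_frequencies G len W \<rho> p m"
  then obtain u where u: "solution lam u" "u \<noteq> 0" by (auto simp: low_index_frequencies_iff)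
  have "0 < mass u" by (rule mass_pos(1)[OF solutionD(1)[OF u(1)] u(2)])
  then have "0 < ennreal (L2_norm_graph G len u)" by (simp add: L2_norm_mass)
  also have "\<dots> \<le> q_sup G len W \<rho> p m lam"
    unfolding q_sup_def by (rule SUP_upper) (use u low_index_solutions_iff in auto)
  finally show "0 < q_sup G len W \<rho> p m lam" .
qed (use q_sup_empty in force)

text \<open>Stated for every frequency that carries no solution of index at most \<open>m\<close>;
  the infimum, when it is not attained, is one of them.\<close>

lemma q_sup_tendsto_zero:
  assumes not: "\<Lambda> \<notin> low_index_frequencies G len W \<rho> p m"
  shows "(q_sup G len W \<rho> p m \<longlongrightarrow> 0) (at \<Lambda>)"
proof (rule order_tendstoI)
  fix a :: ennreal assume a: "0 < a"
  \<comment> \<open>A value strictly below \<open>a\<close> is finite even if \<open>a\<close> is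
    infinite, and so supplies a real lower bound for the norms.\<close>
  obtain y where y: "0 < y" "y < a" using dense[OF a] by blast
  then obtain \<epsilon> where \<epsilon>: "y = ennreal \<epsilon>" "0 < \<epsilon>" by (cases y) (auto simp: ennreal_less_zero_iff top_unique)
  show "\<forall>\<^sub>F x in at \<Lambda>. q_sup G len W \<rho> p m x < a"
  proof (rule ccontr)
    assume no: "\<not> (\<forall>\<^sub>F x in at \<Lambda>. q_sup G len W \<rho> p m x < a)"
    have "\<exists>lam u. \<bar>lam - \<Lambda>\<bar> < 1 / (real n + 1) \<and> solution lam u \<and> \<epsilon>\<^sup>2 \<le> mass u" for n :: nat
    proof -
      obtain lam where lam: "dist lam \<Lambda> < 1 / (real n + 1)" "\<not> q_sup G len W \<rho> p m lam < a"
        using no unfolding eventually_at by (metis add.commute of_nat_Suc of_nat_0_less_iff zero_less_Suc zero_less_divide_1_iff)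
      then have "ennreal \<epsilon> < q_sup G len W \<rho> p m lam" using y \<epsilon> by (auto simp: not_less)
      then obtain u where u: "u \<in> low_index_solutions G len W \<rho> p m lam" "ennreal \<epsilon> < ennreal (L2_norm_graph G len u)"
        unfolding q_sup_def less_SUP_iff by blast
      then have "\<epsilon> < sqrt (mass u)" using \<epsilon>(2) by (simp add: ennreal_less_iff L2_norm_mass)
      then have "\<epsilon>\<^sup>2 \<le> (sqrt (mass u))\<^sup>2" using \<epsilon>(2) by (intro power_mono) auto
      then have "\<epsilon>\<^sup>2 \<le> mass u" using mass_nonneg[of u] by simp
      then show ?thesis using lam(1) u(1) by (auto simp: low_index_solutions_iff dist_real_def)
    qed
    then obtain L U where LU: "\<And>n::nat. \<bar>L n - \<Lambda>\<bar> < 1 / (real n + 1)" "\<And>n::nat. solution (L n) (U n)" "\<And>n::nat. \<epsilon>\<^sup>2 \<le> mass (U n)"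
      by metis
    have "(\<lambda>n. L n - \<Lambda>) \<longlonglongrightarrow> 0"
    proof (rule Lim_null_comparison)
      show "\<forall>\<^sub>F n in sequentially. norm (L n - \<Lambda>) \<le> 1 / real (Suc n)"
        using LU(1) by (auto intro!: always_eventually less_imp_le simp: add.commute)
      show "(\<lambda>n. 1 / real (Suc n)) \<longlonglongrightarrow> 0" by (rule LIMSEQ_Suc[OF lim_1_over_n])
    qed
    then have lim: "L \<longlonglongrightarrow> \<Lambda>" by (simp add: LIM_zero_iff)
    have Lb: "\<bar>L n\<bar> \<le> \<bar>\<Lambda>\<bar> + 1" for n
    proof -
      have "1 / (real n + 1) \<le> 1" by simp
      then show ?thesis using LU(1)[of n] by linarith
    qed
    obtain C where C: "\<And>lam u e x. \<bar>lam\<bar> \<le> \<bar>\<Lambda>\<bar> + 1 \<Longrightarrow> solution lam u \<Longrightarrow> e \<in> arcs G \<Longrightarrow> x \<in> {0..len e} \<Longrightarrow> \<bar>ue u e x\<bar> \<le> C"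
      using norm_bound_bounded_frequency[of "\<bar>\<Lambda>\<bar> + 1"] by blast
    have "\<exists>u. solution \<Lambda> u \<and> u \<noteq> 0"
    proof (rule solutions_limit[OF lim LU(2) _ LU(3)])
      show "\<bar>ue (U n) e x\<bar> \<le> C" if "e \<in> arcs G" "x \<in> {0..len e}" for n e x by (rule C[OF Lb LU(2) that])
      show "0 < \<epsilon>\<^sup>2" using \<epsilon>(2) by simp
    qed
    then show False using not by (simp add: low_index_frequencies_iff)
  qed
qed simp

lemma conclusion:
  assumes "0 < m"
  shows "\<exists>\<Lambda>::real. Lambda_inf G len W \<rho> p m = ereal \<Lambda> \<and>
    (\<forall>\<Lambda>'>0. \<exists>C::real>0. \<forall>lam::real.
      (lam < \<Lambda> \<longrightarrow> q_sup G len W \<rho> p m lam = 0) \<and>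
      (q_sup G len W \<rho> p m \<Lambda> > 0 \<longleftrightarrow> \<Lambda> \<in> low_index_frequencies G len W \<rho> p m) \<and>
      (\<Lambda> \<notin> low_index_frequencies G len W \<rho> p m \<longrightarrow> (q_sup G len W \<rho> p m \<longlongrightarrow> 0) (at \<Lambda>)) \<and>
      (\<Lambda> \<le> lam \<and> lam \<le> \<Lambda>' \<longrightarrow> q_sup G len W \<rho> p m lam \<le> ennreal C) \<and>
      (lam \<ge> \<Lambda>' \<longrightarrow>
        q_sup G len W \<rho> p m lam \<le> ennreal (C * lam powr ((6 - p) / (4 * (p - 2)))))) \<and>
    (p \<ge> 6 \<longrightarrow> (\<exists>B::real. \<forall>lam. q_sup G len W \<rho> p m lam \<le> ennreal B)) \<and>
    (p > 6 \<longrightarrow> (q_sup G len W \<rho> p m \<longlongrightarrow> 0) at_top)"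
proof -
  let ?F = "low_index_frequencies G len W \<rho> p m" and ?q = "q_sup G len W \<rho> p m"
  define \<Lambda> where "\<Lambda> = Inf ?F"
  have F: "?F \<noteq> {}" using solution_exists[OF assms] low_index_frequencies_iff by blast
  have bdd: "bdd_below ?F"
  proof -
    obtain L where "\<forall>lam u. solution lam u \<longrightarrow> L \<le> lam" using frequency_lower_bound by blast
    then show ?thesis by (intro bdd_belowI[of _ L]) (auto simp: low_index_frequencies_iff)
  qed
  have below: "\<Lambda> \<le> lam" if "lam \<in> ?F" for lam unfolding \<Lambda>_def by (rule cInf_lower[OF that bdd])
  \<comment> \<open>Existence and the frequency bound make the infimum a real number, with which the
    extended real infimum agrees.\<close>
  have Lam: "Lambda_inf G len W \<rho> p m = ereal \<Lambda>"
    unfolding Lambda_inf_def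
  proof (rule antisym)
    show "ereal \<Lambda> \<le> (INF lam\<in>?F. ereal lam)" by (rule INF_greatest) (use below in simp)
    show "(INF lam\<in>?F. ereal lam) \<le> ereal \<Lambda>"
    proof (rule ereal_le_epsilon2)
      fix e :: real assume "0 < e"
      then obtain lam where "lam \<in> ?F" "lam < \<Lambda> + e"
        using cInf_less_iff[OF F bdd, of "\<Lambda> + e"] by (auto simp: \<Lambda>_def)
      then show "(INF lam\<in>?F. ereal lam) \<le> ereal \<Lambda> + ereal e"
        by (intro INF_lower2[of lam]) auto
    qed
  qed
  have zero: "?q lam = 0" if "lam < \<Lambda>" for lam
    using below[of lam] that by (intro q_sup_empty) auto
  obtain K lam1 where K: "K > 0" "lam1 \<ge> 1" and large: "\<And>lam. lam \<ge> lam1 \<Longrightarrow> ?q lam \<le> ennreal (K * lam powr \<theta>)"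
    using norm_bound_large_frequency q_sup_le by metis
  have bounded: "\<exists>C>0. \<forall>lam. \<bar>lam\<bar> \<le> L \<longrightarrow> ?q lam \<le> ennreal C" for L
    using norm_bound_bounded_frequency[of L] q_sup_le by metis
  have main: "\<exists>C>0. \<forall>lam. (\<Lambda> \<le> lam \<and> lam \<le> \<Lambda>' \<longrightarrow> ?q lam \<le> ennreal C) \<and> (lam \<ge> \<Lambda>' \<longrightarrow> ?q lam \<le> ennreal (C * lam powr \<theta>))"
    if \<Lambda>': "\<Lambda>' > 0" for \<Lambda>'
  proof -
    obtain C1 where C1: "C1 > 0" "\<And>lam. \<bar>lam\<bar> \<le> \<bar>\<Lambda>\<bar> + \<Lambda>' + lam1 \<Longrightarrow> ?q lam \<le> ennreal C1"
      using bounded[of "\<bar>\<Lambda>\<bar> + \<Lambda>' + lam1"] by blast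
    \<comment> \<open>A positive lower bound for \<open>lam powr \<theta>\<close> between \<Lambda>'
      and \<open>lam1\<close>, at one end or the other according to the sign of the exponent;
      \<open>C1 / \<mu>\<close> then turns the constant bound into a power bound on that
      range.\<close>
    define \<mu> where "\<mu> = min (\<Lambda>' powr \<theta>) (lam1 powr \<theta>)"
    have \<mu>: "\<mu> > 0" using \<Lambda>' K by (simp add: \<mu>_def)
    define C where "C = C1 + C1 / \<mu> + K"
    have C: "C > 0" "C1 \<le> C" "C1 / \<mu> \<le> C" "K \<le> C" using C1(1) K \<mu> by (auto simp: C_def add_pos_pos)
    show ?thesis
    proof (intro exI[of _ C] conjI allI impI)
      fix lam assume "\<Lambda> \<le> lam \<and> lam \<le> \<Lambda>'"
      then have "?q lam \<le> ennreal C1" using K \<Lambda>' by (intro C1(2)) auto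
      also have "\<dots> \<le> ennreal C" using C by (intro ennreal_leI)
      finally show "?q lam \<le> ennreal C" .
    next
      fix lam assume lam: "\<Lambda>' \<le> lam"
      show "?q lam \<le> ennreal (C * lam powr \<theta>)"
      proof (cases "lam1 \<le> lam")
        case True
        have "?q lam \<le> ennreal (K * lam powr \<theta>)" by (rule large[OF True])
        also have "\<dots> \<le> ennreal (C * lam powr \<theta>)" using C by (intro ennreal_leI mult_right_mono) auto
        finally show ?thesis .
      next
        case False
        have "\<mu> \<le> lam powr \<theta>"
        proof (cases "\<theta> \<ge> 0")
          case True
          then have "\<Lambda>' powr \<theta> \<le> lam powr \<theta>" using lam \<Lambda>' by (intro powr_mono2) auto
          then show ?thesis by (simp add: \<mu>_def)
        next
          case False
          then have "lam1 powr \<theta> \<le> lam powr \<theta>" using \<open>\<not> lam1 \<le> lam\<close> lam \<Lambda>' by (intro powr_mono2') auto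
          then show ?thesis by (simp add: \<mu>_def)
        qed
        then have "C1 / \<mu> * \<mu> \<le> C * lam powr \<theta>" using C \<mu> C1(1) by (intro mult_mono) auto
        then have "C1 \<le> C * lam powr \<theta>" using \<mu> by simp
        moreover have "?q lam \<le> ennreal C1" using False lam \<Lambda>' by (intro C1(2)) auto
        ultimately show ?thesis by (meson ennreal_leI order_trans)
      qed
    qed (use C in auto)
  qed
  have p6: "\<exists>B::real. \<forall>lam. ?q lam \<le> ennreal B" if "p \<ge> 6"
  proof -
    obtain C1 where C1: "C1 > 0" "\<And>lam. \<bar>lam\<bar> \<le> \<bar>\<Lambda>\<bar> + lam1 \<Longrightarrow> ?q lam \<le> ennreal C1"
      using bounded[of "\<bar>\<Lambda>\<bar> + lam1"] by blast
    have "?q lam \<le> ennreal (max C1 K)" for lam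
    proof -
      consider "lam < \<Lambda>" | "lam \<ge> lam1" | "\<Lambda> \<le> lam" "lam < lam1" by linarith
      then show ?thesis
      proof cases
        case 1
        then show ?thesis using zero by simp
      next
        case 2
        \<comment> \<open>For p >= 6 the exponent is nonpositive, and \<open>lam\<close> is at least
          1 here.\<close>
        have "lam powr \<theta> \<le> lam powr 0" using 2 K that p2 by (intro powr_mono) (auto simp: divide_nonpos_pos)
        then have "K * lam powr \<theta> \<le> K * 1" using K 2 by (intro mult_left_mono) auto
        then have "ennreal (K * lam powr \<theta>) \<le> ennreal (max C1 K)" by (intro ennreal_leI) auto
        with large[OF 2] show ?thesis by (rule order_trans)
      next
        case 3
        have "?q lam \<le> ennreal C1" using 3 K by (intro C1(2)) auto
        also have "\<dots> \<le> ennreal (max C1 K)" by (intro ennreal_leI) auto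
        finally show ?thesis .
      qed
    qed
    then show ?thesis by blast
  qed
  have top: "(?q \<longlongrightarrow> 0) at_top" if "p > 6"
  proof (rule tendsto_sandwich)
    show "\<forall>\<^sub>F lam in at_top. (0::ennreal) \<le> ?q lam" by simp
    show "\<forall>\<^sub>F lam in at_top. ?q lam \<le> ennreal (K * lam powr \<theta>)"
      using large by (auto simp: eventually_at_top_linorder)
    have "\<theta> < 0" using that by (simp add: divide_neg_pos)
    then have "((\<lambda>lam. K * lam powr \<theta>) \<longlongrightarrow> K * 0) at_top"
      by (intro tendsto_mult tendsto_const tendsto_neg_powr filterlim_ident)
    then show "((\<lambda>lam. ennreal (K * lam powr \<theta>)) \<longlongrightarrow> 0) at_top"
      using tendsto_ennrealI by fastforce
  qed simp
  show ?thesis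
  proof (rule exI[of _ \<Lambda>], intro conjI allI impI Lam)
    fix \<Lambda>' :: real assume "0 < \<Lambda>'"
    from main[OF this] obtain C where C: "C > 0" "\<And>lam. (\<Lambda> \<le> lam \<and> lam \<le> \<Lambda>' \<longrightarrow> ?q lam \<le> ennreal C) \<and>
      (lam \<ge> \<Lambda>' \<longrightarrow> ?q lam \<le> ennreal (C * lam powr \<theta>))" by blast
    show "\<exists>C>0. \<forall>lam. (lam < \<Lambda> \<longrightarrow> ?q lam = 0) \<and> (0 < ?q \<Lambda> \<longleftrightarrow> \<Lambda> \<in> ?F) \<and>
      (\<Lambda> \<notin> ?F \<longrightarrow> (?q \<longlongrightarrow> 0) (at \<Lambda>)) \<and> (\<Lambda> \<le> lam \<and> lam \<le> \<Lambda>' \<longrightarrow> ?q lam \<le> ennreal C) \<and>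
      (lam \<ge> \<Lambda>' \<longrightarrow> ?q lam \<le> ennreal (C * lam powr \<theta>))"
    proof (rule exI[of _ C], intro conjI allI)
      fix lam
      show "lam < \<Lambda> \<longrightarrow> ?q lam = 0" using zero by blast
      show "0 < ?q \<Lambda> \<longleftrightarrow> \<Lambda> \<in> ?F" by (rule q_sup_pos_iff)
      show "\<Lambda> \<notin> ?F \<longrightarrow> (?q \<longlongrightarrow> 0) (at \<Lambda>)" using q_sup_tendsto_zero by blast
      show "\<Lambda> \<le> lam \<and> lam \<le> \<Lambda>' \<longrightarrow> ?q lam \<le> ennreal C" "lam \<ge> \<Lambda>' \<longrightarrow> ?q lam \<le> ennreal (C * lam powr \<theta>)"
        using C(2)[of lam] by (rule conjunct1, rule conjunct2)
    qed fact
  qed (use p6 top in blast)+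
qed

end

section \<open>Representatives of the coefficients\<close>

lemma Linf_graph_bound:
  assumes "f \<in> Linf_graph G len" "finite (arcs G)"
  shows "\<exists>C>0. \<forall>e\<in>arcs G. AE x in lebesgue_on {0..len e}. \<bar>on_edge G len f e x\<bar> \<le> C"
proof (rule finite_uniform_bound[OF assms(2)])
  fix e assume "e \<in> arcs G"
  then have "esssup (lebesgue_on {0..len e}) (\<lambda>x. ereal \<bar>on_edge G len f e x\<bar>) < \<infinity>"
    using assms(1) by (simp add: Linf_graph_def)
  then obtain C where C: "esssup (lebesgue_on {0..len e}) (\<lambda>x. ereal \<bar>on_edge G len f e x\<bar>) \<le> ereal C"
    by (metis ereal_dense2 less_imp_le)
  have "AE x in lebesgue_on {0..len e}. \<bar>on_edge G len f e x\<bar> \<le> C"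
    using esssup_AE[of "\<lambda>x. ereal \<bar>on_edge G len f e x\<bar>" "lebesgue_on {0..len e}"]
  proof eventually_elim
    case (elim x)
    then have "ereal \<bar>on_edge G len f e x\<bar> \<le> ereal C" using C by (rule order_trans)
    then show ?case by simp
  qed
  then show "\<exists>C. AE x in lebesgue_on {0..len e}. \<bar>on_edge G len f e x\<bar> \<le> C" by blast
next
  fix e and C C' :: real
  assume "AE x in lebesgue_on {0..len e}. \<bar>on_edge G len f e x\<bar> \<le> C" "C \<le> C'"
  then show "AE x in lebesgue_on {0..len e}. \<bar>on_edge G len f e x\<bar> \<le> C'" by (auto elim: AE_mp)
qed

text \<open>A real number is placed strictly between 0 and the essential infimum, which is an
  extended real; the negated essential supremum of -f then yields the pointwise bound.\<close>

lemma essinf_graph_bound: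
  assumes "0 < essinf_graph G len f"
  shows "\<exists>r>0. \<forall>e\<in>arcs G. AE x in lebesgue_on {0..len e}. r \<le> on_edge G len f e x"
proof -
  obtain r where r: "0 < ereal r" "ereal r < essinf_graph G len f" using ereal_dense2[OF assms] by (auto simp: zero_ereal_def)
  have "AE x in lebesgue_on {0..len e}. r \<le> on_edge G len f e x" if e: "e \<in> arcs G" for e
  proof -
    have "essinf_graph G len f \<le> - esssup (lebesgue_on {0..len e}) (\<lambda>x. - ereal (on_edge G len f e x))"
      unfolding essinf_graph_def by (rule INF_lower[OF e])
    with r(2) have "ereal r \<le> - esssup (lebesgue_on {0..len e}) (\<lambda>x. - ereal (on_edge G len f e x))" by simp
    then have s: "esssup (lebesgue_on {0..len e}) (\<lambda>x. - ereal (on_edge G len f e x)) \<le> - ereal r"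
      by (metis ereal_minus_le_minus ereal_uminus_uminus)
    show ?thesis
      using esssup_AE[of "\<lambda>x. - ereal (on_edge G len f e x)" "lebesgue_on {0..len e}"]
    proof eventually_elim
      case (elim x)
      then have "- ereal (on_edge G len f e x) \<le> - ereal r" using s by (rule order_trans)
      then show ?case by simp
    qed
  qed
  with r(1) show ?thesis by auto
qed

theorem theorem4p22:
  fixes G :: "('v, 'e) pre_digraph" and len :: "'e \<Rightarrow> real"
    and p :: real and m :: nat
    and W \<rho> :: "('v, 'e) gpoint \<Rightarrow> real"
  assumes "compact_metric_graph G len"
    and "p > 2"
    and "m > 0"
    and "W \<in> Linf_graph G len"
    and "\<rho> \<in> Linf_graph G len"
    and "essinf_graph G len \<rho> > 0"
  shows "\<exists>\<Lambda>::real. Lambda_inf G len W \<rho> p m = ereal \<Lambda> \<and>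
    (\<forall>\<Lambda>'>0. \<exists>C::real>0. \<forall>lam::real.
      (lam < \<Lambda> \<longrightarrow> q_sup G len W \<rho> p m lam = 0) \<and>
      (q_sup G len W \<rho> p m \<Lambda> > 0 \<longleftrightarrow> \<Lambda> \<in> low_index_frequencies G len W \<rho> p m) \<and>
      (\<Lambda> \<notin> low_index_frequencies G len W \<rho> p m \<longrightarrow> (q_sup G len W \<rho> p m \<longlongrightarrow> 0) (at \<Lambda>)) \<and>
      (\<Lambda> \<le> lam \<and> lam \<le> \<Lambda>' \<longrightarrow> q_sup G len W \<rho> p m lam \<le> ennreal C) \<and>
      (lam \<ge> \<Lambda>' \<longrightarrow>
        q_sup G len W \<rho> p m lam \<le> ennreal (C * lam powr ((6 - p) / (4 * (p - 2)))))) \<and>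
    (p \<ge> 6 \<longrightarrow> (\<exists>B::real. \<forall>lam. q_sup G len W \<rho> p m lam \<le> ennreal B)) \<and>
    (p > 6 \<longrightarrow> (q_sup G len W \<rho> p m \<longlongrightarrow> 0) at_top)"
proof -
  interpret compact_metric_graph G len by fact
  obtain w1 where w1: "w1 > 0" "\<And>e. e \<in> arcs G \<Longrightarrow> AE x in lebesgue_on {0..len e}. \<bar>on_edge G len W e x\<bar> \<le> w1"
    using Linf_graph_bound[OF assms(4) finite_arcs] by blast
  obtain C where C: "C > 0" "\<And>e. e \<in> arcs G \<Longrightarrow> AE x in lebesgue_on {0..len e}. \<bar>on_edge G len \<rho> e x\<bar> \<le> C"
    using Linf_graph_bound[OF assms(5) finite_arcs] by blast
  obtain r0 where r0: "r0 > 0" "\<And>e. e \<in> arcs G \<Longrightarrow> AE x in lebesgue_on {0..len e}. r0 \<le> on_edge G len \<rho> e x"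
    using essinf_graph_bound[OF assms(6)] by blast
  define r1 where "r1 = max r0 C"
  \<comment> \<open>Truncation changes the coefficients only on null sets of each edge and makes the
    bounds hold for every argument, also outside the edges.\<close>
  define Wt where "Wt e x = max (- w1) (min w1 (on_edge G len W e x))" for e x
  define rt where "rt e x = max r0 (min r1 (on_edge G len \<rho> e x))" for e x
  have Wm: "on_edge G len W e \<in> borel_measurable (lebesgue_on {0..len e})"
    and \<rho>m: "on_edge G len \<rho> e \<in> borel_measurable (lebesgue_on {0..len e})" if "e \<in> arcs G" for e
    using assms(4,5) that by (auto simp: Linf_graph_def)
  interpret nls_graph G len W \<rho> p m w1 r0 r1 Wt rt
  proof unfold_locales
    fix e assume e: "e \<in> arcs G"
    note [measurable] = Wm[OF e] \<rho>m[OF e]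
    show "Wt e \<in> borel_measurable (lebesgue_on {0..len e})" "rt e \<in> borel_measurable (lebesgue_on {0..len e})"
      unfolding Wt_def[abs_def] rt_def[abs_def] by measurable
    show "AE x in lebesgue_on {0..len e}. on_edge G len W e x = Wt e x"
      using w1(2)[OF e] by eventually_elim (auto simp: Wt_def)
    show "AE x in lebesgue_on {0..len e}. on_edge G len \<rho> e x = rt e x"
      using C(2)[OF e] r0(2)[OF e] by eventually_elim (auto simp: rt_def r1_def)
  qed (use w1 r0 assms(2) Wm \<rho>m in \<open>auto simp: Wt_def rt_def r1_def\<close>)
  show ?thesis by (rule conclusion[OF assms(3)])
qed

end
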